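(* Let $n\in\mathbb{N}$, let $K$ be a field of characteristic $0$, let $W$ be the $n$-th Weyl algebra over $K$, and let $M$ be a finitely generated left $W$-module. Then for all $\omega\in\Omega$ $$\mathrm{Kdim}_{K[X,Y]}\,\mathrm{G}^{\omega}M=\mathrm{GKdim}_{K[X,Y]}\,\mathrm{G}^{\omega}M=\mathrm{GKdim}_W\,M,$$ and hence $\mathrm{Kdim}\,\mathcal{V}^{\omega}(M)=\mathrm{GKdim}_W\,M$ for all $\omega\in\Omega$.
   Context: $\mathbb{N}=\{1,2,\dots\}$, $\mathbb{N}_0=\mathbb{N}\cup\{0\}$. $K[X,Y]=K[X_1,\dots,X_n,Y_1,\dots,Y_n]$. The $n$-th Weyl algebra $W$ is the $K$-subalgebra of $\mathrm{End}_K(K[X_1,\dots,X_n])$ generated by $\xi_i$ (multiplication by $X_i$) and $\partial_i=\partial/\partial X_i$, $1\le i\le n$. It has $K$-basis $\{\xi^\lambda\partial^\mu\mid\lambda,\mu\in\mathbb{N}_0^n\}$; for $w=\sum c_{\lambda\mu}\xi^\lambda\partial^\mu$ put $\mathrm{supp}(w)=\{(\lambda,\mu)\mid c_{\lambda\mu}\neq0\}$. Let $(\lambda|\mu)\in\mathbb{N}_0^{2n}$ denote concatenation and $\cdot$ the standard scalar product. For $\omega\in\mathbb{N}_0^{2n}$, $\deg^\omega(w)=\sup\{\omega\cdot(\lambda|\mu)\mid(\lambda,\mu)\in\mathrm{supp}(w)\}$ (so $\deg^\omega(0)=-\infty$). $\Omega=\{\omega\in\mathbb{N}_0^{2n}\mid\omega_i+\omega_{n+i}>0\text{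 for }1\le i\le n\}$. For $\omega\in\Omega$, $W$ is filtered by $\mathrm{F}^\omega_iW=\{w\in W\mid\deg^\omega(w)\le i\}$, $i\in\mathbb{Z}$; the associated graded ring $\mathrm{G}^\omega W=\bigoplus_i\mathrm{F}^\omega_iW/\mathrm{F}^\omega_{i-1}W$ is commutative and is identified with $K[X,Y]$ by letting $X_i,Y_i$ correspond to the classes of $\xi_i,\partial_i$ in degrees $\omega_i,\omega_{n+i}$. A filtration $(\mathrm{F}_iM)_{i\in\mathbb{Z}}$ of $M$ over $W$ with the $\omega$-filtration is good if there are finitely many $m_j\in M$, $p_j\in\mathbb{Z}$ with $\mathrm{F}_iM=\sum_j\mathrm{F}^\omega_{i-p_j}W\,m_j$ for all $i$. $\mathrm{G}^\omega M=\bigoplus_i\mathrm{F}_iM/\mathrm{F}_{i-1}M$ is the associated graded $K[X,Y]$-module with respect to a good filtration of $M$. The $\omega$-characteristic variety is $\mathcal{V}^\omega(M)=\mathrm{Var}(0:\mathrm{G}^\omega M)$, the closed set of primes of $\mathrm{Spec}(K[X,Y])$ containing the annihilator of $\mathrm{G}^\omega M$; it does not depend on the good filtration. Dimensions. For a module $N$ over a commutative ring $A$, $\mathrm{Kdim}_A N$ is the supremum of lengths of chains of prime ideals of $A/(0:N)$ ($-\infty$ if $N=0$); $\mathrm{Kdim}$ of a closed subset of a spectrum is its Krull dimension as a topological space. For a finitely generated $K$-algebra $B$ and a finitely generated left $B$-module $N$, choose a finite-dimensional $K$-subspace $V\subseteq B$ with $K\subseteq V$ generating $B$ as an algebra and a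 finite-dimensional $K$-subspace $E\subseteq N$ generating $N$ as a $B$-module; with $V^i$ the $K$-span of products of at most $i$ elements of $V$ ($V^0=K$), the Gelfand–Kirillov dimension is $\mathrm{GKdim}_B N=\limsup_{i\to\infty}\log_i(\dim_K V^iE)$, independent of $V$ and $E$ (with value $-\infty$ if $N=0$). *)

theory Defs
  imports
    "HOL-Library.Poly_Mapping"
    "HOL-Library.Extended_Real"
    "HOL-Library.Liminf_Limsup"
    "HOL-Algebra.Algebra"
    "HOL-Algebra.Algebraic_Closure_Type"
    "HOL-Analysis.Abstract_Topology"
begin

section \<open>Left modules over a possibly noncommutative ring\<close>

text \<open>
  The library locale \<^locale>\<open>module\<close> asks for a commutative ring of scalars. We keep its
  record type, whose fields for the product and the unit of the module carry no meaning.
\<close>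

locale left_module = R?: ring R + M?: abelian_group M
  for R :: "('r, 'c) ring_scheme" (structure) and M :: "('r, 'm, 'd) module_scheme" (structure) +
  assumes smult_closed:
      "\<lbrakk>a \<in> carrier R; x \<in> carrier M\<rbrakk> \<Longrightarrow> a \<odot>\<^bsub>M\<^esub> x \<in> carrier M"
    and smult_l_distr:
      "\<lbrakk>a \<in> carrier R; b \<in> carrier R; x \<in> carrier M\<rbrakk> \<Longrightarrow>
        (a \<oplus>\<^bsub>R\<^esub> b) \<odot>\<^bsub>M\<^esub> x = a \<odot>\<^bsub>M\<^esub> x \<oplus>\<^bsub>M\<^esub> b \<odot>\<^bsub>M\<^esub> x"
    and smult_r_distr:
      "\<lbrakk>a \<in> carrier R; x \<in> carrier M; y \<in> carrier M\<rbrakk> \<Longrightarrow>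
        a \<odot>\<^bsub>M\<^esub> (x \<oplus>\<^bsub>M\<^esub> y) = a \<odot>\<^bsub>M\<^esub> x \<oplus>\<^bsub>M\<^esub> a \<odot>\<^bsub>M\<^esub> y"
    and smult_assoc:
      "\<lbrakk>a \<in> carrier R; b \<in> carrier R; x \<in> carrier M\<rbrakk> \<Longrightarrow>
        (a \<otimes>\<^bsub>R\<^esub> b) \<odot>\<^bsub>M\<^esub> x = a \<odot>\<^bsub>M\<^esub> (b \<odot>\<^bsub>M\<^esub> x)"
    and smult_one:
      "x \<in> carrier M \<Longrightarrow> \<one>\<^bsub>R\<^esub> \<odot>\<^bsub>M\<^esub> x = x"

definition lin_span :: "'r set \<Rightarrow> ('r, 'm) module \<Rightarrow> 'm set \<Rightarrow> 'm set" where
  "lin_span C N S = {\<Oplus>\<^bsub>N\<^esub>s\<in>T. c s \<odot>\<^bsub>N\<^esub> s | T c. finite T \<and> T \<subseteq> S \<and> c \<in> T \<rightarrow> C}"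

definition finitely_generated :: "('r, 'c) ring_scheme \<Rightarrow> ('r, 'm) module \<Rightarrow> bool" where
  "finitely_generated R N \<longleftrightarrow>
    (\<exists>S. finite S \<and> S \<subseteq> carrier N \<and> lin_span (carrier R) N S = carrier N)"

definition annihilator :: "('r, 'c) ring_scheme \<Rightarrow> ('r, 'm) module \<Rightarrow> 'r set" where
  "annihilator R N = {a \<in> carrier R. \<forall>x\<in>carrier N. a \<odot>\<^bsub>N\<^esub> x = \<zero>\<^bsub>N\<^esub>}"

definition regular_module :: "('r, 'c) ring_scheme \<Rightarrow> ('r, 'r) module" where
  "regular_module R = \<lparr>carrier = carrier R, monoid.mult = undefined, monoid.one = undefined,
     ring.zero = \<zero>\<^bsub>R\<^esub>, ring.add = ring.add R, module.smult = monoid.mult R\<rparr>"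

definition restrict_scalars :: "('a \<Rightarrow> 'r) \<Rightarrow> ('r, 'm) module \<Rightarrow> ('a, 'm) module" where
  "restrict_scalars \<phi> N = \<lparr>carrier = carrier N, monoid.mult = undefined, monoid.one = undefined,
     ring.zero = \<zero>\<^bsub>N\<^esub>, ring.add = ring.add N, module.smult = (\<lambda>a x. \<phi> a \<odot>\<^bsub>N\<^esub> x)\<rparr>"

section \<open>Krull dimension\<close>

text \<open>Suprema are taken in \<^typ>\<open>ereal\<close>, where the supremum of the empty set is \<open>-\<infinity>\<close>.\<close>

definition chain_dim :: "'a set set \<Rightarrow> ereal" where
  "chain_dim C = (SUP l\<in>{l. \<exists>P :: nat \<Rightarrow> 'a set. (\<forall>i\<le>l. P i \<in> C) \<and> (\<forall>i<l. P i \<subset> P (Suc i))}.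
     ereal (real l))"

definition Kdim :: "('r, 'c) ring_scheme \<Rightarrow> ('r, 'm) module \<Rightarrow> ereal" where
  "Kdim A N = chain_dim {P. primeideal P (A Quot (annihilator A N))}"

definition Spec :: "('r, 'c) ring_scheme \<Rightarrow> 'r set set" where
  "Spec A = {P. primeideal P A}"

definition Var :: "('r, 'c) ring_scheme \<Rightarrow> 'r set \<Rightarrow> 'r set set" where
  "Var A S = {P \<in> Spec A. S \<subseteq> P}"

definition zariski :: "('r, 'c) ring_scheme \<Rightarrow> 'r set topology" where
  "zariski A = topology (\<lambda>U. \<exists>S\<subseteq>carrier A. U = Spec A - Var A S)"

lemma istopology_zariski:
  assumes "cring A"
  shows "istopology (\<lambda>U. \<exists>S\<subseteq>carrier A. U = Spec A - Var A S)"
proof -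
  interpret cring A by fact
  have inter: "\<exists>U\<subseteq>carrier A. (Spec A - Var A S) \<inter> (Spec A - Var A T) = Spec A - Var A U"
    if S: "S \<subseteq> carrier A" and T: "T \<subseteq> carrier A" for S T
  proof (intro exI conjI)
    let ?U = "{s \<otimes>\<^bsub>A\<^esub> t | s t. s \<in> S \<and> t \<in> T}"
    show "?U \<subseteq> carrier A" using S T by auto
    have "?U \<subseteq> P \<longleftrightarrow> S \<subseteq> P \<or> T \<subseteq> P" if P: "P \<in> Spec A" for P
    proof -
      interpret P: primeideal P A using P by (simp add: Spec_def)
      show ?thesis
      proof
        assume U: "?U \<subseteq> P"
        show "S \<subseteq> P \<or> T \<subseteq> P"
        proof (rule ccontr)
          assume "\<not> (S \<subseteq> P \<or> T \<subseteq> P)"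
          then obtain s t where st: "s \<in> S" "s \<notin> P" "t \<in> T" "t \<notin> P" by blast
          with U have "s \<otimes>\<^bsub>A\<^esub> t \<in> P" by blast
          with st S T P.I_prime show False by blast
        qed
      next
        assume "S \<subseteq> P \<or> T \<subseteq> P"
        then show "?U \<subseteq> P" using S T P.I_l_closed P.I_r_closed by blast
      qed
    qed
    then show "(Spec A - Var A S) \<inter> (Spec A - Var A T) = Spec A - Var A ?U"
      unfolding Var_def by blast
  qed
  have union: "\<exists>T\<subseteq>carrier A. \<Union>\<U> = Spec A - Var A T"
    if \<U>: "\<forall>U\<in>\<U>. \<exists>S\<subseteq>carrier A. U = Spec A - Var A S" for \<U>
  proof -
    obtain f where f: "\<And>U. U \<in> \<U> \<Longrightarrow> f U \<subseteq> carrier A \<and> U = Spec A - Var A (f U)"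
      using \<U> by metis
    have "\<Union>\<U> = (\<Union>U\<in>\<U>. Spec A - Var A (f U))"
      by (rule arg_cong[where f = Union]) (use f in \<open>force simp: image_def\<close>)
    also have "\<dots> = Spec A - Var A (\<Union>U\<in>\<U>. f U)" unfolding Var_def UN_subset_iff by blast
    finally have "\<Union>\<U> = Spec A - Var A (\<Union>U\<in>\<U>. f U)" .
    moreover have "(\<Union>U\<in>\<U>. f U) \<subseteq> carrier A" using f by (simp add: UN_subset_iff)
    ultimately show ?thesis by metis
  qed
  show ?thesis
    unfolding istopology_def
  proof (intro conjI allI impI)
    fix U V
    assume "\<exists>S\<subseteq>carrier A. U = Spec A - Var A S" "\<exists>S\<subseteq>carrier A. V = Spec A - Var A S"
    then obtain S T where "S \<subseteq> carrier A" "T \<subseteq> carrier A"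
      "U = Spec A - Var A S" "V = Spec A - Var A T" by (elim exE conjE) (rule that)
    then show "\<exists>S\<subseteq>carrier A. U \<inter> V = Spec A - Var A S" using inter by simp
  next
    fix \<U>
    assume "\<forall>U\<in>\<U>. \<exists>S\<subseteq>carrier A. U = Spec A - Var A S"
    then show "\<exists>S\<subseteq>carrier A. \<Union>\<U> = Spec A - Var A S" by (rule union)
  qed
qed

lemma closedin_zariski:
  assumes "cring A"
  shows "closedin (zariski A) Z \<longleftrightarrow> (\<exists>S\<subseteq>carrier A. Z = Var A S)"
proof -
  interpret cring A by fact
  have open_iff: "openin (zariski A) U \<longleftrightarrow> (\<exists>S\<subseteq>carrier A. U = Spec A - Var A S)" for U
    using topology_inverse'[OF istopology_zariski[OF assms]] by (simp add: zariski_def)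
  have "Var A (carrier A) = {}"
    unfolding Var_def Spec_def
    by (auto simp: primeideal_def primeideal_axioms_def ideal_def
        dest!: additive_subgroup.a_subset)
  then have "openin (zariski A) (Spec A)" unfolding open_iff by blast
  then have "topspace (zariski A) = Spec A"
    by (metis Diff_subset open_iff openin_subset openin_topspace subset_antisym)
  moreover have "Var A S \<subseteq> Spec A" for S by (auto simp: Var_def)
  ultimately show ?thesis
    unfolding closedin_def open_iff by (metis Diff_Diff_Int Diff_subset inf.absorb_iff2)
qed

definition irreducible_closed :: "'a topology \<Rightarrow> 'a set \<Rightarrow> bool" where
  "irreducible_closed T Z \<longleftrightarrow> closedin T Z \<and> Z \<noteq> {} \<and>
    (\<forall>C D. closedin T C \<and> closedin T D \<and> Z \<subseteq> C \<union> D \<longrightarrow> Z \<subseteq> C \<or> Z \<subseteq> D)"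

definition top_Kdim :: "'a topology \<Rightarrow> ereal" where
  "top_Kdim T = chain_dim {Z. irreducible_closed T Z}"

section \<open>Gelfand--Kirillov dimension\<close>

text \<open>
  A \<open>K\<close>-algebra is a ring \<open>B\<close> together with the image \<open>K \<subseteq> carrier B\<close> of the ground field.
\<close>

definition lin_indep :: "'b set \<Rightarrow> ('b, 'c) ring_scheme \<Rightarrow> ('b, 'm) module \<Rightarrow> 'm set \<Rightarrow> bool" where
  "lin_indep K B N S \<longleftrightarrow> (\<forall>T c. finite T \<and> T \<subseteq> S \<and> c \<in> T \<rightarrow> K \<and>
     (\<Oplus>\<^bsub>N\<^esub>s\<in>T. c s \<odot>\<^bsub>N\<^esub> s) = \<zero>\<^bsub>N\<^esub> \<longrightarrow> (\<forall>s\<in>T. c s = \<zero>\<^bsub>B\<^esub>))"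

definition fin_dim_subspace :: "'b set \<Rightarrow> ('b, 'm) module \<Rightarrow> 'm set \<Rightarrow> bool" where
  "fin_dim_subspace K N U \<longleftrightarrow> (\<exists>S. finite S \<and> S \<subseteq> carrier N \<and> U = lin_span K N S)"

definition vdim :: "'b set \<Rightarrow> ('b, 'c) ring_scheme \<Rightarrow> ('b, 'm) module \<Rightarrow> 'm set \<Rightarrow> nat" where
  "vdim K B N U = (THE d. \<exists>S. finite S \<and> S \<subseteq> carrier N \<and> lin_indep K B N S \<and>
     lin_span K N S = U \<and> card S = d)"

definition space_power :: "'b set \<Rightarrow> ('b, 'c) ring_scheme \<Rightarrow> 'b set \<Rightarrow> nat \<Rightarrow> 'b set" where
  "space_power K B V i = lin_span K (regular_module B)
     {foldr (monoid.mult B) vs \<one>\<^bsub>B\<^esub> | vs. set vs \<subseteq> V \<and> length vs \<le> i}"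

definition space_smult :: "'b set \<Rightarrow> ('b, 'm) module \<Rightarrow> 'b set \<Rightarrow> 'm set \<Rightarrow> 'm set" where
  "space_smult K N V E = lin_span K N {v \<odot>\<^bsub>N\<^esub> e | v e. v \<in> V \<and> e \<in> E}"

text \<open>
  Since \<open>K \<subseteq> V\<close>, the ring generated by \<open>V\<close> is the \<open>K\<close>-algebra generated by \<open>V\<close>.
\<close>

definition alg_frame :: "'b set \<Rightarrow> ('b, 'c) ring_scheme \<Rightarrow> 'b set \<Rightarrow> bool" where
  "alg_frame K B V \<longleftrightarrow>
    fin_dim_subspace K (regular_module B) V \<and> K \<subseteq> V \<and> generate_ring B V = carrier B"

definition mod_frame :: "'b set \<Rightarrow> ('b, 'c) ring_scheme \<Rightarrow> ('b, 'm) module \<Rightarrow> 'm set \<Rightarrow> bool" where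
  "mod_frame K B N E \<longleftrightarrow> fin_dim_subspace K N E \<and> lin_span (carrier B) N E = carrier N"

text \<open>The growth exponent does not depend on the choice of \<open>V\<close> and \<open>E\<close>.\<close>

definition GKdim :: "'b set \<Rightarrow> ('b, 'c) ring_scheme \<Rightarrow> ('b, 'm) module \<Rightarrow> ereal" where
  "GKdim K B N = (if carrier N = {\<zero>\<^bsub>N\<^esub>} then -\<infinity> else
     (SOME d. \<exists>V E. alg_frame K B V \<and> mod_frame K B N E \<and>
       d = limsup (\<lambda>i. ereal (log (real i)
             (real (vdim K B N (space_smult K N (space_power K B V i) E)))))))"

section \<open>Associated graded objects\<close>

text \<open>
  For an increasing family \<open>F\<close> of additive subgroups of \<open>A\<close>, the elements of
  \<open>gr_group A F\<close> are the families \<open>g\<close> of cosets \<open>g i \<in> F i / F (i - 1)\<close>, almost all of them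
  equal to the zero coset \<open>F (i - 1)\<close>; the group is written multiplicatively.
\<close>

definition gr_piece :: "('a, 'c) ring_scheme \<Rightarrow> (int \<Rightarrow> 'a set) \<Rightarrow> int \<Rightarrow> 'a set monoid" where
  "gr_piece A F i = (A\<lparr>carrier := F i\<rparr>) A_Mod (F (i - 1))"

definition gr_group :: "('a, 'c) ring_scheme \<Rightarrow> (int \<Rightarrow> 'a set) \<Rightarrow> (int \<Rightarrow> 'a set) monoid" where
  "gr_group A F = sum_group UNIV (gr_piece A F)"

definition gr_class :: "('a, 'c) ring_scheme \<Rightarrow> (int \<Rightarrow> 'a set) \<Rightarrow> int \<Rightarrow> 'a \<Rightarrow> int \<Rightarrow> 'a set" where
  "gr_class A F d a = (\<lambda>i. if i = d then F (d - 1) +>\<^bsub>A\<^esub> a else F (i - 1))"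

text \<open>
  The component of degree \<open>k\<close> of the product of \<open>g\<close> and \<open>h\<close> is the sum over \<open>i\<close> of the products
  of the classes \<open>g i\<close> and \<open>h (k - i)\<close>; here \<^const>\<open>finprod\<close> is the sum in
  \<open>F k / F (k - 1)\<close>.
\<close>

definition gr_mult :: "('r \<Rightarrow> 'a \<Rightarrow> 'a) \<Rightarrow> (int \<Rightarrow> 'r set) \<Rightarrow> ('a, 'c) ring_scheme \<Rightarrow> (int \<Rightarrow> 'a set)
    \<Rightarrow> (int \<Rightarrow> 'r set) \<Rightarrow> (int \<Rightarrow> 'a set) \<Rightarrow> (int \<Rightarrow> 'a set)" where
  "gr_mult act FR A F g h = (\<lambda>k. finprod (gr_piece A F k)
     (\<lambda>i. \<Union>a\<in>g i. \<Union>b\<in>h (k - i). F (k - 1) +>\<^bsub>A\<^esub> act a b) {i. g i \<noteq> FR (i - 1)})"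

definition gr_ring :: "('r, 'c) ring_scheme \<Rightarrow> (int \<Rightarrow> 'r set) \<Rightarrow> (int \<Rightarrow> 'r set) ring" where
  "gr_ring R F = \<lparr>carrier = carrier (gr_group R F),
     monoid.mult = gr_mult (monoid.mult R) F R F, monoid.one = gr_class R F 0 \<one>\<^bsub>R\<^esub>,
     ring.zero = \<one>\<^bsub>gr_group R F\<^esub>, ring.add = monoid.mult (gr_group R F)\<rparr>"

definition gr_module :: "(int \<Rightarrow> 'r set) \<Rightarrow> ('r, 'm) module \<Rightarrow> (int \<Rightarrow> 'm set)
    \<Rightarrow> (int \<Rightarrow> 'r set, int \<Rightarrow> 'm set) module" where
  "gr_module FR M F = \<lparr>carrier = carrier (gr_group M F),
     monoid.mult = undefined, monoid.one = undefined,
     ring.zero = \<one>\<^bsub>gr_group M F\<^esub>, ring.add = monoid.mult (gr_group M F),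
     module.smult = gr_mult (module.smult M) FR M F\<rparr>"

section \<open>Polynomial rings and the Weyl algebra\<close>

text \<open>
  The variables \<open>X\<^sub>1, \<dots>, X\<^sub>n\<close> are indexed by a finite type \<open>'n\<close> with \<open>n\<close> elements. In \<open>K[X, Y]\<close>
  the index \<open>Inl i\<close> stands for \<open>X\<^sub>i\<close> and \<open>Inr i\<close> for \<open>Y\<^sub>i\<close>, so that a multi-index of type
  \<open>'n + 'n \<Rightarrow>\<^sub>0 nat\<close> is the concatenation of \<open>\<lambda>\<close> (on \<open>Inl\<close>) and \<open>\<mu>\<close> (on \<open>Inr\<close>).
\<close>

type_synonym ('v, 'k) mpol = "('v \<Rightarrow>\<^sub>0 nat) \<Rightarrow>\<^sub>0 'k"
type_synonym ('n, 'k) polX = "('n, 'k) mpol"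
type_synonym ('n, 'k) polXY = "('n + 'n, 'k) mpol"
type_synonym ('n, 'k) endo = "('n, 'k) polX \<Rightarrow> ('n, 'k) polX"

definition pconst :: "'k::zero \<Rightarrow> ('v, 'k) mpol" where
  "pconst c = Poly_Mapping.single 0 c"

definition pvar :: "'v \<Rightarrow> ('v, 'k::zero_neq_one) mpol" where
  "pvar v = Poly_Mapping.single (Poly_Mapping.single v 1) 1"

definition KXY :: "('n::finite, 'k::field_char_0) polXY ring" where
  "KXY = ring_of_type_algebra"

definition pscale :: "'k::field_char_0 \<Rightarrow> ('n, 'k) polX \<Rightarrow> ('n, 'k) polX" where
  "pscale c p = pconst c * p"

text \<open>The truncated subtraction of exponents below is harmless: it occurs with coefficient \<open>0\<close>.\<close>

definition pderiv_at :: "'n \<Rightarrow> ('n, 'k::field_char_0) endo" where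
  "pderiv_at i p = (\<Sum>a\<in>Poly_Mapping.keys p.
     Poly_Mapping.single (a - Poly_Mapping.single i 1)
       (of_nat (Poly_Mapping.lookup a i) * Poly_Mapping.lookup p a))"

definition mult_var :: "'n \<Rightarrow> ('n, 'k::field_char_0) endo" where
  "mult_var i p = pvar i * p"

definition End_K :: "('n::finite, 'k::field_char_0) endo ring" where
  "End_K = \<lparr>carrier = {f. Vector_Spaces.linear pscale pscale f},
     monoid.mult = (\<circ>), monoid.one = id, ring.zero = (\<lambda>p. 0), ring.add = (\<lambda>f g p. f p + g p)\<rparr>"

fun weyl_gen :: "'n + 'n \<Rightarrow> ('n::finite, 'k::field_char_0) endo" where
  "weyl_gen (Inl i) = mult_var i"
| "weyl_gen (Inr i) = pderiv_at i"

definition weyl :: "('n::finite, 'k::field_char_0) endo ring" where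
  "weyl = End_K\<lparr>carrier := generate_ring End_K (range pscale \<union> range weyl_gen)\<rparr>"

text \<open>\<open>weyl_monom \<alpha>\<close> is \<open>\<xi>\<^sup>\<lambda> \<partial>\<^sup>\<mu>\<close> for \<open>\<alpha> = (\<lambda>|\<mu>)\<close>.\<close>

definition weyl_monom :: "('n + 'n \<Rightarrow>\<^sub>0 nat) \<Rightarrow> ('n::finite, 'k::field_char_0) endo" where
  "weyl_monom \<alpha> =
     Finite_Set.fold (\<lambda>i f. (weyl_gen (Inl i) ^^ Poly_Mapping.lookup \<alpha> (Inl i)) \<circ> f) id UNIV \<circ>
     Finite_Set.fold (\<lambda>i f. (weyl_gen (Inr i) ^^ Poly_Mapping.lookup \<alpha> (Inr i)) \<circ> f) id UNIV"

text \<open>The coefficient families \<open>c\<close> are finitely supported functions of \<open>\<alpha>\<close>.\<close>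

definition weyl_coeffs :: "('n::finite, 'k::field_char_0) endo \<Rightarrow> ('n + 'n \<Rightarrow>\<^sub>0 nat) \<Rightarrow>\<^sub>0 'k" where
  "weyl_coeffs w = (THE c. w = (\<lambda>p. \<Sum>\<alpha>\<in>Poly_Mapping.keys c.
     pscale (Poly_Mapping.lookup c \<alpha>) (weyl_monom \<alpha> p)))"

definition weyl_supp :: "('n::finite, 'k::field_char_0) endo \<Rightarrow> ('n + 'n \<Rightarrow>\<^sub>0 nat) set" where
  "weyl_supp w = {\<alpha>. Poly_Mapping.lookup (weyl_coeffs w) \<alpha> \<noteq> 0}"

definition Omega :: "('n::finite + 'n \<Rightarrow> nat) set" where
  "Omega = {\<omega>. \<forall>i. \<omega> (Inl i) + \<omega> (Inr i) > 0}"

definition weyl_deg :: "('n + 'n \<Rightarrow> nat) \<Rightarrow> ('n::finite, 'k::field_char_0) endo \<Rightarrow> ereal" where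
  "weyl_deg \<omega> w =
     (SUP \<alpha>\<in>weyl_supp w. ereal (real (\<Sum>v\<in>UNIV. \<omega> v * Poly_Mapping.lookup \<alpha> v)))"

definition weyl_filt :: "('n + 'n \<Rightarrow> nat) \<Rightarrow> int \<Rightarrow> ('n::finite, 'k::field_char_0) endo set" where
  "weyl_filt \<omega> i = {w \<in> carrier weyl. weyl_deg \<omega> w \<le> ereal (real_of_int i)}"

text \<open>The identification of \<open>K[X, Y]\<close> with the associated graded ring of the Weyl algebra.\<close>

definition gr_ident ::
    "('n + 'n \<Rightarrow> nat) \<Rightarrow> ('n::finite, 'k::field_char_0) polXY \<Rightarrow> int \<Rightarrow> ('n, 'k) endo set" where
  "gr_ident \<omega> = (THE \<phi>. \<phi> \<in> ring_hom KXY (gr_ring weyl (weyl_filt \<omega>)) \<and>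
     (\<forall>c. \<phi> (pconst c) = gr_class weyl (weyl_filt \<omega>) 0 (pscale c)) \<and>
     (\<forall>v. \<phi> (pvar v) = gr_class weyl (weyl_filt \<omega>) (int (\<omega> v)) (weyl_gen v)))"

section \<open>Good filtrations and characteristic varieties\<close>

definition module_filtration ::
    "(int \<Rightarrow> 'r set) \<Rightarrow> ('r, 'm) module \<Rightarrow> (int \<Rightarrow> 'm set) \<Rightarrow> bool" where
  "module_filtration FR M F \<longleftrightarrow>
     (\<forall>i. additive_subgroup (F i) M) \<and> (\<forall>i. F i \<subseteq> F (i + 1)) \<and> (\<Union>i. F i) = carrier M \<and>
     (\<forall>i j. \<forall>a\<in>FR i. \<forall>x\<in>F j. a \<odot>\<^bsub>M\<^esub> x \<in> F (i + j))"

definition good_filtration ::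
    "(int \<Rightarrow> 'r set) \<Rightarrow> ('r, 'm) module \<Rightarrow> (int \<Rightarrow> 'm set) \<Rightarrow> bool" where
  "good_filtration FR M F \<longleftrightarrow> module_filtration FR M F \<and>
     (\<exists>(r::nat) m p. (\<forall>j<r. m j \<in> carrier M) \<and>
       (\<forall>i. F i = {\<Oplus>\<^bsub>M\<^esub>j\<in>{..<r}. a j \<odot>\<^bsub>M\<^esub> m j | a. \<forall>j<r. a j \<in> FR (i - p j)}))"

definition GrM :: "('n + 'n \<Rightarrow> nat) \<Rightarrow> (('n::finite, 'k::field_char_0) endo, 'm) module \<Rightarrow>
    (int \<Rightarrow> 'm set) \<Rightarrow> (('n, 'k) polXY, int \<Rightarrow> 'm set) module" where
  "GrM \<omega> M F = restrict_scalars (gr_ident \<omega>) (gr_module (weyl_filt \<omega>) M F)"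

text \<open>The characteristic variety does not depend on the choice of the good filtration.\<close>

definition char_variety :: "('n + 'n \<Rightarrow> nat) \<Rightarrow> (('n::finite, 'k::field_char_0) endo, 'm) module \<Rightarrow>
    ('n, 'k) polXY set set" where
  "char_variety \<omega> M =
     Var KXY (annihilator KXY (GrM \<omega> M (SOME F. good_filtration (weyl_filt \<omega>) M F)))"

end

theory Submission
  imports Defs "HOL-Real_Asymp.Real_Asymp"
begin

text \<open>
  The statement is reduced to counting exponents. Let \<open>m\<^sub>1, \<dots>, m\<^sub>r\<close> be generators of \<open>M\<close> that
  define the good filtration with degree shifts \<open>p\<^sub>j\<close>. The products \<open>\<xi>\<^sup>\<lambda> \<partial>\<^sup>\<mu> m\<^sub>j\<close> span \<open>M\<close> over the
  ground field, and their classes span the graded module. Order the pairs of an exponent and an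
  index \<open>j\<close> by weight, then total degree, then lexicographically. Since \<open>\<omega>\<close> lies in \<open>\<Omega>\<close>, the terms
  that normal ordering adds to a product of monomials have smaller weight, so the leading
  exponents of the relations between the products are closed under adding exponents
  (\<open>shift_relation\<close>). Hence the remaining exponents form a staircase, the complement of a monomial
  submodule. The products indexed by it are a basis of \<open>M\<close>, and their classes are a basis of
  the graded module (\<open>standard_independent\<close>, \<open>standard_independent_graded\<close>, \<open>staircase_reduction\<close>).

  The number of elements of total degree at most \<open>i\<close> in a staircase grows like \<open>i\<^sup>d\<close>, where \<open>d\<close> is the
  largest dimension of a coordinate subspace inside it (\<open>staircase_growth\<close>). In the graded module
  reduction to the basis does not raise the total degree, so its Gelfand--Kirillov dimension is \<open>d\<close>.
  In \<open>M\<close> the total degree may increase during a reduction, but Dickson's lemma bounds the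
  increase by a constant for each drop of the weight. The degree filtration thus changes only by a
  linear substitution, and the Gelfand--Kirillov dimension of \<open>M\<close> is \<open>d\<close> as well
  (\<open>growth_M\<close>, \<open>growth_GM\<close>).

  It remains to compare \<open>d\<close> with Krull dimension. The same count shows that \<open>d\<close> is the largest number
  of variables that are algebraically independent modulo the annihilator of the graded module
  (\<open>cdim_Ann\<close>). For any proper ideal of a polynomial ring this number is the length of the longest
  chains of primes above the ideal (\<open>prime_chains_above_ideal\<close>): a strict inclusion of primes lowers
  it, because otherwise the smaller prime would have a quotient of too small growth, and
  conversely, given a largest independent set of variables modulo a prime, some strictly larger
  prime keeps all of them independent except one. Finally, chains of primes above the
  annihilator are the chains of primes of the quotient ring, and read backwards they are the
  chains of irreducible closed subsets of the characteristic variety.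
\<close>

abbreviation keys where "keys \<equiv> Poly_Mapping.keys"
abbreviation lookup where "lookup \<equiv> Poly_Mapping.lookup"
abbreviation single where "single \<equiv> Poly_Mapping.single"

section \<open>Finitely supported functions and monomial orders\<close>

text \<open>
  The scalar action of the field is kept separate from multiplication by constant polynomials: it also serves finitely
  supported coefficient families whose index type is not a type of exponents.
\<close>
definition sc :: "'k::field \<Rightarrow> ('i \<Rightarrow>\<^sub>0 'k) \<Rightarrow> 'i \<Rightarrow>\<^sub>0 'k" where
  "sc c p = Poly_Mapping.map ((*) c) p"

lemma lookup_sc [simp]: "lookup (sc c p) i = c * lookup p i"
  unfolding sc_def by (simp add: Poly_Mapping.map.rep_eq when_def)

lemma keys_sc: "keys (sc c p) \<subseteq> keys p"
  by (auto simp: in_keys_iff)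

interpretation pm: vector_space sc
  by unfold_locales (auto intro!: poly_mapping_eqI simp: lookup_add algebra_simps)

lemma sc_single [simp]: "sc c (single i d) = single i (c * d)"
  by (rule poly_mapping_eqI) (auto simp: lookup_single when_def)

lemma pconst_times: "pconst c * p = sc c p"
  unfolding sc_def pconst_def by (simp add: mult_map_scale_conv_mult)

lemma pm_expand:
  assumes "finite I" "keys p \<subseteq> I"
  shows "p = (\<Sum>i\<in>I. single i (lookup p i))"
  by (rule poly_mapping_eqI)
     (use assms in \<open>auto simp: lookup_sum lookup_single when_def in_keys_iff\<close>)

lemma pm_keys_expand: "p = (\<Sum>i\<in>keys p. single i (lookup p i))"
  by (rule pm_expand) auto

definition pm_restrict :: "'i set \<Rightarrow> ('i \<Rightarrow>\<^sub>0 'k::comm_monoid_add) \<Rightarrow> 'i \<Rightarrow>\<^sub>0 'k" where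
  "pm_restrict I p = (\<Sum>i\<in>keys p \<inter> I. single i (lookup p i))"

lemma lookup_pm_restrict:
  "lookup (pm_restrict I p) i = (if i \<in> I then lookup p i else 0)"
  unfolding pm_restrict_def
  by (auto simp: lookup_sum lookup_single when_def in_keys_iff)

lemma keys_pm_restrict: "keys (pm_restrict I p) = keys p \<inter> I"
  by (auto simp: in_keys_iff lookup_pm_restrict split: if_splits)

lemma keys_sum_subset:
  assumes "\<And>x. x \<in> A \<Longrightarrow> keys (f x) \<subseteq> I"
  shows "keys (\<Sum>x\<in>A. f x) \<subseteq> I"
  using keys_sum[of f A] assms by blast

text \<open>
  Steinitz for coordinate vectors: independent families supported on a finite set have at most as many members as that
  set. All upper bounds for dimensions below come from this.
\<close>
lemma family_card_le:
  fixes a :: "'x \<Rightarrow> 'i \<Rightarrow>\<^sub>0 'k::field"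
  assumes "finite A" "finite I" and keys: "\<And>x. x \<in> A \<Longrightarrow> keys (a x) \<subseteq> I"
    and indep: "\<And>c. (\<Sum>x\<in>A. sc (c x) (a x)) = 0 \<Longrightarrow> \<forall>x\<in>A. c x = 0"
  shows "card A \<le> card I"
proof -
  have inj: "inj_on a A"
  proof (rule inj_onI, rule ccontr)
    fix x y assume xy: "x \<in> A" "y \<in> A" "a x = a y" "x \<noteq> y"
    let ?c = "\<lambda>z. if z = x then 1 else if z = y then -1 else (0::'k)"
    have "(\<Sum>z\<in>A. sc (?c z) (a z)) = (\<Sum>z\<in>{x,y}. sc (?c z) (a z))"
      by (rule sum.mono_neutral_right) (use xy assms(1) in auto)
    also have "\<dots> = 0" using xy by simp
    finally show False using indep[of ?c] xy by auto
  qed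
  have ind: "pm.independent (a ` A)"
    unfolding pm.dependent_finite[OF finite_imageI[OF assms(1)]]
  proof clarsimp
    fix u x assume "(\<Sum>v\<in>a ` A. sc (u v) v) = 0" "x \<in> A" "u (a x) \<noteq> 0"
    then show False using indep[of "u \<circ> a"] inj by (auto simp: sum.reindex)
  qed
  have "a ` A \<subseteq> pm.span ((\<lambda>i. single i 1) ` I)"
  proof clarify
    fix x assume x: "x \<in> A"
    have "a x = (\<Sum>i\<in>I. sc (lookup (a x) i) (single i 1))"
      using pm_expand[OF assms(2) keys[OF x]] by simp
    also have "\<dots> \<in> pm.span ((\<lambda>i. single i 1) ` I)"
      by (intro pm.span_sum pm.span_scale pm.span_base) auto
    finally show "a x \<in> pm.span ((\<lambda>i. single i 1) ` I)" .
  qed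
  from pm.independent_span_bound[OF _ ind this] assms(2)
  have "card (a ` A) \<le> card ((\<lambda>i. single i (1::'k)) ` I)" by simp
  also have "\<dots> \<le> card I" using assms(2) by (rule card_image_le)
  finally show ?thesis by (simp add: card_image[OF inj])
qed

definition wdeg :: "('v::finite \<Rightarrow> nat) \<Rightarrow> ('v \<Rightarrow>\<^sub>0 nat) \<Rightarrow> nat" where
  "wdeg w a = (\<Sum>v\<in>UNIV. w v * lookup a v)"

abbreviation mdeg :: "('v::finite \<Rightarrow>\<^sub>0 nat) \<Rightarrow> nat" where "mdeg \<equiv> wdeg (\<lambda>_. Suc 0)"

lemma wdeg_add [simp]: "wdeg w (a + b) = wdeg w a + wdeg w b"
  by (simp add: wdeg_def lookup_add distrib_left sum.distrib)

lemma wdeg_0 [simp]: "wdeg w 0 = 0" by (simp add: wdeg_def)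

lemma wdeg_single [simp]: "wdeg w (single v k) = w v * k"
  by (simp add: wdeg_def lookup_single when_def if_distrib cong: if_cong)

lemma lookup_le_mdeg: "lookup a v \<le> mdeg a"
  unfolding wdeg_def by (simp add: member_le_sum)

lemma mdeg_eq_0 [simp]: "mdeg a = 0 \<longleftrightarrow> a = 0"
  by (auto simp: wdeg_def intro: poly_mapping_eqI)

lemma finite_bounded_exponents:
  "finite {a :: 'v::finite \<Rightarrow>\<^sub>0 nat. \<forall>v. lookup a v \<le> b v}"
proof (rule finite_imageD)
  have "lookup ` {a :: 'v \<Rightarrow>\<^sub>0 nat. \<forall>v. lookup a v \<le> b v}
        \<subseteq> PiE UNIV (\<lambda>v. {..b v})" by auto
  then show "finite (lookup ` {a :: 'v \<Rightarrow>\<^sub>0 nat. \<forall>v. lookup a v \<le> b v})"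
    by (rule finite_subset) (auto intro!: finite_PiE)
  show "inj_on lookup {a :: 'v \<Rightarrow>\<^sub>0 nat. \<forall>v. lookup a v \<le> b v}"
    by (auto intro!: inj_onI poly_mapping_eqI)
qed

lemma finite_mdeg_le: "finite {a :: 'v::finite \<Rightarrow>\<^sub>0 nat. mdeg a \<le> i}"
  by (rule finite_subset[OF _ finite_bounded_exponents[of "\<lambda>_. i"]])
     (auto intro: order_trans[OF lookup_le_mdeg])

definition lexless :: "('v::finite \<Rightarrow>\<^sub>0 nat) \<Rightarrow> ('v \<Rightarrow>\<^sub>0 nat) \<Rightarrow> bool" where
  "lexless a b \<longleftrightarrow> (\<exists>v. lookup a v < lookup b v \<and>
     (\<forall>u. to_nat u < to_nat v \<longrightarrow> lookup a u = lookup b u))"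

lemma lexless_irrefl: "\<not> lexless a a" by (simp add: lexless_def)

lemma lexless_trans:
  assumes "lexless a b" "lexless b c" shows "lexless a c"
proof -
  from assms obtain v w where
    v: "lookup a v < lookup b v"
       "\<And>u. to_nat u < to_nat v \<Longrightarrow> lookup a u = lookup b u" and
    w: "lookup b w < lookup c w"
       "\<And>u. to_nat u < to_nat w \<Longrightarrow> lookup b u = lookup c u"
    unfolding lexless_def by blast
  consider "to_nat v < to_nat w" | "to_nat w < to_nat v" | "v = w"
    by (metis linorder_neqE_nat to_nat_split)
  then show ?thesis
  proof cases
    case 1 then show ?thesis unfolding lexless_def using v w by (intro exI[of _ v]) auto
  next
    case 2 then show ?thesis unfolding lexless_def using v w by (intro exI[of _ w]) auto
  next
    case 3 then show ?thesis unfolding lexless_def using v w by (intro exI[of _ w]) auto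
  qed
qed

lemma lexless_total:
  assumes "a \<noteq> b" shows "lexless a b \<or> lexless b a"
proof -
  let ?P = "\<lambda>v. lookup a v \<noteq> lookup b v"
  obtain v0 where "?P v0" using assms by (auto simp: poly_mapping_eq_iff fun_eq_iff)
  from ex_has_least_nat[of ?P v0 to_nat, OF this]
  obtain v where v: "?P v" "\<And>u. ?P u \<Longrightarrow> to_nat v \<le> to_nat u" by blast
  have "\<forall>u. to_nat u < to_nat v \<longrightarrow> lookup a u = lookup b u"
    using v(2) by (meson not_less)
  then show ?thesis unfolding lexless_def using v(1) by (metis linorder_neqE_nat)
qed

lemma lexless_add: "lexless (a + c) (b + c) \<longleftrightarrow> lexless a b"
  by (simp add: lexless_def lookup_add)

lemma finite_has_greatest:
  assumes "finite A" "A \<noteq> {}"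
    and "\<And>x y z. R x y \<Longrightarrow> R y z \<Longrightarrow> R x z" "\<And>x y. x \<in> A \<Longrightarrow> y \<in> A \<Longrightarrow> x \<noteq> y \<Longrightarrow> R x y \<or> R y x"
  shows "\<exists>m\<in>A. \<forall>x\<in>A. x \<noteq> m \<longrightarrow> R x m"
  using assms(1,2,4)
proof (induction A rule: finite_ne_induct)
  case (singleton x) then show ?case by simp
next
  case (insert x F)
  then obtain m where m: "m \<in> F" "\<forall>y\<in>F. y \<noteq> m \<longrightarrow> R y m" by blast
  show ?case
  proof (cases "R x m")
    case True then show ?thesis using m by blast
  next
    case False
    then have "R m x" using insert.prems insert.hyps m by (metis insertCI)
    then show ?thesis using m assms(3) by (metis insertE insertI1)
  qed
qed

definition wlex :: "('v::finite \<Rightarrow> nat) \<Rightarrow> ('v \<Rightarrow>\<^sub>0 nat) \<Rightarrow> ('v \<Rightarrow>\<^sub>0 nat) \<Rightarrow> bool" where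
  "wlex w a b \<longleftrightarrow> wdeg w a < wdeg w b \<or> wdeg w a = wdeg w b \<and> lexless a b"

lemma mult_expand:
  fixes p q :: "('v, 'k::comm_ring_1) mpol"
  shows "p * q = (\<Sum>a\<in>keys p. \<Sum>b\<in>keys q.
    single (a + b) (lookup p a * lookup q b))"
  by (subst pm_keys_expand[of p], subst pm_keys_expand[of q])
     (simp add: sum_product mult_single)

lemma lookup_mult_unique:
  fixes p q :: "('v, 'k::comm_ring_1) mpol"
  assumes "a \<in> keys p" "b \<in> keys q"
    and "\<And>a' b'. a' \<in> keys p \<Longrightarrow> b' \<in> keys q \<Longrightarrow> a' + b' = a + b \<Longrightarrow> a' = a \<and> b' = b"
  shows "lookup (p * q) (a + b) = lookup p a * lookup q b"
proof -
  have "lookup (p * q) (a + b) =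
    (\<Sum>a'\<in>keys p. \<Sum>b'\<in>keys q.
      if a' = a then if b' = b then lookup p a * lookup q b else 0 else 0)"
    unfolding mult_expand lookup_sum lookup_single when_def
    by (intro sum.cong refl) (use assms(3) in auto)
  also have "\<dots> = lookup p a * lookup q b"
    using assms(1,2) by (simp add: sum.If_cases if_distrib[of "sum _"] sum.delta cong: if_cong)
  finally show ?thesis .
qed

lemma wlex_greatest:
  assumes "p \<noteq> 0"
  shows "\<exists>a\<in>keys p. \<forall>b\<in>keys p. (b \<noteq> a \<longrightarrow> wlex w b a) \<and> wdeg w b \<le> wdeg w a"
proof -
  have "\<exists>m\<in>keys p. \<forall>x\<in>keys p. x \<noteq> m \<longrightarrow> wlex w x m"
  proof (rule finite_has_greatest)
    show "keys p \<noteq> {}" using assms by simp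
    show "wlex w x z" if "wlex w x y" "wlex w y z" for x y z
      using that lexless_trans unfolding wlex_def by (metis order.strict_trans)
    show "wlex w x y \<or> wlex w y x" if "x \<noteq> y" for x y
      using lexless_total[OF that] unfolding wlex_def by auto
  qed simp
  then obtain m where m: "m \<in> keys p"
    "\<And>x. x \<in> keys p \<Longrightarrow> x \<noteq> m \<Longrightarrow> wlex w x m" by blast
  have "wdeg w x \<le> wdeg w m" if "x \<in> keys p" for x
    using m(2)[OF that] unfolding wlex_def by (cases "x = m") auto
  then show ?thesis using m by blast
qed

text \<open>
  The product of the greatest exponents for weight-then-lexicographic order cannot cancel. This shows that polynomials
  over a domain form a domain and that weighted degrees add up.
\<close>
lemma mult_key_wdeg:
  fixes p q :: "('v::finite, 'k::idom) mpol"
  assumes "p \<noteq> 0" "q \<noteq> 0"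
  obtains a b where "a \<in> keys p" "b \<in> keys q" "a + b \<in> keys (p * q)"
    "\<And>c. c \<in> keys p \<Longrightarrow> wdeg w c \<le> wdeg w a"
    "\<And>c. c \<in> keys q \<Longrightarrow> wdeg w c \<le> wdeg w b"
proof -
  obtain a where a: "a \<in> keys p" "\<And>b. b \<in> keys p \<Longrightarrow> b \<noteq> a \<Longrightarrow> wlex w b a"
    "\<And>b. b \<in> keys p \<Longrightarrow> wdeg w b \<le> wdeg w a" using wlex_greatest[OF assms(1), of w] by blast
  obtain b where b: "b \<in> keys q" "\<And>c. c \<in> keys q \<Longrightarrow> c \<noteq> b \<Longrightarrow> wlex w c b"
    "\<And>c. c \<in> keys q \<Longrightarrow> wdeg w c \<le> wdeg w b" using wlex_greatest[OF assms(2), of w] by blast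
  have unique: "a' = a \<and> b' = b"
    if ab: "a' \<in> keys p" "b' \<in> keys q" "a' + b' = a + b" for a' b'
  proof (rule ccontr)
    assume "\<not> (a' = a \<and> b' = b)"
    then have ne: "a' \<noteq> a" "b' \<noteq> b" using ab(3) by auto
    have wl: "wlex w a' a" "wlex w b' b" using a(2)[OF ab(1) ne(1)] b(2)[OF ab(2) ne(2)] by auto
    have "wdeg w a' + wdeg w b' = wdeg w a + wdeg w b" using arg_cong[OF ab(3), of "wdeg w"] by simp
    then have "lexless a' a" "lexless b' b" using wl unfolding wlex_def by auto
    then have "lexless (a' + b') (a + b')" "lexless (b' + a) (b + a)" by (simp_all add: lexless_add)
    then have "lexless (a' + b') (a + b)"
      using lexless_trans[of "a' + b'" "a + b'" "a + b"] by (simp add: add.commute)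
    then show False using ab(3) lexless_irrefl[of "a + b"] by simp
  qed
  have "lookup (p * q) (a + b) = lookup p a * lookup q b"
    using a(1) b(1) unique by (rule lookup_mult_unique)
  then have ab: "a + b \<in> keys (p * q)" using a(1) b(1) by (simp add: in_keys_iff)
  show ?thesis by (rule that[OF a(1) b(1) ab a(3) b(3)])
qed

lemma mpol_mult_nonzero:
  fixes p q :: "('v::finite, 'k::idom) mpol"
  assumes "p \<noteq> 0" "q \<noteq> 0" shows "p * q \<noteq> 0"
proof
  assume 0: "p * q = 0"
  show False
  proof (rule mult_key_wdeg[OF assms, of "\<lambda>_. 0"])
    fix a b assume "a + b \<in> keys (p * q)"
    then show False unfolding 0 by simp
  qed
qed

lemma mpol_power_nonzero:
  fixes p :: "('v::finite, 'k::idom) mpol"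
  assumes "p \<noteq> 0" shows "p ^ k \<noteq> 0"
  using assms by (induction k) (auto simp: mpol_mult_nonzero)

lemma mpol_prod_nonzero:
  fixes p :: "'x \<Rightarrow> ('v::finite, 'k::idom) mpol"
  assumes "finite A" "\<And>x. x \<in> A \<Longrightarrow> p x \<noteq> 0" shows "prod p A \<noteq> 0"
  using assms by (induction A rule: finite_induct) (auto simp: mpol_mult_nonzero)

lemma card_box:
  "card {a :: 'v::finite \<Rightarrow>\<^sub>0 nat. \<forall>v. lookup a v < b v} = (\<Prod>v\<in>UNIV. b v)"
proof -
  have "bij_betw lookup {a :: 'v \<Rightarrow>\<^sub>0 nat. \<forall>v. lookup a v < b v} (PiE UNIV (\<lambda>v. {..<b v}))"
  proof (rule bij_betwI[of _ _ _ Abs_poly_mapping])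
    show "lookup \<in> {a. \<forall>v. lookup a v < b v} \<rightarrow> (\<Pi>\<^sub>E v\<in>UNIV. {..<b v})" by auto
    show "Abs_poly_mapping \<in> (\<Pi>\<^sub>E v\<in>UNIV. {..<b v}) \<rightarrow> {a. \<forall>v. lookup a v < b v}"
      by (auto simp: lookup_Abs_poly_mapping PiE_def Pi_def)
  qed (auto intro: poly_mapping_eqI)
  then show ?thesis by (simp add: bij_betw_same_card card_PiE)
qed

lemma finite_box: "finite {a :: 'v::finite \<Rightarrow>\<^sub>0 nat. \<forall>v. lookup a v < b v}"
  by (rule finite_subset[OF _ finite_bounded_exponents[of b]]) (auto simp: less_imp_le)

section \<open>Dimension theory of polynomial ideals\<close>

definition is_ideal :: "'a::comm_ring_1 set \<Rightarrow> bool" where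
  "is_ideal I \<longleftrightarrow> 0 \<in> I \<and> (\<forall>x\<in>I. \<forall>y\<in>I. x + y \<in> I) \<and> (\<forall>a. \<forall>x\<in>I. a * x \<in> I)"

definition is_prime :: "'a::comm_ring_1 set \<Rightarrow> bool" where
  "is_prime P \<longleftrightarrow> is_ideal P \<and> 1 \<notin> P \<and> (\<forall>a b. a * b \<in> P \<longrightarrow> a \<in> P \<or> b \<in> P)"

lemma ideal_closed:
  assumes "is_ideal I"
  shows "0 \<in> I" "x \<in> I \<Longrightarrow> y \<in> I \<Longrightarrow> x + y \<in> I" "x \<in> I \<Longrightarrow> a * x \<in> I" "x \<in> I \<Longrightarrow> x * a \<in> I"
    "x \<in> I \<Longrightarrow> - x \<in> I" "x \<in> I \<Longrightarrow> y \<in> I \<Longrightarrow> x - y \<in> I"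
proof -
  have *: "a * x \<in> I" if "x \<in> I" for a x using assms that by (simp add: is_ideal_def)
  have neg: "- x \<in> I" if "x \<in> I" for x using *[OF that, of "-1"] by simp
  show "0 \<in> I" "x \<in> I \<Longrightarrow> y \<in> I \<Longrightarrow> x + y \<in> I" using assms by (auto simp: is_ideal_def)
  show "x \<in> I \<Longrightarrow> a * x \<in> I" "x \<in> I \<Longrightarrow> - x \<in> I" by (fact * neg)+
  show "x \<in> I \<Longrightarrow> x * a \<in> I" using *[of x a] by (simp add: mult.commute)
  show "x \<in> I \<Longrightarrow> y \<in> I \<Longrightarrow> x - y \<in> I"
    using assms neg[of y] unfolding is_ideal_def by (metis add_uminus_conv_diff)
qed

lemma ideal_sum:
  assumes "is_ideal I" "\<And>x. x \<in> A \<Longrightarrow> f x \<in> I" shows "(\<Sum>x\<in>A. f x) \<in> I"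
  using assms by (induction A rule: infinite_finite_induct) (auto intro: ideal_closed)

lemma prime_ideal: "is_prime P \<Longrightarrow> is_ideal P" by (simp add: is_prime_def)

text \<open>
  Krull's argument: an ideal maximal among those that avoid \<open>T\<close>, found by Zorn's lemma, is prime.
\<close>
lemma prime_disjoint_from_multiplicative_set:
  assumes I: "is_ideal I" and T: "1 \<in> T" "\<And>x y. x \<in> T \<Longrightarrow> y \<in> T \<Longrightarrow> x * y \<in> T" "I \<inter> T = {}"
  shows "\<exists>P. is_prime P \<and> I \<subseteq> P \<and> P \<inter> T = {}"
proof -
  let ?F = "{J. is_ideal J \<and> I \<subseteq> J \<and> J \<inter> T = {}}"
  have "\<exists>M\<in>?F. \<forall>J\<in>?F. M \<subseteq> J \<longrightarrow> J = M"
  proof (rule subset_Zorn_nonempty)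
    show "?F \<noteq> {}" using I T by blast
    fix C assume C: "C \<noteq> {}" "subset.chain ?F C"
    then have F: "C \<subseteq> ?F" and lin: "\<And>J K. J \<in> C \<Longrightarrow> K \<in> C \<Longrightarrow> J \<subseteq> K \<or> K \<subseteq> J"
      unfolding subset_chain_def by blast+
    have "is_ideal (\<Union>C)"
      unfolding is_ideal_def
    proof (intro conjI ballI allI)
      show "0 \<in> \<Union>C" using C(1) F ideal_closed(1) by blast
    next
      fix x y assume "x \<in> \<Union>C" "y \<in> \<Union>C"
      then obtain J K where "J \<in> C" "K \<in> C" "x \<in> J" "y \<in> K" by blast
      then obtain L where "L \<in> C" "x \<in> L" "y \<in> L" using lin by blast
      moreover have "is_ideal L" using \<open>L \<in> C\<close> F by blast
      ultimately show "x + y \<in> \<Union>C" using ideal_closed(2) by blast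
    next
      fix a x assume "x \<in> \<Union>C"
      then obtain J where "J \<in> C" "x \<in> J" by blast
      moreover have "is_ideal J" using \<open>J \<in> C\<close> F by blast
      ultimately show "a * x \<in> \<Union>C" using ideal_closed(3) by blast
    qed
    then show "\<Union>C \<in> ?F" using C(1) F by blast
  qed
  then obtain P where PF: "P \<in> ?F" and maxF: "\<forall>J\<in>?F. P \<subseteq> J \<longrightarrow> J = P" by (rule bexE)
  have P: "is_ideal P" "I \<subseteq> P" "P \<inter> T = {}" using PF by simp_all
  have max: "J = P" if "is_ideal J" "I \<subseteq> J" "J \<inter> T = {}" "P \<subseteq> J" for J
    using maxF that by simp
  have meets: "\<exists>p\<in>P. \<exists>x. p + a * x \<in> T" if "a \<notin> P" for a
  proof -
    let ?J = "{p + a * x | p x. p \<in> P}"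
    have "is_ideal ?J"
      unfolding is_ideal_def
    proof (intro conjI ballI allI)
      have "0 = 0 + a * 0 \<and> 0 \<in> P" using ideal_closed(1)[OF P(1)] by simp
      then show "0 \<in> ?J" by blast
    next
      fix u v assume "u \<in> ?J" "v \<in> ?J"
      then obtain p x q y where uv: "u = p + a * x" "v = q + a * y" "p \<in> P" "q \<in> P" by blast
      then have "u + v = (p + q) + a * (x + y)" by (simp add: algebra_simps)
      then show "u + v \<in> ?J" using ideal_closed(2)[OF P(1) uv(3,4)] by blast
    next
      fix b u assume "u \<in> ?J"
      then obtain p x where uv: "u = p + a * x" "p \<in> P" by blast
      then have "b * u = b * p + a * (b * x)" by (simp add: algebra_simps)
      then show "b * u \<in> ?J" using ideal_closed(3)[OF P(1) uv(2)] by blast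
    qed
    moreover have "P \<subseteq> ?J"
    proof
      fix p assume "p \<in> P"
      then have "p = p + a * 0 \<and> p \<in> P" by simp
      then show "p \<in> ?J" by blast
    qed
    moreover have "?J \<noteq> P"
    proof
      have "a = 0 + a * 1 \<and> 0 \<in> P" using ideal_closed(1)[OF P(1)] by simp
      then have aJ: "a \<in> ?J" by blast
      assume eq: "?J = P"
      show False using that aJ unfolding eq by (rule notE)
    qed
    ultimately have "?J \<inter> T \<noteq> {}" using max[of ?J] P(2) by blast
    then show ?thesis by blast
  qed
  have "a \<in> P \<or> b \<in> P" if ab: "a * b \<in> P" for a b
  proof (rule ccontr)
    assume "\<not> (a \<in> P \<or> b \<in> P)"
    then obtain p x q y where pq: "p \<in> P" "p + a * x \<in> T" "q \<in> P" "q + b * y \<in> T"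
      using meets by meson
    have "(p + a * x) * (q + b * y) = (q + b * y) * p + (a * x) * q + (x * y) * (a * b)"
      by (simp add: algebra_simps)
    also have "\<dots> \<in> P"
      by (rule ideal_closed(2)[OF P(1) ideal_closed(2)[OF P(1)
            ideal_closed(3)[OF P(1) pq(1)] ideal_closed(3)[OF P(1) pq(3)]] ideal_closed(3)[OF P(1) ab]])
    finally show False using T(2)[OF pq(2,4)] P(3) by blast
  qed
  then have "is_prime P" unfolding is_prime_def using P T(1) by blast
  then show ?thesis using P by blast
qed

definition poly_in :: "'v set \<Rightarrow> ('v, 'k::zero) mpol set" where
  "poly_in S = {p. \<forall>a\<in>keys p. keys a \<subseteq> S}"

abbreviation mon :: "('v \<Rightarrow>\<^sub>0 nat) \<Rightarrow> ('v, 'k::zero_neq_one) mpol" where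
  "mon a \<equiv> single a 1"

lemma poly_in_closed:
  fixes p q :: "('v, 'k::comm_ring_1) mpol"
  shows "0 \<in> poly_in S" "1 \<in> poly_in S" "p \<in> poly_in S \<Longrightarrow> q \<in> poly_in S \<Longrightarrow> p + q \<in> poly_in S"
    "p \<in> poly_in S \<Longrightarrow> q \<in> poly_in S \<Longrightarrow> p - q \<in> poly_in S"
    "p \<in> poly_in S \<Longrightarrow> - p \<in> poly_in S"
    "p \<in> poly_in S \<Longrightarrow> q \<in> poly_in S \<Longrightarrow> p * q \<in> poly_in S"
proof -
  show "p \<in> poly_in S \<Longrightarrow> q \<in> poly_in S \<Longrightarrow> p + q \<in> poly_in S"
    using keys_add[of p q] by (auto simp: poly_in_def)
  show "p \<in> poly_in S \<Longrightarrow> q \<in> poly_in S \<Longrightarrow> p - q \<in> poly_in S"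
  proof -
    have "keys (p - q) \<subseteq> keys p \<union> keys q"
      by (auto simp: in_keys_iff lookup_minus)
    then show "p \<in> poly_in S \<Longrightarrow> q \<in> poly_in S \<Longrightarrow> p - q \<in> poly_in S" by (auto simp: poly_in_def)
  qed
  show "p \<in> poly_in S \<Longrightarrow> - p \<in> poly_in S" by (auto simp: poly_in_def in_keys_iff)
  show "p \<in> poly_in S \<Longrightarrow> q \<in> poly_in S \<Longrightarrow> p * q \<in> poly_in S"
  proof -
    assume p: "p \<in> poly_in S" and q: "q \<in> poly_in S"
    show ?thesis unfolding poly_in_def
    proof (intro CollectI ballI)
      fix a assume "a \<in> keys (p * q)"
      then obtain b c where a: "a = b + c" "b \<in> keys p" "c \<in> keys q"
        using keys_mult[of p q] by blast
      have "keys a \<subseteq> keys b \<union> keys c"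
        unfolding a(1) by (rule keys_add)
      then show "keys a \<subseteq> S" using a p q unfolding poly_in_def by blast
    qed
  qed
qed (auto simp: poly_in_def)

lemma poly_in_power: "(p :: ('v, 'k::comm_ring_1) mpol) \<in> poly_in S \<Longrightarrow> p ^ k \<in> poly_in S"
  by (induction k) (auto intro: poly_in_closed)

lemma poly_in_prod:
  "(\<And>x. x \<in> A \<Longrightarrow> (f x :: ('v, 'k::comm_ring_1) mpol) \<in> poly_in S) \<Longrightarrow> prod f A \<in> poly_in S"
  by (induction A rule: infinite_finite_induct) (auto intro: poly_in_closed)

lemma poly_in_sum:
  "(\<And>x. x \<in> A \<Longrightarrow> (f x :: ('v, 'k::comm_ring_1) mpol) \<in> poly_in S) \<Longrightarrow> sum f A \<in> poly_in S"
  by (induction A rule: infinite_finite_induct) (auto intro: poly_in_closed)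

lemma poly_in_mono: "S \<subseteq> T \<Longrightarrow> poly_in S \<subseteq> poly_in T" by (auto simp: poly_in_def)

lemma single_poly_in: "keys a \<subseteq> S \<Longrightarrow> single a c \<in> poly_in S"
  by (auto simp: poly_in_def)

text \<open>
  The variables in \<open>S\<close> are algebraically independent in the quotient by \<open>I\<close>.
\<close>
definition indep_mod :: "('v, 'k::zero) mpol set \<Rightarrow> 'v set \<Rightarrow> bool" where
  "indep_mod I S \<longleftrightarrow> poly_in S \<inter> I \<subseteq> {0}"

text \<open>
  For a proper ideal this is the Krull dimension of the quotient ring. Defining it through independent sets of variables
  makes it comparable with growth, and the theorem at the end of this section makes it comparable with chains of primes.
\<close>
definition cdim :: "('v::finite, 'k::zero) mpol set \<Rightarrow> nat" where
  "cdim I = Max (card ` {S. indep_mod I S})"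

lemma indep_mod_empty:
  fixes I :: "('v::finite, 'k::field) mpol set"
  assumes "is_ideal I" "1 \<notin> I" shows "indep_mod I {}"
proof -
  have "p = 0" if "p \<in> poly_in {}" "p \<in> I" for p
  proof (rule ccontr)
    assume "p \<noteq> 0"
    have k: "keys p \<subseteq> {0}" using that(1) by (auto simp: poly_in_def)
    have p: "p = single 0 (lookup p 0)"
      using pm_expand[OF _ k] by simp
    then have "lookup p 0 \<noteq> 0" using \<open>p \<noteq> 0\<close> by (metis single_zero)
    then have "single 0 (inverse (lookup p 0)) * p = 1"
      by (subst (2) p) (simp add: mult_single flip: single_one)
    then show False using ideal_closed(3)[OF assms(1) that(2)] assms(2) by metis
  qed
  then show ?thesis by (auto simp: indep_mod_def)
qed

lemma cdim_ge: "indep_mod I S \<Longrightarrow> card S \<le> cdim I"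
  unfolding cdim_def by (rule Max_ge) auto

lemma cdim_witness:
  fixes I :: "('v::finite, 'k::field) mpol set"
  assumes "is_ideal I" "1 \<notin> I" obtains S where "indep_mod I S" "card S = cdim I"
proof -
  have "cdim I \<in> card ` {S. indep_mod I S}"
    unfolding cdim_def by (rule Max_in) (use indep_mod_empty[OF assms] in auto)
  then show ?thesis using that by auto
qed

lemma cdim_anti:
  fixes I :: "('v::finite, 'k::field) mpol set"
  assumes "is_ideal J" "1 \<notin> J" "I \<subseteq> J" shows "cdim J \<le> cdim I"
proof -
  obtain S where "indep_mod J S" "card S = cdim J" using cdim_witness assms by metis
  then show ?thesis using cdim_ge[of I S] assms(3) by (auto simp: indep_mod_def)
qed

lemma exponent_growth_le:
  assumes "\<And>i::nat. (i + 1) ^ a \<le> C * (i + 1) ^ b" shows "a \<le> b"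
proof (rule ccontr)
  assume "\<not> a \<le> b"
  then have "(C + 1) ^ Suc b \<le> (C + 1) ^ a" by (intro power_increasing) auto
  also have "\<dots> \<le> C * (C + 1) ^ b" using assms[of C] by simp
  finally show False by simp
qed

text \<open>
  Sort the element of \<open>P\<close> by powers of \<open>v\<close>. The variable \<open>v\<close> occurs in it, since a
  nonzero polynomial in \<open>S\<close> alone is not in \<open>P\<close>.
\<close>
lemma algebraic_relation:
  fixes P :: "('v::finite, 'k::field) mpol set"
  assumes P: "is_ideal P" and S: "indep_mod P S" and v: "v \<notin> S"
    and q: "q \<in> poly_in (insert v S)" "q \<in> P" "q \<noteq> 0"
  shows "\<exists>m c R. m \<ge> 1 \<and> c \<in> poly_in S \<and> c \<noteq> 0 \<and> R \<in> poly_in (insert v S) \<and>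
    (\<forall>a\<in>keys R. lookup a v < m) \<and> c * mon (single v m) - R \<in> P"
proof -
  define m where "m = Max ((\<lambda>a. lookup a v) ` keys q)"
  have fin: "finite ((\<lambda>a. lookup a v) ` keys q)"
    and ne: "(\<lambda>a. lookup a v) ` keys q \<noteq> {}" using q(3) by auto
  have le: "lookup a v \<le> m" if "a \<in> keys q" for a
    unfolding m_def using fin that by (intro Max_ge) auto
  obtain a0 where a0: "a0 \<in> keys q" "lookup a0 v = m"
    using Max_in[OF fin ne] unfolding m_def by auto
  let ?e = "single v m"
  let ?K = "{a \<in> keys q. lookup a v = m}"
  define c where "c = (\<Sum>a\<in>?K. single (a - ?e) (lookup q a))"
  define R where "R = - pm_restrict {a. lookup a v \<noteq> m} q"
  have sub: "a - ?e + ?e = a" if "lookup a v = m" for a :: "'v \<Rightarrow>\<^sub>0 nat"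
    by (rule poly_mapping_eqI) (use that in \<open>auto simp: lookup_add lookup_minus lookup_single when_def\<close>)
  have "c * mon ?e = (\<Sum>a\<in>?K. single a (lookup q a))"
    unfolding c_def sum_distrib_right by (intro sum.cong refl) (simp add: mult_single sub)
  then have top: "c * mon ?e = pm_restrict {a. lookup a v = m} q"
    by (simp add: pm_restrict_def Int_def)
  have "c * mon ?e - R = q"
    unfolding top R_def by (rule poly_mapping_eqI) (simp add: lookup_minus lookup_add lookup_pm_restrict)
  moreover have "c \<in> poly_in S"
    unfolding c_def
  proof (intro poly_in_sum single_poly_in)
    fix a assume a: "a \<in> ?K"
    then have "keys a \<subseteq> insert v S" using q(1) unfolding poly_in_def by blast
    then have "x = v \<or> x \<in> S" if "lookup a x \<noteq> 0" for x using that by (meson in_keys_iff insertE subsetD)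
    moreover have "x \<noteq> v" "lookup a x \<noteq> 0" if "x \<in> keys (a - ?e)" for x
      using that a by (auto simp: in_keys_iff lookup_minus lookup_single when_def split: if_splits)
    ultimately show "keys (a - ?e) \<subseteq> S" by blast
  qed
  moreover have "c \<noteq> 0"
  proof
    assume "c = 0"
    then have "lookup (pm_restrict {a. lookup a v = m} q) a0 = 0"
      unfolding top[symmetric] by simp
    then show False using a0 by (simp add: lookup_pm_restrict in_keys_iff)
  qed
  moreover have "R \<in> poly_in (insert v S)"
    unfolding R_def using q(1)
    by (intro poly_in_closed) (auto simp: poly_in_def keys_pm_restrict)
  moreover have "\<forall>a\<in>keys R. lookup a v < m"
    unfolding R_def using le by (auto simp: keys_pm_restrict order.strict_iff_order)
  moreover have "m \<ge> 1"
  proof (rule ccontr)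
    assume "\<not> m \<ge> 1"
    then have "lookup a v = 0" if "a \<in> keys q" for a using le[OF that] by simp
    then have "v \<notin> keys a" if "a \<in> keys q" for a
      using that by (simp add: in_keys_iff)
    then have "q \<in> poly_in S" using q(1) by (fastforce simp: poly_in_def)
    then show False using S q(2,3) by (auto simp: indep_mod_def)
  qed
  ultimately show ?thesis using q(2) by metis
qed

lemma exponent_split_off:
  fixes a :: "'v \<Rightarrow>\<^sub>0 nat"
  assumes "m \<le> lookup a v" shows "a = (a - single v m) + single v m"
  by (rule poly_mapping_eqI) (use assms in \<open>auto simp: lookup_add lookup_minus lookup_single when_def\<close>)

definition ideg :: "'v set \<Rightarrow> ('v::finite \<Rightarrow>\<^sub>0 nat) \<Rightarrow> nat" where
  "ideg S = wdeg (\<lambda>v. if v \<in> S then 1 else 0)"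

lemma ideg_add [simp]: "ideg S (a + b) = ideg S a + ideg S b" by (simp add: ideg_def)
lemma ideg_single [simp]: "ideg S (single v k) = (if v \<in> S then k else 0)" by (simp add: ideg_def)
lemma ideg_0 [simp]: "ideg S 0 = 0" by (simp add: ideg_def)

lemma ideg_eq_0: "keys a \<inter> S = {} \<Longrightarrow> ideg S a = 0"
  unfolding ideg_def wdeg_def by (auto simp: in_keys_iff)

lemma lookup_le_ideg: "v \<in> S \<Longrightarrow> lookup a v \<le> ideg S a"
  unfolding ideg_def wdeg_def
  by (rule order_trans[OF _ member_le_sum[where i = v]]) auto

lemma ideg_le_mdeg: "ideg S a \<le> mdeg a"
  unfolding ideg_def wdeg_def by (rule sum_mono) auto

lemma keys_power_bound:
  fixes p :: "('v::finite, 'k::comm_ring_1) mpol"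
  assumes "\<And>a. a \<in> keys p \<Longrightarrow> wdeg w a \<le> d" "a \<in> keys (p ^ k)"
  shows "wdeg w a \<le> d * k"
  using assms(2)
proof (induction k arbitrary: a)
  case 0 then show ?case by simp
next
  case (Suc k)
  then obtain b c where a: "a = b + c" "b \<in> keys p" "c \<in> keys (p ^ k)"
    using keys_mult[of p "p ^ k"] by auto
  then show ?case using assms(1)[OF a(2)] Suc.IH[OF a(3)] by simp
qed

text \<open>
  The polynomials whose exponents outside \<open>S\<close> are bounded by \<open>m\<close>: together with bounded degree
  in \<open>S\<close> they form a finite-dimensional space whose size is governed by \<open>S\<close> alone.
\<close>
definition reduced :: "'v set \<Rightarrow> ('v \<Rightarrow> nat) \<Rightarrow> nat \<Rightarrow> ('v::finite, 'k::zero) mpol set" where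
  "reduced S m d = {p. \<forall>a\<in>keys p. (\<forall>v. v \<notin> S \<longrightarrow> lookup a v < m v) \<and> ideg S a \<le> d}"

lemma reduced_combination:
  assumes "\<And>x. x \<in> A \<Longrightarrow> f x \<in> reduced S m d"
  shows "(\<Sum>x\<in>A. sc (c x) (f x)) \<in> reduced S m d"
proof -
  have "keys (\<Sum>x\<in>A. sc (c x) (f x)) \<subseteq>
    {a. (\<forall>v. v \<notin> S \<longrightarrow> lookup a v < m v) \<and> ideg S a \<le> d}"
    by (rule keys_sum_subset) (use assms keys_sc in \<open>fastforce simp: reduced_def\<close>)
  then show ?thesis by (auto simp: reduced_def)
qed

lemma sc_mult_left:
  fixes p q :: "('v, 'k::field) mpol"
  shows "sc c p * q = sc c (p * q)" "p * sc c q = sc c (p * q)"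
  by (simp_all flip: pconst_times add: algebra_simps)

lemma ideal_sc:
  fixes p :: "('v, 'k::field) mpol"
  shows "is_ideal I \<Longrightarrow> p \<in> I \<Longrightarrow> sc c p \<in> I"
  by (metis ideal_closed(3) pconst_times)

lemma pm_mon_expand: "p = (\<Sum>a\<in>keys p. sc (lookup p a) (mon a))"
  using pm_keys_expand[of p] by simp

text \<open>
  When \<open>S\<close> is a maximal independent set, every further variable satisfies an equation over the polynomials in
  \<open>S\<close>. Its leading coefficients, collected in \<open>h\<close>, are the denominators: each multiplication by
  \<open>h\<close> pays for lowering the degree in the other variables once. The degree in \<open>S\<close> grows only by
  a constant per step, and this linear bound is what the counting argument for strict inclusions needs.
\<close>
lemma reduction_mod_prime:
  fixes P :: "('v::finite, 'k::field) mpol set"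
  assumes P: "is_ideal P" and S: "indep_mod P S"
    and max: "\<And>v. v \<notin> S \<Longrightarrow> \<not> indep_mod P (insert v S)"
  obtains h m c0 where "h \<in> poly_in S" "h \<noteq> 0" "\<And>v. v \<notin> S \<Longrightarrow> m v \<ge> (1::nat)"
    "\<And>u N d. (\<And>a. a \<in> keys u \<Longrightarrow> ideg (-S) a \<le> N \<and> ideg S a \<le> d) \<Longrightarrow>
       \<exists>p\<in>reduced S m (d + c0 * N). h ^ N * u - p \<in> P"
proof -
  have "\<forall>v. \<exists>m c R. v \<notin> S \<longrightarrow> (m \<ge> 1 \<and> c \<in> poly_in S \<and> c \<noteq> 0 \<and> R \<in> poly_in (insert v S) \<and>
    (\<forall>a\<in>keys R. lookup a v < m) \<and> c * mon (single v m) - R \<in> P)"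
  proof (intro allI)
    fix v
    show "\<exists>m c R. v \<notin> S \<longrightarrow> (m \<ge> 1 \<and> c \<in> poly_in S \<and> c \<noteq> 0 \<and> R \<in> poly_in (insert v S) \<and>
      (\<forall>a\<in>keys R. lookup a v < m) \<and> c * mon (single v m) - R \<in> P)"
    proof (cases "v \<in> S")
      case False
      then obtain q where "q \<in> poly_in (insert v S)" "q \<in> P" "q \<noteq> 0"
        using max by (auto simp: indep_mod_def)
      from algebraic_relation[OF P S False this] show ?thesis by blast
    qed simp
  qed
  then have "\<exists>m c R. \<forall>v. v \<notin> S \<longrightarrow> (m v \<ge> 1 \<and> c v \<in> poly_in S \<and> c v \<noteq> 0 \<and> R v \<in> poly_in (insert v S) \<and>
    (\<forall>a\<in>keys (R v). lookup a v < m v) \<and> c v * mon (single v (m v)) - R v \<in> P)"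
    unfolding choice_iff .
  then obtain m :: "'v \<Rightarrow> nat" and c R :: "'v \<Rightarrow> ('v, 'k) mpol" where
    m: "\<And>v. v \<notin> S \<Longrightarrow> m v \<ge> 1" and c: "\<And>v. v \<notin> S \<Longrightarrow> c v \<in> poly_in S" "\<And>v. v \<notin> S \<Longrightarrow> c v \<noteq> 0" and
    R: "\<And>v. v \<notin> S \<Longrightarrow> R v \<in> poly_in (insert v S)"
      "\<And>v a. v \<notin> S \<Longrightarrow> a \<in> keys (R v) \<Longrightarrow> lookup a v < m v" and
    rel: "\<And>v. v \<notin> S \<Longrightarrow> c v * mon (single v (m v)) - R v \<in> P"
    by blast
  define h where "h = (\<Prod>v\<in>-S. c v)"
  define h' where "h' v = (\<Prod>u\<in>-S-{v}. c u)" for v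
  define G where "G v = h' v * R v" for v
  have h: "h = h' v * c v" if "v \<notin> S" for v
    unfolding h_def h'_def using that by (subst prod.remove[of _ v]) (auto simp: mult.commute)
  have h_in: "h \<in> poly_in S" unfolding h_def using c by (intro poly_in_prod) auto
  have h0: "h \<noteq> 0" unfolding h_def using c by (intro mpol_prod_nonzero) auto
  have h'_in: "h' v \<in> poly_in S" if "v \<notin> S" for v unfolding h'_def using c by (intro poly_in_prod) auto
  have G_in: "G v \<in> poly_in (insert v S)" if "v \<notin> S" for v
    unfolding G_def using h'_in[OF that] R(1)[OF that] poly_in_mono[of S "insert v S"]
    by (intro poly_in_closed) auto
  have G_lt: "lookup a v < m v" if v: "v \<notin> S" and a: "a \<in> keys (G v)" for a v
  proof -
    obtain b d where a: "a = b + d" "b \<in> keys (h' v)" "d \<in> keys (R v)"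
      using a keys_mult[of "h' v" "R v"] unfolding G_def by blast
    have "keys b \<subseteq> S" using h'_in[OF v] a(2) unfolding poly_in_def by blast
    then have "lookup b v = 0" using v by (meson in_keys_iff subsetD)
    then show ?thesis using R(2)[OF v a(3)] a(1) by (simp add: lookup_add)
  qed
  let ?U = "keys h \<union> (\<Union>v\<in>-S. keys (G v))"
  define c0 where "c0 = (\<Sum>a\<in>?U. ideg S a)"
  have c0: "ideg S a \<le> c0" if "a \<in> ?U" for a
    unfolding c0_def by (rule member_le_sum) (use that in auto)
  have monomial: "\<exists>p\<in>reduced S m (ideg S a + c0 * N). h ^ N * mon a - p \<in> P"
    if "ideg (-S) a \<le> N" for a N
    using that
  proof (induction N arbitrary: a)
    case 0
    have "lookup a v = 0" if "v \<notin> S" for v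
      using lookup_le_ideg[of v "-S" a] that 0 by simp
    then have "mon a \<in> reduced S m (ideg S a)" using m by (auto simp: reduced_def Suc_le_eq)
    then show ?case using ideal_closed(1)[OF P] by (intro bexI[of _ "mon a"]) auto
  next
    case (Suc N)
    show ?case
    proof (cases "\<forall>v. v \<notin> S \<longrightarrow> lookup a v < m v")
      case True
      have "h ^ Suc N * mon a \<in> reduced S m (ideg S a + c0 * Suc N)"
        unfolding reduced_def
      proof (intro CollectI ballI)
        fix b assume "b \<in> keys (h ^ Suc N * mon a)"
        then obtain d where b: "b = d + a" "d \<in> keys (h ^ Suc N)"
          using keys_mult[of "h ^ Suc N" "mon a"] by auto
        have "keys d \<subseteq> S" using poly_in_power[OF h_in, of "Suc N"] b(2)
          unfolding poly_in_def by blast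
        then have "lookup d v = 0" if "v \<notin> S" for v using that by (auto simp: in_keys_iff)
        moreover have "ideg S d \<le> c0 * Suc N" unfolding ideg_def
          by (rule keys_power_bound[OF _ b(2)]) (use c0 in \<open>auto simp: ideg_def\<close>)
        ultimately show "(\<forall>v. v \<notin> S \<longrightarrow> lookup b v < m v) \<and> ideg S b \<le> ideg S a + c0 * Suc N"
          using True b(1) by (simp add: lookup_add)
      qed
      then show ?thesis using ideal_closed(1)[OF P] by (intro bexI[of _ "h ^ Suc N * mon a"]) auto
    next
      case False
      then obtain v where v: "v \<notin> S" "m v \<le> lookup a v" by (auto simp: not_less)
      define b where "b = a - single v (m v)"
      have a: "a = b + single v (m v)" unfolding b_def by (rule exponent_split_off[OF v(2)])
      have G_key: "ideg (-S) (d + b) \<le> N \<and> ideg S (d + b) \<le> ideg S a + c0" if d: "d \<in> keys (G v)" for d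
      proof
        have "keys d \<subseteq> insert v S" using G_in[OF v(1)] d unfolding poly_in_def by blast
        moreover have "x \<noteq> v" "x \<in> keys d"
          if "x \<in> keys (d - single v (lookup d v))" for x
          using that by (auto simp: in_keys_iff lookup_minus lookup_single when_def split: if_splits)
        ultimately have "keys (d - single v (lookup d v)) \<inter> - S = {}"
          by blast
        then have "ideg (-S) d = lookup d v"
          using v(1) by (subst exponent_split_off[of "lookup d v" d v]) (auto simp: ideg_eq_0)
        then show "ideg (-S) (d + b) \<le> N" using G_lt[OF v(1) d] Suc.prems v(1) unfolding a by simp
        have "ideg S d \<le> c0" using c0 d v(1) by blast
        then show "ideg S (d + b) \<le> ideg S a + c0" unfolding a by simp
      qed
      have "\<exists>p. p \<in> reduced S m (ideg S a + c0 * Suc N) \<and> h ^ N * mon (d + b) - p \<in> P"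
        if d: "d \<in> keys (G v)" for d
      proof -
        obtain p where p: "p \<in> reduced S m (ideg S (d + b) + c0 * N)" "h ^ N * mon (d + b) - p \<in> P"
          using Suc.IH G_key[OF d] by blast
        then have "p \<in> reduced S m (ideg S a + c0 * Suc N)" using G_key[OF d] by (auto simp: reduced_def)
        then show ?thesis using p(2) by blast
      qed
      then obtain p where p: "\<And>d. d \<in> keys (G v) \<Longrightarrow> p d \<in> reduced S m (ideg S a + c0 * Suc N)"
        "\<And>d. d \<in> keys (G v) \<Longrightarrow> h ^ N * mon (d + b) - p d \<in> P" by metis
      define p' where "p' = (\<Sum>d\<in>keys (G v). sc (lookup (G v) d) (p d))"
      have "h * mon a - G v * mon b = (h' v * mon b) * (c v * mon (single v (m v)) - R v)"
        unfolding h[OF v(1)] G_def a by (simp add: algebra_simps mult_single)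
      also have "\<dots> \<in> P" by (intro ideal_closed(3)[OF P] rel v)
      finally have 1: "h ^ N * (h * mon a - G v * mon b) \<in> P" by (rule ideal_closed(3)[OF P])
      have "G v * mon b = (\<Sum>d\<in>keys (G v). sc (lookup (G v) d) (mon (d + b)))"
        by (subst pm_mon_expand) (simp add: sum_distrib_right mult_single)
      then have "h ^ N * (G v * mon b) - p' =
        (\<Sum>d\<in>keys (G v). sc (lookup (G v) d) (h ^ N * mon (d + b) - p d))"
        unfolding p'_def
        by (simp add: sum_distrib_left sc_mult_left sum_subtractf pm.scale_right_diff_distrib del: sc_single)
      also have "\<dots> \<in> P" by (intro ideal_sum[OF P] ideal_sc[OF P] p(2))
      finally have "h ^ N * (h * mon a - G v * mon b) + (h ^ N * (G v * mon b) - p') \<in> P"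
        by (rule ideal_closed(2)[OF P 1])
      then have "h ^ Suc N * mon a - p' \<in> P" by (simp add: algebra_simps)
      moreover have "p' \<in> reduced S m (ideg S a + c0 * Suc N)"
        unfolding p'_def by (intro reduced_combination p(1))
      ultimately show ?thesis by blast
    qed
  qed
  have red: "\<exists>p\<in>reduced S m (d + c0 * N). h ^ N * u - p \<in> P"
    if u: "\<And>a. a \<in> keys u \<Longrightarrow> ideg (-S) a \<le> N \<and> ideg S a \<le> d" for u N d
  proof -
    have "\<exists>p. p \<in> reduced S m (d + c0 * N) \<and> h ^ N * mon a - p \<in> P" if a: "a \<in> keys u" for a
    proof -
      obtain p where p: "p \<in> reduced S m (ideg S a + c0 * N)" "h ^ N * mon a - p \<in> P"
        using monomial u[OF a] by blast
      then have "p \<in> reduced S m (d + c0 * N)" using u[OF a] by (fastforce simp: reduced_def)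
      then show ?thesis using p(2) by blast
    qed
    then obtain p where p: "\<And>a. a \<in> keys u \<Longrightarrow> p a \<in> reduced S m (d + c0 * N)"
      "\<And>a. a \<in> keys u \<Longrightarrow> h ^ N * mon a - p a \<in> P" by metis
    define q where "q = (\<Sum>a\<in>keys u. sc (lookup u a) (p a))"
    have q: "q \<in> reduced S m (d + c0 * N)" unfolding q_def by (rule reduced_combination) (rule p(1))
    have "h ^ N * u - q =
      (\<Sum>a\<in>keys u. sc (lookup u a) (h ^ N * mon a - p a))"
      unfolding q_def by (subst (1) pm_mon_expand[of u])
         (simp add: sum_distrib_left sc_mult_left sum_subtractf pm.scale_right_diff_distrib del: sc_single)
    also have "\<dots> \<in> P" by (intro ideal_sum[OF P] ideal_sc[OF P] p(2))
    finally show ?thesis using q by blast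
  qed
  show ?thesis by (rule that[OF h_in h0 m red]) (assumption | blast)+
qed

text \<open>
  If \<open>f\<close> lies in \<open>Q\<close> but not in \<open>P\<close>, the products of powers of \<open>f\<close>
  with monomials in an independent set \<open>S\<close> modulo \<open>Q\<close> are linearly independent modulo
  \<open>P\<close>. There are about \<open>i ^ (card S + 1)\<close> of them of degree at most a multiple of
  \<open>i\<close>, but modulo \<open>P\<close>, up to a power of \<open>h\<close>, they fall into a space of dimension
  about \<open>i ^ cdim P\<close>.
\<close>
lemma cdim_prime_strict:
  fixes P Q :: "('v::finite, 'k::field) mpol set"
  assumes P: "is_prime P" and Q: "is_prime Q" and PQ: "P \<subset> Q"
  shows "cdim Q < cdim P"
proof -
  note iP = prime_ideal[OF P] and iQ = prime_ideal[OF Q]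
  have one: "1 \<notin> P" "1 \<notin> Q" using P Q by (auto simp: is_prime_def)
  obtain f where f: "f \<in> Q" "f \<notin> P" using PQ by blast
  obtain S where S: "indep_mod Q S" "card S = cdim Q" using cdim_witness[OF iQ one(2)] .
  obtain S' where S': "indep_mod P S'" "card S' = cdim P" using cdim_witness[OF iP one(1)] .
  have max: "\<not> indep_mod P (insert v S')" if "v \<notin> S'" for v
    using cdim_ge[of P "insert v S'"] S'(2) that by auto
  obtain h m c0 where h: "h \<in> poly_in S'" "h \<noteq> 0" "\<And>v. v \<notin> S' \<Longrightarrow> m v \<ge> (1::nat)" and
    red: "\<And>u N d. (\<And>a. a \<in> keys u \<Longrightarrow> ideg (-S') a \<le> N \<and> ideg S' a \<le> d) \<Longrightarrow>
       \<exists>p\<in>reduced S' m (d + c0 * N). h ^ N * u - p \<in> P"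
    using reduction_mod_prime[OF iP S'(1) max] by blast
  have hP: "h \<notin> P" using h(1,2) S'(1) by (auto simp: indep_mod_def)
  have hN: "h ^ N \<notin> P" for N
    by (induction N) (use P hP one in \<open>auto simp: is_prime_def\<close>)
  define e where "e = card S + (\<Sum>a\<in>keys f. mdeg a)"
  define b where "b i v = (if v \<in> S then i + 1 else 1)" for i :: nat and v :: 'v
  define E where "E i = {a :: 'v \<Rightarrow>\<^sub>0 nat. \<forall>v. lookup a v < b i v} \<times> {..i}" for i
  define C where "C = (\<Prod>v\<in>-S'. m v) * ((1 + c0) * e + 1) ^ card S'"
  have "(i + 1) ^ (card S + 1) \<le> C * (i + 1) ^ card S'" for i
  proof -
    have finE: "finite (E i)" unfolding E_def using finite_box by auto
    have cardE: "card (E i) = (i + 1) ^ (card S + 1)"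
      unfolding E_def by (simp add: card_cartesian_product card_box b_def prod.If_cases)
    let ?N = "e * i" and ?d = "e * i + c0 * (e * i)"
    let ?B = "{a :: 'v \<Rightarrow>\<^sub>0 nat. \<forall>v. lookup a v < (if v \<in> S' then ?d + 1 else m v)}"
    have keysE: "keys a \<subseteq> S \<and> mdeg a \<le> card S * i" if "(a, k) \<in> E i" for a k
    proof
      show *: "keys a \<subseteq> S" using that by (auto simp: E_def b_def in_keys_iff split: if_splits)
      have "mdeg a = (\<Sum>v\<in>S. lookup a v)"
        unfolding wdeg_def using * by (intro sum.mono_neutral_cong_right) (auto simp: in_keys_iff)
      also have "\<dots> \<le> (\<Sum>v\<in>S. i)"
      proof (rule sum_mono)
        fix v assume "v \<in> S"
        moreover have "lookup a v < b i v" using that by (simp add: E_def)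
        ultimately show "lookup a v \<le> i" by (simp add: b_def)
      qed
      finally show "mdeg a \<le> card S * i" by simp
    qed
    have "\<exists>p\<in>reduced S' m ?d. h ^ ?N * (mon (fst x) * f ^ snd x) - p \<in> P" if x: "x \<in> E i" for x
    proof (rule red)
      fix c assume "c \<in> keys (mon (fst x) * f ^ snd x)"
      then obtain d where c: "c = fst x + d" "d \<in> keys (f ^ snd x)"
        using keys_mult[of "mon (fst x)" "f ^ snd x"] by auto
      have "mdeg d \<le> (\<Sum>a\<in>keys f. mdeg a) * snd x"
        by (rule keys_power_bound[OF _ c(2)]) (rule member_le_sum, auto)
      also have "\<dots> \<le> (\<Sum>a\<in>keys f. mdeg a) * i" using x by (auto simp: E_def)
      finally have "mdeg c \<le> e * i"
        using keysE[of "fst x" "snd x"] x unfolding c(1) e_def by (simp add: algebra_simps)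
      then show "ideg (-S') c \<le> ?N \<and> ideg S' c \<le> e * i"
        using ideg_le_mdeg order_trans by blast
    qed
    then obtain p where p: "\<And>x. x \<in> E i \<Longrightarrow> p x \<in> reduced S' m ?d"
      "\<And>x. x \<in> E i \<Longrightarrow> h ^ ?N * (mon (fst x) * f ^ snd x) - p x \<in> P" by metis
    have "card (E i) \<le> card ?B"
    proof (rule family_card_le[OF finE finite_box])
      fix x assume "x \<in> E i"
      then have "p x \<in> reduced S' m ?d" by (rule p)
      then show "keys (p x) \<subseteq> ?B"
        using lookup_le_ideg[of _ S'] unfolding reduced_def by (fastforce simp: less_Suc_eq_le intro: order_trans)
    next
      fix c assume c: "(\<Sum>x\<in>E i. sc (c x) (p x)) = 0"
      let ?u = "\<lambda>x. mon (fst x) * f ^ snd x"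
      have "h ^ ?N * (\<Sum>x\<in>E i. sc (c x) (?u x)) = (\<Sum>x\<in>E i. sc (c x) (h ^ ?N * ?u x - p x))"
        using c by (simp add: sum_distrib_left sc_mult_left sum_subtractf pm.scale_right_diff_distrib)
      also have "\<dots> \<in> P" by (intro ideal_sum[OF iP] ideal_sc[OF iP] p(2))
      finally have uP: "(\<Sum>x\<in>E i. sc (c x) (?u x)) \<in> P" using hN[of ?N] P by (auto simp: is_prime_def)
      define g where "g k = (\<Sum>a\<in>{a. \<forall>v. lookup a v < b i v}. single a (c (a, k)))" for k
      have "(\<Sum>x\<in>E i. sc (c x) (?u x)) = (\<Sum>k\<le>i. g k * f ^ k)"
        unfolding E_def g_def sum_distrib_right
        by (subst sum.swap, subst sum.cartesian_product)
           (auto intro!: sum.cong simp flip: sc_mult_left)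
      with uP have gP: "(\<Sum>k\<le>i. g k * f ^ k) \<in> P" by simp
      have g_in: "g k \<in> poly_in S" for k unfolding g_def
        by (intro poly_in_sum single_poly_in) (auto simp: b_def in_keys_iff split: if_splits)
      have g0: "g k = 0" if "k \<le> i" for k
      proof (rule ccontr)
        assume "g k \<noteq> 0"
        define k0 where "k0 = (LEAST k. g k \<noteq> 0)"
        have k0: "g k0 \<noteq> 0" unfolding k0_def using \<open>g k \<noteq> 0\<close> by (rule LeastI)
        have low: "g j = 0" if "j < k0" for j using not_less_Least[of j "\<lambda>k. g k \<noteq> 0"] that unfolding k0_def by blast
        have k0i: "k0 \<le> i" using Least_le[of "\<lambda>k. g k \<noteq> 0" k, OF \<open>g k \<noteq> 0\<close>] that unfolding k0_def by simp
        have "(\<Sum>k\<le>i. g k * f ^ k) = (\<Sum>k\<in>{k0..i}. g k * f ^ k)"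
          by (rule sum.mono_neutral_right) (auto simp: low not_le)
        also have "\<dots> = f ^ k0 * (\<Sum>k\<in>{k0..i}. g k * f ^ (k - k0))"
          unfolding sum_distrib_left by (intro sum.cong refl) (auto simp: mult_ac simp flip: power_add)
        finally have "f ^ k0 * (\<Sum>k\<in>{k0..i}. g k * f ^ (k - k0)) \<in> P" using gP by simp
        moreover have "f ^ k \<notin> P" for k
          by (induction k) (use P f one in \<open>auto simp: is_prime_def\<close>)
        ultimately have "(\<Sum>k\<in>{k0..i}. g k * f ^ (k - k0)) \<in> P" using P by (auto simp: is_prime_def)
        then have "(\<Sum>k\<in>{k0..i}. g k * f ^ (k - k0)) \<in> Q" using PQ by blast
        moreover have sum_eq: "(\<Sum>k\<in>{k0..i}. g k * f ^ (k - k0)) = g k0 + (\<Sum>k\<in>{k0<..i}. g k * f ^ (k - k0))"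
          using k0i by (subst atLeastAtMost_insertL[symmetric])
            (auto simp: sum.insert atLeastSucAtMost_greaterThanAtMost)
        moreover have "(\<Sum>k\<in>{k0<..i}. g k * f ^ (k - k0)) \<in> Q"
        proof (rule ideal_sum[OF iQ])
          fix k assume "k \<in> {k0<..i}"
          then have "g k * f ^ (k - k0) = (g k * f ^ (k - k0 - 1)) * f" 
            by (simp add: mult.assoc power_Suc2[symmetric] Suc_diff_Suc del: power_Suc)
          then show "g k * f ^ (k - k0) \<in> Q" using ideal_closed(3)[OF iQ f(1)] by simp
        qed
        ultimately have "(\<Sum>k\<in>{k0..i}. g k * f ^ (k - k0)) - (\<Sum>k\<in>{k0<..i}. g k * f ^ (k - k0)) \<in> Q"
          by (intro ideal_closed(6)[OF iQ])
        then have "g k0 \<in> Q" unfolding sum_eq by simp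
        then show False using g_in[of k0] S(1) k0 by (auto simp: indep_mod_def)
      qed
      show "\<forall>x\<in>E i. c x = 0"
      proof
        fix x assume x: "x \<in> E i"
        then have "lookup (g (snd x)) (fst x) = c x"
          unfolding g_def by (auto simp: E_def lookup_sum lookup_single when_def finite_box)
        then show "c x = 0" using g0[of "snd x"] x by (auto simp: E_def)
      qed
    qed
    also have "card ?B = (?d + 1) ^ card S' * (\<Prod>v\<in>-S'. m v)"
      unfolding card_box by (simp add: prod.If_cases Compl_eq)
    also have "?d + 1 \<le> ((1 + c0) * e + 1) * (i + 1)" by (simp add: algebra_simps)
    then have "(?d + 1) ^ card S' \<le> (((1 + c0) * e + 1) * (i + 1)) ^ card S'" by (rule power_mono) simp
    then have "(?d + 1) ^ card S' * (\<Prod>v\<in>-S'. m v) \<le> C * (i + 1) ^ card S'"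
      unfolding C_def power_mult_distrib by (simp add: mult_ac)
    finally show ?thesis using cardE by simp
  qed
  then have "card S + 1 \<le> card S'" by (rule exponent_growth_le)
  then show ?thesis using S(2) S'(2) by simp
qed

lemma power_congruent_mod_ideal:
  assumes "is_ideal P" "x - y \<in> P" shows "x ^ k - y ^ k \<in> P"
proof (induction k)
  case 0 then show ?case using ideal_closed(1)[OF assms(1)] by simp
next
  case (Suc k)
  have "x ^ Suc k - y ^ Suc k = x * (x ^ k - y ^ k) + y ^ k * (x - y)" by (simp add: algebra_simps)
  then show ?case using Suc assms by (metis ideal_closed(2,3))
qed

text \<open>
  \<open>f - 1\<close> divides \<open>f ^ k - 1\<close> and is therefore invertible modulo \<open>f ^ k\<close>.
\<close>
lemma power_dvd_cancel_minus_one: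
  fixes f x :: "'a::comm_ring_1"
  assumes "f ^ k dvd x * (f - 1) ^ N" shows "f ^ k dvd x"
  using assms
proof (induction N)
  case 0 then show ?case by simp
next
  case (Suc N)
  let ?y = "x * (f - 1) ^ N"
  have "(f - 1) dvd f ^ k - 1" by (metis power_diff_1_eq dvd_triv_left)
  then obtain s where s: "f ^ k - 1 = (f - 1) * s" by (rule dvdE)
  have "f ^ k dvd (?y * (f - 1)) * s" using Suc.prems by (simp add: mult_ac)
  then have "f ^ k dvd ?y * (f ^ k - 1)" unfolding s by (simp add: mult_ac)
  then have "f ^ k dvd ?y * f ^ k - ?y * (f ^ k - 1)" by (intro dvd_diff) simp_all
  then have "f ^ k dvd ?y" by (simp add: algebra_simps)
  then show ?case by (rule Suc.IH)
qed

text \<open>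
  Chains of primes are built upwards with this step. Over the fraction field of the polynomials in \<open>S\<close> the
  quotient by \<open>P\<close> has a finite basis \<open>B\<close> of monomials, with common denominator \<open>D\<close>
  and powers of \<open>h\<close>. Put \<open>f = 1 + h * X\<^sub>t\<close>. If \<open>P\<close> and \<open>f\<close>
  together generated a nonzero \<open>g\<close> free of \<open>X\<^sub>t\<close>, say \<open>g \<equiv> f * u\<close>,
  then comparing the coordinates of \<open>g ^ k \<equiv> f ^ k * u ^ k\<close> at the basis element
  \<open>1\<close> would give that \<open>f ^ k\<close> divides \<open>D * h ^ N * g ^ k\<close>. As
  \<open>h\<close> is invertible modulo \<open>f\<close>, it would divide \<open>D * g ^ k\<close>, whose degree in
  \<open>X\<^sub>t\<close> does not depend on \<open>k\<close>. So some prime contains \<open>P\<close> and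
  \<open>f\<close> and keeps \<open>S - {t}\<close> independent.
\<close>
lemma prime_above_dropping_variable:
  fixes P :: "('v::finite, 'k::field) mpol set"
  assumes P: "is_prime P" and S: "indep_mod P S"
    and max: "\<And>v. v \<notin> S \<Longrightarrow> \<not> indep_mod P (insert v S)" and t: "t \<in> S"
  shows "\<exists>Q. is_prime Q \<and> P \<subset> Q \<and> indep_mod Q (S - {t})"
proof -
  note iP = prime_ideal[OF P]
  have one: "1 \<notin> P" using P by (simp add: is_prime_def)
  obtain h m c0 where h: "h \<in> poly_in S" "h \<noteq> 0" "\<And>v. v \<notin> S \<Longrightarrow> m v \<ge> (1::nat)" and
    red: "\<And>u N d. (\<And>a. a \<in> keys u \<Longrightarrow> ideg (-S) a \<le> N \<and> ideg S a \<le> d) \<Longrightarrow>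
       \<exists>p\<in>reduced S m (d + c0 * N). h ^ N * u - p \<in> P"
    using reduction_mod_prime[OF iP S max] by blast
  define box where "box = {a. \<forall>v. lookup a v < (if v \<in> S then 1 else m v)}"
  have fin_box: "finite box" unfolding box_def by (rule finite_box)
  have box0: "0 \<in> box" using h(3) by (auto simp: box_def Suc_le_eq)
  define ind where "ind B \<longleftrightarrow> (\<forall>c. (\<forall>b\<in>B. c b \<in> poly_in S) \<longrightarrow> (\<Sum>b\<in>B. c b * mon b) \<in> P \<longrightarrow> (\<forall>b\<in>B. c b = 0))" for B
  have "\<exists>B\<in>{B. B \<subseteq> box \<and> 0 \<in> B \<and> ind B}. \<forall>B'\<in>{B. B \<subseteq> box \<and> 0 \<in> B \<and> ind B}. B \<subseteq> B' \<longrightarrow> B = B'"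
  proof (rule finite_has_maximal)
    show "finite {B. B \<subseteq> box \<and> 0 \<in> B \<and> ind B}" using fin_box by simp
    have "ind {0}" using S by (auto simp: ind_def indep_mod_def)
    then have "{0} \<in> {B. B \<subseteq> box \<and> 0 \<in> B \<and> ind B}" using box0 by simp
    then show "{B. B \<subseteq> box \<and> 0 \<in> B \<and> ind B} \<noteq> {}" by (metis empty_iff)
  qed
  then obtain B where BF: "B \<in> {B. B \<subseteq> box \<and> 0 \<in> B \<and> ind B}"
    and maxF: "\<forall>B'\<in>{B. B \<subseteq> box \<and> 0 \<in> B \<and> ind B}. B \<subseteq> B' \<longrightarrow> B = B'" by (rule bexE)
  have B: "B \<subseteq> box" "0 \<in> B" "ind B" using BF by simp_all
  have Bmax: "B = B'" if "B' \<subseteq> box" "0 \<in> B'" "ind B'" "B \<subseteq> B'" for B'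
    using maxF that by simp
  have finB: "finite B" using B(1) fin_box finite_subset by blast
  define rep where "rep u \<longleftrightarrow> (\<exists>c. (\<forall>b\<in>B. c b \<in> poly_in S) \<and> u - (\<Sum>b\<in>B. c b * mon b) \<in> P)" for u
  have rep_add: "rep (u + w)" if uw: "rep u" "rep w" for u w
  proof -
    from uw(1) obtain c where c: "(\<forall>b\<in>B. c b \<in> poly_in S) \<and> u - (\<Sum>b\<in>B. c b * mon b) \<in> P"
      unfolding rep_def by (rule exE)
    from uw(2) obtain d where d: "(\<forall>b\<in>B. d b \<in> poly_in S) \<and> w - (\<Sum>b\<in>B. d b * mon b) \<in> P"
      unfolding rep_def by (rule exE)
    have "u + w - (\<Sum>b\<in>B. (c b + d b) * mon b) = (u - (\<Sum>b\<in>B. c b * mon b)) + (w - (\<Sum>b\<in>B. d b * mon b))"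
      by (simp add: algebra_simps sum.distrib)
    also have "\<dots> \<in> P" using c d by (intro ideal_closed(2)[OF iP]) simp_all
    finally show ?thesis unfolding rep_def using c d by (intro exI[of _ "\<lambda>b. c b + d b"]) (auto intro: poly_in_closed)
  qed
  have rep_mult: "rep (p * u)" if up: "rep u" "p \<in> poly_in S" for p u
  proof -
    from up(1) obtain c where c: "(\<forall>b\<in>B. c b \<in> poly_in S) \<and> u - (\<Sum>b\<in>B. c b * mon b) \<in> P"
      unfolding rep_def by (rule exE)
    have "p * u - (\<Sum>b\<in>B. (p * c b) * mon b) = p * (u - (\<Sum>b\<in>B. c b * mon b))"
      by (simp add: algebra_simps sum_distrib_left)
    also have "\<dots> \<in> P" by (rule ideal_closed(3)[OF iP conjunct2[OF c]])
    finally show ?thesis unfolding rep_def using c up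
      by (intro exI[of _ "\<lambda>b. p * c b"]) (auto intro: poly_in_closed)
  qed
  have rep_0: "rep 0" unfolding rep_def using ideal_closed(1)[OF iP]
    by (intro exI[of _ "\<lambda>_. 0"]) (auto intro: poly_in_closed)
  have rep_sum: "rep (sum f A)" if "\<And>x. x \<in> A \<Longrightarrow> rep (f x)" for f and A :: "('v \<Rightarrow>\<^sub>0 nat) set"
    using that by (induction A rule: infinite_finite_induct) (auto intro: rep_0 rep_add)
  have rep_cong: "rep u" if uw: "rep w" "u - w \<in> P" for u w
  proof -
    from uw(1) obtain c where c: "(\<forall>b\<in>B. c b \<in> poly_in S) \<and> w - (\<Sum>b\<in>B. c b * mon b) \<in> P"
      unfolding rep_def by (rule exE)
    from ideal_closed(2)[OF iP uw(2) conjunct2[OF c]] have "u - (\<Sum>b\<in>B. c b * mon b) \<in> P" by simp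
    then show ?thesis unfolding rep_def using c by blast
  qed
  have "\<exists>d. d \<in> poly_in S \<and> d \<noteq> 0 \<and> rep (d * mon a)" if a: "a \<in> box" for a
  proof (cases "a \<in> B")
    case True
    have "(\<Sum>b\<in>B. (if b = a then 1 else 0) * mon b) = (\<Sum>b\<in>B. if b = a then mon b else (0 :: ('v, 'k) mpol))"
      by (intro sum.cong) auto
    also have "\<dots> = mon a" using True finB by (simp add: sum.delta)
    finally have "rep (1 * mon a)" unfolding rep_def using ideal_closed(1)[OF iP]
      by (intro exI[of _ "\<lambda>b. if b = a then 1 else 0"]) (auto intro: poly_in_closed)
    then show ?thesis using poly_in_closed(2) by (metis one_neq_zero)
  next
    case False
    then have "\<not> ind (insert a B)" using Bmax[of "insert a B"] a B by auto
    then obtain c where c: "\<forall>b\<in>insert a B. c b \<in> poly_in S" "(\<Sum>b\<in>insert a B. c b * mon b) \<in> P"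
      "\<not> (\<forall>b\<in>insert a B. c b = 0)" unfolding ind_def by blast
    have sum: "(\<Sum>b\<in>insert a B. c b * mon b) = c a * mon a + (\<Sum>b\<in>B. c b * mon b)"
      using False finB by simp
    have "c a \<noteq> 0"
    proof
      assume "c a = 0"
      then have "(\<Sum>b\<in>B. c b * mon b) \<in> P" using c(2) sum by simp
      then have "\<forall>b\<in>B. c b = 0" using B(3) c(1) unfolding ind_def by blast
      then show False using c(3) \<open>c a = 0\<close> by blast
    qed
    moreover have "c a * mon a - (\<Sum>b\<in>B. (- c b) * mon b) \<in> P" using c(2) sum by (simp add: sum_negf)
    then have "rep (c a * mon a)" unfolding rep_def using c(1)
      by (intro exI[of _ "\<lambda>b. - c b"]) (auto intro: poly_in_closed)
    ultimately show ?thesis using c(1) by blast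
  qed
  then obtain d where d: "\<And>a. a \<in> box \<Longrightarrow> d a \<in> poly_in S" "\<And>a. a \<in> box \<Longrightarrow> d a \<noteq> 0"
    "\<And>a. a \<in> box \<Longrightarrow> rep (d a * mon a)" by metis
  define D where "D = (\<Prod>a\<in>box. d a)"
  have D: "D \<in> poly_in S" unfolding D_def using d(1) by (rule poly_in_prod)
  have D0: "D \<noteq> 0" unfolding D_def using fin_box d(2) by (rule mpol_prod_nonzero)
  have rep_box: "rep (D * mon a)" if a: "a \<in> box" for a
  proof -
    have "D * mon a = (\<Prod>a\<in>box-{a}. d a) * (d a * mon a)"
      unfolding D_def using fin_box a by (subst prod.remove[of _ a]) (auto simp: mult_ac)
    moreover have "(\<Prod>a\<in>box-{a}. d a) \<in> poly_in S" by (rule poly_in_prod) (use d(1) in auto)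
    ultimately show ?thesis using rep_mult[OF d(3)[OF a]] by simp
  qed
  have rep_reduced: "rep (D * p)" if p: "p \<in> reduced S m e" for p e
  proof -
    have "rep (D * sc (lookup p a) (mon a))" if a: "a \<in> keys p" for a
    proof -
      have split: "a = pm_restrict S a + pm_restrict (-S) a"
        by (rule poly_mapping_eqI) (simp add: lookup_add lookup_pm_restrict)
      have "pm_restrict (-S) a \<in> box"
        using p a by (auto simp: box_def reduced_def lookup_pm_restrict)
      from rep_mult[OF rep_box[OF this], of "single (pm_restrict S a) (lookup p a)"]
      have "rep (single (pm_restrict S a) (lookup p a) * (D * mon (pm_restrict (-S) a)))"
        by (simp add: single_poly_in keys_pm_restrict)
      moreover have "single (pm_restrict S a) (lookup p a) * (D * mon (pm_restrict (-S) a))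
        = D * single (pm_restrict S a + pm_restrict (-S) a) (lookup p a)"
        by (simp add: mult.left_commute mult_single)
      ultimately show ?thesis by (simp add: split[symmetric])
    qed
    then show ?thesis by (subst pm_mon_expand[of p]) (auto simp: sum_distrib_left intro!: rep_sum)
  qed
  have rep_any: "\<exists>N. rep (D * (h ^ N * u))" for u
  proof -
    let ?N = "\<Sum>a\<in>keys u. mdeg a"
    have "\<exists>p\<in>reduced S m (?N + c0 * ?N). h ^ ?N * u - p \<in> P"
    proof (rule red)
      fix a assume a: "a \<in> keys u"
      have "mdeg a \<le> ?N" by (rule member_le_sum[OF a]) auto
      then show "ideg (-S) a \<le> ?N \<and> ideg S a \<le> ?N" using ideg_le_mdeg order_trans by blast
    qed
    then obtain p where p: "p \<in> reduced S m (?N + c0 * ?N)" "h ^ ?N * u - p \<in> P" by blast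
    have "D * (h ^ ?N * u) - D * p \<in> P" using ideal_closed(3)[OF iP p(2), of D] by (simp add: algebra_simps)
    then show ?thesis using rep_cong[OF rep_reduced[OF p(1)]] by blast
  qed
  define et where "et = single t (1::nat)"
  define f where "f = 1 + mon et * h"
  have mt: "mon et \<in> poly_in S" unfolding et_def using t by (intro single_poly_in) auto
  have f_in: "f \<in> poly_in S" unfolding f_def using mt h by (intro poly_in_closed) auto
  obtain b0 where b0: "b0 \<in> keys h" using h(2) by (metis keys_eq_empty ex_in_conv)
  have "lookup (mon et * h) (et + b0) = 1 * lookup h b0"
    by (subst lookup_mult_unique) (use b0 in auto)
  moreover have "et + b0 \<noteq> 0"
  proof
    assume "et + b0 = 0"
    then have "lookup (et + b0) t = 0" by simp
    then show False by (simp add: et_def lookup_add)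
  qed
  ultimately have f_key: "et + b0 \<in> keys f"
    using b0 unfolding f_def by (simp add: in_keys_iff lookup_add lookup_one when_def)
  then have f0: "f \<noteq> 0" by auto
  have fP: "f \<notin> P" using f_in f0 S by (auto simp: indep_mod_def)
  have f_pow_key: "\<exists>a\<in>keys (f ^ k). k \<le> ideg {t} a" for k
  proof (induction k)
    case 0 then show ?case by simp
  next
    case (Suc k)
    obtain a where a: "a \<in> keys (f ^ k)" "k \<le> ideg {t} a" using Suc by blast
    show ?case
    proof (rule mult_key_wdeg[of f "f ^ k" "\<lambda>v. if v \<in> {t} then 1 else 0"])
      show "f \<noteq> 0" "f ^ k \<noteq> 0" using f0 mpol_power_nonzero by auto
      fix a' b' assume ab: "a' + b' \<in> keys (f * f ^ k)"
        and le: "\<And>c. c \<in> keys f \<Longrightarrow> wdeg (\<lambda>v. if v \<in> {t} then 1 else 0) c \<le> wdeg (\<lambda>v. if v \<in> {t} then 1 else 0) a'"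
        "\<And>c. c \<in> keys (f ^ k) \<Longrightarrow> wdeg (\<lambda>v. if v \<in> {t} then 1 else 0) c \<le> wdeg (\<lambda>v. if v \<in> {t} then 1 else 0) b'"
      have "ideg {t} (et + b0) \<le> ideg {t} a'" "ideg {t} a \<le> ideg {t} b'"
        unfolding ideg_def by (rule le(1)[OF f_key], rule le(2)[OF a(1)])
      then have "Suc k \<le> ideg {t} (a' + b')" using a(2) unfolding et_def by simp
      then show ?thesis using ab unfolding power_Suc by (intro bexI)
    qed
  qed
  let ?J = "{p + f * u | p u. p \<in> P}"
  have J: "is_ideal ?J"
    unfolding is_ideal_def
  proof (intro conjI ballI allI)
    have "0 = 0 + f * 0 \<and> 0 \<in> P" using ideal_closed(1)[OF iP] by simp
    then show "0 \<in> ?J" by blast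
  next
    fix x y assume "x \<in> ?J" "y \<in> ?J"
    then obtain p u q w where xy: "x = p + f * u" "y = q + f * w" "p \<in> P" "q \<in> P" by blast
    then have "x + y = (p + q) + f * (u + w)" by (simp add: algebra_simps)
    then show "x + y \<in> ?J" using ideal_closed(2)[OF iP xy(3,4)] by blast
  next
    fix a x assume "x \<in> ?J"
    then obtain p u where xy: "x = p + f * u" "p \<in> P" by blast
    then have "a * x = a * p + f * (a * u)" by (simp add: algebra_simps)
    then show "a * x \<in> ?J" using ideal_closed(3)[OF iP xy(2)] by blast
  qed
  let ?T = "poly_in (S - {t}) - {0}"
  have disj: "?J \<inter> ?T = {}"
  proof (rule ccontr)
    assume "?J \<inter> ?T \<noteq> {}"
    then obtain g p u where g: "g = p + f * u" "p \<in> P" "g \<in> poly_in (S - {t})" "g \<noteq> 0" by blast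
    have gS: "g \<in> poly_in S" using g(3) poly_in_mono[of "S - {t}" S] by blast
    \<comment> \<open>Larger than the degree of \<open>D\<close> in \<open>X\<^sub>t\<close>; each factor \<open>f\<close> contributes at least one to that degree.\<close>
    define k where "k = Suc (\<Sum>a\<in>keys D. ideg {t} a)"
    obtain N where "rep (D * (h ^ N * u ^ k))" using rep_any by blast
    then obtain c where "(\<forall>b\<in>B. c b \<in> poly_in S) \<and> D * (h ^ N * u ^ k) - (\<Sum>b\<in>B. c b * mon b) \<in> P"
      unfolding rep_def by (rule exE)
    then have c: "\<forall>b\<in>B. c b \<in> poly_in S" "D * (h ^ N * u ^ k) - (\<Sum>b\<in>B. c b * mon b) \<in> P" by simp_all
    have "g - f * u \<in> P" using g by simp
    from power_congruent_mod_ideal[OF iP this, of k] have gk: "g ^ k - (f * u) ^ k \<in> P" .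
    define c' where "c' b = (if b = 0 then D * h ^ N * g ^ k else 0) - f ^ k * c b" for b
    have "(\<Sum>b\<in>B. c' b * mon b) = (\<Sum>b\<in>B. if b = 0 then D * h ^ N * g ^ k * mon b else 0) - f ^ k * (\<Sum>b\<in>B. c b * mon b)"
      unfolding c'_def sum_distrib_left left_diff_distrib sum_subtractf
      by (intro arg_cong2[where f = minus] sum.cong) (auto simp: mult_ac)
    also have "(\<Sum>b\<in>B. if b = 0 then D * h ^ N * g ^ k * mon b else 0) = D * h ^ N * g ^ k"
      using finB B(2) by (simp add: sum.delta)
    also have "D * h ^ N * g ^ k - f ^ k * (\<Sum>b\<in>B. c b * mon b) =
      (D * h ^ N) * (g ^ k - (f * u) ^ k) + f ^ k * (D * (h ^ N * u ^ k) - (\<Sum>b\<in>B. c b * mon b))"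
      by (simp add: algebra_simps power_mult_distrib)
    also have "\<dots> \<in> P" by (intro ideal_closed(2,3)[OF iP] gk c(2))
    finally have "(\<Sum>b\<in>B. c' b * mon b) \<in> P" .
    moreover have "\<forall>b\<in>B. c' b \<in> poly_in S"
      unfolding c'_def using c(1) D h(1) gS f_in by (auto intro!: poly_in_closed poly_in_power)
    ultimately have "c' 0 = 0" using B(2,3) unfolding ind_def by blast
    then have "D * h ^ N * g ^ k = f ^ k * c 0" by (simp add: c'_def)
    then have "f ^ k dvd D * h ^ N * g ^ k" by simp
    \<comment> \<open>\<open>h * X\<^sub>t = f - 1\<close>, so multiplying by \<open>X\<^sub>t ^ N\<close> trades the denominator for a power of \<open>f - 1\<close>.\<close>
    then have "f ^ k dvd (D * h ^ N * g ^ k) * mon et ^ N" by (rule dvd_mult2)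
    moreover have "(D * h ^ N * g ^ k) * mon et ^ N = D * g ^ k * (f - 1) ^ N"
      unfolding f_def by (simp add: power_mult_distrib mult_ac)
    ultimately have "f ^ k dvd D * g ^ k" using power_dvd_cancel_minus_one by metis
    then obtain q where q: "D * g ^ k = f ^ k * q" by (rule dvdE)
    have Dg0: "D * g ^ k \<noteq> 0" using D0 g(4) by (intro mpol_mult_nonzero mpol_power_nonzero)
    then have q0: "q \<noteq> 0" using q by auto
    show False
    proof (rule mult_key_wdeg[of "f ^ k" q "\<lambda>v. if v \<in> {t} then 1 else 0"])
      show "f ^ k \<noteq> 0" "q \<noteq> 0" using f0 q0 mpol_power_nonzero by auto
      fix a b assume ab: "a + b \<in> keys (f ^ k * q)"
        and le: "\<And>c. c \<in> keys (f ^ k) \<Longrightarrow> wdeg (\<lambda>v. if v \<in> {t} then 1 else 0) c \<le> wdeg (\<lambda>v. if v \<in> {t} then 1 else 0) a"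
      have "k \<le> ideg {t} a" using f_pow_key[of k] le unfolding ideg_def by (meson order_trans)
      then have 1: "k \<le> ideg {t} (a + b)" by simp
      obtain x y where xy: "a + b = x + y" "x \<in> keys D" "y \<in> keys (g ^ k)"
        using ab keys_mult[of D "g ^ k"] unfolding q[symmetric] by blast
      have "keys y \<subseteq> S - {t}" using poly_in_power[OF g(3), of k] xy(3) unfolding poly_in_def by blast
      then have "ideg {t} y = 0" by (intro ideg_eq_0) auto
      moreover have "ideg {t} x \<le> (\<Sum>a\<in>keys D. ideg {t} a)" by (rule member_le_sum[OF xy(2)]) auto
      ultimately show False using 1 unfolding xy(1) k_def by simp
    qed
  qed
  have "\<exists>Q. is_prime Q \<and> ?J \<subseteq> Q \<and> Q \<inter> ?T = {}"
    by (rule prime_disjoint_from_multiplicative_set[OF J _ _ disj])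
       (auto intro: poly_in_closed simp: mpol_mult_nonzero)
  then obtain Q where Q: "is_prime Q" "?J \<subseteq> Q" "Q \<inter> ?T = {}" by blast
  have "x \<in> ?J" if "x \<in> P" for x
  proof -
    have "x = x + f * 0 \<and> x \<in> P" using that by simp
    then show ?thesis by blast
  qed
  moreover have "f \<in> ?J"
  proof -
    have "f = 0 + f * 1 \<and> 0 \<in> P" using ideal_closed(1)[OF iP] by simp
    then show ?thesis by blast
  qed
  ultimately have "P \<subset> Q" using Q(2) fP by blast
  then show ?thesis using Q by (auto simp: indep_mod_def)
qed

lemma prime_chain_exists:
  fixes P :: "('v::finite, 'k::field) mpol set"
  assumes "is_prime P" "n \<le> cdim P"
  shows "\<exists>F. F 0 = P \<and> (\<forall>i\<le>n. is_prime (F i)) \<and> (\<forall>i<n. F i \<subset> F (Suc i))"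
  using assms
proof (induction n arbitrary: P)
  case 0 then show ?case by (intro exI[of _ "\<lambda>_. P"]) auto
next
  case (Suc n)
  have one: "1 \<notin> P" using Suc.prems by (simp add: is_prime_def)
  obtain S where S: "indep_mod P S" "card S = cdim P" using cdim_witness[OF prime_ideal[OF Suc.prems(1)] one] .
  have max: "\<not> indep_mod P (insert v S)" if "v \<notin> S" for v
    using cdim_ge[of P "insert v S"] S(2) that by auto
  obtain t where t: "t \<in> S" using S(2) Suc.prems(2) by (metis card.empty ex_in_conv not_less_eq_eq zero_le)
  obtain Q where Q: "is_prime Q" "P \<subset> Q" "indep_mod Q (S - {t})"
    using prime_above_dropping_variable[OF Suc.prems(1) S(1) max t] by blast
  have "n \<le> cdim Q" using cdim_ge[OF Q(3)] S(2) Suc.prems(2) t by simp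
  then obtain F where F: "F 0 = Q" "\<forall>i\<le>n. is_prime (F i)" "\<forall>i<n. F i \<subset> F (Suc i)"
    using Suc.IH[OF Q(1)] by blast
  then show ?case
    using Suc.prems(1) Q(2)
    by (intro exI[of _ "\<lambda>i. case i of 0 \<Rightarrow> P | Suc j \<Rightarrow> F j"]) (auto split: nat.split)
qed

lemma prime_chain_length_le:
  fixes F :: "nat \<Rightarrow> ('v::finite, 'k::field) mpol set"
  assumes "\<And>i. i \<le> n \<Longrightarrow> is_prime (F i)" "\<And>i. i < n \<Longrightarrow> F i \<subset> F (Suc i)"
  shows "n \<le> cdim (F 0)"
  using assms
proof (induction n arbitrary: F)
  case 0 then show ?case by simp
next
  case (Suc n)
  have "n \<le> cdim (F (Suc 0))" using Suc.IH[of "\<lambda>i. F (Suc i)"] Suc.prems by simp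
  moreover have "cdim (F (Suc 0)) < cdim (F 0)"
    by (rule cdim_prime_strict) (use Suc.prems in auto)
  ultimately show ?case by simp
qed

text \<open>
  Chains of primes cannot be longer than \<open>cdim\<close> because it drops at each strict inclusion; conversely a prime
  that avoids the nonzero polynomials in a largest independent set can be enlarged one variable at a time.
\<close>
theorem prime_chains_above_ideal:
  fixes I :: "('v::finite, 'k::field) mpol set"
  assumes I: "is_ideal I" "1 \<notin> I"
  shows "(\<exists>F. (\<forall>i\<le>n. is_prime (F i) \<and> I \<subseteq> F i) \<and> (\<forall>i<n. F i \<subset> F (Suc i))) \<longleftrightarrow> n \<le> cdim I"
proof
  assume "\<exists>F. (\<forall>i\<le>n. is_prime (F i) \<and> I \<subseteq> F i) \<and> (\<forall>i<n. F i \<subset> F (Suc i))"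
  then obtain F where F: "\<forall>i\<le>n. is_prime (F i) \<and> I \<subseteq> F i" "\<forall>i<n. F i \<subset> F (Suc i)" by blast
  have "n \<le> cdim (F 0)" by (rule prime_chain_length_le) (use F in auto)
  also have "\<dots> \<le> cdim I" by (rule cdim_anti) (use F(1) in \<open>auto simp: is_prime_def\<close>)
  finally show "n \<le> cdim I" .
next
  assume n: "n \<le> cdim I"
  obtain S where S: "indep_mod I S" "card S = cdim I" using cdim_witness[OF I] .
  let ?T = "poly_in S - {0}"
  have "\<exists>P. is_prime P \<and> I \<subseteq> P \<and> P \<inter> ?T = {}"
    by (rule prime_disjoint_from_multiplicative_set[OF I(1)])
       (use S(1) in \<open>auto intro: poly_in_closed simp: mpol_mult_nonzero indep_mod_def\<close>)
  then obtain P where P: "is_prime P" "I \<subseteq> P" "P \<inter> ?T = {}" by blast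
  have "indep_mod P S" using P(3) by (auto simp: indep_mod_def)
  then have nP: "n \<le> cdim P" using cdim_ge S(2) n by fastforce
  from prime_chain_exists[OF P(1) nP]
  obtain F where F': "F 0 = P \<and> (\<forall>i\<le>n. is_prime (F i)) \<and> (\<forall>i<n. F i \<subset> F (Suc i))" by (rule exE)
  then have F: "F 0 = P" "\<forall>i\<le>n. is_prime (F i)" "\<forall>i<n. F i \<subset> F (Suc i)" by simp_all
  have "P \<subseteq> F i" if "i \<le> n" for i
    using that
  proof (induction i)
    case (Suc i)
    then have "F i \<subseteq> F (Suc i)" using F(3) by (simp add: Suc_le_eq psubset_imp_subset)
    then show ?case using Suc by simp
  qed (simp add: F(1))
  then show "\<exists>F. (\<forall>i\<le>n. is_prime (F i) \<and> I \<subseteq> F i) \<and> (\<forall>i<n. F i \<subset> F (Suc i))"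
    using F P(2) by blast
qed

section \<open>Staircases and the growth of their Hilbert functions\<close>

lemma monotone_subsequence_all_coordinates:
  fixes f :: "nat \<Rightarrow> 'v \<Rightarrow> nat"
  assumes "finite V"
  shows "\<exists>r :: nat \<Rightarrow> nat. strict_mono r \<and> (\<forall>v\<in>V. \<forall>i j. i \<le> j \<longrightarrow> f (r i) v \<le> f (r j) v)"
  using assms
proof (induction V rule: finite_induct)
  case empty
  have "strict_mono (\<lambda>i::nat. i)" by (simp add: strict_mono_def)
  then show ?case by blast
next
  case (insert v V)
  then obtain r :: "nat \<Rightarrow> nat" where r: "strict_mono r" "\<forall>v\<in>V. \<forall>i j. i \<le> j \<longrightarrow> f (r i) v \<le> f (r j) v" by blast
  let ?g = "\<lambda>i. f (r i) v"
  obtain s :: "nat \<Rightarrow> nat" where s: "strict_mono s" "monoseq (\<lambda>i. ?g (s i))" using seq_monosub[of ?g] by blast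
  have "\<exists>k. \<forall>i\<ge>k. \<forall>j\<ge>i. ?g (s i) \<le> ?g (s j)"
  proof (cases "\<forall>i j. i \<le> j \<longrightarrow> ?g (s i) \<le> ?g (s j)")
    case True then show ?thesis by blast
  next
    case False
    then have dec: "\<forall>i j. i \<le> j \<longrightarrow> ?g (s j) \<le> ?g (s i)" using s(2) unfolding monoseq_def by blast
    obtain k where k: "\<forall>i. ?g (s k) \<le> ?g (s i)"
      using ex_has_least_nat[of "\<lambda>_. True" 0 "\<lambda>i. ?g (s i)"] by blast
    then show ?thesis using dec by (metis order_trans)
  qed
  then obtain k where k: "\<And>i j. k \<le> i \<Longrightarrow> i \<le> j \<Longrightarrow> ?g (s i) \<le> ?g (s j)" by blast
  let ?t = "\<lambda>i. r (s (k + i))"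
  have "strict_mono ?t" using r(1) s(1) by (simp add: strict_mono_def)
  moreover have "f (?t i) u \<le> f (?t j) u" if u: "u \<in> insert v V" and ij: "i \<le> j" for u i j
  proof (cases "u = v")
    case True then show ?thesis using k[of "k + i" "k + j"] ij by simp
  next
    case False
    have "s (k + i) \<le> s (k + j)" using s(1) ij by (simp add: strict_mono_less_eq)
    then show ?thesis using r(2) u False by blast
  qed
  ultimately show ?case by blast
qed

text \<open>
  The minimal elements for componentwise comparison do the job; infinitely many of them would contain a nondecreasing
  subsequence.
\<close>
lemma dickson:
  fixes G :: "(('v::finite \<Rightarrow>\<^sub>0 nat) \<times> 'j) set"
  assumes J: "finite J" "snd ` G \<subseteq> J"
  shows "\<exists>G0. finite G0 \<and> G0 \<subseteq> G \<and> (\<forall>e\<in>G. \<exists>g\<in>G0. \<exists>b. e = (fst g + b, snd g))"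
proof -
  let ?le = "\<lambda>g e :: ('v \<Rightarrow>\<^sub>0 nat) \<times> 'j. snd g = snd e \<and> (\<forall>v. lookup (fst g) v \<le> lookup (fst e) v)"
  define G0 where "G0 = {g\<in>G. \<forall>e\<in>G. ?le e g \<longrightarrow> e = g}"
  have "finite G0"
  proof (rule ccontr)
    assume "infinite G0"
    have "finite (snd ` G0)" using J finite_subset[of "snd ` G0" J] by (auto simp: G0_def)
    from pigeonhole_infinite[OF \<open>infinite G0\<close> this]
    obtain g0 where "g0 \<in> G0" and "infinite {g\<in>G0. snd g = snd g0}" by (rule bexE)
    from infinite_countable_subset[OF this(2)]
    obtain e :: "nat \<Rightarrow> ('v \<Rightarrow>\<^sub>0 nat) \<times> 'j" where e0: "inj e \<and> range e \<subseteq> {g\<in>G0. snd g = snd g0}"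
      by (rule exE)
    define j where "j = snd g0"
    have e: "inj e" "range e \<subseteq> {g\<in>G0. snd g = j}" using e0 unfolding j_def by simp_all
    obtain r :: "nat \<Rightarrow> nat" where r: "strict_mono r"
      "\<forall>v\<in>UNIV. \<forall>i j. i \<le> j \<longrightarrow> lookup (fst (e (r i))) v \<le> lookup (fst (e (r j))) v"
      using monotone_subsequence_all_coordinates[of UNIV "\<lambda>i. lookup (fst (e i))", OF finite_class.finite_UNIV]
      by (elim exE conjE)
    have m: "e (r 0) \<in> G0" "e (r 1) \<in> G0" "snd (e (r 0)) = j" "snd (e (r 1)) = j" using e(2) by auto
    have "?le (e (r 0)) (e (r 1))" using m r(2) by simp
    then have "e (r 0) = e (r 1)" using m(1,2) unfolding G0_def by blast
    then have "r 0 = r 1" using e(1) by (simp add: inj_eq)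
    then show False using r(1) by (simp add: strict_mono_eq)
  qed
  moreover have "\<exists>g\<in>G0. \<exists>b. e = (fst g + b, snd g)" if eG: "e \<in> G" for e
  proof -
    obtain g where g: "g \<in> G" "?le g e" and min: "\<And>g'. g' \<in> G \<Longrightarrow> ?le g' e \<Longrightarrow> mdeg (fst g) \<le> mdeg (fst g')"
      using ex_has_least_nat[of "\<lambda>g. g \<in> G \<and> ?le g e" e "\<lambda>g. mdeg (fst g)", OF conjI[OF eG]] by blast
    have "g' = g" if g': "g' \<in> G" "?le g' g" for g'
    proof -
      have "?le g' e" using g(2) g'(2) order_trans by metis
      then have "mdeg (fst g) \<le> mdeg (fst g')" using min g'(1) by blast
      moreover have "fst g = (fst g - fst g') + fst g'"
        by (rule poly_mapping_eqI) (use g'(2) in \<open>simp add: lookup_add lookup_minus\<close>)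
      then have "mdeg (fst g) = mdeg (fst g - fst g') + mdeg (fst g')" by (metis wdeg_add)
      ultimately have "fst g - fst g' = 0" by simp
      then have "fst g = fst g'" using \<open>fst g = (fst g - fst g') + fst g'\<close> by simp
      then show ?thesis using g'(2) by (simp add: prod_eq_iff)
    qed
    then have "g \<in> G0" using g(1) unfolding G0_def by blast
    moreover have "fst e = fst g + (fst e - fst g)"
      by (rule poly_mapping_eqI) (use g(2) in \<open>simp add: lookup_add lookup_minus\<close>)
    then have "e = (fst g + (fst e - fst g), snd g)" using g(2) by (simp add: prod_eq_iff)
    ultimately show ?thesis by blast
  qed
  moreover have "G0 \<subseteq> G" by (auto simp: G0_def)
  ultimately show ?thesis by blast
qed

text \<open>
  Polynomial growth of exponent \<open>d\<close>, in a form that is insensitive to linear changes of the argument.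
\<close>
definition growth :: "(nat \<Rightarrow> nat) \<Rightarrow> nat \<Rightarrow> bool" where
  "growth f d \<longleftrightarrow> (\<exists>C. \<forall>i. f i \<le> C * (i + 1) ^ d) \<and> (\<exists>a b. \<forall>i. (i + 1) ^ d \<le> f (a * i + b))"

lemma growth_transfer:
  assumes g: "growth g d" and "\<And>i. f i \<le> g (a * i + b)" "\<And>i. g i \<le> f (a' * i + b')"
  shows "growth f d"
proof -
  obtain C p q where C: "\<And>i. g i \<le> C * (i + 1) ^ d" and pq: "\<And>i. (i + 1) ^ d \<le> g (p * i + q)"
    using g unfolding growth_def by blast
  have "f i \<le> (C * (a + b + 1) ^ d) * (i + 1) ^ d" for i
  proof -
    have "f i \<le> C * (a * i + b + 1) ^ d" using assms(2)[of i] C[of "a * i + b"] by linarith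
    also have "\<dots> \<le> C * ((a + b + 1) * (i + 1)) ^ d"
      by (intro mult_left_mono power_mono) (auto simp: algebra_simps)
    finally show ?thesis by (simp only: power_mult_distrib mult_ac)
  qed
  moreover have "(i + 1) ^ d \<le> f ((a' * p) * i + (a' * q + b'))" for i
  proof -
    have "(i + 1) ^ d \<le> f (a' * (p * i + q) + b')" using pq[of i] assms(3)[of "p * i + q"] by linarith
    then show ?thesis by (simp add: algebra_simps)
  qed
  ultimately show ?thesis unfolding growth_def by blast
qed

text \<open>
  Staircases are the complements of monomial submodules of a free module of rank \<open>r\<close>.
\<close>
definition staircase :: "nat \<Rightarrow> (('v::finite \<Rightarrow>\<^sub>0 nat) \<times> nat) set \<Rightarrow> bool" where
  "staircase r D \<longleftrightarrow> D \<subseteq> UNIV \<times> {..<r} \<and> (\<forall>a b j. (a + b, j) \<in> D \<longrightarrow> (a, j) \<in> D)"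

text \<open>
  The largest dimension of a coordinate subspace contained in a layer of the staircase: the Krull dimension of the
  quotient by the corresponding monomial submodule.
\<close>
definition coordinate_dim :: "(('v::finite \<Rightarrow>\<^sub>0 nat) \<times> nat) set \<Rightarrow> nat" where
  "coordinate_dim D = Max (card ` {S. \<exists>j. \<forall>a. keys a \<subseteq> S \<longrightarrow> (a, j) \<in> D})"

lemma finite_mdeg_le_pairs:
  "finite {e \<in> UNIV \<times> {..<r::nat}. mdeg (fst e :: 'v::finite \<Rightarrow>\<^sub>0 nat) \<le> i}"
proof (rule finite_subset)
  show "{e \<in> UNIV \<times> {..<r}. mdeg (fst e :: 'v \<Rightarrow>\<^sub>0 nat) \<le> i} \<subseteq> {a. mdeg a \<le> i} \<times> {..<r}" by auto
  show "finite ({a :: 'v \<Rightarrow>\<^sub>0 nat. mdeg a \<le> i} \<times> {..<r})"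
    by (intro finite_cartesian_product finite_mdeg_le) simp
qed

lemma coordinate_dim_witness:
  assumes "staircase r D" "D \<noteq> {}"
  obtains S j where "\<And>a. keys a \<subseteq> S \<Longrightarrow> (a, j) \<in> D" "card S = coordinate_dim D"
proof -
  let ?A = "{S. \<exists>j. \<forall>a. keys a \<subseteq> S \<longrightarrow> (a, j) \<in> D}"
  obtain a j where "(a, j) \<in> D" using assms(2) by auto
  then have "(0, j) \<in> D" using assms(1) unfolding staircase_def by (metis add_0)
  then have "\<forall>a. keys a \<subseteq> {} \<longrightarrow> (a, j) \<in> D" by auto
  then have "{} \<in> ?A" by blast
  then have "coordinate_dim D \<in> card ` ?A"
    unfolding coordinate_dim_def by (intro Max_in) (simp, blast)
  then obtain S j where "\<forall>a. keys a \<subseteq> S \<longrightarrow> (a, j) \<in> D" "coordinate_dim D = card S" by auto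
  then show ?thesis by (intro that[of S j]) simp_all
qed

lemma coordinate_dim_ge:
  assumes "\<And>a. keys a \<subseteq> S \<Longrightarrow> (a, j) \<in> D" shows "card S \<le> coordinate_dim D"
  unfolding coordinate_dim_def by (rule Max_ge) (use assms in auto)

lemma staircase_lower_count:
  fixes D :: "(('v::finite \<Rightarrow>\<^sub>0 nat) \<times> nat) set"
  assumes D: "D \<subseteq> UNIV \<times> {..<r}" and S: "\<And>a. keys a \<subseteq> S \<Longrightarrow> (a, j) \<in> D"
  shows "(i + 1) ^ card S \<le> card {e\<in>D. mdeg (fst e) \<le> card S * i}"
proof -
  let ?b = "\<lambda>v. if v \<in> S then i + 1 else 1"
  let ?B = "{a :: 'v \<Rightarrow>\<^sub>0 nat. \<forall>v. lookup a v < ?b v}"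
  have sub: "(\<lambda>a. (a, j)) ` ?B \<subseteq> {e\<in>D. mdeg (fst e) \<le> card S * i}"
  proof clarify
    fix a :: "'v \<Rightarrow>\<^sub>0 nat" assume a: "\<forall>v. lookup a v < ?b v"
    then have k: "keys a \<subseteq> S" by (auto simp: in_keys_iff split: if_splits)
    have "mdeg a = (\<Sum>v\<in>S. lookup a v)"
      unfolding wdeg_def using k by (intro sum.mono_neutral_cong_right) (auto simp: in_keys_iff)
    also have "\<dots> \<le> (\<Sum>v\<in>S. i)"
    proof (rule sum_mono)
      fix v assume "v \<in> S" then show "lookup a v \<le> i" using a[rule_format, of v] by simp
    qed
    finally show "(a, j) \<in> D \<and> mdeg (fst (a, j)) \<le> card S * i" using S[OF k] by simp
  qed
  have fin: "finite {e\<in>D. mdeg (fst e) \<le> card S * i}"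
    by (rule finite_subset[OF _ finite_mdeg_le_pairs[of r "card S * i"]]) (use D in auto)
  have "(i + 1) ^ card S = card ?B"
    by (simp add: card_box prod.If_cases)
  also have "\<dots> = card ((\<lambda>a. (a, j)) ` ?B)" by (simp add: card_image inj_on_def)
  also have "\<dots> \<le> card {e\<in>D. mdeg (fst e) \<le> card S * i}" using fin sub by (rule card_mono)
  finally show ?thesis .
qed

text \<open>
  The lower bound is a box in a coordinate subspace. For the upper bound, call a coordinate of an exponent large if it
  exceeds all coordinates of the finitely many generators of the complement. All exponents supported on the large
  coordinates of an element of the staircase lie in the staircase too, so it has at most \<open>coordinate_dim D\<close>
  large coordinates, and only finitely many choices remain for the others.
\<close>
lemma staircase_growth:
  fixes D :: "(('v::finite \<Rightarrow>\<^sub>0 nat) \<times> nat) set"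
  assumes D: "staircase r D" "D \<noteq> {}"
  shows "growth (\<lambda>i. card {e\<in>D. mdeg (fst e) \<le> i}) (coordinate_dim D)"
proof -
  let ?d = "coordinate_dim D"
  have Dr: "D \<subseteq> UNIV \<times> {..<r}" and down: "\<And>a b j. (a + b, j) \<in> D \<Longrightarrow> (a, j) \<in> D"
    using D(1) unfolding staircase_def by blast+
  obtain S j where "\<And>a. keys a \<subseteq> S \<Longrightarrow> (a, j) \<in> D" "card S = ?d"
    using coordinate_dim_witness[OF D] by blast
  then have lower: "(i + 1) ^ ?d \<le> card {e\<in>D. mdeg (fst e) \<le> ?d * i + 0}" for i
    using staircase_lower_count[OF Dr, of S j i] by simp
  have "snd ` (UNIV \<times> {..<r} - D) \<subseteq> {..<r}" by auto
  from dickson[OF finite_lessThan this]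
  obtain G where "finite G \<and> G \<subseteq> UNIV \<times> {..<r} - D \<and>
    (\<forall>e\<in>UNIV \<times> {..<r} - D. \<exists>g\<in>G. \<exists>b. e = (fst g + b, snd g))" by (rule exE)
  then have G: "finite G" "G \<subseteq> UNIV \<times> {..<r} - D"
    and gen: "\<forall>e\<in>UNIV \<times> {..<r} - D. \<exists>g\<in>G. \<exists>b. e = (fst g + b, snd g)" by simp_all
  define q where "q = Suc (\<Sum>g\<in>G. mdeg (fst g))"
  have q: "lookup (fst g) v < q" if "g \<in> G" for g v
  proof -
    have "lookup (fst g) v \<le> mdeg (fst g)" by (rule lookup_le_mdeg)
    also have "\<dots> \<le> (\<Sum>g\<in>G. mdeg (fst g))" by (rule member_le_sum[OF that]) (use G in auto)
    finally show ?thesis by (simp add: q_def)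
  qed
  define big where "big a = {v. q \<le> lookup a v}" for a :: "'v \<Rightarrow>\<^sub>0 nat"
  have big: "card (big a) \<le> ?d" if aj: "(a, j) \<in> D" for a j
  proof (rule coordinate_dim_ge)
    fix c :: "'v \<Rightarrow>\<^sub>0 nat" assume c: "keys c \<subseteq> big a"
    show "(c, j) \<in> D"
    proof (rule ccontr)
      assume "(c, j) \<notin> D"
      moreover have "j < r" using aj Dr by auto
      ultimately have "(c, j) \<in> UNIV \<times> {..<r} - D" by simp
      from bspec[OF gen this] obtain g b where g: "g \<in> G" "(c, j) = (fst g + b, snd g)" by (elim bexE exE)
      have "lookup (fst g) v \<le> lookup a v" for v
      proof (cases "v \<in> big a")
        case True then show ?thesis using q[OF g(1), of v] by (simp add: big_def)
      next
        case False
        then have "lookup c v = 0" using c by (meson in_keys_iff subsetD)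
        then show ?thesis using g(2) by (simp add: lookup_add)
      qed
      then have "a = fst g + (a - fst g)"
        by (intro poly_mapping_eqI) (simp add: lookup_add lookup_minus)
      then have "(fst g, j) \<in> D" using down[of "fst g" "a - fst g" j] aj by simp
      then show False using g G(2) by auto
    qed
  qed
  let ?B = "\<lambda>i S. {a :: 'v \<Rightarrow>\<^sub>0 nat. \<forall>v. lookup a v < (if v \<in> S then i + 1 else q)}"
  have "card {e\<in>D. mdeg (fst e) \<le> i} \<le> (2 ^ card (UNIV :: 'v set) * q ^ card (UNIV :: 'v set) * r) * (i + 1) ^ ?d" for i
  proof -
    let ?F = "{S :: 'v set. card S \<le> ?d}"
    have sub: "{e\<in>D. mdeg (fst e) \<le> i} \<subseteq> (\<Union>S\<in>?F. ?B i S) \<times> {..<r}"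
    proof (rule subsetI)
      fix e assume "e \<in> {e\<in>D. mdeg (fst e) \<le> i}"
      then obtain a j where e: "e = (a, j)" and aj: "(a, j) \<in> D" "mdeg (fst (a, j)) \<le> i" by (cases e) auto
      have "lookup a v < (if v \<in> big a then i + 1 else q)" for v
        using lookup_le_mdeg[of a v] aj(2) by (simp add: big_def)
      then have "a \<in> ?B i (big a)" by blast
      then show "e \<in> (\<Union>S\<in>?F. ?B i S) \<times> {..<r}" unfolding e using big[OF aj(1)] aj(1) Dr by blast
    qed
    have cardB: "card (?B i S) \<le> q ^ card (UNIV :: 'v set) * (i + 1) ^ ?d" if "card S \<le> ?d" for S
    proof -
      have "card (?B i S) = (i + 1) ^ card S * q ^ card (- S)"
        unfolding card_box by (simp add: prod.If_cases Compl_eq)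
      also have "\<dots> \<le> (i + 1) ^ ?d * q ^ card (UNIV :: 'v set)"
        using that card_mono[of UNIV "- S"] by (intro mult_mono power_increasing) (auto simp: q_def)
      finally show ?thesis by (simp add: mult.commute)
    qed
    have "card {e\<in>D. mdeg (fst e) \<le> i} \<le> card ((\<Union>S\<in>?F. ?B i S) \<times> {..<r})"
      by (rule card_mono[OF _ sub]) (auto simp: finite_box)
    also have "\<dots> = card (\<Union>S\<in>?F. ?B i S) * r" by (simp add: card_cartesian_product)
    also have "card (\<Union>S\<in>?F. ?B i S) \<le> (\<Sum>S\<in>?F. card (?B i S))" by (rule card_UN_le) simp
    also have "\<dots> \<le> (\<Sum>S\<in>?F. q ^ card (UNIV :: 'v set) * (i + 1) ^ ?d)" by (rule sum_mono) (use cardB in auto)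
    also have "\<dots> = card ?F * (q ^ card (UNIV :: 'v set) * (i + 1) ^ ?d)" by simp
    also have "card ?F \<le> card (Pow (UNIV :: 'v set))" by (rule card_mono) auto
    also have "card (Pow (UNIV :: 'v set)) = 2 ^ card (UNIV :: 'v set)" by (rule card_Pow) simp
    finally show ?thesis by (simp add: mult_ac)
  qed
  then show ?thesis unfolding growth_def using lower by blast
qed

text \<open>The weight of a generator of a filtered module; \<open>p\<close> holds the degree shifts.\<close>
definition mkey :: "('v::finite \<Rightarrow> nat) \<Rightarrow> (nat \<Rightarrow> nat) \<Rightarrow> ('v \<Rightarrow>\<^sub>0 nat) \<times> nat \<Rightarrow> nat" where
  "mkey w p e = wdeg w (fst e) + p (snd e)"

text \<open>
  The total degree comes second: it makes the order well-founded also when some variables have weight zero, and it makes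
  reductions of homogeneous elements respect total degree.
\<close>
definition mless :: "('v::finite \<Rightarrow> nat) \<Rightarrow> (nat \<Rightarrow> nat) \<Rightarrow> ('v \<Rightarrow>\<^sub>0 nat) \<times> nat \<Rightarrow> ('v \<Rightarrow>\<^sub>0 nat) \<times> nat \<Rightarrow> bool" where
  "mless w p e f \<longleftrightarrow> mkey w p e < mkey w p f \<or> mkey w p e = mkey w p f \<and>
     (mdeg (fst e) < mdeg (fst f) \<or> mdeg (fst e) = mdeg (fst f) \<and>
       (lexless (fst e) (fst f) \<or> fst e = fst f \<and> snd e < snd f))"

lemma mless_irrefl: "\<not> mless w p e e" by (simp add: mless_def lexless_irrefl)

lemma mless_trans: "mless w p e f \<Longrightarrow> mless w p f g \<Longrightarrow> mless w p e g"
  unfolding mless_def using lexless_trans[of "fst e" "fst f" "fst g"] by auto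

lemma mless_total: "e \<noteq> f \<Longrightarrow> mless w p e f \<or> mless w p f e"
proof (cases "fst e = fst f")
  case True
  assume "e \<noteq> f"
  then have "snd e \<noteq> snd f" using True by (simp add: prod_eq_iff)
  then show ?thesis unfolding mless_def using True by auto
next
  case False
  then show ?thesis unfolding mless_def using lexless_total[OF False] by auto
qed

definition mshift :: "('v \<Rightarrow>\<^sub>0 nat) \<Rightarrow> ('v \<Rightarrow>\<^sub>0 nat) \<times> nat \<Rightarrow> ('v \<Rightarrow>\<^sub>0 nat) \<times> nat" where
  "mshift b e = (b + fst e, snd e)"

lemma mkey_mshift [simp]: "mkey w p (mshift b e) = wdeg w b + mkey w p e"
  by (simp add: mkey_def mshift_def)

lemma mless_mshift: "mless w p (mshift b e) (mshift b f) \<longleftrightarrow> mless w p e f"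
  unfolding mless_def mkey_mshift by (simp add: mshift_def lexless_add add.commute[of b])

lemma mless_wf: "wf {(e, f). mless w p e f \<and> snd e < r}"
proof -
  let ?R = "{(e, f). mdeg (fst e) = mdeg (fst f) \<and> snd e < r \<and> mkey w p e = mkey w p f \<and> mless w p e f}"
  have fin: "finite {e. (e, f) \<in> ?R}" for f
    by (rule finite_subset[OF _ finite_mdeg_le_pairs[of r "mdeg (fst f)"]]) auto
  have "wf ?R"
  proof (rule wf_subset[OF wf_measure[of "\<lambda>f. card {e. (e, f) \<in> ?R}"]], rule subsetI)
    fix x assume "x \<in> ?R"
    then obtain e f where x: "x = (e, f)" and ef: "(e, f) \<in> ?R" by (metis surj_pair)
    have "{g. (g, e) \<in> ?R} \<subseteq> {g. (g, f) \<in> ?R}" using ef by (auto intro: mless_trans)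
    moreover have "e \<notin> {g. (g, e) \<in> ?R}" by (simp add: mless_irrefl)
    moreover have "e \<in> {g. (g, f) \<in> ?R}" using ef by simp
    ultimately have "{g. (g, e) \<in> ?R} \<subset> {g. (g, f) \<in> ?R}" by blast
    from psubset_card_mono[OF fin this]
    show "x \<in> measure (\<lambda>f. card {e. (e, f) \<in> ?R})" unfolding x by simp
  qed
  then have "wf (inv_image (less_than <*lex*> less_than <*lex*> ?R) (\<lambda>e. (mkey w p e, mdeg (fst e), e)))"
    by (intro wf_inv_image wf_lex_prod wf_less_than)
  then show ?thesis
    by (rule wf_subset) (auto simp: mless_def)
qed

section \<open>Linear algebra over the ground field inside a module\<close>

text \<open>
  The map \<open>\<kappa>\<close> embeds the ground field centrally into the ring. Coefficients are taken from the field
  and not from its image, so that vectors can be described by finitely supported functions.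
\<close>
locale kmodule = left_module B N for B :: "('b, 'c) ring_scheme" and N :: "('b, 'm) module" +
  fixes \<kappa> :: "'k::field \<Rightarrow> 'b"
  assumes k_closed: "\<kappa> c \<in> carrier B"
    and k_add: "\<kappa> (c + d) = \<kappa> c \<oplus>\<^bsub>B\<^esub> \<kappa> d"
    and k_mult: "\<kappa> (c * d) = \<kappa> c \<otimes>\<^bsub>B\<^esub> \<kappa> d"
    and k_one: "\<kappa> 1 = \<one>\<^bsub>B\<^esub>"
    and k_zero_iff: "\<kappa> c = \<zero>\<^bsub>B\<^esub> \<longleftrightarrow> c = 0"
    and k_central: "b \<in> carrier B \<Longrightarrow> \<kappa> c \<otimes>\<^bsub>B\<^esub> b = b \<otimes>\<^bsub>B\<^esub> \<kappa> c"
begin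

definition scal :: "'k \<Rightarrow> 'm \<Rightarrow> 'm" where "scal c x = \<kappa> c \<odot>\<^bsub>N\<^esub> x"

lemma smult_zero_left: "x \<in> carrier N \<Longrightarrow> \<zero>\<^bsub>B\<^esub> \<odot>\<^bsub>N\<^esub> x = \<zero>\<^bsub>N\<^esub>"
proof -
  assume x: "x \<in> carrier N"
  have "\<zero>\<^bsub>B\<^esub> \<odot>\<^bsub>N\<^esub> x \<oplus>\<^bsub>N\<^esub> \<zero>\<^bsub>B\<^esub> \<odot>\<^bsub>N\<^esub> x = \<zero>\<^bsub>B\<^esub> \<odot>\<^bsub>N\<^esub> x"
    using smult_l_distr[of "\<zero>\<^bsub>B\<^esub>" "\<zero>\<^bsub>B\<^esub>" x] x by simp
  then show ?thesis using x smult_closed[of "\<zero>\<^bsub>B\<^esub>" x]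
    by (metis M.add.l_cancel_one' R.zero_closed)
qed

lemma smult_zero_right: "b \<in> carrier B \<Longrightarrow> b \<odot>\<^bsub>N\<^esub> \<zero>\<^bsub>N\<^esub> = \<zero>\<^bsub>N\<^esub>"
proof -
  assume b: "b \<in> carrier B"
  have "b \<odot>\<^bsub>N\<^esub> \<zero>\<^bsub>N\<^esub> \<oplus>\<^bsub>N\<^esub> b \<odot>\<^bsub>N\<^esub> \<zero>\<^bsub>N\<^esub> = b \<odot>\<^bsub>N\<^esub> \<zero>\<^bsub>N\<^esub>"
    using smult_r_distr[of b "\<zero>\<^bsub>N\<^esub>" "\<zero>\<^bsub>N\<^esub>"] b by simp
  then show ?thesis using b smult_closed[of b "\<zero>\<^bsub>N\<^esub>"]
    by (metis M.add.l_cancel_one' M.zero_closed)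
qed

lemma smult_finsum:
  assumes "b \<in> carrier B" "f \<in> I \<rightarrow> carrier N"
  shows "b \<odot>\<^bsub>N\<^esub> (\<Oplus>\<^bsub>N\<^esub>i\<in>I. f i) = (\<Oplus>\<^bsub>N\<^esub>i\<in>I. b \<odot>\<^bsub>N\<^esub> f i)"
  using assms(2)
proof (induction I rule: infinite_finite_induct)
  case (insert i I)
  then have f: "f \<in> I \<rightarrow> carrier N" "f i \<in> carrier N" by auto
  have "(\<lambda>i. b \<odot>\<^bsub>N\<^esub> f i) \<in> I \<rightarrow> carrier N" using f(1) assms(1) by (auto intro!: smult_closed)
  then show ?case using insert f assms(1)
    by (simp add: M.finsum_insert M.finsum_closed smult_r_distr smult_closed)
qed (simp_all add: smult_zero_right assms(1))

lemma scal_closed [simp, intro]: "x \<in> carrier N \<Longrightarrow> scal c x \<in> carrier N"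
  unfolding scal_def by (intro smult_closed k_closed)

lemma scal_add_left: "x \<in> carrier N \<Longrightarrow> scal (c + d) x = scal c x \<oplus>\<^bsub>N\<^esub> scal d x"
  unfolding scal_def k_add by (intro smult_l_distr k_closed)

lemma scal_scal: "x \<in> carrier N \<Longrightarrow> scal c (scal d x) = scal (c * d) x"
  unfolding scal_def k_mult by (simp add: smult_assoc k_closed)

lemma scal_one: "x \<in> carrier N \<Longrightarrow> scal 1 x = x"
  unfolding scal_def k_one by (rule smult_one)

lemma scal_zero_left: "x \<in> carrier N \<Longrightarrow> scal 0 x = \<zero>\<^bsub>N\<^esub>"
  using k_zero_iff[of 0] smult_zero_left unfolding scal_def by simp

lemma scal_zero_right [simp]: "scal c \<zero>\<^bsub>N\<^esub> = \<zero>\<^bsub>N\<^esub>"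
  unfolding scal_def by (rule smult_zero_right[OF k_closed])

lemma scal_finsum:
  "f \<in> I \<rightarrow> carrier N \<Longrightarrow> scal c (\<Oplus>\<^bsub>N\<^esub>i\<in>I. f i) = (\<Oplus>\<^bsub>N\<^esub>i\<in>I. scal c (f i))"
  unfolding scal_def by (rule smult_finsum[OF k_closed])

lemma smult_scal: "b \<in> carrier B \<Longrightarrow> x \<in> carrier N \<Longrightarrow> b \<odot>\<^bsub>N\<^esub> scal c x = scal c (b \<odot>\<^bsub>N\<^esub> x)"
  unfolding scal_def using k_central[of b c] k_closed[of c] by (metis smult_assoc)

subsection \<open>Linear combinations\<close>

definition lin :: "('i \<Rightarrow> 'm) \<Rightarrow> ('i \<Rightarrow>\<^sub>0 'k) \<Rightarrow> 'm" where
  "lin x a = (\<Oplus>\<^bsub>N\<^esub>i\<in>keys a. scal (lookup a i) (x i))"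

context
  fixes x :: "'i \<Rightarrow> 'm"
  assumes x: "\<And>i. x i \<in> carrier N"
begin

lemma lin_superset:
  assumes "finite I" "keys a \<subseteq> I"
  shows "lin x a = (\<Oplus>\<^bsub>N\<^esub>i\<in>I. scal (lookup a i) (x i))"
  unfolding lin_def
  by (rule M.add.finprod_mono_neutral_cong_left[OF assms(1) assms(2)])
     (use x in \<open>auto simp: in_keys_iff scal_zero_left\<close>)

lemma lin_closed [simp, intro]: "lin x a \<in> carrier N"
  unfolding lin_def using x by (intro M.finsum_closed) auto

lemma lin_add: "lin x (a + b) = lin x a \<oplus>\<^bsub>N\<^esub> lin x b"
proof -
  let ?I = "keys a \<union> keys b"
  have "lin x (a + b) = (\<Oplus>\<^bsub>N\<^esub>i\<in>?I. scal (lookup a i) (x i) \<oplus>\<^bsub>N\<^esub> scal (lookup b i) (x i))"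
    by (subst lin_superset[of ?I]) (use keys_add[of a b] x in \<open>auto simp: lookup_add scal_add_left\<close>)
  also have "\<dots> = lin x a \<oplus>\<^bsub>N\<^esub> lin x b"
    by (subst M.finsum_addf) (use x in \<open>auto simp: lin_superset[of ?I]\<close>)
  finally show ?thesis .
qed

lemma lin_sc: "lin x (sc c a) = scal c (lin x a)"
proof -
  have "lin x (sc c a) = (\<Oplus>\<^bsub>N\<^esub>i\<in>keys a. scal c (scal (lookup a i) (x i)))"
    by (subst lin_superset[of "keys a"]) (use keys_sc[of c a] x in \<open>auto simp: scal_scal\<close>)
  also have "\<dots> = scal c (lin x a)" unfolding lin_def by (rule scal_finsum[symmetric]) (use x in auto)
  finally show ?thesis .
qed

lemma lin_0 [simp]: "lin x 0 = \<zero>\<^bsub>N\<^esub>" by (simp add: lin_def)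

lemma lin_single [simp]: "lin x (single i c) = scal c (x i)"
  by (subst lin_superset[of "{i}"]) (use x in auto)

lemma lin_uminus: "lin x (- a) = \<ominus>\<^bsub>N\<^esub> lin x a"
  using lin_add[of "- a" a] by (simp add: M.minus_equality)

lemma lin_diff_eq_0: "lin x (a - b) = \<zero>\<^bsub>N\<^esub> \<longleftrightarrow> lin x a = lin x b"
  using lin_add[of "a - b" b] by (auto simp: M.l_zero)

lemma lin_sum: "finite I \<Longrightarrow> lin x (\<Sum>i\<in>I. f i) = (\<Oplus>\<^bsub>N\<^esub>i\<in>I. lin x (f i))"
  by (induction I rule: finite_induct) (auto simp: lin_add M.finsum_insert Pi_def)

end

subsection \<open>Subspaces and spans\<close>

abbreviation kspan :: "'m set \<Rightarrow> 'm set" where "kspan \<equiv> lin_span (range \<kappa>) N"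

definition ksub :: "'m set \<Rightarrow> bool" where
  "ksub U \<longleftrightarrow> U \<subseteq> carrier N \<and> \<zero>\<^bsub>N\<^esub> \<in> U \<and> (\<forall>x\<in>U. \<forall>y\<in>U. x \<oplus>\<^bsub>N\<^esub> y \<in> U) \<and> (\<forall>c. \<forall>x\<in>U. scal c x \<in> U)"

lemma ksub_finsum:
  assumes "ksub U" "\<And>i. i \<in> I \<Longrightarrow> f i \<in> U" shows "(\<Oplus>\<^bsub>N\<^esub>i\<in>I. f i) \<in> U"
  using assms(2)
proof (induction I rule: infinite_finite_induct)
  case (insert i I)
  have "f \<in> I \<rightarrow> carrier N" "f i \<in> carrier N" using insert.prems assms(1) unfolding ksub_def by auto
  then show ?case using insert assms(1) by (simp add: M.finsum_insert ksub_def)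
qed (use assms(1) in \<open>simp_all add: ksub_def\<close>)

lemma lin_span_iff:
  assumes "S \<subseteq> carrier N"
  shows "y \<in> kspan S \<longleftrightarrow> (\<exists>T c. finite T \<and> T \<subseteq> S \<and> y = (\<Oplus>\<^bsub>N\<^esub>s\<in>T. scal (c s) s))"
proof
  assume "y \<in> kspan S"
  then obtain T c where T: "y = (\<Oplus>\<^bsub>N\<^esub>s\<in>T. c s \<odot>\<^bsub>N\<^esub> s)" "finite T" "T \<subseteq> S" "c \<in> T \<rightarrow> range \<kappa>"
    unfolding lin_span_def by blast
  then have "\<forall>s\<in>T. \<exists>d. c s = \<kappa> d" by auto
  then obtain d where d: "\<forall>s\<in>T. c s = \<kappa> (d s)" by metis
  have "y = (\<Oplus>\<^bsub>N\<^esub>s\<in>T. scal (d s) s)"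
    unfolding T(1) using d T(3) assms by (intro M.add.finprod_cong') (auto simp: scal_def intro!: smult_closed k_closed)
  then show "\<exists>T c. finite T \<and> T \<subseteq> S \<and> y = (\<Oplus>\<^bsub>N\<^esub>s\<in>T. scal (c s) s)" using T by blast
next
  assume "\<exists>T c. finite T \<and> T \<subseteq> S \<and> y = (\<Oplus>\<^bsub>N\<^esub>s\<in>T. scal (c s) s)"
  then obtain T c where "finite T" "T \<subseteq> S" "y = (\<Oplus>\<^bsub>N\<^esub>s\<in>T. \<kappa> (c s) \<odot>\<^bsub>N\<^esub> s)" unfolding scal_def by blast
  then show "y \<in> kspan S" unfolding lin_span_def by (auto intro!: exI[of _ T] exI[of _ "\<lambda>s. \<kappa> (c s)"])
qed

lemma ksub_range_lin:
  assumes x: "\<And>i. x i \<in> carrier N" shows "ksub (lin x ` {a. keys a \<subseteq> I})"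
  unfolding ksub_def
proof (intro conjI ballI allI)
  show "lin x ` {a. keys a \<subseteq> I} \<subseteq> carrier N" using x by auto
  show "\<zero>\<^bsub>N\<^esub> \<in> lin x ` {a. keys a \<subseteq> I}" by (rule image_eqI[of _ _ 0]) (simp_all add: x)
next
  fix y z assume "y \<in> lin x ` {a. keys a \<subseteq> I}" "z \<in> lin x ` {a. keys a \<subseteq> I}"
  then obtain a b where "y = lin x a" "z = lin x b" "keys a \<subseteq> I" "keys b \<subseteq> I" by blast
  then show "y \<oplus>\<^bsub>N\<^esub> z \<in> lin x ` {a. keys a \<subseteq> I}"
    using keys_add[of a b] by (intro image_eqI[of _ _ "a + b"]) (auto simp: lin_add x)
next
  fix c y assume "y \<in> lin x ` {a. keys a \<subseteq> I}"
  then obtain a where "y = lin x a" "keys a \<subseteq> I" by blast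
  then show "scal c y \<in> lin x ` {a. keys a \<subseteq> I}"
    using keys_sc[of c a] by (intro image_eqI[of _ _ "sc c a"]) (auto simp: lin_sc x)
qed

lemma kspan_ksub:
  assumes S: "S \<subseteq> carrier N" shows "ksub (kspan S)"
  unfolding ksub_def
proof (intro conjI ballI allI subsetI)
  fix y assume "y \<in> kspan S"
  then obtain T c where T: "T \<subseteq> S" "y = (\<Oplus>\<^bsub>N\<^esub>s\<in>T. scal (c s) s)" unfolding lin_span_iff[OF S] by blast
  show "y \<in> carrier N" unfolding T(2) using T(1) S by (intro M.finsum_closed) auto
next
  show "\<zero>\<^bsub>N\<^esub> \<in> kspan S" unfolding lin_span_iff[OF S] by (intro exI[of _ "{}"]) simp
next
  fix y z assume "y \<in> kspan S" "z \<in> kspan S"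
  then obtain T c R d where T: "finite T" "T \<subseteq> S" "y = (\<Oplus>\<^bsub>N\<^esub>s\<in>T. scal (c s) s)"
    and R: "finite R" "R \<subseteq> S" "z = (\<Oplus>\<^bsub>N\<^esub>s\<in>R. scal (d s) s)" unfolding lin_span_iff[OF S] by blast
  let ?c = "\<lambda>s. if s \<in> T then c s else 0" and ?d = "\<lambda>s. if s \<in> R then d s else 0"
  have y: "y = (\<Oplus>\<^bsub>N\<^esub>s\<in>T \<union> R. scal (?c s) s)"
    unfolding T(3) by (rule M.add.finprod_mono_neutral_cong_left) (use T R S in \<open>auto simp: scal_zero_left\<close>)
  have z: "z = (\<Oplus>\<^bsub>N\<^esub>s\<in>T \<union> R. scal (?d s) s)"
    unfolding R(3) by (rule M.add.finprod_mono_neutral_cong_left) (use T R S in \<open>auto simp: scal_zero_left\<close>)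
  have "y \<oplus>\<^bsub>N\<^esub> z = (\<Oplus>\<^bsub>N\<^esub>s\<in>T \<union> R. scal (?c s) s \<oplus>\<^bsub>N\<^esub> scal (?d s) s)"
    unfolding y z by (rule M.finsum_addf[symmetric]) (use T R S in auto)
  also have "\<dots> = (\<Oplus>\<^bsub>N\<^esub>s\<in>T \<union> R. scal (?c s + ?d s) s)"
  proof (rule M.add.finprod_cong')
    fix s assume "s \<in> T \<union> R"
    then have "s \<in> carrier N" using T R S by blast
    then show "scal (?c s) s \<oplus>\<^bsub>N\<^esub> scal (?d s) s = scal (?c s + ?d s) s" by (rule scal_add_left[symmetric])
  qed (use T R S in auto)
  finally show "y \<oplus>\<^bsub>N\<^esub> z \<in> kspan S" unfolding lin_span_iff[OF S]
    using T R by (intro exI[of _ "T \<union> R"] exI[of _ "\<lambda>s. ?c s + ?d s"]) simp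
next
  fix e y assume "y \<in> kspan S"
  then obtain T c where T: "finite T" "T \<subseteq> S" "y = (\<Oplus>\<^bsub>N\<^esub>s\<in>T. scal (c s) s)" unfolding lin_span_iff[OF S] by blast
  have "scal e y = (\<Oplus>\<^bsub>N\<^esub>s\<in>T. scal e (scal (c s) s))"
    unfolding T(3) by (rule scal_finsum) (use T S in auto)
  also have "\<dots> = (\<Oplus>\<^bsub>N\<^esub>s\<in>T. scal (e * c s) s)"
    by (rule M.add.finprod_cong') (use T S in \<open>auto simp: scal_scal\<close>)
  finally show "scal e y \<in> kspan S" unfolding lin_span_iff[OF S]
    using T by (intro exI[of _ T] exI[of _ "\<lambda>s. e * c s"]) simp
qed

lemma kspan_base: "S \<subseteq> carrier N \<Longrightarrow> s \<in> S \<Longrightarrow> s \<in> kspan S"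
  unfolding lin_span_iff by (intro exI[of _ "{s}"] exI[of _ "\<lambda>_. 1"]) (auto simp: scal_one)

lemma kspan_minimal: "ksub U \<Longrightarrow> S \<subseteq> U \<Longrightarrow> kspan S \<subseteq> U"
proof
  fix y assume U: "ksub U" "S \<subseteq> U" and y: "y \<in> kspan S"
  have SN: "S \<subseteq> carrier N" using U unfolding ksub_def by blast
  from y obtain T c where T: "finite T" "T \<subseteq> S" "y = (\<Oplus>\<^bsub>N\<^esub>s\<in>T. scal (c s) s)"
    unfolding lin_span_iff[OF SN] by blast
  show "y \<in> U" unfolding T(3) by (rule ksub_finsum[OF U(1)]) (use T U in \<open>auto simp: ksub_def\<close>)
qed

lemma kspan_eq_lin:
  assumes x: "\<And>i. x i \<in> carrier N"
  shows "kspan (x ` I) = lin x ` {a. keys a \<subseteq> I}"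
proof
  have xI: "x ` I \<subseteq> carrier N" using x by blast
  show "kspan (x ` I) \<subseteq> lin x ` {a. keys a \<subseteq> I}"
  proof (rule kspan_minimal[OF ksub_range_lin[OF x]], rule image_subsetI)
    fix i assume "i \<in> I"
    then show "x i \<in> lin x ` {a. keys a \<subseteq> I}"
      by (intro image_eqI[of _ _ "single i 1"]) (auto simp: lin_single[OF x] scal_one x)
  qed
  show "lin x ` {a. keys a \<subseteq> I} \<subseteq> kspan (x ` I)"
  proof (rule image_subsetI)
    fix a :: "_ \<Rightarrow>\<^sub>0 'k" assume a: "a \<in> {a. keys a \<subseteq> I}"
    have "scal (lookup a i) (x i) \<in> kspan (x ` I)" if "i \<in> keys a" for i
      using kspan_ksub[OF xI] kspan_base[OF xI, of "x i"] a that unfolding ksub_def by blast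
    then show "lin x a \<in> kspan (x ` I)" unfolding lin_def by (intro ksub_finsum[OF kspan_ksub[OF xI]])
  qed
qed

lemma kspan_mono: "S \<subseteq> T \<Longrightarrow> T \<subseteq> carrier N \<Longrightarrow> kspan S \<subseteq> kspan T"
  using kspan_minimal[OF kspan_ksub, of T S] kspan_base[of T] by (simp add: subset_iff)

lemma kspan_in_carrier: "S \<subseteq> carrier N \<Longrightarrow> kspan S \<subseteq> carrier N"
  using kspan_ksub unfolding ksub_def by blast

subsection \<open>Dimension\<close>

abbreviation lindep_free :: "'m set \<Rightarrow> bool" where "lindep_free \<equiv> lin_indep (range \<kappa>) B N"

lemma lin_indep_iff:
  assumes "S \<subseteq> carrier N"
  shows "lindep_free S \<longleftrightarrow> (\<forall>T c. finite T \<longrightarrow> T \<subseteq> S \<longrightarrow> (\<Oplus>\<^bsub>N\<^esub>s\<in>T. scal (c s) s) = \<zero>\<^bsub>N\<^esub> \<longrightarrow> (\<forall>s\<in>T. c s = 0))"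
proof
  assume L: "lindep_free S"
  show "\<forall>T c. finite T \<longrightarrow> T \<subseteq> S \<longrightarrow> (\<Oplus>\<^bsub>N\<^esub>s\<in>T. scal (c s) s) = \<zero>\<^bsub>N\<^esub> \<longrightarrow> (\<forall>s\<in>T. c s = 0)"
  proof (intro allI impI)
    fix T c assume T: "finite T" "T \<subseteq> S" "(\<Oplus>\<^bsub>N\<^esub>s\<in>T. scal (c s) s) = \<zero>\<^bsub>N\<^esub>"
    from L[unfolded lin_indep_def, THEN spec, THEN spec, of T "\<lambda>s. \<kappa> (c s)"]
    have "\<forall>s\<in>T. \<kappa> (c s) = \<zero>\<^bsub>B\<^esub>" by (rule mp) (use T in \<open>simp add: scal_def Pi_def\<close>)
    then show "\<forall>s\<in>T. c s = 0" by (simp add: k_zero_iff)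
  qed
next
  assume R: "\<forall>T c. finite T \<longrightarrow> T \<subseteq> S \<longrightarrow> (\<Oplus>\<^bsub>N\<^esub>s\<in>T. scal (c s) s) = \<zero>\<^bsub>N\<^esub> \<longrightarrow> (\<forall>s\<in>T. c s = 0)"
  show "lindep_free S"
    unfolding lin_indep_def
  proof (intro allI impI, elim conjE)
    fix T c assume T: "finite T" "T \<subseteq> S" "c \<in> T \<rightarrow> range \<kappa>" "(\<Oplus>\<^bsub>N\<^esub>s\<in>T. c s \<odot>\<^bsub>N\<^esub> s) = \<zero>\<^bsub>N\<^esub>"
    then have "\<forall>s\<in>T. \<exists>d. c s = \<kappa> d" by auto
    then obtain d where d: "\<forall>s\<in>T. c s = \<kappa> (d s)" by metis
    have "(\<Oplus>\<^bsub>N\<^esub>s\<in>T. scal (d s) s) = (\<Oplus>\<^bsub>N\<^esub>s\<in>T. c s \<odot>\<^bsub>N\<^esub> s)"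
      using d T(2) assms by (intro M.add.finprod_cong') (auto simp: scal_def intro!: smult_closed k_closed)
    then have "\<forall>s\<in>T. d s = 0" using R T by simp
    then show "\<forall>s\<in>T. c s = \<zero>\<^bsub>B\<^esub>" using d k_zero_iff by simp
  qed
qed

lemma steinitz:
  assumes "finite T" "lindep_free T" "T \<subseteq> kspan S" "finite S" "S \<subseteq> carrier N"
  shows "card T \<le> card S"
proof -
  let ?x = "\<lambda>s. if s \<in> carrier N then s else \<zero>\<^bsub>N\<^esub>"
  have x: "?x s \<in> carrier N" for s by simp
  have "?x ` S = S" using assms(5) by force
  then have "kspan S = lin ?x ` {a. keys a \<subseteq> S}" using kspan_eq_lin[of ?x S, OF x] by simp
  then have "\<forall>t\<in>T. \<exists>a. keys a \<subseteq> S \<and> t = lin ?x a" using assms(3) by blast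
  from bchoice[OF this] obtain a where a: "\<forall>t\<in>T. keys (a t) \<subseteq> S \<and> t = lin ?x (a t)" by (rule exE)
  have TN: "T \<subseteq> carrier N" using assms(3,5) kspan_in_carrier by blast
  show ?thesis
  proof (rule family_card_le[OF assms(1,4), of a])
    fix c assume c: "(\<Sum>t\<in>T. sc (c t) (a t)) = 0"
    have "(\<Oplus>\<^bsub>N\<^esub>t\<in>T. scal (c t) t) = (\<Oplus>\<^bsub>N\<^esub>t\<in>T. lin ?x (sc (c t) (a t)))"
      using a TN by (intro M.add.finprod_cong') (auto simp: lin_sc[OF x] intro!: scal_closed lin_closed[OF x])
    also have "\<dots> = lin ?x (\<Sum>t\<in>T. sc (c t) (a t))" by (rule lin_sum[OF x assms(1), symmetric])
    also have "\<dots> = \<zero>\<^bsub>N\<^esub>" unfolding c by (rule lin_0[OF x])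
    finally show "\<forall>t\<in>T. c t = 0"
      using assms(2)[unfolded lin_indep_iff[OF TN], THEN spec, THEN spec, of T c] assms(1) by simp
  qed (use a in blast)
qed

text \<open>An independent subset with the largest possible number of elements is a basis.\<close>
lemma ksub_has_basis:
  assumes U: "ksub U" "U \<subseteq> kspan S" and S: "finite S" "S \<subseteq> carrier N"
  shows "\<exists>T. finite T \<and> T \<subseteq> U \<and> lindep_free T \<and> kspan T = U"
proof -
  let ?P = "\<lambda>T. finite T \<and> T \<subseteq> U \<and> lindep_free T"
  have "?P {}" by (simp add: lin_indep_def)
  moreover have "\<forall>T. ?P T \<longrightarrow> card T < Suc (card S)" using steinitz S U(2) by (meson less_Suc_eq_le subset_trans)
  ultimately have "\<exists>T. ?P T \<and> (\<forall>T'. ?P T' \<longrightarrow> card T' \<le> card T)"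
    by (rule ex_has_greatest_nat)
  then obtain T where T': "?P T \<and> (\<forall>T'. ?P T' \<longrightarrow> card T' \<le> card T)" by (rule exE)
  then have T: "?P T" and max: "\<And>T'. ?P T' \<Longrightarrow> card T' \<le> card T" by simp_all
  have UN: "U \<subseteq> carrier N" using U(1) by (simp add: ksub_def)
  have TN: "T \<subseteq> carrier N" using T UN by blast
  have "u \<in> kspan T" if u: "u \<in> U" for u
  proof (rule ccontr)
    assume nu: "u \<notin> kspan T"
    have uN: "u \<in> carrier N" using u UN by blast
    have uT: "u \<notin> T" using nu kspan_base[OF TN] by blast
    have "lindep_free (insert u T)"
      unfolding lin_indep_iff[OF insert_subsetI[OF uN TN]]
    proof (intro allI impI)
      fix R c assume R: "finite R" "R \<subseteq> insert u T" "(\<Oplus>\<^bsub>N\<^esub>s\<in>R. scal (c s) s) = \<zero>\<^bsub>N\<^esub>"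
      have RT: "R - {u} \<subseteq> T" "finite (R - {u})" using R by auto
      have in_span: "(\<Oplus>\<^bsub>N\<^esub>s\<in>R - {u}. scal (c s) s) \<in> kspan T" unfolding lin_span_iff[OF TN] using RT by blast
      have closed: "(\<lambda>s. scal (c s) s) \<in> R - {u} \<rightarrow> carrier N" using RT TN by auto
      have cu: "u \<in> R \<Longrightarrow> c u = 0"
      proof (rule ccontr)
        assume uR: "u \<in> R" and c0: "c u \<noteq> 0"
        have "(\<Oplus>\<^bsub>N\<^esub>s\<in>insert u (R - {u}). scal (c s) s) = scal (c u) u \<oplus>\<^bsub>N\<^esub> (\<Oplus>\<^bsub>N\<^esub>s\<in>R - {u}. scal (c s) s)"
          by (rule M.finsum_insert) (use RT closed uN in auto)
        then have "scal (c u) u \<oplus>\<^bsub>N\<^esub> (\<Oplus>\<^bsub>N\<^esub>s\<in>R - {u}. scal (c s) s) = \<zero>\<^bsub>N\<^esub>"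
          using R(3) uR by (simp add: insert_absorb)
        then have "scal (c u) u = \<ominus>\<^bsub>N\<^esub> (\<Oplus>\<^bsub>N\<^esub>s\<in>R - {u}. scal (c s) s)"
          using uN M.finsum_closed[OF closed] by (metis M.minus_equality scal_closed)
        also have "\<dots> = scal (- 1) (\<Oplus>\<^bsub>N\<^esub>s\<in>R - {u}. scal (c s) s)"
        proof (rule M.minus_equality)
          have y: "(\<Oplus>\<^bsub>N\<^esub>s\<in>R - {u}. scal (c s) s) \<in> carrier N" by (rule M.finsum_closed[OF closed])
          show "scal (- 1) (\<Oplus>\<^bsub>N\<^esub>s\<in>R - {u}. scal (c s) s) \<oplus>\<^bsub>N\<^esub> (\<Oplus>\<^bsub>N\<^esub>s\<in>R - {u}. scal (c s) s) = \<zero>\<^bsub>N\<^esub>"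
            using scal_add_left[OF y, of "- 1" 1] scal_one[OF y] scal_zero_left[OF y] by simp
        qed (use M.finsum_closed[OF closed] in auto)
        finally have "scal (inverse (c u)) (scal (c u) u) \<in> kspan T"
          using kspan_ksub[OF TN] in_span unfolding ksub_def by auto
        then show False using nu c0 uN by (simp add: scal_scal scal_one)
      qed
      have "(\<Oplus>\<^bsub>N\<^esub>s\<in>R - {u}. scal (c s) s) = \<zero>\<^bsub>N\<^esub>"
      proof (cases "u \<in> R")
        case True
        have "(\<Oplus>\<^bsub>N\<^esub>s\<in>insert u (R - {u}). scal (c s) s) = scal (c u) u \<oplus>\<^bsub>N\<^esub> (\<Oplus>\<^bsub>N\<^esub>s\<in>R - {u}. scal (c s) s)"
          by (rule M.finsum_insert) (use RT closed uN in auto)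
        then show ?thesis using R(3) True cu M.finsum_closed[OF closed] uN by (simp add: insert_absorb scal_zero_left)
      qed (use R(3) in simp)
      then have "\<forall>s\<in>R - {u}. c s = 0"
        using T lin_indep_iff[OF TN, THEN iffD1, THEN spec, THEN spec, of "R - {u}" c] RT by simp
      then show "\<forall>s\<in>R. c s = 0" using cu by blast
    qed
    then have "card (insert u T) \<le> card T" using max[of "insert u T"] T u by auto
    then show False using T uT by simp
  qed
  moreover have "kspan T \<subseteq> U" using kspan_minimal[OF U(1)] T by blast
  ultimately show ?thesis using T by blast
qed

lemma vdim_basis:
  assumes "ksub U" "U \<subseteq> kspan S" "finite S" "S \<subseteq> carrier N"
  shows "\<exists>T. finite T \<and> T \<subseteq> U \<and> lindep_free T \<and> kspan T = U \<and> card T = vdim (range \<kappa>) B N U"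
proof -
  obtain T where T: "finite T" "T \<subseteq> U" "lindep_free T" "kspan T = U" using ksub_has_basis[OF assms] by blast
  have TN: "T \<subseteq> carrier N" using T(2) assms(1) by (auto simp: ksub_def)
  have "vdim (range \<kappa>) B N U = card T"
    unfolding vdim_def
  proof (rule the_equality)
    show "\<exists>S. finite S \<and> S \<subseteq> carrier N \<and> lindep_free S \<and> kspan S = U \<and> card S = card T" using T TN by blast
    fix d assume "\<exists>S. finite S \<and> S \<subseteq> carrier N \<and> lindep_free S \<and> kspan S = U \<and> card S = d"
    then obtain R where R: "finite R" "R \<subseteq> carrier N" "lindep_free R" "kspan R = U" "card R = d" by blast
    have "card R \<le> card T" by (rule steinitz) (use R T TN kspan_base in auto)
    moreover have "card T \<le> card R" by (rule steinitz) (use R T TN kspan_base in auto)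
    ultimately show "d = card T" using R(5) by simp
  qed
  then show ?thesis using T by metis
qed

lemma vdim_le_card:
  assumes "ksub U" "U \<subseteq> kspan S" "finite S" "S \<subseteq> carrier N"
  shows "vdim (range \<kappa>) B N U \<le> card S"
proof -
  from vdim_basis[OF assms] obtain T where T: "finite T" "T \<subseteq> U" "lindep_free T" "card T = vdim (range \<kappa>) B N U" by blast
  then show ?thesis using steinitz[of T S] assms by auto
qed

lemma card_le_vdim:
  assumes "ksub U" "U \<subseteq> kspan S" "finite S" "S \<subseteq> carrier N" and T: "finite T" "lindep_free T" "T \<subseteq> U"
  shows "card T \<le> vdim (range \<kappa>) B N U"
proof -
  from vdim_basis[OF assms(1-4)] obtain R where R: "finite R" "R \<subseteq> U" "kspan R = U" "card R = vdim (range \<kappa>) B N U" by blast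
  have "R \<subseteq> carrier N" using R(2) assms(1) by (auto simp: ksub_def)
  then show ?thesis using steinitz[OF T(1,2), of R] R T(3) by simp
qed

lemma vdim_mono:
  assumes "ksub U" "ksub V" "U \<subseteq> V" "V \<subseteq> kspan S" "finite S" "S \<subseteq> carrier N"
  shows "vdim (range \<kappa>) B N U \<le> vdim (range \<kappa>) B N V"
proof -
  have "U \<subseteq> kspan S" using assms by blast
  from vdim_basis[OF assms(1) this assms(5,6)]
  obtain T where T: "finite T" "T \<subseteq> U" "lindep_free T" "card T = vdim (range \<kappa>) B N U" by blast
  then show ?thesis using card_le_vdim[OF assms(2,4,5,6) T(1,3)] assms(3) by auto
qed

lemma family_le_vdim:
  assumes U: "ksub U" "U \<subseteq> kspan S" "finite S" "S \<subseteq> carrier N"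
    and x: "\<And>i. x i \<in> carrier N" and I: "finite I" "x ` I \<subseteq> U"
    and ind: "\<And>a. keys a \<subseteq> I \<Longrightarrow> lin x a = \<zero>\<^bsub>N\<^esub> \<Longrightarrow> a = 0"
  shows "card I \<le> vdim (range \<kappa>) B N U"
proof -
  have inj: "inj_on x I"
  proof (rule inj_onI, rule ccontr)
    fix i j assume ij: "i \<in> I" "j \<in> I" "x i = x j" "i \<noteq> j"
    let ?a = "single i 1 - single j (1 :: 'k)"
    have "lin x ?a = \<zero>\<^bsub>N\<^esub>" by (subst lin_diff_eq_0[OF x]) (simp add: lin_single[OF x] ij(3))
    moreover have "keys ?a \<subseteq> I"
      using ij(1,2) by (auto simp: in_keys_iff lookup_minus lookup_single when_def split: if_splits)
    ultimately have "?a = 0" using ind by blast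
    then have "lookup ?a i = 0" by simp
    then show False using ij(4) by (simp add: lookup_minus lookup_single)
  qed
  have "lindep_free (x ` I)"
  proof (subst lin_indep_iff)
    show "x ` I \<subseteq> carrier N" using x by auto
    show "\<forall>T c. finite T \<longrightarrow> T \<subseteq> x ` I \<longrightarrow> (\<Oplus>\<^bsub>N\<^esub>s\<in>T. scal (c s) s) = \<zero>\<^bsub>N\<^esub> \<longrightarrow> (\<forall>s\<in>T. c s = 0)"
    proof (intro allI impI)
      fix T c assume T: "finite T" "T \<subseteq> x ` I" "(\<Oplus>\<^bsub>N\<^esub>s\<in>T. scal (c s) s) = \<zero>\<^bsub>N\<^esub>"
      from T(2) obtain I0 where "I0 \<subseteq> I \<and> inj_on x I0 \<and> T = x ` I0" unfolding subset_image_inj by (rule exE)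
      then have I0: "I0 \<subseteq> I" "inj_on x I0" "T = x ` I0" by simp_all
      have fin: "finite I0" using I(1) I0(1) finite_subset by blast
      let ?a = "\<Sum>i\<in>I0. single i (c (x i))"
      have "lin x ?a = (\<Oplus>\<^bsub>N\<^esub>i\<in>I0. scal (c (x i)) (x i))" using fin by (simp add: lin_sum[OF x] lin_single[OF x])
      also have "\<dots> = \<zero>\<^bsub>N\<^esub>" unfolding T(3)[symmetric] I0(3)
        by (rule M.add.finprod_reindex[symmetric]) (use x I0(2) in auto)
      finally have "lin x ?a = \<zero>\<^bsub>N\<^esub>" .
      moreover have "keys ?a \<subseteq> I" by (rule keys_sum_subset) (use I0(1) in auto)
      ultimately have "?a = 0" by (intro ind)
      have "lookup ?a i = c (x i)" if "i \<in> I0" for i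
        using that fin by (simp add: lookup_sum lookup_single when_def)
      then have "c (x i) = 0" if "i \<in> I0" for i
        using that \<open>?a = 0\<close> by (metis lookup_zero)
      then show "\<forall>s\<in>T. c s = 0" using I0(3) by blast
    qed
  qed
  from card_le_vdim[OF U _ this I(2)] I(1) show ?thesis by (simp add: card_image[OF inj])
qed

lemma lin_indep_relation:
  assumes x: "\<And>i. x i \<in> carrier N" and "finite I"
  shows "lin x (\<Sum>i\<in>I. sc (c i) (f i)) = (\<Oplus>\<^bsub>N\<^esub>i\<in>I. scal (c i) (lin x (f i)))"
proof -
  have "lin x (\<Sum>i\<in>I. sc (c i) (f i)) = (\<Oplus>\<^bsub>N\<^esub>i\<in>I. lin x (sc (c i) (f i)))" by (rule lin_sum[OF x assms(2)])
  then show ?thesis by (simp only: lin_sc[OF x])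
qed

end

subsection \<open>Logarithmic growth\<close>

text \<open>
  The logarithm is squeezed between functions of the form \<open>(c + d * ln (i + 1)) / ln i\<close>; the linear
  substitution in the lower bound of the growth only shifts the logarithm by a constant.
\<close>
lemma limsup_log_growth:
  assumes "growth f d"
  shows "limsup (\<lambda>i. ereal (log (real i) (real (f i)))) = ereal (real d)"
proof (rule antisym)
  obtain C where C: "\<And>i. f i \<le> C * (i + 1) ^ d" using assms unfolding growth_def by blast
  have "\<forall>\<^sub>F i in sequentially. ereal (log (real i) (real (f i))) \<le> ereal (ln (real (C + 1)) / ln (real i) + d * (ln (real i + 1) / ln (real i)))"
  proof (rule eventually_sequentiallyI[of 2])
    fix i :: nat assume i: "2 \<le> i"
    have "f i \<le> (C + 1) * (i + 1) ^ d" by (rule order_trans[OF C mult_right_mono]) simp_all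
    then have "real (f i) \<le> real ((C + 1) * (i + 1) ^ d)" by (simp only: of_nat_le_iff)
    moreover have "0 < (C + 1) * (i + 1) ^ d" by simp
    then have "1 \<le> real ((C + 1) * (i + 1) ^ d)" by linarith
    ultimately have "ln (real (f i)) \<le> ln (real ((C + 1) * (i + 1) ^ d))"
      by (cases "f i = 0") (auto simp del: of_nat_mult of_nat_power of_nat_Suc of_nat_add intro!: ln_mono ln_ge_zero)
    also have "real ((C + 1) * (i + 1) ^ d) = real (C + 1) * (real i + 1) ^ d"
      by (simp only: of_nat_mult of_nat_power) (simp add: add.commute)
    also have "ln \<dots> = ln (real (C + 1)) + ln ((real i + 1) ^ d)" by (rule ln_mult_pos) auto
    also have "ln ((real i + 1) ^ d) = d * ln (real i + 1)" by (rule ln_realpow)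
    finally show "ereal (log (real i) (real (f i))) \<le> ereal (ln (real (C + 1)) / ln (real i) + d * (ln (real i + 1) / ln (real i)))"
      using i by (simp add: log_def divide_simps)
  qed
  then have "limsup (\<lambda>i. ereal (log (real i) (real (f i)))) \<le>
    limsup (\<lambda>i. ereal (ln (real (C + 1)) / ln (real i) + d * (ln (real i + 1) / ln (real i))))"
    by (rule Limsup_mono)
  also have "(\<lambda>i. ln (real (C + 1)) / ln (real i) + real d * (ln (real i + 1) / ln (real i))) \<longlonglongrightarrow> 0 + real d * 1"
  proof (intro tendsto_add tendsto_mult tendsto_const)
    show "(\<lambda>i. ln (real (C + 1)) / ln (real i)) \<longlonglongrightarrow> 0"
      by (rule real_tendsto_divide_at_top[OF tendsto_const]) real_asymp
    show "(\<lambda>i. ln (real i + 1) / ln (real i)) \<longlonglongrightarrow> 1" by real_asymp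
  qed
  then have "limsup (\<lambda>i. ereal (ln (real (C + 1)) / ln (real i) + d * (ln (real i + 1) / ln (real i)))) = ereal (real d)"
    by (intro lim_imp_Limsup) (auto intro: tendsto_ereal)
  finally show "limsup (\<lambda>i. ereal (log (real i) (real (f i)))) \<le> ereal (real d)" .
next
  obtain a b where ab: "\<And>i. (i + 1) ^ d \<le> f (a * i + b)" using assms unfolding growth_def by blast
  show "ereal (real d) \<le> limsup (\<lambda>i. ereal (log (real i) (real (f i))))"
  proof (cases "d = 0")
    case True
    have "0 = limsup (\<lambda>i::nat. 0 :: ereal)" by (simp add: Limsup_const)
    also have "\<dots> \<le> limsup (\<lambda>i. ereal (log (real i) (real (f i))))"
    proof (rule Limsup_mono, rule eventually_sequentiallyI[of 2])
      fix i :: nat assume "2 \<le> i"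
      then show "0 \<le> ereal (log (real i) (real (f i)))"
        by (cases "f i = 0") (auto simp: log_def intro!: divide_nonneg_nonneg)
    qed
    finally show ?thesis using True by (simp add: zero_ereal_def)
  next
    case False
    have a: "a > 0"
    proof (rule ccontr)
      assume "\<not> a > 0"
      then have le: "(i + 1) ^ d \<le> f b" for i using ab[of i] by simp
      have "f b + 1 \<le> (f b + 1) ^ d" using False by (intro self_le_power) auto
      then show False using le[of "f b"] by simp
    qed
    let ?r = "\<lambda>i. a * i + b" and ?X = "\<lambda>i. ereal (log (real i) (real (f i)))"
    have lim: "(\<lambda>i. real d * (ln (real i + 1) / ln (real a * real i + real b))) \<longlonglongrightarrow> real d * 1"
    proof (intro tendsto_mult tendsto_const)
      show "(\<lambda>i. ln (real i + 1) / ln (real a * real i + real b)) \<longlonglongrightarrow> 1"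
        using a by real_asymp
    qed
    have "ereal (real d) = limsup (\<lambda>i. ereal (real d * (ln (real i + 1) / ln (real a * real i + real b))))"
      using lim by (intro lim_imp_Limsup[symmetric]) (auto intro: tendsto_ereal)
    also have "\<dots> \<le> limsup (?X \<circ> ?r)"
    proof (rule Limsup_mono, rule eventually_sequentiallyI[of 2])
      fix i :: nat assume i: "2 \<le> i"
      have "real ((i + 1) ^ d) \<le> real (f (?r i))" using ab[of i] by (simp only: of_nat_le_iff)
      then have "ln (real ((i + 1) ^ d)) \<le> ln (real (f (?r i)))" by (intro ln_mono) auto
      then have "real d * ln (real i + 1) \<le> ln (real (f (?r i)))" by (simp add: ln_realpow add.commute)
      moreover have "1 * 2 \<le> a * i" using a i by (intro mult_le_mono) auto
      then have "1 < a * i + b" by linarith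
      then have "1 < real (a * i + b)" by linarith
      then have "1 < real a * real i + real b" by simp
      ultimately show "ereal (real d * (ln (real i + 1) / ln (real a * real i + real b))) \<le> (?X \<circ> ?r) i"
        by (simp add: log_def divide_right_mono)
    qed
    also have "\<dots> \<le> limsup ?X"
      by (rule limsup_subseq_mono) (use a in \<open>simp add: strict_mono_def\<close>)
    finally show ?thesis .
  qed
qed

section \<open>Gelfand--Kirillov dimension through a standard filtration\<close>

lemma (in kmodule) ksub_preimage:
  assumes b: "b \<in> carrier B" and U: "ksub U"
  shows "ksub {y \<in> carrier N. b \<odot>\<^bsub>N\<^esub> y \<in> U}"
  unfolding ksub_def
proof (intro conjI ballI allI)
  show "\<zero>\<^bsub>N\<^esub> \<in> {y \<in> carrier N. b \<odot>\<^bsub>N\<^esub> y \<in> U}" using U smult_zero_right[OF b] by (simp add: ksub_def)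
next
  fix y z assume "y \<in> {y \<in> carrier N. b \<odot>\<^bsub>N\<^esub> y \<in> U}" "z \<in> {y \<in> carrier N. b \<odot>\<^bsub>N\<^esub> y \<in> U}"
  then show "y \<oplus>\<^bsub>N\<^esub> z \<in> {y \<in> carrier N. b \<odot>\<^bsub>N\<^esub> y \<in> U}" using U b by (simp add: ksub_def smult_r_distr)
next
  fix c y assume "y \<in> {y \<in> carrier N. b \<odot>\<^bsub>N\<^esub> y \<in> U}"
  then show "scal c y \<in> {y \<in> carrier N. b \<odot>\<^bsub>N\<^esub> y \<in> U}" using U b by (simp add: ksub_def smult_scal)
qed auto

lemma (in kmodule) kmodule_regular: "kmodule B (regular_module B) \<kappa>"
proof -
  have ag: "abelian_group (regular_module B)"
  proof (rule abelian_groupI)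
    fix x assume "x \<in> carrier (regular_module B)"
    then show "\<exists>y\<in>carrier (regular_module B). y \<oplus>\<^bsub>regular_module B\<^esub> x = \<zero>\<^bsub>regular_module B\<^esub>"
      by (intro bexI[of _ "\<ominus>\<^bsub>B\<^esub> x"]) (simp_all add: regular_module_def R.l_neg)
  qed (simp_all add: regular_module_def R.a_ac)
  show ?thesis
  proof (intro kmodule.intro left_module.intro left_module_axioms.intro kmodule_axioms.intro ag R.ring_axioms)
    show "\<kappa> c \<otimes>\<^bsub>B\<^esub> b = b \<otimes>\<^bsub>B\<^esub> \<kappa> c" if "b \<in> carrier B" for b c using that by (rule k_central)
  qed (simp_all add: regular_module_def R.l_distr R.r_distr R.m_assoc k_closed k_add k_mult k_one k_zero_iff)
qed

lemma regular_module_simps [simp]: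
  "carrier (regular_module B) = carrier B" "ring.zero (regular_module B) = ring.zero B"
  "ring.add (regular_module B) = ring.add B" "module.smult (regular_module B) = monoid.mult B"
  by (simp_all add: regular_module_def)

text \<open>
  A ring spanned by elements \<open>u a\<close> indexed by exponents, in which multiplication by a generator raises the
  total degree by at most one, together with a module generated by \<open>m j\<close>. Both the Weyl algebra and the
  polynomial ring are of this kind, so their modules are treated alike.
\<close>
locale framed_module = kmodule B N \<kappa>
  for B :: "('b, 'c) ring_scheme" and N :: "('b, 'm) module" and \<kappa> :: "'k::field \<Rightarrow> 'b" +
  fixes u :: "('v::finite \<Rightarrow>\<^sub>0 nat) \<Rightarrow> 'b" and m :: "nat \<Rightarrow> 'm" and r :: nat
  assumes u_closed: "u a \<in> carrier B" and u_zero: "u 0 = \<one>\<^bsub>B\<^esub>"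
    and u_peel: "a \<noteq> 0 \<Longrightarrow> \<exists>v b. a = single v 1 + b \<and> u a = u (single v 1) \<otimes>\<^bsub>B\<^esub> u b"
    and u_gen: "u (single v 1) \<otimes>\<^bsub>B\<^esub> u b \<in>
      lin_span (range \<kappa>) (regular_module B) (u ` {c. mdeg c \<le> mdeg b + 1})"
    and u_span: "lin_span (range \<kappa>) (regular_module B) (range u) = carrier B"
    and m_closed: "m j \<in> carrier N"
    and m_gen: "lin_span (range \<kappa>) N ((\<lambda>e. u (fst e) \<odot>\<^bsub>N\<^esub> m (snd e)) ` (UNIV \<times> {..<r})) = carrier N"
begin

sublocale reg: kmodule B "regular_module B" \<kappa> by (rule kmodule_regular)

definition gx :: "('v \<Rightarrow>\<^sub>0 nat) \<times> nat \<Rightarrow> 'm" where "gx e = u (fst e) \<odot>\<^bsub>N\<^esub> m (snd e)"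
definition FB :: "nat \<Rightarrow> 'b set" where "FB i = reg.kspan (u ` {c. mdeg c \<le> i})"
definition FN :: "nat \<Rightarrow> 'm set" where "FN i = kspan (gx ` {e \<in> UNIV \<times> {..<r}. mdeg (fst e) \<le> i})"

lemma gx_closed [simp]: "gx e \<in> carrier N" unfolding gx_def by (intro smult_closed u_closed m_closed)

lemma FB_sub: "reg.ksub (FB i)" unfolding FB_def by (rule reg.kspan_ksub) (auto simp: u_closed)
lemma FN_sub: "ksub (FN i)" unfolding FN_def by (rule kspan_ksub) auto
lemma FB_mono: "i \<le> j \<Longrightarrow> FB i \<subseteq> FB j" unfolding FB_def by (rule reg.kspan_mono) (auto simp: u_closed)
lemma FN_mono: "i \<le> j \<Longrightarrow> FN i \<subseteq> FN j" unfolding FN_def by (rule kspan_mono) auto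
lemma FB_carrier: "FB i \<subseteq> carrier B" using FB_sub unfolding reg.ksub_def by simp
lemma FN_carrier: "FN i \<subseteq> carrier N" using FN_sub unfolding ksub_def by simp

lemma u_in_FB: "mdeg a \<le> i \<Longrightarrow> u a \<in> FB i"
  unfolding FB_def by (rule reg.kspan_base) (auto simp: u_closed)
lemma gx_in_FN: "snd e < r \<Longrightarrow> mdeg (fst e) \<le> i \<Longrightarrow> gx e \<in> FN i"
  unfolding FN_def by (rule kspan_base) (auto intro!: imageI simp: mem_Times_iff)

lemma ksub_preimage_right:
  assumes y: "y \<in> carrier N" and U: "ksub U"
  shows "reg.ksub {b \<in> carrier B. b \<odot>\<^bsub>N\<^esub> y \<in> U}"
  unfolding reg.ksub_def
proof (intro conjI ballI allI)
  show "\<zero>\<^bsub>regular_module B\<^esub> \<in> {b \<in> carrier B. b \<odot>\<^bsub>N\<^esub> y \<in> U}" using U smult_zero_left[OF y] by (simp add: ksub_def)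
next
  fix b c assume "b \<in> {b \<in> carrier B. b \<odot>\<^bsub>N\<^esub> y \<in> U}" "c \<in> {b \<in> carrier B. b \<odot>\<^bsub>N\<^esub> y \<in> U}"
  then show "b \<oplus>\<^bsub>regular_module B\<^esub> c \<in> {b \<in> carrier B. b \<odot>\<^bsub>N\<^esub> y \<in> U}"
    using U y by (simp add: ksub_def smult_l_distr)
next
  fix c b assume b: "b \<in> {b \<in> carrier B. b \<odot>\<^bsub>N\<^esub> y \<in> U}"
  have "reg.scal c b \<odot>\<^bsub>N\<^esub> y = scal c (b \<odot>\<^bsub>N\<^esub> y)"
    using b y by (simp add: reg.scal_def scal_def smult_assoc k_closed)
  then show "reg.scal c b \<in> {b \<in> carrier B. b \<odot>\<^bsub>N\<^esub> y \<in> U}"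
    using b U reg.scal_closed[of b c] by (simp add: ksub_def)
qed auto

lemma reg_ksub_preimage_right:
  assumes y: "y \<in> carrier B" and U: "reg.ksub U"
  shows "reg.ksub {b \<in> carrier B. b \<otimes>\<^bsub>B\<^esub> y \<in> U}"
  unfolding reg.ksub_def
proof (intro conjI ballI allI)
  show "\<zero>\<^bsub>regular_module B\<^esub> \<in> {b \<in> carrier B. b \<otimes>\<^bsub>B\<^esub> y \<in> U}" using U y by (simp add: reg.ksub_def)
next
  fix b c assume "b \<in> {b \<in> carrier B. b \<otimes>\<^bsub>B\<^esub> y \<in> U}" "c \<in> {b \<in> carrier B. b \<otimes>\<^bsub>B\<^esub> y \<in> U}"
  then show "b \<oplus>\<^bsub>regular_module B\<^esub> c \<in> {b \<in> carrier B. b \<otimes>\<^bsub>B\<^esub> y \<in> U}"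
    using U y by (simp add: reg.ksub_def R.l_distr)
next
  fix c b assume b: "b \<in> {b \<in> carrier B. b \<otimes>\<^bsub>B\<^esub> y \<in> U}"
  have "reg.scal c b \<otimes>\<^bsub>B\<^esub> y = reg.scal c (b \<otimes>\<^bsub>B\<^esub> y)"
    using b y by (simp add: reg.scal_def R.m_assoc k_closed)
  then show "reg.scal c b \<in> {b \<in> carrier B. b \<otimes>\<^bsub>B\<^esub> y \<in> U}"
    using b U reg.scal_closed[of b c] by (simp add: reg.ksub_def)
qed auto

lemma FB_gen_mult:
  assumes "c \<in> FB j" shows "u (single v 1) \<otimes>\<^bsub>B\<^esub> c \<in> FB (j + 1)"
proof -
  let ?U = "{c \<in> carrier B. u (single v 1) \<otimes>\<^bsub>B\<^esub> c \<in> FB (j + 1)}"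
  have "reg.ksub ?U" using reg.ksub_preimage[OF u_closed FB_sub] by simp
  then have "FB j \<subseteq> ?U"
    unfolding FB_def[of j]
  proof (rule reg.kspan_minimal, intro image_subsetI CollectI conjI)
    fix b :: "'v \<Rightarrow>\<^sub>0 nat" assume b: "b \<in> {c. mdeg c \<le> j}"
    show "u b \<in> carrier B" by (rule u_closed)
    have "u (single v 1) \<otimes>\<^bsub>B\<^esub> u b \<in> FB (mdeg b + 1)" unfolding FB_def by (rule u_gen)
    then show "u (single v 1) \<otimes>\<^bsub>B\<^esub> u b \<in> FB (j + 1)" using FB_mono[of "mdeg b + 1" "j + 1"] b by auto
  qed
  then show ?thesis using assms by blast
qed

lemma FB_u_mult: "c \<in> FB j \<Longrightarrow> u a \<otimes>\<^bsub>B\<^esub> c \<in> FB (mdeg a + j)"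
proof (induction "mdeg a" arbitrary: a)
  case 0
  then have "a = 0" by (metis mdeg_eq_0)
  then show ?case using 0 FB_carrier[of j] by (auto simp: u_zero)
next
  case (Suc n)
  then have "a \<noteq> 0" by auto
  from u_peel[OF this] obtain v b where ab: "a = single v 1 + b"
    "u a = u (single v 1) \<otimes>\<^bsub>B\<^esub> u b" by (elim exE conjE)
  have n: "n = mdeg b" using Suc.hyps(2) unfolding ab(1) by simp
  from FB_gen_mult[OF Suc.hyps(1)[OF n Suc.prems], of v]
  have "u (single v 1) \<otimes>\<^bsub>B\<^esub> (u b \<otimes>\<^bsub>B\<^esub> c) \<in> FB (mdeg b + j + 1)" .
  moreover have "c \<in> carrier B" using Suc.prems FB_carrier by blast
  ultimately show ?case unfolding ab(2) by (simp add: ab(1) R.m_assoc u_closed)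
qed

lemma FB_mult: assumes b: "b \<in> FB i" and c: "c \<in> FB j" shows "b \<otimes>\<^bsub>B\<^esub> c \<in> FB (i + j)"
proof -
  have cB: "c \<in> carrier B" using c FB_carrier by blast
  have "FB i \<subseteq> {b \<in> carrier B. b \<otimes>\<^bsub>B\<^esub> c \<in> FB (i + j)}"
    unfolding FB_def[of i]
  proof (rule reg.kspan_minimal[OF reg_ksub_preimage_right[OF cB FB_sub]], intro image_subsetI CollectI conjI)
    fix a :: "'v \<Rightarrow>\<^sub>0 nat" assume "a \<in> {c. mdeg c \<le> i}"
    then show "u a \<otimes>\<^bsub>B\<^esub> c \<in> FB (i + j)" using FB_u_mult[OF c, of a] FB_mono[of "mdeg a + j" "i + j"] by auto
  qed (rule u_closed)
  then show ?thesis using b by blast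
qed

lemma FB_m: assumes "b \<in> FB i" "j < r" shows "b \<odot>\<^bsub>N\<^esub> m j \<in> FN i"
proof -
  have "FB i \<subseteq> {b \<in> carrier B. b \<odot>\<^bsub>N\<^esub> m j \<in> FN i}"
    unfolding FB_def
  proof (rule reg.kspan_minimal[OF ksub_preimage_right[OF m_closed FN_sub]], intro image_subsetI CollectI conjI)
    fix a :: "'v \<Rightarrow>\<^sub>0 nat" assume "a \<in> {c. mdeg c \<le> i}"
    then show "u a \<odot>\<^bsub>N\<^esub> m j \<in> FN i" using gx_in_FN[of "(a, j)" i] assms(2) by (simp add: gx_def)
  qed (rule u_closed)
  then show ?thesis using assms(1) by blast
qed

lemma FB_act: assumes b: "b \<in> FB i" and y: "y \<in> FN j" shows "b \<odot>\<^bsub>N\<^esub> y \<in> FN (i + j)"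
proof -
  have bB: "b \<in> carrier B" using b FB_carrier by blast
  have "FN j \<subseteq> {y \<in> carrier N. b \<odot>\<^bsub>N\<^esub> y \<in> FN (i + j)}"
    unfolding FN_def[of j]
  proof (rule kspan_minimal[OF ksub_preimage[OF bB FN_sub]], intro image_subsetI CollectI conjI)
    fix e :: "('v \<Rightarrow>\<^sub>0 nat) \<times> nat" assume e: "e \<in> {e \<in> UNIV \<times> {..<r}. mdeg (fst e) \<le> j}"
    have "b \<otimes>\<^bsub>B\<^esub> u (fst e) \<in> FB (i + j)" using FB_mult[OF b u_in_FB[of "fst e" j]] e by auto
    then have "(b \<otimes>\<^bsub>B\<^esub> u (fst e)) \<odot>\<^bsub>N\<^esub> m (snd e) \<in> FN (i + j)" using e by (intro FB_m) auto
    then show "b \<odot>\<^bsub>N\<^esub> gx e \<in> FN (i + j)" by (simp add: gx_def smult_assoc[OF bB u_closed m_closed])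
  qed simp
  then show ?thesis using y by blast
qed

lemma FB_exhaust: assumes "b \<in> carrier B" shows "\<exists>i. b \<in> FB i"
proof -
  have "b \<in> reg.lin u ` {a. keys a \<subseteq> UNIV}"
    using assms u_span reg.kspan_eq_lin[of u UNIV] u_closed by simp
  then obtain a where a: "b = reg.lin u a" by blast
  have "b \<in> reg.lin u ` {c. keys c \<subseteq> {c. mdeg c \<le> (\<Sum>d\<in>keys a. mdeg d)}}"
    unfolding a by (intro imageI) (auto intro!: member_le_sum)
  then show ?thesis unfolding FB_def using reg.kspan_eq_lin[of u] u_closed by auto
qed

lemma FN_exhaust: assumes "y \<in> carrier N" shows "\<exists>i. y \<in> FN i"
proof -
  have "y \<in> lin gx ` {a. keys a \<subseteq> UNIV \<times> {..<r}}"
    unfolding kspan_eq_lin[of gx, OF gx_closed, symmetric] using assms m_gen by (simp add: gx_def[abs_def])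
  then obtain a where a: "y = lin gx a" "keys a \<subseteq> UNIV \<times> {..<r}" by blast
  let ?i = "\<Sum>d\<in>keys a. mdeg (fst d)"
  have "mdeg (fst e) \<le> ?i" if "e \<in> keys a" for e by (rule member_le_sum[OF that]) auto
  then have "keys a \<subseteq> {e \<in> UNIV \<times> {..<r}. mdeg (fst e) \<le> ?i}" using a(2) by blast
  then have "y \<in> FN ?i" unfolding FN_def a(1) kspan_eq_lin[of gx, OF gx_closed] by blast
  then show ?thesis by blast
qed

lemma finite_common_bound:
  assumes "finite T" "\<And>s. s \<in> T \<Longrightarrow> \<exists>i. s \<in> F i" "\<And>i j. i \<le> j \<Longrightarrow> F i \<subseteq> F (j::nat)"
  shows "\<exists>i. T \<subseteq> F i"
  using assms(1,2)
proof (induction T rule: finite_induct)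
  case (insert s T)
  then obtain i j where "s \<in> F i" "T \<subseteq> F j" by blast
  then have "insert s T \<subseteq> F (max i j)" using assms(3)[of i "max i j"] assms(3)[of j "max i j"] by auto
  then show ?case by blast
qed simp

subsection \<open>Comparison with an arbitrary frame\<close>

abbreviation spow :: "'b set \<Rightarrow> nat \<Rightarrow> 'b set" where "spow V i \<equiv> space_power (range \<kappa>) B V i"
abbreviation sact :: "'b set \<Rightarrow> 'm set \<Rightarrow> nat \<Rightarrow> 'm set" where
  "sact V E i \<equiv> space_smult (range \<kappa>) N (spow V i) E"

lemma word_closed: "set vs \<subseteq> carrier B \<Longrightarrow> foldr (monoid.mult B) vs \<one>\<^bsub>B\<^esub> \<in> carrier B"
  by (induction vs) auto

lemma word_append:
  "set vs \<subseteq> carrier B \<Longrightarrow> set ws \<subseteq> carrier B \<Longrightarrow>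
   foldr (monoid.mult B) (vs @ ws) \<one>\<^bsub>B\<^esub> = foldr (monoid.mult B) vs \<one>\<^bsub>B\<^esub> \<otimes>\<^bsub>B\<^esub> foldr (monoid.mult B) ws \<one>\<^bsub>B\<^esub>"
  by (induction vs) (auto simp: R.m_assoc word_closed)

lemma word_in_FB: "set vs \<subseteq> FB a \<Longrightarrow> foldr (monoid.mult B) vs \<one>\<^bsub>B\<^esub> \<in> FB (a * length vs)"
proof (induction vs)
  case Nil then show ?case using u_in_FB[of 0 0] by (simp add: u_zero)
next
  case (Cons v vs)
  then show ?case using FB_mult[of v a "foldr (monoid.mult B) vs \<one>\<^bsub>B\<^esub>" "a * length vs"] by simp
qed

context
  fixes V :: "'b set" and E :: "'m set"
  assumes V: "alg_frame (range \<kappa>) B V" and E: "mod_frame (range \<kappa>) B N E"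
begin

lemma V_span: obtains S where "finite S" "S \<subseteq> carrier B" "V = reg.kspan S"
  using V unfolding alg_frame_def fin_dim_subspace_def by auto
lemma E_span: obtains S where "finite S" "S \<subseteq> carrier N" "E = kspan S"
  using E unfolding mod_frame_def fin_dim_subspace_def by auto
lemma V_closed: "V \<subseteq> carrier B" using V_span reg.kspan_in_carrier by (metis regular_module_simps(1))
lemma E_closed: "E \<subseteq> carrier N" using E_span kspan_in_carrier by metis

lemma words_closed: "{foldr (monoid.mult B) vs \<one>\<^bsub>B\<^esub> | vs. set vs \<subseteq> V \<and> length vs \<le> i} \<subseteq> carrier B"
  using word_closed V_closed by blast
lemma spow_sub: "reg.ksub (spow V i)"
  unfolding space_power_def using reg.kspan_ksub words_closed by simp
lemma spow_closed: "spow V i \<subseteq> carrier B" using spow_sub unfolding reg.ksub_def by simp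
lemma spow_word: "set vs \<subseteq> V \<Longrightarrow> length vs \<le> i \<Longrightarrow> foldr (monoid.mult B) vs \<one>\<^bsub>B\<^esub> \<in> spow V i"
  unfolding space_power_def by (rule reg.kspan_base) (use words_closed in auto)
lemma spow_mono: "i \<le> j \<Longrightarrow> spow V i \<subseteq> spow V j"
  unfolding space_power_def by (rule reg.kspan_mono) (use words_closed in auto)

lemma spow_minimal:
  assumes "reg.ksub U" "\<And>vs. set vs \<subseteq> V \<Longrightarrow> length vs \<le> i \<Longrightarrow> foldr (monoid.mult B) vs \<one>\<^bsub>B\<^esub> \<in> U"
  shows "spow V i \<subseteq> U"
  unfolding space_power_def by (rule reg.kspan_minimal[OF assms(1)]) (use assms(2) in auto)

lemma spow_mult: assumes b: "b \<in> spow V i" and c: "c \<in> spow V j" shows "b \<otimes>\<^bsub>B\<^esub> c \<in> spow V (i + j)"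
proof -
  have "spow V i \<subseteq> {b \<in> carrier B. b \<otimes>\<^bsub>B\<^esub> c \<in> spow V (i + j)}"
  proof (rule spow_minimal[OF reg_ksub_preimage_right[OF _ spow_sub]])
    show "c \<in> carrier B" using c spow_closed by blast
    fix vs assume vs: "set vs \<subseteq> V" "length vs \<le> i"
    let ?b = "foldr (monoid.mult B) vs \<one>\<^bsub>B\<^esub>"
    have bB: "?b \<in> carrier B" using vs V_closed by (intro word_closed) auto
    have "reg.ksub {c \<in> carrier B. ?b \<otimes>\<^bsub>B\<^esub> c \<in> spow V (i + j)}"
      using reg.ksub_preimage[OF bB spow_sub] by simp
    then have "spow V j \<subseteq> {c \<in> carrier B. ?b \<otimes>\<^bsub>B\<^esub> c \<in> spow V (i + j)}"
    proof (rule spow_minimal)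
      fix ws assume ws: "set ws \<subseteq> V" "length ws \<le> j"
      have "foldr (monoid.mult B) (vs @ ws) \<one>\<^bsub>B\<^esub> \<in> spow V (i + j)" using vs ws by (intro spow_word) auto
      moreover have "foldr (monoid.mult B) (vs @ ws) \<one>\<^bsub>B\<^esub> = ?b \<otimes>\<^bsub>B\<^esub> foldr (monoid.mult B) ws \<one>\<^bsub>B\<^esub>"
        by (rule word_append) (use vs ws V_closed in auto)
      ultimately show "foldr (monoid.mult B) ws \<one>\<^bsub>B\<^esub> \<in> {c \<in> carrier B. ?b \<otimes>\<^bsub>B\<^esub> c \<in> spow V (i + j)}"
        using ws V_closed word_closed[of ws] by auto
    qed
    then show "?b \<in> {b \<in> carrier B. b \<otimes>\<^bsub>B\<^esub> c \<in> spow V (i + j)}" using c bB by blast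
  qed
  then show ?thesis using b by blast
qed

lemma spow_exhaust: assumes "b \<in> carrier B" shows "\<exists>i. b \<in> spow V i"
proof -
  have "b \<in> generate_ring B V" using assms V by (simp add: alg_frame_def)
  then show ?thesis
  proof (induction rule: generate_ring.induct)
    case one then show ?case using spow_word[of "[]" 0] by auto
  next
    case (incl h) then show ?case using spow_word[of "[h]" 1] V_closed by (intro exI[of _ 1]) auto
  next
    case (a_inv h)
    then obtain i where h: "h \<in> spow V i" by blast
    then have hB: "h \<in> carrier B" using spow_closed by blast
    have "reg.scal (- 1) h \<oplus>\<^bsub>B\<^esub> h = \<zero>\<^bsub>B\<^esub>"
      using reg.scal_add_left[of h "- 1" 1] reg.scal_one[of h] reg.scal_zero_left[of h] hB by simp
    then have "reg.scal (- 1) h = \<ominus>\<^bsub>B\<^esub> h"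
      using R.minus_equality[of "reg.scal (- 1) h" h] reg.scal_closed[of h "- 1"] hB by simp
    then show ?case using spow_sub h unfolding reg.ksub_def by metis
  next
    case (eng_add b c)
    then obtain i j where "b \<in> spow V i" "c \<in> spow V j" by blast
    then have "b \<in> spow V (max i j)" "c \<in> spow V (max i j)" using spow_mono[of i "max i j"] spow_mono[of j "max i j"] by auto
    then show ?case using spow_sub[of "max i j"] unfolding reg.ksub_def by auto
  next
    case (eng_mult b c)
    then show ?case using spow_mult by blast
  qed
qed

lemma products_closed: "{v \<odot>\<^bsub>N\<^esub> e | v e. v \<in> spow V i \<and> e \<in> E} \<subseteq> carrier N"
  using spow_closed E_closed by (auto intro!: smult_closed)
lemma sact_sub: "ksub (sact V E i)" unfolding space_smult_def by (rule kspan_ksub[OF products_closed])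
lemma sact_base: "v \<in> spow V i \<Longrightarrow> e \<in> E \<Longrightarrow> v \<odot>\<^bsub>N\<^esub> e \<in> sact V E i"
  unfolding space_smult_def by (rule kspan_base[OF products_closed]) auto
lemma sact_minimal: "ksub U \<Longrightarrow> (\<And>v e. v \<in> spow V i \<Longrightarrow> e \<in> E \<Longrightarrow> v \<odot>\<^bsub>N\<^esub> e \<in> U) \<Longrightarrow> sact V E i \<subseteq> U"
  unfolding space_smult_def by (rule kspan_minimal) auto
lemma sact_mono: "i \<le> j \<Longrightarrow> sact V E i \<subseteq> sact V E j"
  by (rule sact_minimal[OF sact_sub]) (use spow_mono in \<open>auto intro!: sact_base\<close>)

lemma sact_act: assumes b: "b \<in> spow V i" and y: "y \<in> sact V E j" shows "b \<odot>\<^bsub>N\<^esub> y \<in> sact V E (i + j)"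
proof -
  have bB: "b \<in> carrier B" using b spow_closed by blast
  have "sact V E j \<subseteq> {y \<in> carrier N. b \<odot>\<^bsub>N\<^esub> y \<in> sact V E (i + j)}"
  proof (rule sact_minimal[OF ksub_preimage[OF bB sact_sub]])
    fix v e assume ve: "v \<in> spow V j" "e \<in> E"
    then have c: "v \<in> carrier B" "e \<in> carrier N" using spow_closed E_closed by auto
    show "v \<odot>\<^bsub>N\<^esub> e \<in> {y \<in> carrier N. b \<odot>\<^bsub>N\<^esub> y \<in> sact V E (i + j)}"
      using sact_base[OF spow_mult[OF b ve(1)] ve(2)] bB c by (simp add: smult_assoc smult_closed)
  qed
  then show ?thesis using y by blast
qed

lemma sact_exhaust: assumes "y \<in> carrier N" shows "\<exists>i. y \<in> sact V E i"
proof -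
  have "y \<in> lin_span (carrier B) N E" using assms E by (simp add: mod_frame_def)
  then obtain T c where T: "finite T" "T \<subseteq> E" "c \<in> T \<rightarrow> carrier B" "y = (\<Oplus>\<^bsub>N\<^esub>s\<in>T. c s \<odot>\<^bsub>N\<^esub> s)"
    unfolding lin_span_def by blast
  have "\<exists>i. c s \<odot>\<^bsub>N\<^esub> s \<in> sact V E i" if "s \<in> T" for s
    using spow_exhaust[of "c s"] sact_base[of "c s" _ s] T that by blast
  then have "\<exists>i. (\<lambda>s. c s \<odot>\<^bsub>N\<^esub> s) ` T \<subseteq> sact V E i"
    by (intro finite_common_bound sact_mono) (use T(1) in auto)
  then obtain i where "(\<lambda>s. c s \<odot>\<^bsub>N\<^esub> s) ` T \<subseteq> sact V E i" by blast
  then have "y \<in> sact V E i" unfolding T(4) by (intro ksub_finsum[OF sact_sub]) auto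
  then show ?thesis by blast
qed

text \<open>
  A finite-dimensional subspace lies in some \<open>FB a\<close> or \<open>FN b\<close>, and the filtrations are
  multiplicative.
\<close>
lemma frame_upper: "\<exists>a b. \<forall>i. sact V E i \<subseteq> FN (a * i + b)"
proof -
  obtain S where S: "finite S" "S \<subseteq> carrier B" "V = reg.kspan S" by (rule V_span)
  have "\<exists>a. S \<subseteq> FB a" by (rule finite_common_bound[OF S(1)]) (use S(2) FB_exhaust FB_mono in auto)
  then obtain a where "S \<subseteq> FB a" by blast
  then have Va: "V \<subseteq> FB a" unfolding S(3) by (rule reg.kspan_minimal[OF FB_sub])
  obtain T where T: "finite T" "T \<subseteq> carrier N" "E = kspan T" by (rule E_span)
  have "\<exists>b. T \<subseteq> FN b" by (rule finite_common_bound[OF T(1)]) (use T(2) FN_exhaust FN_mono in auto)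
  then obtain b where "T \<subseteq> FN b" by blast
  then have Eb: "E \<subseteq> FN b" unfolding T(3) by (rule kspan_minimal[OF FN_sub])
  have "spow V i \<subseteq> FB (a * i)" for i
  proof (rule spow_minimal[OF FB_sub])
    fix vs assume vs: "set vs \<subseteq> V" "length vs \<le> i"
    then have "foldr (monoid.mult B) vs \<one>\<^bsub>B\<^esub> \<in> FB (a * length vs)" using Va by (intro word_in_FB) auto
    then show "foldr (monoid.mult B) vs \<one>\<^bsub>B\<^esub> \<in> FB (a * i)" using FB_mono[of "a * length vs" "a * i"] vs(2) by auto
  qed
  then have "sact V E i \<subseteq> FN (a * i + b)" for i
    by (intro sact_minimal[OF FN_sub] FB_act) (use Eb in auto)
  then show ?thesis by blast
qed

text \<open>
  The finitely many generators lie in some power of the given frame, and the monomials are products of generators.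
\<close>
lemma frame_lower: "\<exists>a b. \<forall>i. FN i \<subseteq> sact V E (a * i + b)"
proof -
  have "\<exists>a. (\<lambda>v. u (single v 1)) ` UNIV \<subseteq> spow V a"
    by (rule finite_common_bound) (use spow_exhaust u_closed spow_mono in auto)
  then obtain a where a: "\<And>v. u (single v 1) \<in> spow V a" by blast
  have "\<exists>b. m ` {..<r} \<subseteq> sact V E b"
    by (rule finite_common_bound) (use sact_exhaust m_closed sact_mono in auto)
  then obtain b where b: "m ` {..<r} \<subseteq> sact V E b" by blast
  have gx: "u c \<odot>\<^bsub>N\<^esub> m j \<in> sact V E (a * mdeg c + b)" if j: "j < r" for c j
  proof (induction "mdeg c" arbitrary: c)
    case 0
    then have "c = 0" by (metis mdeg_eq_0)
    then show ?case using b j by (auto simp: u_zero smult_one m_closed)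
  next
    case (Suc n)
    then have "c \<noteq> 0" by auto
    from u_peel[OF this] obtain v d where cd: "c = single v 1 + d"
      "u c = u (single v 1) \<otimes>\<^bsub>B\<^esub> u d" by (elim exE conjE)
    have n: "n = mdeg d" using Suc.hyps(2) unfolding cd(1) by simp
    have "u (single v 1) \<odot>\<^bsub>N\<^esub> (u d \<odot>\<^bsub>N\<^esub> m j) \<in> sact V E (a + (a * mdeg d + b))"
      by (rule sact_act[OF a Suc.hyps(1)[OF n]])
    then show ?case unfolding cd(2) by (simp add: cd(1) smult_assoc u_closed m_closed add.assoc)
  qed
  have "FN i \<subseteq> sact V E (a * i + b)" for i
    unfolding FN_def
  proof (rule kspan_minimal[OF sact_sub], rule image_subsetI)
    fix e :: "('v \<Rightarrow>\<^sub>0 nat) \<times> nat" assume e: "e \<in> {e \<in> UNIV \<times> {..<r}. mdeg (fst e) \<le> i}"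
    then have "gx e \<in> sact V E (a * mdeg (fst e) + b)" unfolding gx_def by (intro gx) auto
    moreover have "a * mdeg (fst e) + b \<le> a * i + b" using e by simp
    ultimately show "gx e \<in> sact V E (a * i + b)" using sact_mono by blast
  qed
  then show ?thesis by blast
qed

abbreviation "kdim \<equiv> vdim (range \<kappa>) B N"

lemma FN_finite: "FN i = kspan (gx ` {e \<in> UNIV \<times> {..<r}. mdeg (fst e) \<le> i})"
  "finite (gx ` {e \<in> UNIV \<times> {..<r}. mdeg (fst e) \<le> i})" "gx ` {e \<in> UNIV \<times> {..<r}. mdeg (fst e) \<le> i} \<subseteq> carrier N"
proof -
  show "finite (gx ` {e \<in> UNIV \<times> {..<r}. mdeg (fst e) \<le> i})"
    by (rule finite_imageI[OF finite_mdeg_le_pairs])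
qed (auto simp: FN_def)

lemma frame_growth:
  assumes "growth (\<lambda>i. kdim (FN i)) d" shows "growth (\<lambda>i. kdim (sact V E i)) d"
proof -
  obtain a b where ab: "\<And>i. sact V E i \<subseteq> FN (a * i + b)" using frame_upper by blast
  obtain a' b' where ab': "\<And>i. FN i \<subseteq> sact V E (a' * i + b')" using frame_lower by blast
  show ?thesis
  proof (rule growth_transfer[OF assms])
    fix i
    show "kdim (sact V E i) \<le> kdim (FN (a * i + b))"
      by (rule vdim_mono[OF sact_sub FN_sub ab _ FN_finite(2)[of "a * i + b"] FN_finite(3)[of "a * i + b"]]) (simp add: FN_def)
    show "kdim (FN i) \<le> kdim (sact V E (a' * i + b'))"
      by (rule vdim_mono[OF FN_sub sact_sub ab' _ FN_finite(2)[of "a * (a' * i + b') + b"] FN_finite(3)[of "a * (a' * i + b') + b"]])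
         (use ab[of "a' * i + b'"] in \<open>simp add: FN_def\<close>)
  qed
qed

end

lemma scal_one_B: "reg.scal c \<one>\<^bsub>B\<^esub> = \<kappa> c"
  by (simp add: reg.scal_def k_closed)

lemma standard_alg_frame: "alg_frame (range \<kappa>) B (FB 1)"
  unfolding alg_frame_def
proof (intro conjI)
  show "fin_dim_subspace (range \<kappa>) (regular_module B) (FB 1)"
    unfolding fin_dim_subspace_def FB_def
    by (intro exI[of _ "u ` {c. mdeg c \<le> 1}"]) (auto simp: u_closed finite_mdeg_le)
  show K: "range \<kappa> \<subseteq> FB 1"
  proof clarify
    fix c
    have "u 0 \<in> FB 1" by (rule u_in_FB) simp
    then have "reg.scal c \<one>\<^bsub>B\<^esub> \<in> FB 1" using FB_sub unfolding reg.ksub_def u_zero by blast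
    then show "\<kappa> c \<in> FB 1" by (simp add: scal_one_B)
  qed
  show "generate_ring B (FB 1) = carrier B"
  proof
    show "generate_ring B (FB 1) \<subseteq> carrier B" using R.generate_ring_in_carrier[OF FB_carrier] by (rule subsetI)
    have u: "u a \<in> generate_ring B (FB 1)" for a
    proof (induction "mdeg a" arbitrary: a)
      case 0
      then have "a = 0" by (metis mdeg_eq_0)
      then show ?case by (simp add: u_zero generate_ring.one)
    next
      case (Suc n)
      then have "a \<noteq> 0" by auto
      from u_peel[OF this] obtain v d where cd: "a = single v 1 + d"
        "u a = u (single v 1) \<otimes>\<^bsub>B\<^esub> u d" by (elim exE conjE)
      have "n = mdeg d" using Suc.hyps(2) unfolding cd(1) by simp
      then show ?case unfolding cd(2)
        by (intro generate_ring.eng_mult generate_ring.incl u_in_FB Suc.hyps) simp_all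
    qed
    have "reg.ksub (generate_ring B (FB 1))"
      unfolding reg.ksub_def
    proof (intro conjI ballI allI)
      show "generate_ring B (FB 1) \<subseteq> carrier (regular_module B)" using R.generate_ring_in_carrier[OF FB_carrier] by auto
      have "\<kappa> 0 \<in> generate_ring B (FB 1)" using K by (intro generate_ring.incl) auto
      then show "\<zero>\<^bsub>regular_module B\<^esub> \<in> generate_ring B (FB 1)" using k_zero_iff[of 0] by simp
    next
      fix x y assume "x \<in> generate_ring B (FB 1)" "y \<in> generate_ring B (FB 1)"
      then show "x \<oplus>\<^bsub>regular_module B\<^esub> y \<in> generate_ring B (FB 1)" by (simp add: generate_ring.eng_add)
    next
      fix c x assume "x \<in> generate_ring B (FB 1)"
      moreover have "\<kappa> c \<in> generate_ring B (FB 1)" using K by (intro generate_ring.incl) auto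
      ultimately show "reg.scal c x \<in> generate_ring B (FB 1)" by (simp add: reg.scal_def generate_ring.eng_mult)
    qed
    then have "reg.kspan (range u) \<subseteq> generate_ring B (FB 1)" by (rule reg.kspan_minimal) (use u in auto)
    then show "carrier B \<subseteq> generate_ring B (FB 1)" using u_span by simp
  qed
qed

lemma standard_mod_frame: "mod_frame (range \<kappa>) B N (FN 0)"
  unfolding mod_frame_def
proof (intro conjI)
  show "fin_dim_subspace (range \<kappa>) N (FN 0)"
    unfolding fin_dim_subspace_def FN_def
    by (intro exI[of _ "gx ` {e \<in> UNIV \<times> {..<r}. mdeg (fst e) \<le> 0}"] conjI finite_imageI finite_mdeg_le_pairs) auto
  have S: "FN 0 \<subseteq> carrier N" by (rule FN_carrier)
  let ?L = "lin_span (carrier B) N (FN 0)"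
  have L_in: "?L \<subseteq> carrier N"
    unfolding lin_span_def using S by (auto intro!: M.finsum_closed smult_closed)
  have L_sub: "ksub ?L"
    unfolding ksub_def
  proof (intro conjI ballI allI L_in)
    show "\<zero>\<^bsub>N\<^esub> \<in> ?L" unfolding lin_span_def by (auto intro!: exI[of _ "{}"])
  next
    fix y z assume "y \<in> ?L" "z \<in> ?L"
    then obtain T c R d where T: "finite T" "T \<subseteq> FN 0" "c \<in> T \<rightarrow> carrier B" "y = (\<Oplus>\<^bsub>N\<^esub>s\<in>T. c s \<odot>\<^bsub>N\<^esub> s)"
      and R: "finite R" "R \<subseteq> FN 0" "d \<in> R \<rightarrow> carrier B" "z = (\<Oplus>\<^bsub>N\<^esub>s\<in>R. d s \<odot>\<^bsub>N\<^esub> s)" unfolding lin_span_def by blast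
    let ?c = "\<lambda>s. if s \<in> T then c s else \<zero>\<^bsub>B\<^esub>" and ?d = "\<lambda>s. if s \<in> R then d s else \<zero>\<^bsub>B\<^esub>"
    have y: "y = (\<Oplus>\<^bsub>N\<^esub>s\<in>T \<union> R. ?c s \<odot>\<^bsub>N\<^esub> s)"
      unfolding T(4) by (rule M.add.finprod_mono_neutral_cong_left)
        (use T R S in \<open>auto simp: smult_zero_left Pi_def intro!: smult_closed\<close>)
    have z: "z = (\<Oplus>\<^bsub>N\<^esub>s\<in>T \<union> R. ?d s \<odot>\<^bsub>N\<^esub> s)"
      unfolding R(4) by (rule M.add.finprod_mono_neutral_cong_left)
        (use T R S in \<open>auto simp: smult_zero_left Pi_def intro!: smult_closed\<close>)
    have cl: "s \<in> carrier N \<and> ?c s \<in> carrier B \<and> ?d s \<in> carrier B" if "s \<in> T \<union> R" for s using that T R S by auto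
    have "y \<oplus>\<^bsub>N\<^esub> z = (\<Oplus>\<^bsub>N\<^esub>s\<in>T \<union> R. ?c s \<odot>\<^bsub>N\<^esub> s \<oplus>\<^bsub>N\<^esub> ?d s \<odot>\<^bsub>N\<^esub> s)"
      unfolding y z by (rule M.finsum_addf[symmetric]) (use cl in \<open>auto intro!: smult_closed simp del: split_paired_All\<close>)
    also have "\<dots> = (\<Oplus>\<^bsub>N\<^esub>s\<in>T \<union> R. (?c s \<oplus>\<^bsub>B\<^esub> ?d s) \<odot>\<^bsub>N\<^esub> s)"
    proof (rule M.add.finprod_cong')
      fix s assume "s \<in> T \<union> R"
      from cl[OF this] show "?c s \<odot>\<^bsub>N\<^esub> s \<oplus>\<^bsub>N\<^esub> ?d s \<odot>\<^bsub>N\<^esub> s = (?c s \<oplus>\<^bsub>B\<^esub> ?d s) \<odot>\<^bsub>N\<^esub> s"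
        by (intro smult_l_distr[symmetric]) blast+
    next
      show "(\<lambda>s. (?c s \<oplus>\<^bsub>B\<^esub> ?d s) \<odot>\<^bsub>N\<^esub> s) \<in> T \<union> R \<rightarrow> carrier N" using cl by (auto intro!: smult_closed)
    qed simp
    finally have eq: "y \<oplus>\<^bsub>N\<^esub> z = (\<Oplus>\<^bsub>N\<^esub>s\<in>T \<union> R. (?c s \<oplus>\<^bsub>B\<^esub> ?d s) \<odot>\<^bsub>N\<^esub> s)" .
    have coeff: "(\<lambda>s. ?c s \<oplus>\<^bsub>B\<^esub> ?d s) \<in> T \<union> R \<rightarrow> carrier B" using cl by blast
    show "y \<oplus>\<^bsub>N\<^esub> z \<in> ?L" unfolding lin_span_def
      by (intro CollectI exI[of _ "T \<union> R"] exI[of _ "\<lambda>s. ?c s \<oplus>\<^bsub>B\<^esub> ?d s"] conjI eq coeff) (use T R in auto)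
  next
    fix e y assume "y \<in> ?L"
    then obtain T c where T: "finite T" "T \<subseteq> FN 0" "c \<in> T \<rightarrow> carrier B" "y = (\<Oplus>\<^bsub>N\<^esub>s\<in>T. c s \<odot>\<^bsub>N\<^esub> s)"
      unfolding lin_span_def by blast
    have cl: "s \<in> carrier N \<and> c s \<in> carrier B" if "s \<in> T" for s using that T S by auto
    have "scal e y = (\<Oplus>\<^bsub>N\<^esub>s\<in>T. scal e (c s \<odot>\<^bsub>N\<^esub> s))"
      unfolding T(4) by (rule scal_finsum) (use cl in \<open>auto intro!: smult_closed\<close>)
    also have "\<dots> = (\<Oplus>\<^bsub>N\<^esub>s\<in>T. (\<kappa> e \<otimes>\<^bsub>B\<^esub> c s) \<odot>\<^bsub>N\<^esub> s)"
      by (rule M.add.finprod_cong') (use cl in \<open>auto simp: scal_def smult_assoc k_closed intro!: smult_closed\<close>)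
    finally have eq: "scal e y = (\<Oplus>\<^bsub>N\<^esub>s\<in>T. (\<kappa> e \<otimes>\<^bsub>B\<^esub> c s) \<odot>\<^bsub>N\<^esub> s)" .
    show "scal e y \<in> ?L" unfolding lin_span_def
      by (intro CollectI exI[of _ T] exI[of _ "\<lambda>s. \<kappa> e \<otimes>\<^bsub>B\<^esub> c s"] conjI eq) (use T cl k_closed in auto)
  qed
  have "kspan (gx ` (UNIV \<times> {..<r})) \<subseteq> ?L"
  proof (rule kspan_minimal[OF L_sub], rule image_subsetI)
    fix e :: "('v \<Rightarrow>\<^sub>0 nat) \<times> nat" assume e: "e \<in> UNIV \<times> {..<r}"
    have "gx (0, snd e) \<in> FN 0" using e by (intro gx_in_FN) auto
    then have "m (snd e) \<in> FN 0" by (simp add: gx_def u_zero smult_one m_closed)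
    then show "gx e \<in> ?L"
      unfolding lin_span_def gx_def using u_closed m_closed
      by (intro CollectI exI[of _ "{m (snd e)}"] exI[of _ "\<lambda>_. u (fst e)"]) (auto simp: smult_closed)
  qed
  then show "?L = carrier N" using L_in m_gen by (auto simp: gx_def[abs_def])
qed

text \<open>
  Any two frames give filtrations that contain each other up to a linear change of index, so the growth exponent computed
  for one of them is the value for all; the arbitrary choice in the definition of the dimension is harmless.
\<close>
theorem GKdim_eq_growth:
  assumes "carrier N \<noteq> {\<zero>\<^bsub>N\<^esub>}" "growth (\<lambda>i. vdim (range \<kappa>) B N (FN i)) d"
  shows "GKdim (range \<kappa>) B N = ereal (real d)"
proof -
  have lim: "limsup (\<lambda>i. ereal (log (real i) (real (vdim (range \<kappa>) B N (sact V E i))))) = ereal (real d)"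
    if "alg_frame (range \<kappa>) B V" "mod_frame (range \<kappa>) B N E" for V E
    by (rule limsup_log_growth[OF frame_growth[OF that assms(2)]])
  have "(SOME d. \<exists>V E. alg_frame (range \<kappa>) B V \<and> mod_frame (range \<kappa>) B N E \<and>
    d = limsup (\<lambda>i. ereal (log (real i) (real (vdim (range \<kappa>) B N (sact V E i)))))) = ereal (real d)"
  proof (rule some_equality)
    show "\<exists>V E. alg_frame (range \<kappa>) B V \<and> mod_frame (range \<kappa>) B N E \<and>
      ereal (real d) = limsup (\<lambda>i. ereal (log (real i) (real (vdim (range \<kappa>) B N (sact V E i)))))"
      by (rule exI[of _ "FB 1"], rule exI[of _ "FN 0"], intro conjI standard_alg_frame standard_mod_frame)
         (rule lim[OF standard_alg_frame standard_mod_frame, symmetric])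
  next
    fix d' assume "\<exists>V E. alg_frame (range \<kappa>) B V \<and> mod_frame (range \<kappa>) B N E \<and>
      d' = limsup (\<lambda>i. ereal (log (real i) (real (vdim (range \<kappa>) B N (sact V E i)))))"
    then obtain V E where "alg_frame (range \<kappa>) B V" "mod_frame (range \<kappa>) B N E"
      "d' = limsup (\<lambda>i. ereal (log (real i) (real (vdim (range \<kappa>) B N (sact V E i)))))" by (elim exE conjE)
    then show "d' = ereal (real d)" by (simp only: lim)
  qed
  then show ?thesis using assms(1) by (simp add: GKdim_def)
qed

end

section \<open>Normal ordering in the Weyl algebra\<close>

lemma pscale_sc: "pscale c p = sc c p"
  by (simp add: pscale_def pconst_times)

lemma pderiv_at_superset:
  assumes "finite A" "keys p \<subseteq> A"
  shows "pderiv_at i p = (\<Sum>a\<in>A. single (a - single i 1)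
       (of_nat (lookup a i) * lookup p a))"
  unfolding pderiv_at_def by (rule sum.mono_neutral_left) (use assms in \<open>auto simp: in_keys_iff\<close>)

lemma pderiv_at_add: "pderiv_at i (p + q) = pderiv_at i p + pderiv_at i q"
proof -
  let ?A = "keys p \<union> keys q"
  have "finite ?A" "keys (p + q) \<subseteq> ?A" "keys p \<subseteq> ?A" "keys q \<subseteq> ?A"
    using keys_add[of p q] by auto
  then show ?thesis
    by (simp add: pderiv_at_superset[of ?A] lookup_add distrib_left single_add sum.distrib)
qed

lemma pderiv_at_sc: "pderiv_at i (sc c p) = sc c (pderiv_at i p)"
proof -
  have "pderiv_at i (sc c p) = (\<Sum>a\<in>keys p. sc c (single (a - single i 1)
       (of_nat (lookup a i) * lookup p a)))"
    by (subst pderiv_at_superset[OF finite_keys keys_sc]) (simp add: mult_ac)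
  then show ?thesis unfolding pderiv_at_def by (simp only: pm.scale_sum_right)
qed

lemma pderiv_at_single:
  "pderiv_at i (single a c) = single (a - single i 1) (of_nat (lookup a i) * c)"
  by (subst pderiv_at_superset[of "{a}"]) auto

lemma additive_eqI:
  fixes f g :: "('v, 'k::field) mpol \<Rightarrow> ('w, 'k) mpol"
  assumes "\<And>p q. f (p + q) = f p + f q" "\<And>p q. g (p + q) = g p + g q"
    and "\<And>a c. f (single a c) = g (single a c)"
  shows "f p = g p"
proof -
  have z: "f 0 = 0" "g 0 = 0" using assms(1)[of 0 0] assms(2)[of 0 0] by simp_all
  have "f (\<Sum>a\<in>A. h a) = g (\<Sum>a\<in>A. h a)" if "\<And>a. f (h a) = g (h a)" for A :: "('v \<Rightarrow>\<^sub>0 nat) set" and h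
    by (induction A rule: infinite_finite_induct) (simp_all add: z assms(1,2) that)
  from this[of "\<lambda>a. single a (lookup p a)" "keys p"] assms(3)
  show ?thesis by (simp flip: pm_keys_expand)
qed

lemma single_minus_plus:
  fixes a :: "'v \<Rightarrow>\<^sub>0 nat"
  assumes "0 < lookup b i"
  shows "a + b - single i 1 = a + (b - single i 1)"
  by (rule poly_mapping_eqI) (use assms in \<open>auto simp: lookup_add lookup_minus lookup_single when_def\<close>)

lemma pderiv_at_times_monomial:
  fixes p :: "('n, 'k::field_char_0) polX"
  shows "pderiv_at i (mon l * p) = mon l * pderiv_at i p +
     single (l - single i 1) (of_nat (lookup l i)) * p"
proof (rule additive_eqI[of "\<lambda>p. pderiv_at i (mon l * p)"])
  fix a :: "'n \<Rightarrow>\<^sub>0 nat" and c :: 'k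
  let ?e = "single i (1::nat)"
  have 1: "single (l + a - ?e) (of_nat (lookup a i) * c) =
      single (l + (a - ?e)) (of_nat (lookup a i) * c)"
    by (cases "lookup a i = 0") (simp_all add: single_minus_plus[unfolded One_nat_def])
  have 2: "single (l + a - ?e) (of_nat (lookup l i) * c) =
      single (l - ?e + a) (of_nat (lookup l i) * c)"
    by (cases "lookup l i = 0") (simp_all add: single_minus_plus[unfolded One_nat_def] add.commute[of _ a])
  have "pderiv_at i (mon l * single a c) =
    single (l + a - ?e) (of_nat (lookup a i) * c) +
    single (l + a - ?e) (of_nat (lookup l i) * c)"
    by (simp add: mult_single pderiv_at_single lookup_add distrib_right single_add add.commute)
  also have "\<dots> = mon l * pderiv_at i (single a c) + single (l - ?e) (of_nat (lookup l i)) * single a c"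
    unfolding 1 2 by (simp add: mult_single pderiv_at_single)
  finally show "pderiv_at i (mon l * single a c) = mon l * pderiv_at i (single a c) + single (l - ?e) (of_nat (lookup l i)) * single a c" .
qed (simp_all add: distrib_left pderiv_at_add)

lemma pderiv_at_commute: "pderiv_at i (pderiv_at j p) = pderiv_at j (pderiv_at i p)"
proof (rule additive_eqI[of "\<lambda>p. pderiv_at i (pderiv_at j p)"])
  fix a :: "'a \<Rightarrow>\<^sub>0 nat" and c :: 'b
  have "a - single j 1 - single i 1 = a - single i 1 - single j (1::nat)"
    by (rule poly_mapping_eqI) (simp add: lookup_minus)
  then show "pderiv_at i (pderiv_at j (single a c)) = pderiv_at j (pderiv_at i (single a c))"
    by (cases "i = j") (simp_all add: pderiv_at_single lookup_minus lookup_single when_def mult_ac)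
qed (simp_all add: pderiv_at_add)

lemma funpow_commute:
  assumes "f \<circ> g = g \<circ> f" shows "(f ^^ a) \<circ> (g ^^ b) = (g ^^ b) \<circ> (f ^^ a)"
proof -
  have 1: "f \<circ> (g ^^ b) = (g ^^ b) \<circ> f" for b
  proof (induction b)
    case (Suc b)
    have "f \<circ> (g ^^ Suc b) = (f \<circ> g) \<circ> (g ^^ b)" by (simp add: comp_assoc)
    also have "\<dots> = g \<circ> (f \<circ> (g ^^ b))" unfolding assms by (simp add: comp_assoc)
    also have "\<dots> = (g ^^ Suc b) \<circ> f" unfolding Suc by (simp add: comp_assoc)
    finally show ?case .
  qed simp
  show ?thesis
  proof (induction a)
    case (Suc a)
    have "(f ^^ Suc a) \<circ> (g ^^ b) = f \<circ> ((f ^^ a) \<circ> (g ^^ b))" by (simp add: comp_assoc)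
    also have "\<dots> = (f \<circ> (g ^^ b)) \<circ> (f ^^ a)" unfolding Suc by (simp add: comp_assoc)
    also have "\<dots> = (g ^^ b) \<circ> (f ^^ Suc a)" unfolding 1 by (simp add: comp_assoc)
    finally show ?case .
  qed simp
qed

text \<open>
  Ordered products of powers of commuting maps, the form in which the normally ordered monomials are given.
\<close>
definition pows :: "('n::finite \<Rightarrow> 'a \<Rightarrow> 'a) \<Rightarrow> ('n \<Rightarrow> nat) \<Rightarrow> 'a \<Rightarrow> 'a" where
  "pows g e = Finite_Set.fold (\<lambda>i f. (g i ^^ e i) \<circ> f) id UNIV"

context
  fixes g :: "'n::finite \<Rightarrow> 'a \<Rightarrow> 'a"
  assumes comm: "\<And>i j. g i \<circ> g j = g j \<circ> g i"
begin

lemma pows_cfc: "comp_fun_commute (\<lambda>i f. (g i ^^ e i) \<circ> f)"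
proof
  fix i j
  show "((\<circ>) (g i ^^ e i)) \<circ> ((\<circ>) (g j ^^ e j)) = ((\<circ>) (g j ^^ e j)) \<circ> ((\<circ>) (g i ^^ e i))"
    using funpow_commute[OF comm[of i j], of "e i" "e j"] by (auto simp: fun_eq_iff)
qed

lemma pows_insert: "pows g e = (g i ^^ e i) \<circ> Finite_Set.fold (\<lambda>i f. (g i ^^ e i) \<circ> f) id (UNIV - {i})"
proof -
  interpret comp_fun_commute "\<lambda>i f. (g i ^^ e i) \<circ> f" by (rule pows_cfc)
  have "pows g e = Finite_Set.fold (\<lambda>i f. (g i ^^ e i) \<circ> f) id (insert i (UNIV - {i}))"
    unfolding pows_def by (simp add: insert_absorb)
  also have "\<dots> = (g i ^^ e i) \<circ> Finite_Set.fold (\<lambda>i f. (g i ^^ e i) \<circ> f) id (UNIV - {i})"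
    by (rule fold_insert) auto
  finally show ?thesis .
qed

lemma pows_Suc: "pows g (e(i := Suc (e i))) = g i \<circ> pows g e"
proof -
  have "Finite_Set.fold (\<lambda>j f. (g j ^^ (e(i := Suc (e i))) j) \<circ> f) id (UNIV - {i}) =
        Finite_Set.fold (\<lambda>j f. (g j ^^ e j) \<circ> f) id (UNIV - {i})"
  proof (rule fold_closed_eq[of _ UNIV])
  qed auto
  then show ?thesis
    unfolding pows_insert[of "e(i := Suc (e i))" i] pows_insert[of e i] by (simp add: comp_assoc)
qed

lemma pows_zero: "pows g (\<lambda>_. 0) = id"
proof -
  interpret comp_fun_commute "\<lambda>(i::'n) (f::'a \<Rightarrow> 'a). f" by unfold_locales auto
  have "Finite_Set.fold (\<lambda>i f. f) id A = (id :: 'a \<Rightarrow> 'a)" if "finite A" for A :: "'n set"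
    using that by (induction A rule: finite_induct) simp_all
  from this[of UNIV] show ?thesis by (simp add: pows_def)
qed

end

lemma exponent_induct [case_names zero Suc]:
  fixes e :: "'n::finite \<Rightarrow> nat"
  assumes "P (\<lambda>_. 0)" "\<And>e i. P e \<Longrightarrow> P (e(i := Suc (e i)))"
  shows "P e"
proof (induction "\<Sum>i\<in>UNIV. e i" arbitrary: e)
  case 0
  then have "e = (\<lambda>_. 0)" by auto
  then show ?case using assms(1) by simp
next
  case (Suc n)
  then obtain i where i: "e i \<noteq> 0" by fastforce
  define e' where "e' = e(i := e i - 1)"
  have e: "e = e'(i := Suc (e' i))" using i by (auto simp: e'_def)
  have "(\<Sum>j\<in>UNIV. e j) = Suc (\<Sum>j\<in>UNIV. e' j)"
    by (subst (1 2) sum.remove[of UNIV i]) (use i in \<open>auto simp: e'_def intro!: sum.cong\<close>)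
  then have "P e'" using Suc by (intro Suc.hyps(1)) simp
  then show ?case by (subst e) (rule assms(2))
qed

lemma mult_var_comm: "mult_var i \<circ> mult_var j = mult_var j \<circ> (mult_var i :: ('n, 'k::field_char_0) endo)"
  by (auto simp: mult_var_def fun_eq_iff mult.left_commute)

lemma pderiv_comm: "pderiv_at i \<circ> pderiv_at j = pderiv_at j \<circ> (pderiv_at i :: ('n, 'k::field_char_0) endo)"
  by (auto simp: fun_eq_iff pderiv_at_commute)

abbreviation Lpart :: "('n + 'n \<Rightarrow>\<^sub>0 nat) \<Rightarrow> 'n \<Rightarrow> nat" where "Lpart a \<equiv> (\<lambda>i. lookup a (Inl i))"
abbreviation Rpart :: "('n + 'n \<Rightarrow>\<^sub>0 nat) \<Rightarrow> 'n \<Rightarrow> nat" where "Rpart a \<equiv> (\<lambda>i. lookup a (Inr i))"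

lemma weyl_monom_pows: "weyl_monom a = pows mult_var (Lpart a) \<circ> pows pderiv_at (Rpart a)"
  unfolding weyl_monom_def pows_def by simp

lemma lookup_Abs [simp]: "lookup (Abs_poly_mapping (e :: 'n::finite \<Rightarrow> nat)) = e"
  by (rule lookup_Abs_poly_mapping) simp

lemma Abs_Suc: "Abs_poly_mapping (e(i := Suc (e i))) = single i 1 + Abs_poly_mapping (e :: 'n::finite \<Rightarrow> nat)"
  by (rule poly_mapping_eqI) (simp add: lookup_add lookup_single when_def)

lemma pows_mult_var: "pows mult_var e p = mon (Abs_poly_mapping e) * (p :: ('n::finite, 'k::field_char_0) polX)"
proof (induction e rule: exponent_induct)
  case zero
  have "Abs_poly_mapping (\<lambda>_::'n. 0::nat) = 0" by simp
  then show ?case by (simp add: pows_zero[where g = mult_var, OF mult_var_comm])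
next
  case (Suc e i)
  have "mon (single i 1) * mon (Abs_poly_mapping e) = (mon (Abs_poly_mapping (e(i := Suc (e i)))) :: ('n, 'k) polX)"
    by (simp add: mult_single Abs_Suc)
  then have "mon (single i 1) * (mon (Abs_poly_mapping e) * p) = mon (Abs_poly_mapping (e(i := Suc (e i)))) * p"
    by (simp only: mult.assoc[symmetric])
  moreover have "pows mult_var (e(i := Suc (e i))) p = mult_var i (pows mult_var e p)"
    by (simp only: pows_Suc[where g = mult_var, OF mult_var_comm] o_apply)
  moreover have "mult_var i q = mon (single i 1) * q" for q :: "('n, 'k) polX"
    by (simp only: mult_var_def pvar_def)
  ultimately show ?case by (simp only: Suc)
qed

lemma pows_pderiv_single:
  "\<exists>k. pows pderiv_at e (mon a) = single (a - Abs_poly_mapping e) (k :: 'k::field_char_0)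
     \<and> (k \<noteq> 0 \<longleftrightarrow> (\<forall>i::'n::finite. e i \<le> lookup a i))"
proof (induction e rule: exponent_induct)
  case zero
  have "Abs_poly_mapping (\<lambda>_::'n. 0::nat) = 0" by simp
  then show ?case by (intro exI[of _ 1]) (simp add: pows_zero[where g = pderiv_at, OF pderiv_comm])
next
  case (Suc e i)
  then obtain k :: 'k where "pows pderiv_at e (mon a) = single (a - Abs_poly_mapping e) k \<and>
    (k \<noteq> 0 \<longleftrightarrow> (\<forall>i. e i \<le> lookup a i))" by (rule exE)
  then have k: "pows pderiv_at e (mon a) = single (a - Abs_poly_mapping e) k"
    "k \<noteq> 0 \<longleftrightarrow> (\<forall>i. e i \<le> lookup a i)" by simp_all
  let ?k = "of_nat (lookup a i - e i) * k"
  have "pows pderiv_at (e(i := Suc (e i))) (mon a) = single (a - Abs_poly_mapping e - single i 1) ?k"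
    unfolding pows_Suc[where g = pderiv_at, OF pderiv_comm] by (simp add: k(1) pderiv_at_single lookup_minus)
  moreover have "a - Abs_poly_mapping e - single i 1 = a - Abs_poly_mapping (e(i := Suc (e i)))"
    unfolding Abs_Suc by (rule poly_mapping_eqI) (simp add: lookup_minus lookup_add)
  moreover have "?k \<noteq> 0 \<longleftrightarrow> (\<forall>j. (e(i := Suc (e i))) j \<le> lookup a j)"
  proof -
    have fwd: "e i < lookup a i \<and> (\<forall>j. e j \<le> lookup a j)"
      if H: "\<forall>j. (e(i := Suc (e i))) j \<le> lookup a j"
    proof
      show lt: "e i < lookup a i" using H[rule_format, of i] by simp
      show "\<forall>j. e j \<le> lookup a j"
      proof
        fix j show "e j \<le> lookup a j" using H[rule_format, of j] lt by (cases "j = i") auto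
      qed
    qed
    have "(\<forall>j. (e(i := Suc (e i))) j \<le> lookup a j) \<longleftrightarrow>
      e i < lookup a i \<and> (\<forall>j. e j \<le> lookup a j)"
      by (rule iffI[OF fwd]) (assumption, simp add: Suc_le_eq)
    then show ?thesis unfolding k(2)[symmetric] by (simp add: not_le)
  qed
  ultimately show ?case by metis
qed

lemma pows_pderiv_add: "pows pderiv_at e (p + q) = pows pderiv_at e p + (pows pderiv_at e q :: ('n::finite, 'k::field_char_0) polX)"
  by (induction e arbitrary: p q rule: exponent_induct)
     (simp_all add: pows_zero[where g = pderiv_at, OF pderiv_comm] pows_Suc[where g = pderiv_at, OF pderiv_comm] pderiv_at_add)

lemma pows_pderiv_sc: "pows pderiv_at e (sc c p) = sc c (pows pderiv_at e p :: ('n::finite, 'k::field_char_0) polX)"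
  by (induction e arbitrary: p rule: exponent_induct)
     (simp_all add: pows_zero[where g = pderiv_at, OF pderiv_comm] pows_Suc[where g = pderiv_at, OF pderiv_comm] pderiv_at_sc)

lemma weyl_monom_add: "weyl_monom a (p + q) = weyl_monom a p + weyl_monom a q"
  by (simp add: weyl_monom_pows pows_mult_var pows_pderiv_add distrib_left)

lemma weyl_monom_sc: "weyl_monom a (sc c p) = sc c (weyl_monom a p)"
  by (simp add: weyl_monom_pows pows_mult_var pows_pderiv_sc sc_mult_left)

text \<open>
  The operator with a given normally ordered symbol. All computations in the Weyl algebra are done on symbols.
\<close>
definition symb :: "('n::finite, 'k::field_char_0) polXY \<Rightarrow> ('n, 'k) endo" where
  "symb c = (\<lambda>p. \<Sum>\<alpha>\<in>keys c. pscale (lookup c \<alpha>) (weyl_monom \<alpha> p))"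

lemma symb_superset:
  assumes "finite A" "keys c \<subseteq> A"
  shows "symb c p = (\<Sum>\<alpha>\<in>A. sc (lookup c \<alpha>) (weyl_monom \<alpha> p))"
  unfolding symb_def pscale_sc by (rule sum.mono_neutral_left) (use assms in \<open>auto simp: in_keys_iff\<close>)

lemma symb_add: "symb (c + d) p = symb c p + symb d p"
proof -
  let ?A = "keys c \<union> keys d"
  have "finite ?A" "keys (c + d) \<subseteq> ?A" "keys c \<subseteq> ?A" "keys d \<subseteq> ?A"
    using keys_add[of c d] by auto
  then show ?thesis
    by (simp add: symb_superset[of ?A] lookup_add pm.scale_left_distrib sum.distrib)
qed

lemma symb_zero [simp]: "symb 0 p = 0" by (simp add: symb_def)

lemma symb_sc: "symb (sc k c) p = sc k (symb c p)"
  by (subst symb_superset[OF finite_keys keys_sc], subst symb_superset[OF finite_keys order_refl])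
     (simp add: pm.scale_sum_right)

lemma symb_single: "symb (single a k) p = sc k (weyl_monom a p)"
  by (subst symb_superset[of "{a}"]) auto

lemma symb_mon [simp]: "symb (mon a) = weyl_monom a"
  by (rule ext) (simp add: symb_single)

lemma symb_one [simp]: "symb (1 :: ('n::finite, 'k::field_char_0) polXY) = id"
proof -
  have "(weyl_monom 0 :: ('n, 'k) endo) = id"
    by (simp add: weyl_monom_pows pows_zero[where g = mult_var, OF mult_var_comm] pows_zero[where g = pderiv_at, OF pderiv_comm])
  moreover have "symb (mon 0 :: ('n, 'k) polXY) = weyl_monom 0" by (rule symb_mon)
  ultimately show ?thesis by simp
qed

lemma symb_sum: "symb (\<Sum>x\<in>A. f x) p = (\<Sum>x\<in>A. symb (f x) p)"
  by (induction A rule: infinite_finite_induct) (simp_all add: symb_add)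

lemma symb_linear_add: "symb c (p + q) = symb c p + symb c q"
  by (simp add: symb_superset[OF finite_keys order_refl] weyl_monom_add pm.scale_right_distrib sum.distrib)

lemma symb_linear_sc: "symb c (sc k p) = sc k (symb c p)"
  by (simp add: symb_superset[OF finite_keys order_refl] weyl_monom_sc pm.scale_sum_right mult.commute)

lemma symb_linear_zero: "symb c 0 = 0"
  using symb_linear_sc[of c 0 0] by simp

lemma symb_linear_sum: "symb c (\<Sum>x\<in>A. f x) = (\<Sum>x\<in>A. symb c (f x))"
  by (induction A rule: infinite_finite_induct) (simp_all add: symb_linear_add symb_linear_zero)

text \<open>
  Apply the operator to \<open>X\<^sup>\<mu>\<close> for an exponent \<open>(\<lambda>|\<mu>)\<close> of the symbol with
  \<open>\<mu>\<close> of least total degree: the derivatives of the other orders kill it, and in characteristic zero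
  \<open>\<partial>\<^sup>\<mu>\<close> turns it into a nonzero constant.
\<close>
lemma symb_eq_0:
  fixes c :: "('n::finite, 'k::field_char_0) polXY"
  assumes "symb c = (\<lambda>p. 0)" shows "c = 0"
proof (rule ccontr)
  assume "c \<noteq> 0"
  then obtain a1 where "a1 \<in> keys c" by (metis keys_eq_empty ex_in_conv)
  let ?f = "\<lambda>a :: 'n + 'n \<Rightarrow>\<^sub>0 nat. \<Sum>i\<in>UNIV. Rpart a i"
  from ex_has_least_nat[of "\<lambda>a. a \<in> keys c" a1 ?f, OF \<open>a1 \<in> _\<close>]
  obtain a0 where "a0 \<in> keys c \<and> (\<forall>a. a \<in> keys c \<longrightarrow> ?f a0 \<le> ?f a)" by (rule exE)
  then have a0: "a0 \<in> keys c" and min: "\<And>a. a \<in> keys c \<Longrightarrow> ?f a0 \<le> ?f a" by simp_all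
  define x :: "'n \<Rightarrow>\<^sub>0 nat" where "x = Abs_poly_mapping (Rpart a0)"
  define K where "K = {a \<in> keys c. Rpart a = Rpart a0}"
  obtain k :: 'k where k: "pows pderiv_at (Rpart a0) (mon x) = single (x - Abs_poly_mapping (Rpart a0)) k"
    "k \<noteq> 0 \<longleftrightarrow> (\<forall>i. Rpart a0 i \<le> lookup x i)"
    using pows_pderiv_single[of "Rpart a0" x] by blast
  have k0: "k \<noteq> 0" using k(2) by (simp add: x_def)
  have other: "weyl_monom a (mon x) = (0 :: ('n, 'k) polX)" if a: "a \<in> keys c" "a \<notin> K" for a
  proof -
    obtain l :: 'k where l: "pows pderiv_at (Rpart a) (mon x) = single (x - Abs_poly_mapping (Rpart a)) l"
      "l \<noteq> 0 \<longleftrightarrow> (\<forall>i. Rpart a i \<le> lookup x i)"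
      using pows_pderiv_single[of "Rpart a" x] by blast
    have "l = 0"
    proof (rule ccontr)
      assume "l \<noteq> 0"
      then have le: "Rpart a i \<le> Rpart a0 i" for i using l(2) by (simp add: x_def)
      have "Rpart a i = Rpart a0 i" for i
      proof (rule ccontr)
        assume "Rpart a i \<noteq> Rpart a0 i"
        then have "?f a < ?f a0" by (intro sum_strict_mono_ex1) (use le in \<open>auto intro!: bexI[of _ i] simp: order.strict_iff_order\<close>)
        then show False using min[OF a(1)] by simp
      qed
      then show False using a by (auto simp: K_def)
    qed
    then show ?thesis using l(1) by (simp add: weyl_monom_pows symb_linear_zero pows_mult_var)
  qed
  have same: "weyl_monom a (mon x) = single (Abs_poly_mapping (Lpart a)) k" if a: "a \<in> K" for a
  proof -
    have R: "Rpart a = Rpart a0" using a by (simp add: K_def)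
    show ?thesis unfolding weyl_monom_pows R using k(1) by (simp add: x_def pows_mult_var mult_single)
  qed
  have "0 = symb c (mon x)" by (simp add: assms)
  also have "\<dots> = (\<Sum>a\<in>keys c. sc (lookup c a) (weyl_monom a (mon x)))"
    by (simp add: symb_superset[OF finite_keys order_refl])
  also have "\<dots> = (\<Sum>a\<in>K. sc (lookup c a) (weyl_monom a (mon x)))"
    by (rule sum.mono_neutral_right) (auto simp: K_def other)
  also have "\<dots> = (\<Sum>a\<in>K. single (Abs_poly_mapping (Lpart a)) (lookup c a * k))"
    by (intro sum.cong refl) (simp add: same)
  finally have "lookup (\<Sum>a\<in>K. single (Abs_poly_mapping (Lpart a)) (lookup c a * k)) (Abs_poly_mapping (Lpart a0)) = 0"
    by simp
  moreover have "(Abs_poly_mapping (Lpart a) = Abs_poly_mapping (Lpart a0)) = (a = a0)" if a: "a \<in> K" for a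
  proof
    assume "Abs_poly_mapping (Lpart a) = Abs_poly_mapping (Lpart a0)"
    then have "Lpart a = Lpart a0" by (metis lookup_Abs)
    moreover have "Rpart a = Rpart a0" using a by (simp add: K_def)
    ultimately show "a = a0"
      by (intro poly_mapping_eqI) (metis obj_sumE)
  qed simp
  then have "lookup (\<Sum>a\<in>K. single (Abs_poly_mapping (Lpart a)) (lookup c a * k)) (Abs_poly_mapping (Lpart a0))
    = (\<Sum>a\<in>K. if a = a0 then lookup c a * k else 0)"
    unfolding lookup_sum by (intro sum.cong) (auto simp: lookup_single when_def)
  moreover have "\<dots> = lookup c a0 * k" using a0 by (simp add: sum.delta' K_def)
  ultimately show False using a0 k0 by (simp add: in_keys_iff)
qed

lemma symb_inj: "symb c = symb d \<longleftrightarrow> c = d"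
proof
  assume eq: "symb c = symb d"
  have "symb (c - d) p = 0" for p using symb_add[of "c - d" d p] eq by simp
  then have "c - d = 0" by (intro symb_eq_0 ext)
  then show "c = d" by simp
qed simp

lemma weyl_coeffs_symb: "weyl_coeffs (symb c) = c"
  unfolding weyl_coeffs_def symb_def[symmetric] by (rule the_equality) (simp_all add: symb_inj)

lemma weyl_supp_symb: "weyl_supp (symb c) = keys c"
  by (auto simp: weyl_supp_def weyl_coeffs_symb in_keys_iff)

subsection \<open>Products of normally ordered monomials\<close>

text \<open>
  Normal ordering replaces pairs \<open>\<partial>\<^sub>i \<xi>\<^sub>i\<close> by
  \<open>\<xi>\<^sub>i \<partial>\<^sub>i + 1\<close>. The extra terms of a product therefore lose equally many factors
  \<open>\<xi>\<^sub>i\<close> and \<open>\<partial>\<^sub>i\<close>, at least one pair altogether.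
\<close>
definition below :: "('n + 'n \<Rightarrow>\<^sub>0 nat) \<Rightarrow> ('n + 'n \<Rightarrow>\<^sub>0 nat) \<Rightarrow> bool" where
  "below c a \<longleftrightarrow> (\<exists>d. d \<noteq> 0 \<and> a = c + d \<and> (\<forall>i. lookup d (Inl i) = lookup d (Inr i)))"

lemma below_trans: assumes "below c b" "below b a" shows "below c a"
proof -
  obtain d where d: "d \<noteq> 0" "b = c + d" "\<forall>i. lookup d (Inl i) = lookup d (Inr i)"
    using assms(1) unfolding below_def by blast
  obtain e where e: "e \<noteq> 0" "a = b + e" "\<forall>i. lookup e (Inl i) = lookup e (Inr i)"
    using assms(2) unfolding below_def by blast
  have "d + e \<noteq> 0"
  proof
    assume "d + e = 0"
    then have "lookup (d + e) v = 0" for v by simp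
    then have "d = 0" by (intro poly_mapping_eqI) (simp add: lookup_add)
    then show False using d by simp
  qed
  then show ?thesis unfolding below_def using d e
    by (intro exI[of _ "d + e"]) (simp add: lookup_add add.assoc)
qed

lemma below_add: "below c a \<Longrightarrow> below (b + c) (b + a)"
  unfolding below_def by (metis add.assoc)

lemma below_wdeg_le: "below c a \<Longrightarrow> wdeg w c \<le> wdeg w a"
  unfolding below_def by auto

text \<open>
  The weight of a lost pair \<open>\<xi>\<^sub>i, \<partial>\<^sub>i\<close> is positive exactly because
  \<open>\<omega>\<close> lies in \<open>\<Omega>\<close>.
\<close>
lemma below_wdeg_less:
  fixes w :: "'n::finite + 'n \<Rightarrow> nat"
  assumes "below c a" and w: "\<And>i. w (Inl i) + w (Inr i) > 0" shows "wdeg w c < wdeg w a"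
proof -
  obtain d where d: "d \<noteq> 0" "a = c + d" "\<forall>i. lookup d (Inl i) = lookup d (Inr i)"
    using assms(1) unfolding below_def by blast
  obtain v where v: "lookup d v \<noteq> 0" using d(1) by (auto simp: poly_mapping_eq_iff fun_eq_iff)
  obtain i where i: "lookup d (Inl i) \<noteq> 0" "lookup d (Inr i) \<noteq> 0"
    using v d(3) by (cases v) auto
  have "wdeg w d \<noteq> 0"
  proof
    assume "wdeg w d = 0"
    then have "\<forall>v. w v * lookup d v = 0" by (simp add: wdeg_def)
    then have "w (Inl i) = 0" "w (Inr i) = 0" using i by (metis mult_eq_0_iff)+
    then show False using w[of i] by simp
  qed
  then show ?thesis using d(2) by simp
qed

text \<open>
  The commutator term in
  \<open>\<partial>\<^sub>i \<xi>\<^sup>\<lambda> \<partial>\<^sup>\<mu> = \<xi>\<^sup>\<lambda> \<partial>\<^sub>i \<partial>\<^sup>\<mu> + \<lambda>\<^sub>i \<xi>\<^sup>\<lambda>\<^sup>-\<^sup>e \<partial>\<^sup>\<mu>\<close>,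
  where \<open>e\<close> is the \<open>i\<close>-th unit vector.
\<close>
definition extra :: "'n + 'n \<Rightarrow> ('n + 'n \<Rightarrow>\<^sub>0 nat) \<Rightarrow> ('n::finite, 'k::field_char_0) polXY" where
  "extra v b = (case v of Inl i \<Rightarrow> 0 | Inr i \<Rightarrow>
     single (b - single (Inl i) 1) (of_nat (lookup b (Inl i))))"

lemma extra_below:
  assumes "c \<in> keys (extra v b :: ('n::finite, 'k::field_char_0) polXY)"
  shows "below c (single v 1 + b)"
proof (cases v)
  case (Inl i) then show ?thesis using assms by (simp add: extra_def)
next
  case (Inr i)
  let ?d = "single (Inl i) 1 + single (Inr i) (1::nat)"
  have c: "c = b - single (Inl i) 1" "lookup b (Inl i) \<noteq> 0"
    using assms by (auto simp: extra_def Inr split: if_splits)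
  have "single v 1 + b = c + ?d"
    unfolding Inr c(1) using c(2)
    by (intro poly_mapping_eqI) (auto simp: lookup_add lookup_minus lookup_single when_def)
  moreover have "lookup ?d (Inl i) = 1" by (simp add: lookup_add lookup_single)
  then have "?d \<noteq> 0" by (metis lookup_zero zero_neq_one)
  moreover have "\<forall>j. lookup ?d (Inl j) = lookup ?d (Inr j)"
    by (auto simp: lookup_add lookup_single when_def)
  ultimately show ?thesis unfolding below_def by blast
qed

lemma Lpart_add_Inl: "Lpart (single (Inl i) 1 + b) = (Lpart b)(i := Suc (Lpart b i))"
  "Rpart (single (Inl i) 1 + b) = Rpart b"
  by (auto simp: fun_eq_iff lookup_add lookup_single when_def)

lemma Lpart_add_Inr: "Rpart (single (Inr i) 1 + b) = (Rpart b)(i := Suc (Rpart b i))"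
  "Lpart (single (Inr i) 1 + b) = Lpart b"
  by (auto simp: fun_eq_iff lookup_add lookup_single when_def)

lemma weyl_monom_Inl: "weyl_monom (single (Inl i) 1 + b) = weyl_gen (Inl i) \<circ> weyl_monom b"
  unfolding weyl_monom_pows Lpart_add_Inl pows_Suc[where g = mult_var and e = "Lpart b" and i = i, OF mult_var_comm]
  by (simp add: comp_assoc)

lemma weyl_monom_Inr:
  assumes "Lpart b = (\<lambda>_. 0)"
  shows "weyl_monom (single (Inr i) 1 + b) = weyl_gen (Inr i) \<circ> weyl_monom b"
  unfolding weyl_monom_pows Lpart_add_Inr pows_Suc[where g = pderiv_at and e = "Rpart b" and i = i, OF pderiv_comm]
    assms pows_zero[where g = mult_var, OF mult_var_comm] by simp

lemma weyl_monom_zero: "weyl_monom 0 = id"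
  by (simp add: weyl_monom_pows pows_zero[where g = mult_var, OF mult_var_comm] pows_zero[where g = pderiv_at, OF pderiv_comm])

lemma weyl_monom_single: "weyl_monom (single v 1) = weyl_gen v"
proof (cases v)
  case (Inl i) show ?thesis using weyl_monom_Inl[of i 0] by (simp add: Inl weyl_monom_zero)
next
  case (Inr i) show ?thesis using weyl_monom_Inr[of 0 i] by (simp add: Inr weyl_monom_zero)
qed

lemma weyl_monom_peel:
  assumes "a \<noteq> 0"
  shows "\<exists>v b. a = single v 1 + b \<and> weyl_monom a = weyl_gen v \<circ> weyl_monom b"
proof (cases "Lpart a = (\<lambda>_. 0)")
  case False
  then obtain i where i: "lookup a (Inl i) \<noteq> 0" by auto
  then have a: "a = single (Inl i) 1 + (a - single (Inl i) 1)"
    using exponent_split_off[of 1 a "Inl i"] by (simp add: add.commute)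
  then show ?thesis using weyl_monom_Inl[of i "a - single (Inl i) 1"] by metis
next
  case True
  obtain v where v: "lookup a v \<noteq> 0" using assms by (auto simp: poly_mapping_eq_iff fun_eq_iff)
  obtain i where i: "v = Inr i"
  proof (cases v)
    case (Inl j)
    then show ?thesis using v fun_cong[OF True, of j] by simp
  qed
  let ?b = "a - single (Inr i) 1"
  have a: "a = single (Inr i) 1 + ?b"
    using exponent_split_off[of 1 a "Inr i"] v i by (simp add: add.commute)
  have "Lpart ?b = (\<lambda>_. 0)" using True by (auto simp: fun_eq_iff lookup_minus)
  from weyl_monom_Inr[OF this, of i] show ?thesis using a by metis
qed

lemma gen_times_monom:
  "weyl_gen v (weyl_monom b p) = symb (mon (single v 1 + b) + extra v b) p"
proof (cases v)
  case (Inl i)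
  show ?thesis unfolding Inl by (simp add: extra_def weyl_monom_Inl[unfolded One_nat_def])
next
  case (Inr i)
  let ?q = "pows pderiv_at (Rpart b) p" and ?m = "mon (Abs_poly_mapping (Lpart b)) :: ('a, 'b) polX"
  have "weyl_gen v (weyl_monom b p) = pderiv_at i (?m * ?q)" by (simp add: Inr weyl_monom_pows pows_mult_var)
  also have "\<dots> = ?m * pderiv_at i ?q + single (Abs_poly_mapping (Lpart b) - single i 1) (of_nat (Lpart b i)) * ?q"
    unfolding pderiv_at_times_monomial by simp
  also have "?m * pderiv_at i ?q = weyl_monom (single (Inr i) 1 + b) p"
    unfolding weyl_monom_pows Lpart_add_Inr pows_Suc[where g = pderiv_at and e = "Rpart b" and i = i, OF pderiv_comm]
    by (simp add: pows_mult_var)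
  also have "single (Abs_poly_mapping (Lpart b) - single i 1) (of_nat (Lpart b i)) * ?q =
    sc (of_nat (Lpart b i)) (weyl_monom (b - single (Inl i) 1) p)"
  proof -
    have L: "Abs_poly_mapping (Lpart (b - single (Inl i) 1)) = Abs_poly_mapping (Lpart b) - single i 1"
      by (rule poly_mapping_eqI) (auto simp: lookup_minus lookup_single when_def)
    have R: "Rpart (b - single (Inl i) 1) = Rpart b"
      by (auto simp: fun_eq_iff lookup_minus lookup_single)
    show ?thesis unfolding weyl_monom_pows o_apply R pows_mult_var L
      by (simp flip: sc_mult_left)
  qed
  finally show ?thesis by (simp add: extra_def Inr symb_add symb_single)
qed

lemma gen_linear: "weyl_gen v (p + q) = weyl_gen v p + weyl_gen v q" "weyl_gen v (sc c p) = sc c (weyl_gen v p)"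
  by (cases v; simp add: mult_var_def pderiv_at_add pderiv_at_sc distrib_left sc_mult_left)+

lemma gen_linear_sum: "weyl_gen v (\<Sum>x\<in>A. f x) = (\<Sum>x\<in>A. weyl_gen v (f x))"
proof -
  have "weyl_gen v 0 = 0" using gen_linear(2)[of v 0 0] by simp
  then show ?thesis by (induction A rule: infinite_finite_induct) (simp_all add: gen_linear)
qed

lemma gen_times_symb:
  "weyl_gen v \<circ> symb c = symb (\<Sum>b\<in>keys c. sc (lookup c b) (mon (single v 1 + b) + extra v b))"
  by (rule ext) (simp only: o_apply symb_sum symb_sc gen_times_monom[symmetric]
      symb_superset[OF finite_keys order_refl, of c] gen_linear_sum gen_linear)

text \<open>
  Peel off one generator of the left factor at a time; every step adds only exponents that are \<open>below\<close> the
  expected one.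
\<close>
lemma monom_times_monom:
  fixes a b :: "'n::finite + 'n \<Rightarrow>\<^sub>0 nat"
  shows "\<exists>s :: ('n, 'k::field_char_0) polXY. (\<forall>c\<in>keys s. below c (a + b)) \<and> weyl_monom a \<circ> weyl_monom b = symb (mon (a + b) + s)"
proof (induction "mdeg a" arbitrary: a)
  case 0
  then have "a = 0" by (metis mdeg_eq_0)
  then show ?case by (intro exI[of _ 0]) (simp add: weyl_monom_zero)
next
  case (Suc n)
  then have "a \<noteq> 0" by auto
  then have "\<exists>v b. a = single v 1 + b \<and> (weyl_monom a :: ('n, 'k) endo) = weyl_gen v \<circ> weyl_monom b"
    by (rule weyl_monom_peel)
  then obtain v a' where a: "a = single v 1 + a'"
    "weyl_monom a = weyl_gen v \<circ> (weyl_monom a' :: ('n, 'k) endo)" by (elim exE conjE)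
  have "n = mdeg a'" using Suc.hyps(2) unfolding a(1) by simp
  from Suc.hyps(1)[OF this] obtain s :: "('n, 'k) polXY" where s: "\<forall>c\<in>keys s. below c (a' + b)"
    "weyl_monom a' \<circ> weyl_monom b = symb (mon (a' + b) + s)" by (elim exE conjE)
  let ?q = "mon (a' + b) + s"
  define s' where "s' = (\<Sum>c\<in>keys s. sc (lookup s c) (mon (single v 1 + c) + extra v c)) + extra v (a' + b)"
  have "weyl_monom a \<circ> weyl_monom b = weyl_gen v \<circ> symb ?q" unfolding a(2) comp_assoc s(2) ..
  also have "\<dots> = symb (mon (a + b) + s')"
  proof
    fix p
    have "(weyl_gen v \<circ> symb ?q) p = weyl_gen v (weyl_monom (a' + b) p) + (weyl_gen v \<circ> symb s) p"
      by (simp add: symb_add gen_linear)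
    also have "\<dots> = symb (mon (a + b) + s') p"
      unfolding gen_times_symb[of v s] gen_times_monom s'_def a(1) by (simp add: symb_add add_ac)
    finally show "(weyl_gen v \<circ> symb ?q) p = symb (mon (a + b) + s') p" .
  qed
  finally have "weyl_monom a \<circ> weyl_monom b = symb (mon (a + b) + s')" .
  moreover have "below c (a + b)" if c: "c \<in> keys s'" for c
  proof -
    have ab: "a + b = single v 1 + (a' + b)" by (simp add: a(1) add.assoc)
    have "keys (\<Sum>c\<in>keys s. sc (lookup s c) (mon (single v 1 + c) + extra v c))
      \<subseteq> {c. below c (a + b)}"
    proof (rule keys_sum_subset)
      fix d assume d: "d \<in> keys s"
      have bd: "below (single v 1 + d) (a + b)" unfolding ab using s(1) d by (intro below_add) blast
      show "keys (sc (lookup s d) (mon (single v 1 + d) + extra v d)) \<subseteq> {c. below c (a + b)}"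
      proof
        let ?m = "mon (single v 1 + d) :: ('n, 'k) polXY" and ?x = "extra v d :: ('n, 'k) polXY"
        fix e assume e: "e \<in> keys (sc (lookup s d) (?m + ?x))"
        have "e \<in> keys (?m + ?x)" by (rule subsetD[OF keys_sc e])
        from subsetD[OF keys_add this] show "e \<in> {c. below c (a + b)}"
        proof
          assume "e \<in> keys ?m"
          then show ?thesis using bd by simp
        next
          assume "e \<in> keys ?x"
          from below_trans[OF extra_below[OF this] bd] show ?thesis by simp
        qed
      qed
    qed
    moreover have "keys (extra v (a' + b) :: ('n, 'k) polXY) \<subseteq> {c. below c (a + b)}"
      unfolding ab using extra_below by blast
    ultimately show ?thesis using subsetD[OF keys_add c[unfolded s'_def]] by blast
  qed
  ultimately show ?case by blast
qed

subsection \<open>The Weyl algebra as a ring\<close>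

lemma vector_space_pscale: "vector_space (pscale :: 'k::field_char_0 \<Rightarrow> ('n, 'k) polX \<Rightarrow> _)"
  unfolding pscale_sc[abs_def] by unfold_locales

lemma linear_symb: "Vector_Spaces.linear pscale pscale (symb c)"
  unfolding Vector_Spaces.linear_iff
  by (simp add: vector_space_pscale symb_linear_add pscale_sc symb_linear_sc)

lemma product_of_symbs:
  fixes c d :: "('n::finite, 'k::field_char_0) polXY"
  obtains s where "symb c \<circ> symb d = symb (c * d + s)"
    "\<And>e. e \<in> keys s \<Longrightarrow> \<exists>a\<in>keys c. \<exists>b\<in>keys d. below e (a + b)"
proof -
  have "\<forall>a b :: 'n + 'n \<Rightarrow>\<^sub>0 nat. \<exists>s :: ('n, 'k) polXY. (\<forall>c\<in>keys s. below c (a + b)) \<and> weyl_monom a \<circ> weyl_monom b = symb (mon (a + b) + s)"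
    using monom_times_monom by blast
  then have "\<exists>s. \<forall>a b :: 'n + 'n \<Rightarrow>\<^sub>0 nat. (\<forall>c\<in>keys (s a b :: ('n, 'k) polXY). below c (a + b)) \<and> weyl_monom a \<circ> weyl_monom b = symb (mon (a + b) + s a b)"
    unfolding choice_iff .
  then obtain s :: "_ \<Rightarrow> _ \<Rightarrow> ('n, 'k) polXY" where s': "\<forall>a b :: 'n + 'n \<Rightarrow>\<^sub>0 nat. (\<forall>c\<in>keys (s a b). below c (a + b)) \<and> weyl_monom a \<circ> weyl_monom b = symb (mon (a + b) + s a b)"
    by (rule exE)
  then have s: "\<And>a b e. e \<in> keys (s a b) \<Longrightarrow> below e (a + b)"
    and mm: "\<And>a b p. weyl_monom a (weyl_monom b p) = symb (mon (a + b) + s a b) p"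
    by (blast, metis o_apply)
  let ?K = "keys c" and ?L = "keys d"
  let ?c = "lookup c" and ?d = "lookup d"
  define S where "S = (\<Sum>a\<in>?K. \<Sum>b\<in>?L. sc (?c a * ?d b) (s a b))"
  have cd: "c * d = (\<Sum>a\<in>?K. \<Sum>b\<in>?L. sc (?c a * ?d b) (mon (a + b)))"
    unfolding mult_expand by simp
  show ?thesis
  proof (rule that[of S])
    show "symb c \<circ> symb d = symb (c * d + S)"
    proof
      fix p
      have "(symb c \<circ> symb d) p = (\<Sum>a\<in>?K. \<Sum>b\<in>?L. sc (?c a * ?d b) (weyl_monom a (weyl_monom b p)))"
        by (simp add: symb_superset[OF finite_keys order_refl, of c] symb_superset[OF finite_keys order_refl, of d]
            symb_linear_sum[of "mon _", simplified] weyl_monom_sc pm.scale_sum_right)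
      also have "\<dots> = (\<Sum>a\<in>?K. \<Sum>b\<in>?L. symb (sc (?c a * ?d b) (mon (a + b)) + sc (?c a * ?d b) (s a b)) p)"
        by (simp add: mm symb_add symb_sc pm.scale_right_distrib del: sc_single symb_mon)
      also have "\<dots> = symb (c * d + S) p"
        unfolding cd S_def by (simp add: symb_add symb_sum sum.distrib del: sc_single)
      finally show "(symb c \<circ> symb d) p = symb (c * d + S) p" .
    qed
  next
    fix e assume e: "e \<in> keys S"
    have "keys S \<subseteq> {e. \<exists>a\<in>?K. \<exists>b\<in>?L. below e (a + b)}"
      unfolding S_def
    proof (intro keys_sum_subset)
      fix a b assume ab: "a \<in> ?K" "b \<in> ?L"
      show "keys (sc (?c a * ?d b) (s a b)) \<subseteq> {e. \<exists>a\<in>?K. \<exists>b\<in>?L. below e (a + b)}"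
        using keys_sc[of "?c a * ?d b" "s a b"] s[of _ a b] ab by blast
    qed
    then show "\<exists>a\<in>?K. \<exists>b\<in>?L. below e (a + b)" using e by blast
  qed
qed

lemma End_K_simps [simp]:
  "monoid.mult (End_K :: ('n::finite, 'k::field_char_0) endo ring) = (\<circ>)" "monoid.one (End_K :: ('n, 'k) endo ring) = id"
  "ring.zero (End_K :: ('n, 'k) endo ring) = (\<lambda>p. 0)" "ring.add (End_K :: ('n, 'k) endo ring) = (\<lambda>f g p. f p + g p)"
  by (simp_all add: End_K_def)

lemma weyl_simps [simp]:
  "monoid.mult (weyl :: ('n::finite, 'k::field_char_0) endo ring) = (\<circ>)" "monoid.one (weyl :: ('n, 'k) endo ring) = id"
  "ring.zero (weyl :: ('n, 'k) endo ring) = (\<lambda>p. 0)" "ring.add (weyl :: ('n, 'k) endo ring) = (\<lambda>f g p. f p + g p)"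
  by (simp_all add: weyl_def End_K_def)

lemma pscale_symb: "pscale c = symb (single 0 c)"
  by (rule ext) (simp add: symb_single weyl_monom_zero pscale_sc)

lemma End_K_minus: "\<ominus>\<^bsub>End_K\<^esub> symb c = symb (- c)"
proof -
  have lin: "symb d \<in> carrier End_K" for d :: "('n::finite, 'k::field_char_0) polXY"
    using linear_symb by (simp add: End_K_def)
  have z: "symb c p + symb (- c) p = 0" for p using symb_add[of c "- c" p] by simp
  show ?thesis
    unfolding a_inv_def m_inv_def
  proof (rule the_equality)
    show "symb (- c) \<in> carrier (add_monoid End_K) \<and> symb c \<otimes>\<^bsub>add_monoid End_K\<^esub> symb (- c) = \<one>\<^bsub>add_monoid End_K\<^esub> \<and>
      symb (- c) \<otimes>\<^bsub>add_monoid End_K\<^esub> symb c = \<one>\<^bsub>add_monoid End_K\<^esub>"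
      using lin z by (simp add: add.commute fun_eq_iff)
    fix y assume "y \<in> carrier (add_monoid End_K) \<and> symb c \<otimes>\<^bsub>add_monoid End_K\<^esub> y = \<one>\<^bsub>add_monoid End_K\<^esub> \<and>
      y \<otimes>\<^bsub>add_monoid End_K\<^esub> symb c = \<one>\<^bsub>add_monoid End_K\<^esub>"
    then have y: "symb c p + y p = 0" for p by (simp add: fun_eq_iff)
    show "y = symb (- c)"
    proof
      fix p show "y p = symb (- c) p" using y[of p] z[of p] by (metis add_left_cancel)
    qed
  qed
qed

lemma carrier_weyl: "carrier (weyl :: ('n::finite, 'k::field_char_0) endo ring) = range symb"
proof
  have C: "carrier weyl = generate_ring End_K (range pscale \<union> range (weyl_gen :: _ \<Rightarrow> ('n, 'k) endo))"
    by (simp add: weyl_def)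
  show "carrier weyl \<subseteq> range (symb :: _ \<Rightarrow> ('n, 'k) endo)"
    unfolding C
  proof
    fix w assume "w \<in> generate_ring End_K (range pscale \<union> range (weyl_gen :: _ \<Rightarrow> ('n, 'k) endo))"
    then show "w \<in> range symb"
    proof (induction rule: generate_ring.induct)
      case one
      show ?case by (rule range_eqI[of _ _ 1]) simp
    next
      case (incl h)
      then show ?case
      proof
        assume "h \<in> range pscale" then show ?thesis by (auto simp: pscale_symb)
      next
        assume "h \<in> range weyl_gen"
        then obtain v where "h = weyl_gen v" by blast
        then have "h = symb (mon (single v 1))" by (simp only: symb_mon weyl_monom_single)
        then show ?thesis by blast
      qed
    next
      case (a_inv h) then show ?case by (auto simp: End_K_minus)
    next
      case (eng_add w1 w2)
      then obtain c d where "w1 = symb c" "w2 = symb d" by blast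
      then have "w1 \<oplus>\<^bsub>End_K\<^esub> w2 = symb (c + d)" by (simp add: symb_add fun_eq_iff)
      then show ?case by blast
    next
      case (eng_mult w1 w2)
      then obtain c d where "w1 = symb c" "w2 = symb d" by blast
      then have "w1 \<otimes>\<^bsub>End_K\<^esub> w2 = symb c \<circ> symb d" by simp
      then show ?case using product_of_symbs[of c d] by (metis rangeI)
    qed
  qed
  let ?G = "generate_ring End_K (range pscale \<union> range (weyl_gen :: _ \<Rightarrow> ('n, 'k) endo))"
  have mon: "weyl_monom a \<in> ?G" for a
  proof (induction "mdeg a" arbitrary: a)
    case 0
    then have "a = 0" by (metis mdeg_eq_0)
    have "(weyl_monom a :: ('n, 'k) endo) = \<one>\<^bsub>End_K\<^esub>" unfolding \<open>a = 0\<close> weyl_monom_zero by (simp only: End_K_simps)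
    then show ?case using generate_ring.one[of End_K] by metis
  next
    case (Suc n)
    then have "a \<noteq> 0" by auto
    then have "\<exists>v b. a = single v 1 + b \<and> (weyl_monom a :: ('n, 'k) endo) = weyl_gen v \<circ> weyl_monom b"
      by (rule weyl_monom_peel)
    then obtain v b where a: "a = single v 1 + b"
      "weyl_monom a = weyl_gen v \<circ> (weyl_monom b :: ('n, 'k) endo)" by (elim exE conjE)
    have "n = mdeg b" using Suc.hyps(2) unfolding a(1) by simp
    then have "weyl_monom b \<in> ?G" by (rule Suc.hyps(1))
    moreover have "weyl_gen v \<in> ?G" by (rule generate_ring.incl) auto
    ultimately show ?case using generate_ring.eng_mult[of "weyl_gen v" End_K _ "weyl_monom b"] unfolding a(2) by simp
  qed
  have single: "symb (single a c) \<in> ?G" for a c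
  proof -
    have "pscale c \<in> ?G" by (rule generate_ring.incl) auto
    from generate_ring.eng_mult[OF this mon[of a]] show ?thesis by (simp add: symb_single[abs_def] pscale_sc o_def)
  qed
  have zero: "symb 0 \<in> ?G" using single[of 0 0] by simp
  have add: "symb (c + d) \<in> ?G" if "symb c \<in> ?G" "symb d \<in> ?G" for c d
    using generate_ring.eng_add[OF that] by (simp add: symb_add[abs_def])
  have sums: "symb (\<Sum>a\<in>A. single a (f a)) \<in> ?G" for A f
  proof (induction A rule: infinite_finite_induct)
    case (insert a A)
    show ?case unfolding sum.insert[OF insert.hyps] by (rule add[OF single insert.IH])
  qed (simp_all only: sum.infinite sum.empty zero not_False_eq_True)
  show "range symb \<subseteq> carrier (weyl :: ('n, 'k) endo ring)"
    unfolding C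
  proof (rule image_subsetI)
    fix c :: "('n, 'k) polXY"
    show "symb c \<in> ?G"
      using sums[of "lookup c" "keys c"] unfolding pm_keys_expand[of c, symmetric] .
  qed
qed

lemma weyl_filt_eq: "weyl_filt \<omega> i = symb ` {c :: ('n::finite, 'k::field_char_0) polXY. \<forall>a\<in>keys c. int (wdeg \<omega> a) \<le> i}"
proof -
  have "weyl_deg \<omega> (symb c) \<le> ereal (real_of_int i) \<longleftrightarrow> (\<forall>a\<in>keys c. int (wdeg \<omega> a) \<le> i)" for c :: "('n, 'k) polXY"
  proof -
    have "real (wdeg \<omega> a) \<le> real_of_int i \<longleftrightarrow> int (wdeg \<omega> a) \<le> i" for a by linarith
    then show ?thesis unfolding weyl_deg_def weyl_supp_symb wdeg_def[symmetric] SUP_le_iff by simp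
  qed
  then show ?thesis unfolding weyl_filt_def carrier_weyl by auto
qed

section \<open>Associated graded groups and their actions\<close>

locale filtered_group = abelian_group A for A :: "('a, 'c) ring_scheme" (structure) +
  fixes F :: "int \<Rightarrow> 'a set"
  assumes F_sub: "additive_subgroup (F i) A" and F_inc: "F i \<subseteq> F (i + 1)"
begin

lemma F_abelian: "abelian_subgroup (F i) A"
  by (rule abelian_subgroupI3[OF F_sub abelian_group_axioms])

lemma F_carrier: "F i \<subseteq> carrier A" using additive_subgroup.a_subset[OF F_sub] .
lemma F_zero [simp]: "\<zero> \<in> F i" using additive_subgroup.zero_closed[OF F_sub] .
lemma F_add: "x \<in> F i \<Longrightarrow> y \<in> F i \<Longrightarrow> x \<oplus> y \<in> F i" using additive_subgroup.a_closed[OF F_sub] .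
lemma F_inv: "x \<in> F i \<Longrightarrow> \<ominus> x \<in> F i"
  using additive_subgroup.a_subgroup[OF F_sub, of i] subgroup.m_inv_closed[of "F i" "add_monoid A" x] by (simp add: a_inv_def)
lemma F_minus: "x \<in> F i \<Longrightarrow> y \<in> F i \<Longrightarrow> x \<ominus> y \<in> F i" unfolding a_minus_def by (intro F_add F_inv)

lemma F_mono: assumes "i \<le> j" shows "F i \<subseteq> F j"
proof -
  have "F i \<subseteq> F (i + int n)" for n
  proof (induction n)
    case (Suc n)
    then show ?case using F_inc[of "i + int n"] by (auto simp: algebra_simps)
  qed simp
  from this[of "nat (j - i)"] show ?thesis using assms by simp
qed

lemma F_finsum: "(\<And>x. x \<in> I \<Longrightarrow> f x \<in> F k) \<Longrightarrow> (\<Oplus>x\<in>I. f x) \<in> F k"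
proof (induction I rule: infinite_finite_induct)
  case (insert x I)
  then have "f \<in> I \<rightarrow> carrier A" "f x \<in> carrier A" using F_carrier by auto
  then show ?case using insert by (simp add: finsum_insert F_add)
qed simp_all

definition cst :: "int \<Rightarrow> 'a \<Rightarrow> 'a set" where "cst k x = F (k - 1) +>\<^bsub>A\<^esub> x"

lemma cst_eq_iff:
  assumes "x \<in> carrier A" "y \<in> carrier A" shows "cst k x = cst k y \<longleftrightarrow> x \<ominus> y \<in> F (k - 1)"
proof -
  interpret H: abelian_subgroup "F (k - 1)" A by (rule F_abelian)
  have "cst k x = cst k y \<longleftrightarrow> x \<in> F (k - 1) +> y"
    unfolding cst_def using H.a_repr_independence'[of x y] H.a_rcos_self[of x] assms by metis
  also have "\<dots> \<longleftrightarrow> x \<oplus> \<ominus> y \<in> F (k - 1)" by (rule H.a_rcos_module[OF assms(2,1)])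
  finally show ?thesis by (simp add: a_minus_def)
qed

lemma neg_zero: "\<ominus> \<zero> = \<zero>"
  by (rule minus_equality) simp_all

lemma mem_cst: assumes "x \<in> carrier A" shows "y \<in> cst k x \<longleftrightarrow> (\<exists>h\<in>F (k - 1). y = h \<oplus> x)"
  unfolding cst_def a_r_coset_def' by auto

lemma cst_self: "x \<in> carrier A \<Longrightarrow> x \<in> cst k x"
  using mem_cst[of x x k] F_zero[of "k - 1"] by (metis l_zero)

lemma cst_zero: "cst k \<zero> = F (k - 1)"
proof -
  have eq: "y \<in> F (k - 1) \<longleftrightarrow> (\<exists>h\<in>F (k - 1). y = h \<oplus> \<zero>)" for y
  proof
    assume y: "y \<in> F (k - 1)"
    then have "y = y \<oplus> \<zero>" using F_carrier[of "k - 1"] by auto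
    then show "\<exists>h\<in>F (k - 1). y = h \<oplus> \<zero>" using y by (rule bexI)
  next
    assume "\<exists>h\<in>F (k - 1). y = h \<oplus> \<zero>"
    then show "y \<in> F (k - 1)" using F_carrier[of "k - 1"] by auto
  qed
  show ?thesis by (rule Set.set_eqI) (simp only: mem_cst[OF zero_closed] eq[symmetric])
qed

lemma cst_eq_zero: "x \<in> carrier A \<Longrightarrow> cst k x = F (k - 1) \<longleftrightarrow> x \<in> F (k - 1)"
  using cst_eq_iff[of x \<zero> k] by (simp add: cst_zero a_minus_def neg_zero)

lemma gr_piece_carrier: "carrier (gr_piece A F k) = cst k ` F k"
  unfolding gr_piece_def A_FactGroup_def FactGroup_def cst_def
  by (auto simp: RCOSETS_def r_coset_def a_r_coset_def)

lemma gr_piece_one: "\<one>\<^bsub>gr_piece A F k\<^esub> = F (k - 1)"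
  unfolding gr_piece_def A_FactGroup_def FactGroup_def by simp

lemma gr_piece_mult:
  assumes "x \<in> carrier A" "y \<in> carrier A"
  shows "cst k x \<otimes>\<^bsub>gr_piece A F k\<^esub> cst k y = cst k (x \<oplus> y)"
proof -
  interpret H: abelian_subgroup "F (k - 1)" A by (rule F_abelian)
  have "cst k x \<otimes>\<^bsub>gr_piece A F k\<^esub> cst k y = (F (k - 1) +> x) <+> (F (k - 1) +> y)"
    unfolding gr_piece_def A_FactGroup_def FactGroup_def cst_def by (simp add: set_mult_def set_add_def)
  then show ?thesis unfolding cst_def using H.a_rcos_sum[OF assms] by simp
qed

lemma gr_piece_comm_group: "comm_group (gr_piece A F k)"
proof (rule comm_groupI)
  fix X1 assume "X1 \<in> carrier (gr_piece A F k)"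
  then obtain x where x: "x \<in> F k" "X1 = cst k x" by (auto simp: gr_piece_carrier)
  then have c: "x \<in> carrier A" using F_carrier by blast
  show "\<one>\<^bsub>gr_piece A F k\<^esub> \<otimes>\<^bsub>gr_piece A F k\<^esub> X1 = X1"
    unfolding gr_piece_one cst_zero[symmetric] x(2) using c by (subst gr_piece_mult) auto
  show "\<exists>Y\<in>carrier (gr_piece A F k). Y \<otimes>\<^bsub>gr_piece A F k\<^esub> X1 = \<one>\<^bsub>gr_piece A F k\<^esub>"
    unfolding gr_piece_carrier x(2) gr_piece_one cst_zero[symmetric]
    using c F_inv[OF x(1)] by (intro bexI[of _ "cst k (\<ominus> x)"]) (simp_all add: gr_piece_mult l_neg)
  fix Y1 assume "Y1 \<in> carrier (gr_piece A F k)"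
  then obtain y where y: "y \<in> F k" "Y1 = cst k y" by (auto simp: gr_piece_carrier)
  then have d: "y \<in> carrier A" using F_carrier by blast
  show "X1 \<otimes>\<^bsub>gr_piece A F k\<^esub> Y1 \<in> carrier (gr_piece A F k)"
    unfolding x(2) y(2) gr_piece_carrier using c d F_add[OF x(1) y(1)] by (simp add: gr_piece_mult)
  show "X1 \<otimes>\<^bsub>gr_piece A F k\<^esub> Y1 = Y1 \<otimes>\<^bsub>gr_piece A F k\<^esub> X1"
    unfolding x(2) y(2) using c d by (simp add: gr_piece_mult a_comm)
  fix Z1 assume "Z1 \<in> carrier (gr_piece A F k)"
  then obtain z where z: "z \<in> F k" "Z1 = cst k z" by (auto simp: gr_piece_carrier)
  then have e: "z \<in> carrier A" using F_carrier by blast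
  show "X1 \<otimes>\<^bsub>gr_piece A F k\<^esub> Y1 \<otimes>\<^bsub>gr_piece A F k\<^esub> Z1 = X1 \<otimes>\<^bsub>gr_piece A F k\<^esub> (Y1 \<otimes>\<^bsub>gr_piece A F k\<^esub> Z1)"
    unfolding x(2) y(2) z(2) using c d e by (simp add: gr_piece_mult a_assoc)
qed (auto simp: gr_piece_one gr_piece_carrier cst_zero[symmetric])

lemma gr_piece_finprod:
  assumes "finite I" "\<And>i. i \<in> I \<Longrightarrow> x i \<in> F k"
  shows "finprod (gr_piece A F k) (\<lambda>i. cst k (x i)) I = cst k (\<Oplus>i\<in>I. x i)"
proof -
  interpret G: comm_group "gr_piece A F k" by (rule gr_piece_comm_group)
  show ?thesis using assms
  proof (induction I rule: finite_induct)
    case empty then show ?case by (simp add: gr_piece_one cst_zero)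
  next
    case (insert i I)
    have 1: "(\<lambda>i. cst k (x i)) \<in> I \<rightarrow> carrier (gr_piece A F k)" "cst k (x i) \<in> carrier (gr_piece A F k)"
      using insert by (auto simp: gr_piece_carrier)
    have 2: "x \<in> I \<rightarrow> carrier A" "x i \<in> carrier A" using insert F_carrier by auto
    have "finprod (gr_piece A F k) (\<lambda>i. cst k (x i)) (insert i I) = cst k (x i) \<otimes>\<^bsub>gr_piece A F k\<^esub> cst k (\<Oplus>i\<in>I. x i)"
      using insert 1 by (simp add: G.finprod_insert)
    also have "\<dots> = cst k (\<Oplus>i\<in>insert i I. x i)"
      using insert 2 by (simp add: gr_piece_mult finsum_insert finsum_closed)
    finally show ?case .
  qed
qed

subsection \<open>Families of representatives\<close>

definition fam :: "(int \<Rightarrow> 'a) \<Rightarrow> bool" where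
  "fam b \<longleftrightarrow> (\<forall>k. b k \<in> F k) \<and> finite {k. b k \<notin> F (k - 1)}"
definition cls :: "(int \<Rightarrow> 'a) \<Rightarrow> int \<Rightarrow> 'a set" where "cls b = (\<lambda>k. cst k (b k))"

lemma fam_F: "fam b \<Longrightarrow> b k \<in> F k" by (simp add: fam_def)
lemma fam_carrier: "fam b \<Longrightarrow> b k \<in> carrier A" using F_carrier by (auto simp: fam_def)

lemma famI: assumes "\<And>k. b k \<in> F k" "finite I" "\<And>k. k \<notin> I \<Longrightarrow> b k \<in> F (k - 1)" shows "fam b"
  unfolding fam_def using assms by (auto intro: finite_subset[of _ I])

lemma gr_group_carrier: "carrier (gr_group A F) = cls ` {b. fam b}"
proof -
  have g: "group (gr_piece A F k)" for k using gr_piece_comm_group by (simp add: comm_group_def)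
  have C: "carrier (gr_group A F) = {g. (\<forall>k. g k \<in> cst k ` F k) \<and> finite {k. g k \<noteq> F (k - 1)}}"
    unfolding gr_group_def by (subst carrier_sum_group) (auto simp: g gr_piece_carrier gr_piece_one)
  show ?thesis unfolding C
  proof (intro equalityI subsetI)
    fix g assume g: "g \<in> {g. (\<forall>k. g k \<in> cst k ` F k) \<and> finite {k. g k \<noteq> F (k - 1)}}"
    then have "\<forall>k. \<exists>x. x \<in> F k \<and> g k = cst k x" by blast
    from choice[OF this] obtain b where b: "\<forall>k. b k \<in> F k \<and> g k = cst k (b k)" by (rule exE)
    have bc: "b k \<in> carrier A" for k using b F_carrier by blast
    have "{k. b k \<notin> F (k - 1)} = {k. g k \<noteq> F (k - 1)}" using b bc cst_eq_zero by simp
    then have "fam b" unfolding fam_def using b g by simp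
    moreover have "g = cls b" unfolding cls_def using b by auto
    ultimately show "g \<in> cls ` {b. fam b}" by blast
  next
    fix g assume "g \<in> cls ` {b. fam b}"
    then obtain b where b: "fam b" "g = cls b" by blast
    have "{k. g k \<noteq> F (k - 1)} = {k. b k \<notin> F (k - 1)}"
      unfolding b(2) cls_def using cst_eq_zero fam_carrier[OF b(1)] by simp
    then show "g \<in> {g. (\<forall>k. g k \<in> cst k ` F k) \<and> finite {k. g k \<noteq> F (k - 1)}}"
      using b unfolding fam_def by (auto simp: cls_def)
  qed
qed

lemma gr_group_mult:
  assumes "\<And>k. b k \<in> carrier A" "\<And>k. c k \<in> carrier A"
  shows "cls b \<otimes>\<^bsub>gr_group A F\<^esub> cls c = cls (\<lambda>k. b k \<oplus> c k)"
  unfolding gr_group_def cls_def by (rule ext) (simp add: gr_piece_mult assms)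

lemma gr_group_one: "\<one>\<^bsub>gr_group A F\<^esub> = cls (\<lambda>_. \<zero>)"
  unfolding gr_group_def cls_def by (rule ext) (simp add: gr_piece_one cst_zero)

lemma cls_eq_iff:
  assumes "\<And>k. b k \<in> carrier A" "\<And>k. c k \<in> carrier A"
  shows "cls b = cls c \<longleftrightarrow> (\<forall>k. b k \<ominus> c k \<in> F (k - 1))"
  unfolding cls_def fun_eq_iff using cst_eq_iff assms by simp

lemma cls_eq_zero_iff: assumes "\<And>k. b k \<in> carrier A" shows "cls b = cls (\<lambda>_. \<zero>) \<longleftrightarrow> (\<forall>k. b k \<in> F (k - 1))"
  by (subst cls_eq_iff) (use assms in \<open>auto simp: a_minus_def neg_zero\<close>)

lemma fam_add: assumes "fam b" "fam c" shows "fam (\<lambda>k. b k \<oplus> c k)"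
proof (rule famI)
  show "b k \<oplus> c k \<in> F k" for k using assms by (intro F_add) (simp_all add: fam_def)
  show "finite ({k. b k \<notin> F (k - 1)} \<union> {k. c k \<notin> F (k - 1)})" using assms by (simp add: fam_def)
  show "b k \<oplus> c k \<in> F (k - 1)" if "k \<notin> {k. b k \<notin> F (k - 1)} \<union> {k. c k \<notin> F (k - 1)}" for k
    using that by (intro F_add) auto
qed

lemma fam_zero: "fam (\<lambda>_. \<zero>)" by (simp add: fam_def)

lemma fam_uminus: assumes "fam b" shows "fam (\<lambda>k. \<ominus> b k)"
proof (rule famI)
  show "\<ominus> b k \<in> F k" for k using assms by (intro F_inv) (simp add: fam_def)
  show "finite {k. b k \<notin> F (k - 1)}" using assms by (simp add: fam_def)
  show "\<ominus> b k \<in> F (k - 1)" if "k \<notin> {k. b k \<notin> F (k - 1)}" for k using that by (intro F_inv) simp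
qed

lemma gr_class_cls: "x \<in> carrier A \<Longrightarrow> gr_class A F d x = cls (\<lambda>k. if k = d then x else \<zero>)"
  unfolding gr_class_def cls_def by (rule ext) (auto simp: cst_def[symmetric] cst_zero)

end

locale filtered_action = R: filtered_group R FR + M: filtered_group A F
  for R :: "('r, 'c) ring_scheme" and FR :: "int \<Rightarrow> 'r set" and A :: "('a, 'd) ring_scheme" and F :: "int \<Rightarrow> 'a set" +
  fixes act :: "'r \<Rightarrow> 'a \<Rightarrow> 'a"
  assumes act_filt: "a \<in> FR i \<Longrightarrow> x \<in> F j \<Longrightarrow> act a x \<in> F (i + j)"
    and act_closed: "a \<in> carrier R \<Longrightarrow> x \<in> carrier A \<Longrightarrow> act a x \<in> carrier A"
    and act_add_left: "a \<in> carrier R \<Longrightarrow> b \<in> carrier R \<Longrightarrow> x \<in> carrier A \<Longrightarrow> act (a \<oplus>\<^bsub>R\<^esub> b) x = act a x \<oplus>\<^bsub>A\<^esub> act b x"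
    and act_add_right: "a \<in> carrier R \<Longrightarrow> x \<in> carrier A \<Longrightarrow> y \<in> carrier A \<Longrightarrow> act a (x \<oplus>\<^bsub>A\<^esub> y) = act a x \<oplus>\<^bsub>A\<^esub> act a y"
begin

lemma product_of_cosets:
  assumes a: "a \<in> FR i" and x: "x \<in> F j"
  shows "(\<Union>a'\<in>R.cst i a. \<Union>x'\<in>M.cst j x. F (i + j - 1) +>\<^bsub>A\<^esub> act a' x') = M.cst (i + j) (act a x)"
proof -
  have aR: "a \<in> carrier R" and xA: "x \<in> carrier A" using a x R.F_carrier M.F_carrier by auto
  have eq: "M.cst (i + j) (act a' x') = M.cst (i + j) (act a x)"
    if ax: "a' \<in> R.cst i a" "x' \<in> M.cst j x" for a' x'
  proof -
    from ax(1) obtain h where h: "h \<in> FR (i - 1)" "a' = h \<oplus>\<^bsub>R\<^esub> a" unfolding R.mem_cst[OF aR] by (rule bexE)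
    from ax(2) obtain g where g: "g \<in> F (j - 1)" "x' = g \<oplus>\<^bsub>A\<^esub> x" unfolding M.mem_cst[OF xA] by (rule bexE)
    have hR: "h \<in> carrier R" and gA: "g \<in> carrier A" using h g R.F_carrier M.F_carrier by auto
    have x'F: "x' \<in> F j" unfolding g(2) using g(1) x M.F_mono[of "j - 1" j] by (intro M.F_add) auto
    have x'A: "x' \<in> carrier A" using x'F M.F_carrier by blast
    have 1: "act h x' \<in> F (i + j - 1)" using act_filt[OF h(1) x'F] by (simp add: algebra_simps)
    have 2: "act a g \<in> F (i + j - 1)" using act_filt[OF a g(1)] by (simp add: algebra_simps)
    have "act a' x' = (act h x' \<oplus>\<^bsub>A\<^esub> act a g) \<oplus>\<^bsub>A\<^esub> act a x"
      unfolding h(2) using hR aR x'A gA xA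
      by (simp add: act_add_left) (simp add: g(2) act_add_right act_closed M.a_assoc)
    then have "act a' x' \<ominus>\<^bsub>A\<^esub> act a x = act h x' \<oplus>\<^bsub>A\<^esub> act a g"
      using hR aR x'A gA xA by (simp add: a_minus_def M.a_assoc M.r_neg act_closed)
    then have "act a' x' \<ominus>\<^bsub>A\<^esub> act a x \<in> F (i + j - 1)" using M.F_add[OF 1 2] by simp
    then show ?thesis using M.cst_eq_iff[of "act a' x'" "act a x" "i + j"] hR aR x'A xA h(2)
      by (simp add: act_closed)
  qed
  have "(\<Union>a'\<in>R.cst i a. \<Union>x'\<in>M.cst j x. F (i + j - 1) +>\<^bsub>A\<^esub> act a' x')
    = (\<Union>a'\<in>R.cst i a. \<Union>x'\<in>M.cst j x. M.cst (i + j) (act a x))"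
    unfolding M.cst_def[of "i + j", symmetric] using eq by simp
  then show ?thesis using R.cst_self[OF aR, of i] M.cst_self[OF xA, of j] by auto
qed

text \<open>
  Elements of the graded object are handled through families of representatives, one for each degree. The index set of the
  sum defining a product may be replaced by any larger finite set, as the other classes are zero.
\<close>
lemma gr_mult_cls:
  assumes a: "R.fam a" and b: "M.fam b" and I: "finite I" "\<And>i. a i \<notin> FR (i - 1) \<Longrightarrow> i \<in> I"
  shows "gr_mult act FR A F (R.cls a) (M.cls b) = M.cls (\<lambda>k. \<Oplus>\<^bsub>A\<^esub>i\<in>I. act (a i) (b (k - i)))"
proof
  fix k
  let ?I = "{i. a i \<notin> FR (i - 1)}"
  have supp: "{i. R.cls a i \<noteq> FR (i - 1)} = ?I"
    unfolding R.cls_def using R.cst_eq_zero R.fam_carrier[OF a] by simp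
  have sub: "?I \<subseteq> I" using I(2) by blast
  have fin: "finite ?I" using sub I(1) finite_subset by blast
  have in_F: "act (a i) (b (k - i)) \<in> F k" for i
    using act_filt[OF R.fam_F[OF a] M.fam_F[OF b], of i "k - i"] by simp
  have in_A: "act (a i) (b (k - i)) \<in> carrier A" for i using in_F M.F_carrier by blast
  have piece: "(\<Union>x\<in>R.cls a i. \<Union>y\<in>M.cls b (k - i). F (k - 1) +>\<^bsub>A\<^esub> act x y) = M.cst k (act (a i) (b (k - i)))" for i
    using product_of_cosets[OF R.fam_F[OF a, of i] M.fam_F[OF b, of "k - i"]] by (simp add: R.cls_def M.cls_def)
  have "gr_mult act FR A F (R.cls a) (M.cls b) k = finprod (gr_piece A F k) (\<lambda>i. M.cst k (act (a i) (b (k - i)))) ?I"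
    unfolding gr_mult_def supp piece ..
  also have "\<dots> = M.cst k (\<Oplus>\<^bsub>A\<^esub>i\<in>?I. act (a i) (b (k - i)))" by (rule M.gr_piece_finprod[OF fin in_F])
  also have "\<dots> = M.cst k (\<Oplus>\<^bsub>A\<^esub>i\<in>I. act (a i) (b (k - i)))"
  proof -
    have "(\<Oplus>\<^bsub>A\<^esub>i\<in>?I \<union> (I - ?I). act (a i) (b (k - i))) = (\<Oplus>\<^bsub>A\<^esub>i\<in>?I. act (a i) (b (k - i))) \<oplus>\<^bsub>A\<^esub> (\<Oplus>\<^bsub>A\<^esub>i\<in>I - ?I. act (a i) (b (k - i)))"
      by (rule M.finsum_Un_disjoint) (use fin I in_A in auto)
    moreover have "?I \<union> (I - ?I) = I" using sub by blast
    moreover have rest: "(\<Oplus>\<^bsub>A\<^esub>i\<in>I - ?I. act (a i) (b (k - i))) \<in> F (k - 1)"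
    proof (rule M.F_finsum)
      fix i assume "i \<in> I - ?I"
      then have "a i \<in> FR (i - 1)" by blast
      from act_filt[OF this M.fam_F[OF b, of "k - i"]] show "act (a i) (b (k - i)) \<in> F (k - 1)" by simp
    qed
    moreover have c: "(\<Oplus>\<^bsub>A\<^esub>i\<in>?I. act (a i) (b (k - i))) \<in> carrier A" "(\<Oplus>\<^bsub>A\<^esub>i\<in>I. act (a i) (b (k - i))) \<in> carrier A"
      using in_A by (auto intro!: M.finsum_closed)
    moreover have r: "(\<Oplus>\<^bsub>A\<^esub>i\<in>I - ?I. act (a i) (b (k - i))) \<in> carrier A" using rest M.F_carrier by blast
    ultimately have "(\<Oplus>\<^bsub>A\<^esub>i\<in>?I. act (a i) (b (k - i))) \<ominus>\<^bsub>A\<^esub> (\<Oplus>\<^bsub>A\<^esub>i\<in>I. act (a i) (b (k - i))) = \<ominus>\<^bsub>A\<^esub> (\<Oplus>\<^bsub>A\<^esub>i\<in>I - ?I. act (a i) (b (k - i)))"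
      by (simp add: a_minus_def M.minus_add M.a_assoc[symmetric] M.r_neg)
    then show ?thesis unfolding M.cst_eq_iff[OF c] using M.F_inv[OF rest] by simp
  qed
  finally show "gr_mult act FR A F (R.cls a) (M.cls b) k = M.cls (\<lambda>k. \<Oplus>\<^bsub>A\<^esub>i\<in>I. act (a i) (b (k - i))) k"
    by (simp add: M.cls_def)
qed

end

section \<open>The graded ring of the Weyl algebra\<close>

lemma mpol_additive_induct [case_names single add]:
  fixes p :: "'i \<Rightarrow>\<^sub>0 'k::comm_monoid_add"
  assumes "\<And>a c. P (single a c)" "\<And>p q. P p \<Longrightarrow> P q \<Longrightarrow> P (p + q)"
  shows "P p"
proof -
  have "P 0" using assms(1)[of undefined 0] by simp
  then have "P (\<Sum>a\<in>A. single a (f a))" for A f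
    by (induction A rule: infinite_finite_induct) (simp_all add: assms)
  moreover have "p = (\<Sum>i\<in>keys p. single i (lookup p i))"
    by (rule poly_mapping_eqI) (auto simp: lookup_sum lookup_single when_def in_keys_iff)
  ultimately show ?thesis by metis
qed

lemma KXY_simps [simp]:
  "carrier (KXY :: ('n::finite, 'k::field_char_0) polXY ring) = UNIV"
  "monoid.mult (KXY :: ('n, 'k) polXY ring) = (*)" "monoid.one (KXY :: ('n, 'k) polXY ring) = 1"
  "ring.zero (KXY :: ('n, 'k) polXY ring) = 0" "ring.add (KXY :: ('n, 'k) polXY ring) = (+)"
  by (auto simp: KXY_def ring_of_type_algebra_def)

lemma cring_KXY: "cring (KXY :: ('n::finite, 'k::field_char_0) polXY ring)"
  unfolding KXY_def by (rule cring_from_type_algebra)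

text \<open>
  The component of weighted degree \<open>k\<close>; the degree is an integer because filtrations are indexed by integers.
\<close>
definition hcomp :: "('v::finite \<Rightarrow> nat) \<Rightarrow> int \<Rightarrow> ('v, 'k::comm_ring_1) mpol \<Rightarrow> ('v, 'k) mpol" where
  "hcomp w k p = pm_restrict {a. int (wdeg w a) = k} p"

lemma lookup_hcomp: "lookup (hcomp w k p) a = (if int (wdeg w a) = k then lookup p a else 0)"
  by (simp add: hcomp_def lookup_pm_restrict)

lemma hcomp_add: "hcomp w k (p + q) = hcomp w k p + hcomp w k q"
  by (rule poly_mapping_eqI) (simp add: lookup_hcomp lookup_add)

lemma hcomp_zero [simp]: "hcomp w k 0 = 0"
  by (rule poly_mapping_eqI) (simp add: lookup_hcomp)

lemma hcomp_single: "hcomp w k (single a c) = (if int (wdeg w a) = k then single a c else 0)"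
  by (rule poly_mapping_eqI) (auto simp: lookup_hcomp lookup_single when_def)

lemma keys_hcomp: "a \<in> keys (hcomp w k p) \<Longrightarrow> int (wdeg w a) = k \<and> a \<in> keys p"
  by (auto simp: in_keys_iff lookup_hcomp split: if_splits)

definition wts :: "('v::finite \<Rightarrow> nat) \<Rightarrow> ('v, 'k::comm_ring_1) mpol \<Rightarrow> int set" where
  "wts w p = (\<lambda>a. int (wdeg w a)) ` keys p"

lemma finite_wts [simp]: "finite (wts w p)" by (simp add: wts_def)

lemma hcomp_outside: "k \<notin> wts w p \<Longrightarrow> hcomp w k p = 0"
  by (rule poly_mapping_eqI) (auto simp: lookup_hcomp wts_def in_keys_iff)

lemma hcomp_mult:
  fixes p q :: "('v::finite, 'k::comm_ring_1) mpol"
  assumes I: "finite I" "wts w p \<subseteq> I"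
  shows "hcomp w k (p * q) = (\<Sum>i\<in>I. hcomp w i p * hcomp w (k - i) q)"
  using I
proof (induction q arbitrary: I rule: mpol_additive_induct)
  case (add q1 q2)
  then show ?case by (simp add: distrib_left hcomp_add sum.distrib)
next
  case (single b d)
  have "hcomp w k (p * single b d) = hcomp w (k - int (wdeg w b)) p * single b d"
  proof (induction p rule: mpol_additive_induct)
    case (single a c)
    then show ?case by (auto simp: mult_single hcomp_single)
  qed (simp add: distrib_right hcomp_add)
  also have "\<dots> = (\<Sum>i\<in>I. if i = k - int (wdeg w b) then hcomp w i p * single b d else 0)"
  proof -
    have "k - int (wdeg w b) \<notin> I \<Longrightarrow> hcomp w (k - int (wdeg w b)) p = 0"
      using single(2) by (intro hcomp_outside) blast
    then show ?thesis using single(1) by (auto simp: sum.delta)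
  qed
  also have "\<dots> = (\<Sum>i\<in>I. hcomp w i p * hcomp w (k - i) (single b d))"
    by (intro sum.cong) (auto simp: hcomp_single)
  finally show ?case .
qed

locale weyl_module = left_module "weyl :: ('n::finite, 'k::field_char_0) endo ring" M
  for M :: "(('n::finite, 'k::field_char_0) endo, 'm) module" +
  fixes \<omega> :: "'n::finite + 'n \<Rightarrow> nat"
  assumes \<omega>: "\<omega> \<in> Omega"
begin

abbreviation W :: "('n, 'k) endo ring" where "W \<equiv> weyl"
abbreviation FW :: "int \<Rightarrow> ('n, 'k) endo set" where "FW \<equiv> weyl_filt \<omega>"

lemma \<omega>_pos: "\<omega> (Inl i) + \<omega> (Inr i) > 0" using \<omega> by (simp add: Omega_def)

lemma symb_closed [simp]: "(symb c :: ('n, 'k) endo) \<in> carrier weyl" unfolding carrier_weyl by simp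

lemma symb_in_FW: "symb c \<in> FW i \<longleftrightarrow> (\<forall>a\<in>keys c. int (wdeg \<omega> a) \<le> i)"
  unfolding weyl_filt_eq by (auto simp: symb_inj)

lemma FW_cases: assumes "w \<in> FW i" obtains c where "w = symb c" "\<forall>a\<in>keys c. int (wdeg \<omega> a) \<le> i"
  using assms unfolding weyl_filt_eq by auto

lemma symb_product:
  obtains s where "symb c \<circ> symb d = symb (c * d + s)"
    "\<forall>e\<in>keys s. \<exists>a\<in>keys c. \<exists>b\<in>keys d. below e (a + b)"
proof (rule product_of_symbs[of c d])
  fix s assume "symb c \<circ> symb d = symb (c * d + s)"
    "\<And>e. e \<in> keys s \<Longrightarrow> \<exists>a\<in>keys c. \<exists>b\<in>keys d. below e (a + b)"
  then show thesis by (intro that ballI)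
qed

lemma weyl_add_symb: "symb c \<oplus>\<^bsub>W\<^esub> symb d = symb (c + d)"
  by (simp add: symb_add[abs_def])

lemma weyl_zero_symb: "\<zero>\<^bsub>W\<^esub> = symb 0" by (rule ext) simp

lemma weyl_minus_symb: "\<ominus>\<^bsub>W\<^esub> symb c = symb (- c)"
proof (rule R.minus_equality)
  show "symb (- c) \<oplus>\<^bsub>W\<^esub> symb c = \<zero>\<^bsub>W\<^esub>" unfolding weyl_add_symb weyl_zero_symb by simp
qed simp_all

lemma weyl_finsum_symb: "(\<Oplus>\<^bsub>W\<^esub>i\<in>I. symb (f i)) = symb (\<Sum>i\<in>I. f i)"
proof (induction I rule: infinite_finite_induct)
  case (insert i I)
  have "(\<Oplus>\<^bsub>W\<^esub>i\<in>insert i I. symb (f i)) = symb (f i) \<oplus>\<^bsub>W\<^esub> (\<Oplus>\<^bsub>W\<^esub>i\<in>I. symb (f i))"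
    using insert.hyps by (intro R.finsum_insert) auto
  then show ?case unfolding insert.IH weyl_add_symb using insert.hyps by simp
qed (simp_all only: R.finsum_empty R.finsum_infinite sum.infinite sum.empty weyl_zero_symb not_False_eq_True)

lemma FW_filtered: "filtered_group W FW"
proof (intro filtered_group.intro filtered_group_axioms.intro R.abelian_group_axioms additive_subgroup.intro subgroup.intro)
  fix i
  show "FW i \<subseteq> carrier (add_monoid W)" by (auto simp: weyl_filt_def)
  show "\<one>\<^bsub>add_monoid W\<^esub> \<in> FW i" using symb_in_FW[of 0 i] weyl_zero_symb by simp
  show "FW i \<subseteq> FW (i + 1)" unfolding weyl_filt_eq by (force intro!: imageI)
next
  fix i x y assume xy: "x \<in> FW i" "y \<in> FW i"
  obtain c where c: "x = symb c" "\<forall>a\<in>keys c. int (wdeg \<omega> a) \<le> i" using xy(1) by (rule FW_cases)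
  obtain d where d: "y = symb d" "\<forall>a\<in>keys d. int (wdeg \<omega> a) \<le> i" using xy(2) by (rule FW_cases)
  have "symb (c + d) \<in> FW i" unfolding symb_in_FW using c(2) d(2) keys_add[of c d] by blast
  then show "x \<otimes>\<^bsub>add_monoid W\<^esub> y \<in> FW i" unfolding c(1) d(1) using weyl_add_symb by simp
next
  fix i x assume "x \<in> FW i"
  then obtain c where c: "x = symb c" "\<forall>a\<in>keys c. int (wdeg \<omega> a) \<le> i" by (rule FW_cases)
  have "symb (- c) \<in> FW i" unfolding symb_in_FW using c(2) by (auto simp: in_keys_iff)
  then have "\<ominus>\<^bsub>W\<^esub> x \<in> FW i" unfolding c(1) weyl_minus_symb .
  then show "inv\<^bsub>add_monoid W\<^esub> x \<in> FW i" by (simp only: a_inv_def)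
qed

sublocale FW: filtered_group W FW by (rule FW_filtered)

lemma FW_mult: assumes "x \<in> FW i" "y \<in> FW j" shows "x \<otimes>\<^bsub>W\<^esub> y \<in> FW (i + j)"
proof -
  obtain c where c: "x = symb c" "\<forall>a\<in>keys c. int (wdeg \<omega> a) \<le> i" using assms(1) by (rule FW_cases)
  obtain d where d: "y = symb d" "\<forall>a\<in>keys d. int (wdeg \<omega> a) \<le> j" using assms(2) by (rule FW_cases)
  obtain s where s: "symb c \<circ> symb d = symb (c * d + s)"
    "\<forall>e\<in>keys s. \<exists>a\<in>keys c. \<exists>b\<in>keys d. below e (a + b)" by (rule symb_product)
  have "int (wdeg \<omega> e) \<le> i + j" if "e \<in> keys (c * d + s)" for e
  proof -
    have "e \<in> keys (c * d) \<or> e \<in> keys s" using that keys_add[of "c * d" s] by blast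
    then obtain a b where ab: "a \<in> keys c" "b \<in> keys d" "wdeg \<omega> e \<le> wdeg \<omega> (a + b)"
    proof
      assume "e \<in> keys (c * d)"
      then obtain a b where ab: "e = a + b" "a \<in> keys c" "b \<in> keys d" using keys_mult[of c d] by blast
      show thesis by (rule that[OF ab(2,3)]) (simp only: ab(1) order_refl)
    next
      assume "e \<in> keys s"
      from bspec[OF s(2) this] obtain a b where "a \<in> keys c" "b \<in> keys d" "below e (a + b)" by blast
      then show thesis by (intro that[of a b] below_wdeg_le)
    qed
    then show ?thesis using bspec[OF c(2) ab(1)] bspec[OF d(2) ab(2)] ab(3) by simp
  qed
  then show ?thesis unfolding c(1) d(1) by (simp add: s(1) symb_in_FW)
qed

lemma symb_mult_congruent:
  assumes "\<And>a. a \<in> keys c \<Longrightarrow> int (wdeg \<omega> a) \<le> i" "\<And>a. a \<in> keys d \<Longrightarrow> int (wdeg \<omega> a) \<le> j"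
  obtains s where "symb c \<otimes>\<^bsub>W\<^esub> symb d = symb (c * d + s)" "symb s \<in> FW (i + j - 1)"
proof -
  obtain s where s: "symb c \<circ> symb d = symb (c * d + s)"
    "\<forall>e\<in>keys s. \<exists>a\<in>keys c. \<exists>b\<in>keys d. below e (a + b)" by (rule symb_product)
  have "int (wdeg \<omega> e) \<le> i + j - 1" if e: "e \<in> keys s" for e
  proof -
    from bspec[OF s(2) e] obtain a b where ab: "a \<in> keys c" "b \<in> keys d" "below e (a + b)" by blast
    have "wdeg \<omega> e < wdeg \<omega> (a + b)" by (rule below_wdeg_less[OF ab(3) \<omega>_pos])
    then show ?thesis using assms(1)[OF ab(1)] assms(2)[OF ab(2)] by simp
  qed
  then show ?thesis using that[of s] s(1) by (simp add: symb_in_FW)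
qed

lemma FW_self_action: "filtered_action W FW W FW (monoid.mult W)"
  by (intro filtered_action.intro filtered_action_axioms.intro FW_filtered FW_mult)
     (simp_all only: R.m_closed R.l_distr R.r_distr)

sublocale self: filtered_action W FW W FW "monoid.mult W" by (rule FW_self_action)

subsection \<open>Identification with the polynomial ring\<close>

text \<open>
  The candidate for the identification: the homogeneous component of degree \<open>i\<close>, read as a normally ordered
  symbol, represents the component of degree \<open>i\<close> of the graded ring.
\<close>
definition ident :: "('n, 'k) polXY \<Rightarrow> int \<Rightarrow> ('n, 'k) endo set" where
  "ident p = FW.cls (\<lambda>i. symb (hcomp \<omega> i p))"

lemma hcomp_in_FW: "symb (hcomp \<omega> i p) \<in> FW i"
  unfolding symb_in_FW using keys_hcomp by fastforce

lemma fam_ident: "FW.fam (\<lambda>i. symb (hcomp \<omega> i p))"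
proof (rule FW.famI[OF hcomp_in_FW, of "wts \<omega> p"])
  fix k assume "k \<notin> wts \<omega> p"
  then show "symb (hcomp \<omega> k p) \<in> FW (k - 1)" by (simp add: hcomp_outside symb_in_FW del: symb_zero)
qed simp

lemma ident_support: "symb (hcomp \<omega> i p) \<notin> FW (i - 1) \<Longrightarrow> i \<in> wts \<omega> p"
  by (rule ccontr) (simp add: hcomp_outside symb_in_FW)

lemma ident_add: "ident (p + q) = ident p \<oplus>\<^bsub>gr_ring W FW\<^esub> ident q"
  unfolding ident_def gr_ring_def ring_record_simps
  by (subst FW.gr_group_mult) (simp_all add: hcomp_add symb_add[abs_def])

lemma ident_mult: "ident (p * q) = ident p \<otimes>\<^bsub>gr_ring W FW\<^esub> ident q"
proof -
  let ?I = "wts \<omega> p"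
  have "\<forall>k i. \<exists>s. symb (hcomp \<omega> i p) \<otimes>\<^bsub>W\<^esub> symb (hcomp \<omega> (k - i) q) = symb (hcomp \<omega> i p * hcomp \<omega> (k - i) q + s) \<and> symb s \<in> FW (k - 1)"
  proof (intro allI)
    fix k i
    obtain s where "symb (hcomp \<omega> i p) \<otimes>\<^bsub>W\<^esub> symb (hcomp \<omega> (k - i) q) = symb (hcomp \<omega> i p * hcomp \<omega> (k - i) q + s)" "symb s \<in> FW (i + (k - i) - 1)"
      by (rule symb_mult_congruent[of "hcomp \<omega> i p" i "hcomp \<omega> (k - i) q" "k - i"]) (use keys_hcomp in fastforce)+
    then show "\<exists>s. symb (hcomp \<omega> i p) \<otimes>\<^bsub>W\<^esub> symb (hcomp \<omega> (k - i) q) = symb (hcomp \<omega> i p * hcomp \<omega> (k - i) q + s) \<and> symb s \<in> FW (k - 1)"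
      by (intro exI[of _ s]) simp
  qed
  then have "\<exists>s. \<forall>k i. symb (hcomp \<omega> i p) \<otimes>\<^bsub>W\<^esub> symb (hcomp \<omega> (k - i) q) = symb (hcomp \<omega> i p * hcomp \<omega> (k - i) q + s k i) \<and> symb (s k i) \<in> FW (k - 1)"
    unfolding choice_iff .
  then obtain s where s: "\<forall>k i. symb (hcomp \<omega> i p) \<otimes>\<^bsub>W\<^esub> symb (hcomp \<omega> (k - i) q) = symb (hcomp \<omega> i p * hcomp \<omega> (k - i) q + s k i) \<and> symb (s k i) \<in> FW (k - 1)"
    by (rule exE)
  have "ident p \<otimes>\<^bsub>gr_ring W FW\<^esub> ident q = FW.cls (\<lambda>k. \<Oplus>\<^bsub>W\<^esub>i\<in>?I. symb (hcomp \<omega> i p) \<otimes>\<^bsub>W\<^esub> symb (hcomp \<omega> (k - i) q))"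
    unfolding ident_def gr_ring_def monoid_record_simps
    by (rule self.gr_mult_cls[OF fam_ident fam_ident finite_wts ident_support])
  also have "\<dots> = FW.cls (\<lambda>k. symb (hcomp \<omega> k (p * q) + (\<Sum>i\<in>?I. s k i)))"
  proof (rule arg_cong[where f = FW.cls], rule ext)
    fix k
    have "(\<Oplus>\<^bsub>W\<^esub>i\<in>?I. symb (hcomp \<omega> i p) \<otimes>\<^bsub>W\<^esub> symb (hcomp \<omega> (k - i) q)) = (\<Oplus>\<^bsub>W\<^esub>i\<in>?I. symb (hcomp \<omega> i p * hcomp \<omega> (k - i) q + s k i))"
      using s by (simp only:)
    also have "\<dots> = symb (hcomp \<omega> k (p * q) + (\<Sum>i\<in>?I. s k i))"
      unfolding weyl_finsum_symb sum.distrib hcomp_mult[OF finite_wts order_refl, of \<omega> k p q] ..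
    finally show "(\<Oplus>\<^bsub>W\<^esub>i\<in>?I. symb (hcomp \<omega> i p) \<otimes>\<^bsub>W\<^esub> symb (hcomp \<omega> (k - i) q)) = symb (hcomp \<omega> k (p * q) + (\<Sum>i\<in>?I. s k i))" .
  qed
  also have "\<dots> = ident (p * q)"
    unfolding ident_def
  proof (subst FW.cls_eq_iff)
    show "\<forall>k. symb (hcomp \<omega> k (p * q) + (\<Sum>i\<in>?I. s k i)) \<ominus>\<^bsub>W\<^esub> symb (hcomp \<omega> k (p * q)) \<in> FW (k - 1)"
    proof
      fix k
      have "symb (hcomp \<omega> k (p * q) + (\<Sum>i\<in>?I. s k i)) \<ominus>\<^bsub>W\<^esub> symb (hcomp \<omega> k (p * q)) = symb (\<Sum>i\<in>?I. s k i)"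
        unfolding a_minus_def weyl_minus_symb weyl_add_symb by simp
      also have "\<dots> \<in> FW (k - 1)" unfolding weyl_finsum_symb[symmetric] by (rule FW.F_finsum) (use s in blast)
      finally show "symb (hcomp \<omega> k (p * q) + (\<Sum>i\<in>?I. s k i)) \<ominus>\<^bsub>W\<^esub> symb (hcomp \<omega> k (p * q)) \<in> FW (k - 1)" .
    qed
  qed (rule symb_closed)+
  finally show ?thesis ..
qed

lemma ident_single:
  "ident (single a c) = gr_class W FW (int (wdeg \<omega> a)) (symb (single a c))"
  unfolding ident_def FW.gr_class_cls[OF symb_closed]
  by (rule arg_cong[where f = FW.cls]) (auto simp: hcomp_single weyl_zero_symb simp del: weyl_simps symb_zero)

lemma ident_hom: "ident \<in> ring_hom KXY (gr_ring W FW)"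
proof (rule ring_hom_memI)
  fix p :: "('n, 'k) polXY"
  show "ident p \<in> carrier (gr_ring W FW)"
    unfolding gr_ring_def partial_object.simps FW.gr_group_carrier ident_def using fam_ident by blast
next
  show "ident \<one>\<^bsub>KXY\<^esub> = \<one>\<^bsub>gr_ring W FW\<^esub>"
    using ident_single[of 0 1] by (simp add: gr_ring_def)
qed (simp_all add: ident_mult ident_add)

lemma ident_pconst: "ident (pconst c) = gr_class W FW 0 (pscale c)"
  using ident_single[of 0 c] by (simp add: pconst_def pscale_symb)

lemma ident_pvar: "ident (pvar v) = gr_class W FW (int (\<omega> v)) (weyl_gen v)"
  using ident_single[of "single v 1" 1] by (simp only: pvar_def symb_mon weyl_monom_single wdeg_single mult_1_right)

text \<open>
  A ring homomorphism out of a polynomial ring is determined by its values on constants and variables; this resolves the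
  definite description in the identification map.
\<close>
lemma KXY_hom_unique:
  assumes f: "f \<in> ring_hom (KXY :: ('n, 'k) polXY ring) S" and g: "g \<in> ring_hom KXY S"
    and eq: "\<And>c. f (pconst c) = g (pconst c)" "\<And>v. f (pvar v) = g (pvar v)"
  shows "f = g"
proof
  note hom = ring_hom_mult[OF f] ring_hom_mult[OF g] ring_hom_add[OF f] ring_hom_add[OF g]
  have mon: "f (mon a) = g (mon a)" for a
  proof (induction "mdeg a" arbitrary: a)
    case 0
    then have "a = 0" by (metis mdeg_eq_0)
    then show ?case using eq(1)[of 1] by (simp add: pconst_def)
  next
    case (Suc n)
    then have "a \<noteq> 0" by auto
    then obtain v where "lookup a v \<noteq> 0" by (auto simp: poly_mapping_eq_iff fun_eq_iff)
    then have a: "a = single v 1 + (a - single v 1)"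
      using exponent_split_off[of 1 a v] by (simp add: add.commute)
    have "mdeg a = Suc (mdeg (a - single v 1))" by (subst a) simp
    then have "f (mon (a - single v 1)) = g (mon (a - single v 1))"
      using Suc.hyps by simp
    moreover have "mon a = (pvar v * mon (a - single v 1) :: ('n, 'k) polXY)"
      by (subst a) (simp add: pvar_def mult_single)
    ultimately show ?case using hom(1,2)[of "pvar v" "mon (a - single v 1)"] eq(2)[of v] by simp
  qed
  fix p
  show "f p = g p"
  proof (induction p rule: mpol_additive_induct)
    case (single a c)
    have "single a c = pconst c * mon a" by (simp add: pconst_def mult_single)
    then show ?case using hom(1,2)[of "pconst c" "mon a"] mon eq(1) by simp
  next
    case (add p q)
    then show ?case using hom(3,4)[of p q] by simp
  qed
qed

lemma gr_ident_eq: "gr_ident \<omega> = ident"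
  unfolding gr_ident_def
proof (rule the_equality)
  show "ident \<in> ring_hom KXY (gr_ring W FW) \<and> (\<forall>c. ident (pconst c) = gr_class W FW 0 (pscale c)) \<and>
    (\<forall>v. ident (pvar v) = gr_class W FW (int (\<omega> v)) (weyl_gen v))"
    using ident_hom ident_pconst ident_pvar by blast
  fix f assume "f \<in> ring_hom KXY (gr_ring W FW) \<and> (\<forall>c. f (pconst c) = gr_class W FW 0 (pscale c)) \<and>
    (\<forall>v. f (pvar v) = gr_class W FW (int (\<omega> v)) (weyl_gen v))"
  then show "f = ident"
    by (intro KXY_hom_unique[OF _ ident_hom]) (simp_all add: ident_pconst ident_pvar)
qed

lemma kmodule_weyl: "kmodule W M pscale"
proof (intro kmodule.intro left_module_axioms kmodule_axioms.intro)
  fix c d :: 'k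
  show "pscale c \<in> carrier W" by (simp add: pscale_symb)
  show "pscale (c + d) = pscale c \<oplus>\<^bsub>W\<^esub> pscale d" by (rule ext) (simp add: pscale_sc pm.scale_left_distrib)
  show "pscale (c * d) = pscale c \<otimes>\<^bsub>W\<^esub> pscale d" by (rule ext) (simp add: pscale_sc)
  show "pscale 1 = \<one>\<^bsub>W\<^esub>" by (rule ext) (simp add: pscale_sc)
  show "pscale c = \<zero>\<^bsub>W\<^esub> \<longleftrightarrow> c = 0"
    unfolding pscale_symb weyl_zero_symb symb_inj by (metis lookup_single_eq single_zero)
  fix b assume "b \<in> carrier W"
  then obtain q where "b = symb q" unfolding carrier_weyl by blast
  then show "pscale c \<otimes>\<^bsub>W\<^esub> b = b \<otimes>\<^bsub>W\<^esub> pscale c" by (auto simp: fun_eq_iff pscale_sc symb_linear_sc)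
qed

sublocale KM: kmodule W M pscale by (rule kmodule_weyl)

end

section \<open>Normal forms with respect to a staircase\<close>

context framed_module
begin

text \<open>
  Well-founded induction along the monomial order, replacing each nonstandard generator by smaller ones.
\<close>
lemma staircase_reduction:
  assumes red: "\<And>e. e \<in> UNIV \<times> {..<r} \<Longrightarrow> e \<notin> D \<Longrightarrow>
      \<exists>b. gx e = lin gx b \<and> (\<forall>f\<in>keys b. f \<in> UNIV \<times> {..<r} \<and> mless w p f e \<and> \<delta> f \<le> (\<delta> e :: nat))"
    and e: "e \<in> UNIV \<times> {..<r}"
  shows "\<exists>b. gx e = lin gx b \<and> keys b \<subseteq> {f \<in> D. \<delta> f \<le> \<delta> e}"
  using mless_wf[of w p r] e
proof (induction e rule: wf_induct_rule)
  case (less e)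
  show ?case
  proof (cases "e \<in> D")
    case True
    then show ?thesis
      by (intro exI[of _ "single e 1"]) (auto simp: lin_single[of gx, OF gx_closed] scal_one)
  next
    case False
    from red[OF less.prems this] obtain b where b: "gx e = lin gx b"
      "\<forall>f\<in>keys b. f \<in> UNIV \<times> {..<r} \<and> mless w p f e \<and> \<delta> f \<le> \<delta> e" by (elim exE conjE)
    have "\<forall>f\<in>keys b. \<exists>c. gx f = lin gx c \<and> keys c \<subseteq> {g \<in> D. \<delta> g \<le> \<delta> f}"
    proof
      fix f assume f: "f \<in> keys b"
      show "\<exists>c. gx f = lin gx c \<and> keys c \<subseteq> {g \<in> D. \<delta> g \<le> \<delta> f}"
        by (rule less.IH) (use b(2) f in auto)
    qed
    from bchoice[OF this] obtain c where c: "\<forall>f\<in>keys b. gx f = lin gx (c f) \<and> keys (c f) \<subseteq> {g \<in> D. \<delta> g \<le> \<delta> f}"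
      by (rule exE)
    let ?s = "\<Sum>f\<in>keys b. sc (lookup b f) (c f)"
    have "lin gx ?s = (\<Oplus>\<^bsub>N\<^esub>f\<in>keys b. scal (lookup b f) (lin gx (c f)))"
      by (rule lin_indep_relation[of gx, OF gx_closed finite_keys])
    also have "\<dots> = (\<Oplus>\<^bsub>N\<^esub>f\<in>keys b. scal (lookup b f) (gx f))"
      by (rule M.add.finprod_cong') (use c in auto)
    also have "\<dots> = gx e" unfolding b(1) lin_def ..
    finally have "gx e = lin gx ?s" ..
    moreover have "keys ?s \<subseteq> {f \<in> D. \<delta> f \<le> \<delta> e}"
    proof (rule keys_sum_subset)
      fix f assume f: "f \<in> keys b"
      show "keys (sc (lookup b f) (c f)) \<subseteq> {f \<in> D. \<delta> f \<le> \<delta> e}"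
      proof
        fix g assume "g \<in> keys (sc (lookup b f) (c f))"
        from subsetD[OF keys_sc this] have "g \<in> D" "\<delta> g \<le> \<delta> f" using c f by auto
        moreover have "\<delta> f \<le> \<delta> e" using b(2) f by blast
        ultimately show "g \<in> {f \<in> D. \<delta> f \<le> \<delta> e}" by simp
      qed
    qed
    ultimately show ?thesis by (intro exI conjI)
  qed
qed

text \<open>
  If the generators indexed by a staircase are independent and the others reduce to them with controlled total degree,
  dimensions are sandwiched between counts of staircase elements. The measure \<open>\<delta>\<close> bounds the degrees
  that occur during a reduction; a linear bound suffices, since growth exponents ignore linear substitutions.
\<close>
lemma staircase_growth_FN:
  assumes D: "staircase r D" "carrier N \<noteq> {\<zero>\<^bsub>N\<^esub>}"
    and indep: "\<And>a. keys a \<subseteq> D \<Longrightarrow> lin gx a = \<zero>\<^bsub>N\<^esub> \<Longrightarrow> a = 0"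
    and red: "\<And>e. e \<in> UNIV \<times> {..<r} \<Longrightarrow> e \<notin> D \<Longrightarrow>
      \<exists>b. gx e = lin gx b \<and> (\<forall>f\<in>keys b. f \<in> UNIV \<times> {..<r} \<and> mless w p f e \<and> \<delta> f \<le> (\<delta> e :: nat))"
    and \<delta>: "\<And>e. mdeg (fst e) \<le> \<delta> e" "\<And>e. e \<in> UNIV \<times> {..<r} \<Longrightarrow> \<delta> e \<le> c * mdeg (fst e) + c'"
  shows "growth (\<lambda>i. vdim (range \<kappa>) B N (FN i)) (coordinate_dim D)" and "D \<noteq> {}"
proof -
  have Dr: "D \<subseteq> UNIV \<times> {..<r}" using D(1) by (simp add: staircase_def)
  have nf: "\<exists>b. gx e = lin gx b \<and> keys b \<subseteq> {f \<in> D. \<delta> f \<le> \<delta> e}" if er: "e \<in> UNIV \<times> {..<r}" for e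
    by (rule staircase_reduction[where w = w and p = p and \<delta> = \<delta>]) (rule red, assumption+, rule er)
  have fin: "finite {e \<in> D. mdeg (fst e) \<le> i}" for i
    by (rule finite_subset[OF _ finite_mdeg_le_pairs[of r i]]) (use Dr in auto)
  show ne: "D \<noteq> {}"
  proof
    assume D0: "D = {}"
    have "gx e = \<zero>\<^bsub>N\<^esub>" if e: "e \<in> UNIV \<times> {..<r}" for e
    proof -
      from nf[OF e] obtain b where "gx e = lin gx b" "keys b \<subseteq> {f \<in> D. \<delta> f \<le> \<delta> e}" by (elim exE conjE)
      then have "b = 0" using D0 by simp
      then show ?thesis using \<open>gx e = lin gx b\<close> lin_0[of gx, OF gx_closed] by simp
    qed
    then have "gx ` (UNIV \<times> {..<r}) \<subseteq> {\<zero>\<^bsub>N\<^esub>}" by blast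
    moreover have "ksub {\<zero>\<^bsub>N\<^esub>}" by (simp add: ksub_def)
    ultimately have "kspan (gx ` (UNIV \<times> {..<r})) \<subseteq> {\<zero>\<^bsub>N\<^esub>}" by (intro kspan_minimal)
    then have "carrier N \<subseteq> {\<zero>\<^bsub>N\<^esub>}" using m_gen by (simp add: gx_def[abs_def])
    then show False using D(2) M.zero_closed by blast
  qed
  show "growth (\<lambda>i. vdim (range \<kappa>) B N (FN i)) (coordinate_dim D)"
  proof (rule growth_transfer[OF staircase_growth[OF D(1) ne]])
    fix i
    let ?T = "{e \<in> D. mdeg (fst e) \<le> c * i + c'}"
    have gT: "gx ` ?T \<subseteq> carrier N" by auto
    have sub: "FN i \<subseteq> kspan (gx ` ?T)"
      unfolding FN_def
    proof (rule kspan_minimal[OF kspan_ksub[OF gT]], rule image_subsetI)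
      fix e :: "('v \<Rightarrow>\<^sub>0 nat) \<times> nat" assume e: "e \<in> {e \<in> UNIV \<times> {..<r}. mdeg (fst e) \<le> i}"
      then have er: "e \<in> UNIV \<times> {..<r}" by simp
      from nf[OF er] obtain b where b: "gx e = lin gx b" "keys b \<subseteq> {f \<in> D. \<delta> f \<le> \<delta> e}" by (elim exE conjE)
      have "\<delta> e \<le> c * mdeg (fst e) + c'" by (rule \<delta>(2)[OF er])
      also have "\<dots> \<le> c * i + c'" using e by simp
      finally have "keys b \<subseteq> ?T" using b(2) \<delta>(1) order_trans by fastforce
      then show "gx e \<in> kspan (gx ` ?T)" unfolding kspan_eq_lin[of gx, OF gx_closed] b(1) by blast
    qed
    have "vdim (range \<kappa>) B N (FN i) \<le> card (gx ` ?T)"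
      by (rule vdim_le_card[OF FN_sub sub _ gT]) (rule finite_imageI[OF fin])
    also have "\<dots> \<le> card ?T" by (rule card_image_le[OF fin])
    finally show "vdim (range \<kappa>) B N (FN i) \<le> card {e \<in> D. mdeg (fst e) \<le> c * i + c'}" .
    have fg: "finite (gx ` {e \<in> UNIV \<times> {..<r}. mdeg (fst e) \<le> i})" by (rule finite_imageI[OF finite_mdeg_le_pairs])
    have "card {e \<in> D. mdeg (fst e) \<le> i} \<le> vdim (range \<kappa>) B N (FN i)"
    proof (rule family_le_vdim[OF FN_sub _ fg _ gx_closed fin])
      show "FN i \<subseteq> kspan (gx ` {e \<in> UNIV \<times> {..<r}. mdeg (fst e) \<le> i})" by (simp add: FN_def)
      show "gx ` {e \<in> D. mdeg (fst e) \<le> i} \<subseteq> FN i" using Dr by (auto intro!: gx_in_FN)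
      fix a :: "('v \<Rightarrow>\<^sub>0 nat) \<times> nat \<Rightarrow>\<^sub>0 'k" assume "keys a \<subseteq> {e \<in> D. mdeg (fst e) \<le> i}" "lin gx a = \<zero>\<^bsub>N\<^esub>"
      then show "a = 0" by (intro indep) auto
    qed auto
    then show "card {e \<in> D. mdeg (fst e) \<le> i} \<le> vdim (range \<kappa>) B N (FN (1 * i + 0))" by simp
  qed
qed

end

lemma wdeg_le_mdeg: "wdeg w a \<le> (\<Sum>v\<in>UNIV. w v) * mdeg a"
proof -
  have "wdeg w a \<le> (\<Sum>v\<in>UNIV. w v * mdeg a)"
    unfolding wdeg_def[of w] by (intro sum_mono mult_le_mono2 lookup_le_mdeg)
  then show ?thesis by (simp add: sum_distrib_right)
qed

definition leads :: "('v::finite \<Rightarrow> nat) \<Rightarrow> (nat \<Rightarrow> nat) \<Rightarrow> (('v \<Rightarrow>\<^sub>0 nat) \<times> nat \<Rightarrow>\<^sub>0 'k::zero) \<Rightarrow> ('v \<Rightarrow>\<^sub>0 nat) \<times> nat \<Rightarrow> bool" where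
  "leads w p a e \<longleftrightarrow> e \<in> keys a \<and> (\<forall>f\<in>keys a. f \<noteq> e \<longrightarrow> mless w p f e)"

lemma leads_exists: assumes "a \<noteq> 0" shows "\<exists>e. leads w p a e"
proof -
  have "\<exists>m\<in>keys a. \<forall>x\<in>keys a. x \<noteq> m \<longrightarrow> mless w p x m"
  proof (rule finite_has_greatest)
    show "keys a \<noteq> {}" using assms by simp
    show "mless w p x z" if "mless w p x y" "mless w p y z" for x y z using that by (rule mless_trans)
    show "mless w p x y \<or> mless w p y x" if "x \<noteq> y" for x y using that by (rule mless_total)
  qed simp
  then show ?thesis unfolding leads_def by blast
qed

text \<open>
  A tuple of polynomials is encoded as one coefficient family on pairs; this is the inclusion of the \<open>j\<close>-th
  summand.
\<close>
definition emb :: "nat \<Rightarrow> ('v, 'k::comm_monoid_add) mpol \<Rightarrow> ('v \<Rightarrow>\<^sub>0 nat) \<times> nat \<Rightarrow>\<^sub>0 'k" where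
  "emb j c = (\<Sum>a\<in>keys c. single (a, j) (lookup c a))"

lemma lookup_emb: "lookup (emb j c) e = (if snd e = j then lookup c (fst e) else 0)"
proof (cases e)
  case (Pair x k)
  show ?thesis unfolding Pair emb_def lookup_sum
    by (cases "k = j") (auto simp: lookup_single when_def in_keys_iff intro!: sum.neutral)
qed

lemma emb_add: "emb j (c + d) = emb j c + emb j d"
  by (rule poly_mapping_eqI) (simp add: lookup_emb lookup_add)
lemma emb_single [simp]: "emb j (single a c) = single (a, j) c"
  by (rule poly_mapping_eqI) (auto simp: lookup_emb lookup_single when_def prod_eq_iff)
lemma keys_emb: "e \<in> keys (emb j c) \<longleftrightarrow> snd e = j \<and> fst e \<in> keys c"
  by (simp add: in_keys_iff lookup_emb)

definition component :: "nat \<Rightarrow> (('v \<Rightarrow>\<^sub>0 nat) \<times> nat \<Rightarrow>\<^sub>0 'k::comm_monoid_add) \<Rightarrow> ('v, 'k) mpol" where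
  "component j a = (\<Sum>e\<in>keys a. if snd e = j then single (fst e) (lookup a e) else 0)"

lemma lookup_component: "lookup (component j a) x = lookup a (x, j)"
proof -
  have "lookup (component j a) x = (\<Sum>e\<in>keys a. if e = (x, j) then lookup a e else 0)"
    unfolding component_def lookup_sum by (intro sum.cong) (auto simp: lookup_single when_def prod_eq_iff)
  then show ?thesis by (auto simp: in_keys_iff)
qed

lemma emb_component_sum:
  assumes "keys a \<subseteq> UNIV \<times> {..<r}"
  shows "a = (\<Sum>j<r. emb j (component j a))"
proof (rule poly_mapping_eqI)
  fix e
  have "lookup (\<Sum>j<r. emb j (component j a)) e = (\<Sum>j<r. if j = snd e then lookup a e else 0)"
    unfolding lookup_sum lookup_emb lookup_component by (intro sum.cong) auto
  also have "\<dots> = lookup a e"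
    using assms by (cases e) (auto simp: in_keys_iff mem_Times_iff subset_iff)
  finally show "lookup a e = lookup (\<Sum>j<r. emb j (component j a)) e" ..
qed

section \<open>The graded module of a good filtration\<close>

context weyl_module
begin

sublocale KR: kmodule W "regular_module W" pscale by (rule KM.kmodule_regular)

lemma KR_lin: "KR.lin weyl_monom c = symb c"
proof (induction c rule: mpol_additive_induct)
  have cl: "weyl_monom a \<in> carrier (regular_module W)" for a by (simp flip: symb_mon)
  case (single a k)
  have "KR.lin weyl_monom (single a k) = KR.scal k (weyl_monom a)" by (rule KR.lin_single[of weyl_monom, OF cl])
  also have "\<dots> = symb (single a k)"
    by (rule ext) (simp add: KR.scal_def symb_single pscale_sc)
  finally show ?case .
next
  have cl: "weyl_monom a \<in> carrier (regular_module W)" for a by (simp flip: symb_mon)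
  case (add p q)
  have "KR.lin weyl_monom (p + q) = KR.lin weyl_monom p \<oplus>\<^bsub>regular_module W\<^esub> KR.lin weyl_monom q" by (rule KR.lin_add[of weyl_monom, OF cl])
  also have "\<dots> = symb p \<oplus>\<^bsub>W\<^esub> symb q" unfolding add by (simp only: regular_module_simps)
  also have "\<dots> = symb (p + q)" by (rule weyl_add_symb)
  finally show ?case .
qed

lemma weyl_monom_closed: "(weyl_monom a :: ('n, 'k) endo) \<in> carrier W" by (simp flip: symb_mon)

lemma KR_kspan: "KR.kspan (weyl_monom ` I) = symb ` {c. keys c \<subseteq> I}"
  using KR.kspan_eq_lin[of weyl_monom I] weyl_monom_closed by (simp add: KR_lin)

lemma weyl_u_gen: "weyl_monom (single v 1) \<otimes>\<^bsub>W\<^esub> weyl_monom b \<in> KR.kspan (weyl_monom ` {c. mdeg c \<le> mdeg b + 1})"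
proof -
  let ?q = "mon (single v 1 + b) + extra v b :: ('n, 'k) polXY"
  have "weyl_monom (single v 1) \<otimes>\<^bsub>W\<^esub> weyl_monom b = symb ?q"
    by (rule ext) (simp only: weyl_simps o_apply weyl_monom_single gen_times_monom)
  moreover have "keys ?q \<subseteq> {c. mdeg c \<le> mdeg b + 1}"
  proof
    fix c assume "c \<in> keys ?q"
    from subsetD[OF keys_add this] show "c \<in> {c. mdeg c \<le> mdeg b + 1}"
    proof
      assume "c \<in> keys (mon (single v 1 + b) :: ('n, 'k) polXY)"
      then show ?thesis by simp
    next
      assume "c \<in> keys (extra v b :: ('n, 'k) polXY)"
      from below_wdeg_le[OF extra_below[OF this], of "\<lambda>_. Suc 0"] show ?thesis by simp
    qed
  qed
  ultimately show ?thesis unfolding KR_kspan by blast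
qed

lemma weyl_u_peel:
  assumes "a \<noteq> 0"
  shows "\<exists>v b. a = single v 1 + b \<and> weyl_monom a = weyl_monom (single v 1) \<otimes>\<^bsub>W\<^esub> weyl_monom b"
  unfolding weyl_monom_single weyl_simps by (rule weyl_monom_peel[OF assms])

end

text \<open>
  The generators are extended by zero to a total function, so that they are elements of the module at every index.
\<close>
locale good_filtered = weyl_module M \<omega>
  for M :: "(('n::finite, 'k::field_char_0) endo, 'm) module" and \<omega> :: "'n::finite + 'n \<Rightarrow> nat" +
  fixes F :: "int \<Rightarrow> 'm set" and r :: nat and mm :: "nat \<Rightarrow> 'm" and p :: "nat \<Rightarrow> int"
  assumes filt: "module_filtration FW M F"
    and mm_closed: "mm j \<in> carrier M" and mm_zero: "r \<le> j \<Longrightarrow> mm j = \<zero>\<^bsub>M\<^esub>"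
    and gen: "F i = {\<Oplus>\<^bsub>M\<^esub>j\<in>{..<r}. a j \<odot>\<^bsub>M\<^esub> mm j | a. \<forall>j<r. a j \<in> FW (i - p j)}"
begin

lemma F_filtered: "filtered_group M F"
  using filt unfolding module_filtration_def
  by (intro filtered_group.intro filtered_group_axioms.intro M.abelian_group_axioms) auto

sublocale FM: filtered_group M F by (rule F_filtered)

lemma F_action: "filtered_action W FW M F (module.smult M)"
proof (intro filtered_action.intro filtered_action_axioms.intro FW_filtered F_filtered)
  show "a \<odot>\<^bsub>M\<^esub> x \<in> F (i + j)" if "a \<in> FW i" "x \<in> F j" for a x i j
    using filt that unfolding module_filtration_def by blast
qed (simp_all only: smult_closed smult_l_distr smult_r_distr)

sublocale FA: filtered_action W FW M F "module.smult M" by (rule F_action)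

definition gm :: "('n + 'n \<Rightarrow>\<^sub>0 nat) \<times> nat \<Rightarrow> 'm" where "gm e = weyl_monom (fst e) \<odot>\<^bsub>M\<^esub> mm (snd e)"

lemma gm_closed [simp]: "gm e \<in> carrier M" unfolding gm_def by (intro smult_closed weyl_monom_closed mm_closed)

abbreviation \<Psi> :: "(('n + 'n \<Rightarrow>\<^sub>0 nat) \<times> nat \<Rightarrow>\<^sub>0 'k) \<Rightarrow> 'm" where "\<Psi> \<equiv> KM.lin gm"

lemmas \<Psi>_closed = KM.lin_closed[of gm, OF gm_closed]
lemmas \<Psi>_add = KM.lin_add[of gm, OF gm_closed]
lemmas \<Psi>_sum = KM.lin_sum[of gm, OF gm_closed]
lemmas \<Psi>_zero = KM.lin_0[of gm, OF gm_closed]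
lemmas \<Psi>_single = KM.lin_single[of gm, OF gm_closed]
lemmas \<Psi>_uminus = KM.lin_uminus[of gm, OF gm_closed]

lemma symb_smult: "symb c \<odot>\<^bsub>M\<^esub> mm j = \<Psi> (emb j c)"
proof (induction c rule: mpol_additive_induct)
  case (single a k)
  have "symb (single a k) = pscale k \<otimes>\<^bsub>W\<^esub> weyl_monom a"
    by (rule ext) (simp add: symb_single pscale_sc)
  then have "symb (single a k) \<odot>\<^bsub>M\<^esub> mm j = pscale k \<odot>\<^bsub>M\<^esub> (weyl_monom a \<odot>\<^bsub>M\<^esub> mm j)"
    by (simp only: smult_assoc KM.k_closed weyl_monom_closed mm_closed)
  then show ?case unfolding emb_single \<Psi>_single by (simp add: gm_def KM.scal_def)
next
  case (add c d)
  have "symb (c + d) \<odot>\<^bsub>M\<^esub> mm j = symb c \<odot>\<^bsub>M\<^esub> mm j \<oplus>\<^bsub>M\<^esub> symb d \<odot>\<^bsub>M\<^esub> mm j"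
    unfolding weyl_add_symb[symmetric] by (rule smult_l_distr[OF symb_closed symb_closed mm_closed])
  then show ?case unfolding emb_add \<Psi>_add add .
qed

definition wt :: "('n + 'n \<Rightarrow>\<^sub>0 nat) \<times> nat \<Rightarrow> int" where "wt e = int (wdeg \<omega> (fst e)) + p (snd e)"

text \<open>
  Expanding the coefficients of a good filtration in normally ordered monomials shows that it is the filtration by the
  weight \<open>wt\<close> of the products \<open>gm e\<close>.
\<close>
lemma F_eq: "F k = \<Psi> ` {a. \<forall>e\<in>keys a. snd e < r \<and> wt e \<le> k}"
proof
  show "F k \<subseteq> \<Psi> ` {a. \<forall>e\<in>keys a. snd e < r \<and> wt e \<le> k}"
  proof
    fix y assume "y \<in> F k"
    then obtain a where a: "y = (\<Oplus>\<^bsub>M\<^esub>j\<in>{..<r}. a j \<odot>\<^bsub>M\<^esub> mm j)" "\<forall>j<r. a j \<in> FW (k - p j)" unfolding gen by blast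
    have "\<forall>j\<in>{..<r}. \<exists>c. a j = symb c \<and> (\<forall>b\<in>keys c. int (wdeg \<omega> b) \<le> k - p j)"
    proof
      fix j assume "j \<in> {..<r}"
      then have "a j \<in> FW (k - p j)" using a(2) by simp
      then obtain c where "a j = symb c" "\<forall>b\<in>keys c. int (wdeg \<omega> b) \<le> k - p j" by (rule FW_cases)
      then show "\<exists>c. a j = symb c \<and> (\<forall>b\<in>keys c. int (wdeg \<omega> b) \<le> k - p j)" by (intro exI conjI)
    qed
    from bchoice[OF this] obtain c where c: "\<forall>j\<in>{..<r}. a j = symb (c j) \<and> (\<forall>b\<in>keys (c j). int (wdeg \<omega> b) \<le> k - p j)" by (rule exE)
    have "y = (\<Oplus>\<^bsub>M\<^esub>j\<in>{..<r}. \<Psi> (emb j (c j)))"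
      unfolding a(1) using c by (intro M.add.finprod_cong') (auto simp: symb_smult intro!: \<Psi>_closed)
    also have "\<dots> = \<Psi> (\<Sum>j<r. emb j (c j))" by (rule \<Psi>_sum[symmetric]) simp
    finally have y: "y = \<Psi> (\<Sum>j<r. emb j (c j))" .
    have "keys (\<Sum>j<r. emb j (c j)) \<subseteq> {e. snd e < r \<and> wt e \<le> k}"
    proof (rule keys_sum_subset, rule subsetI)
      fix j e assume j: "j \<in> {..<r}" and e: "e \<in> keys (emb j (c j))"
      then have "snd e = j" "fst e \<in> keys (c j)" by (simp_all add: keys_emb)
      then show "e \<in> {e. snd e < r \<and> wt e \<le> k}" using c j by (force simp: wt_def)
    qed
    then show "y \<in> \<Psi> ` {a. \<forall>e\<in>keys a. snd e < r \<and> wt e \<le> k}"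
      unfolding y by (intro imageI CollectI ballI) auto
  qed
  show "\<Psi> ` {a. \<forall>e\<in>keys a. snd e < r \<and> wt e \<le> k} \<subseteq> F k"
  proof (rule image_subsetI)
    fix a :: "('n + 'n \<Rightarrow>\<^sub>0 nat) \<times> nat \<Rightarrow>\<^sub>0 'k" assume a: "a \<in> {a. \<forall>e\<in>keys a. snd e < r \<and> wt e \<le> k}"
    have "keys a \<subseteq> UNIV \<times> {..<r}" using a by (auto simp: mem_Times_iff)
    then have "\<Psi> a = \<Psi> (\<Sum>j<r. emb j (component j a))" by (subst emb_component_sum[of a r]) simp_all
    also have "\<dots> = (\<Oplus>\<^bsub>M\<^esub>j\<in>{..<r}. \<Psi> (emb j (component j a)))" by (rule \<Psi>_sum) simp
    also have "\<dots> = (\<Oplus>\<^bsub>M\<^esub>j\<in>{..<r}. symb (component j a) \<odot>\<^bsub>M\<^esub> mm j)" unfolding symb_smult ..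
    finally have eq: "\<Psi> a = (\<Oplus>\<^bsub>M\<^esub>j\<in>{..<r}. symb (component j a) \<odot>\<^bsub>M\<^esub> mm j)" .
    have "\<forall>j<r. symb (component j a) \<in> FW (k - p j)"
    proof (intro allI impI)
      fix j assume "j < r"
      show "symb (component j a) \<in> FW (k - p j)" unfolding symb_in_FW
      proof
        fix x assume "x \<in> keys (component j a)"
        then have "(x, j) \<in> keys a" by (simp add: in_keys_iff lookup_component)
        then show "int (wdeg \<omega> x) \<le> k - p j" using a by (force simp: wt_def)
      qed
    qed
    then show "\<Psi> a \<in> F k" unfolding eq gen by (intro CollectI exI[of _ "\<lambda>j. symb (component j a)"] conjI refl)
  qed
qed

lemma \<Psi>_in_F: "(\<And>e. e \<in> keys a \<Longrightarrow> snd e < r \<and> wt e \<le> k) \<Longrightarrow> \<Psi> a \<in> F k"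
  unfolding F_eq by (intro imageI CollectI ballI)

lemma F_exhaust: "y \<in> carrier M \<Longrightarrow> \<exists>k. y \<in> F k"
  using filt unfolding module_filtration_def by blast

lemma gm_gen: "KM.kspan (gm ` (UNIV \<times> {..<r})) = carrier M"
proof
  show "KM.kspan (gm ` (UNIV \<times> {..<r})) \<subseteq> carrier M" by (rule KM.kspan_in_carrier) auto
  show "carrier M \<subseteq> KM.kspan (gm ` (UNIV \<times> {..<r}))"
  proof
    fix y assume "y \<in> carrier M"
    then obtain k where "y \<in> F k" using F_exhaust by blast
    then obtain a where a: "y = \<Psi> a" "\<forall>e\<in>keys a. snd e < r \<and> wt e \<le> k" unfolding F_eq by blast
    then have "keys a \<subseteq> UNIV \<times> {..<r}" by (auto simp: mem_Times_iff)
    then show "y \<in> KM.kspan (gm ` (UNIV \<times> {..<r}))"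
      unfolding KM.kspan_eq_lin[of gm, OF gm_closed] a(1) by (intro imageI CollectI)
  qed
qed

lemma framed_M: "framed_module W M pscale weyl_monom mm r"
proof (intro framed_module.intro kmodule_weyl framed_module_axioms.intro)
  show "weyl_monom 0 = \<one>\<^bsub>W\<^esub>" by (simp only: weyl_monom_zero weyl_simps)
  show "lin_span (range pscale) (regular_module W) (range weyl_monom) = carrier W"
    using KR_kspan[of UNIV] by (simp add: carrier_weyl)
  show "lin_span (range pscale) M ((\<lambda>e. weyl_monom (fst e) \<odot>\<^bsub>M\<^esub> mm (snd e)) ` (UNIV \<times> {..<r})) = carrier M"
    using gm_gen by (simp add: gm_def[abs_def])
qed (rule weyl_monom_closed weyl_u_peel weyl_u_gen mm_closed | assumption)+

sublocale SM: framed_module W M pscale weyl_monom mm r by (rule framed_M)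

lemma SM_gx: "SM.gx = gm" by (rule ext) (simp add: SM.gx_def gm_def)

subsection \<open>The associated graded module\<close>

abbreviation GM :: "(('n, 'k) polXY, int \<Rightarrow> 'm set) module" where "GM \<equiv> GrM \<omega> M F"

lemma GM_simps: "carrier GM = FM.cls ` {b. FM.fam b}" "\<zero>\<^bsub>GM\<^esub> = FM.cls (\<lambda>_. \<zero>\<^bsub>M\<^esub>)"
  "q \<odot>\<^bsub>GM\<^esub> g = gr_mult (module.smult M) FW M F (ident q) g"
  by (simp_all add: GrM_def restrict_scalars_def gr_module_def gr_ident_eq FM.gr_group_carrier FM.gr_group_one)

lemma GM_add:
  assumes "\<And>k. b k \<in> carrier M" "\<And>k. c k \<in> carrier M"
  shows "FM.cls b \<oplus>\<^bsub>GM\<^esub> FM.cls c = FM.cls (\<lambda>k. b k \<oplus>\<^bsub>M\<^esub> c k)"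
  using FM.gr_group_mult[of b c] assms by (simp add: GrM_def restrict_scalars_def gr_module_def)

lemma GM_cases: assumes "g \<in> carrier GM" obtains b where "g = FM.cls b" "FM.fam b"
  using assms unfolding GM_simps by blast

lemma GM_cls: "FM.fam b \<Longrightarrow> FM.cls b \<in> carrier GM" unfolding GM_simps by blast

lemma GM_smult:
  assumes b: "FM.fam b" and I: "finite I" "wts \<omega> q \<subseteq> I"
  shows "q \<odot>\<^bsub>GM\<^esub> FM.cls b = FM.cls (\<lambda>k. \<Oplus>\<^bsub>M\<^esub>i\<in>I. symb (hcomp \<omega> i q) \<odot>\<^bsub>M\<^esub> b (k - i))"
proof -
  have "i \<in> I" if "symb (hcomp \<omega> i q) \<notin> FW (i - 1)" for i using ident_support[OF that] I(2) by blast
  then show ?thesis unfolding GM_simps ident_def by (intro FA.gr_mult_cls[OF fam_ident b I(1)])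
qed

lemma fam_smult:
  assumes b: "FM.fam b" and I: "finite I"
  shows "FM.fam (\<lambda>k. \<Oplus>\<^bsub>M\<^esub>i\<in>I. symb (hcomp \<omega> i q) \<odot>\<^bsub>M\<^esub> b (k - i))"
proof (rule FM.famI)
  let ?T = "{k. b k \<notin> F (k - 1)}"
  show "(\<Oplus>\<^bsub>M\<^esub>i\<in>I. symb (hcomp \<omega> i q) \<odot>\<^bsub>M\<^esub> b (k - i)) \<in> F k" for k
  proof (rule FM.F_finsum)
    fix i show "symb (hcomp \<omega> i q) \<odot>\<^bsub>M\<^esub> b (k - i) \<in> F k"
      using FA.act_filt[OF hcomp_in_FW FM.fam_F[OF b], of i q "k - i"] by simp
  qed
  show "finite ((\<lambda>(i, j). i + j) ` (I \<times> ?T))" using I b by (simp add: FM.fam_def)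
  fix k assume k: "k \<notin> (\<lambda>(i, j). i + j) ` (I \<times> ?T)"
  show "(\<Oplus>\<^bsub>M\<^esub>i\<in>I. symb (hcomp \<omega> i q) \<odot>\<^bsub>M\<^esub> b (k - i)) \<in> F (k - 1)"
  proof (rule FM.F_finsum)
    fix i assume i: "i \<in> I"
    have "k - i \<notin> ?T"
    proof
      assume "k - i \<in> ?T"
      then have "(\<lambda>(i, j). i + j) (i, k - i) \<in> (\<lambda>(i, j). i + j) ` (I \<times> ?T)" using i by (intro imageI) simp
      then show False using k by simp
    qed
    then have "b (k - i) \<in> F (k - i - 1)" by simp
    from FA.act_filt[OF hcomp_in_FW this, of i q] show "symb (hcomp \<omega> i q) \<odot>\<^bsub>M\<^esub> b (k - i) \<in> F (k - 1)"
      by (simp add: algebra_simps)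
  qed
qed

lemma GM_smult_single:
  assumes b: "FM.fam b"
  shows "single a c \<odot>\<^bsub>GM\<^esub> FM.cls b =
    FM.cls (\<lambda>k. symb (single a c) \<odot>\<^bsub>M\<^esub> b (k - int (wdeg \<omega> a)))"
proof -
  have "wts \<omega> (single a c) \<subseteq> {int (wdeg \<omega> a)}" by (auto simp: wts_def)
  from GM_smult[OF b _ this] have "single a c \<odot>\<^bsub>GM\<^esub> FM.cls b =
    FM.cls (\<lambda>k. \<Oplus>\<^bsub>M\<^esub>i\<in>{int (wdeg \<omega> a)}. symb (hcomp \<omega> i (single a c)) \<odot>\<^bsub>M\<^esub> b (k - i))" by simp
  also have "\<dots> = FM.cls (\<lambda>k. symb (single a c) \<odot>\<^bsub>M\<^esub> b (k - int (wdeg \<omega> a)))"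
  proof (rule arg_cong[where f = FM.cls], rule ext)
    fix k
    have "symb (single a c) \<odot>\<^bsub>M\<^esub> b (k - int (wdeg \<omega> a)) \<in> carrier M"
      by (intro smult_closed symb_closed FM.fam_carrier[OF b])
    then show "(\<Oplus>\<^bsub>M\<^esub>i\<in>{int (wdeg \<omega> a)}. symb (hcomp \<omega> i (single a c)) \<odot>\<^bsub>M\<^esub> b (k - i)) =
      symb (single a c) \<odot>\<^bsub>M\<^esub> b (k - int (wdeg \<omega> a))"
      by (subst M.finsum_insert) (simp_all add: hcomp_single)
  qed
  finally show ?thesis .
qed

lemma GM_smult_closed: assumes "g \<in> carrier GM" shows "q \<odot>\<^bsub>GM\<^esub> g \<in> carrier GM"
proof -
  obtain b where b: "g = FM.cls b" "FM.fam b" using assms by (rule GM_cases)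
  show ?thesis unfolding b(1) GM_smult[OF b(2) finite_wts order_refl]
    by (rule GM_cls[OF fam_smult[OF b(2) finite_wts]])
qed

lemma GM_abelian_group: "abelian_group GM"
proof (rule abelian_groupI)
  fix x assume "x \<in> carrier GM"
  then obtain a where a: "x = FM.cls a" "FM.fam a" by (rule GM_cases)
  note ac = FM.fam_carrier[OF a(2)]
  show "\<zero>\<^bsub>GM\<^esub> \<oplus>\<^bsub>GM\<^esub> x = x"
    unfolding a(1) GM_simps by (subst GM_add) (simp_all add: ac)
  show "\<exists>y\<in>carrier GM. y \<oplus>\<^bsub>GM\<^esub> x = \<zero>\<^bsub>GM\<^esub>"
  proof
    show "FM.cls (\<lambda>k. \<ominus>\<^bsub>M\<^esub> a k) \<in> carrier GM" by (rule GM_cls[OF FM.fam_uminus[OF a(2)]])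
    show "FM.cls (\<lambda>k. \<ominus>\<^bsub>M\<^esub> a k) \<oplus>\<^bsub>GM\<^esub> x = \<zero>\<^bsub>GM\<^esub>"
      unfolding a(1) GM_simps by (subst GM_add) (simp_all add: ac M.l_neg)
  qed
  fix y assume "y \<in> carrier GM"
  then obtain b where b: "y = FM.cls b" "FM.fam b" by (rule GM_cases)
  note bc = FM.fam_carrier[OF b(2)]
  show "x \<oplus>\<^bsub>GM\<^esub> y \<in> carrier GM"
    unfolding a(1) b(1) by (subst GM_add[OF ac bc]) (rule GM_cls[OF FM.fam_add[OF a(2) b(2)]])
  show "x \<oplus>\<^bsub>GM\<^esub> y = y \<oplus>\<^bsub>GM\<^esub> x"
    unfolding a(1) b(1) by (subst (1 2) GM_add) (simp_all add: ac bc M.a_comm)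
  fix z assume "z \<in> carrier GM"
  then obtain c where c: "z = FM.cls c" "FM.fam c" by (rule GM_cases)
  note cc = FM.fam_carrier[OF c(2)]
  show "x \<oplus>\<^bsub>GM\<^esub> y \<oplus>\<^bsub>GM\<^esub> z = x \<oplus>\<^bsub>GM\<^esub> (y \<oplus>\<^bsub>GM\<^esub> z)"
    unfolding a(1) b(1) c(1) by (simp add: GM_add ac bc cc M.a_assoc)
next
  show "\<zero>\<^bsub>GM\<^esub> \<in> carrier GM" unfolding GM_simps using FM.fam_zero by blast
qed

lemma GM_l_distr:
  assumes "g \<in> carrier GM"
  shows "(q1 + q2) \<odot>\<^bsub>GM\<^esub> g = q1 \<odot>\<^bsub>GM\<^esub> g \<oplus>\<^bsub>GM\<^esub> q2 \<odot>\<^bsub>GM\<^esub> g"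
proof -
  obtain b where b: "g = FM.cls b" "FM.fam b" using assms by (rule GM_cases)
  let ?I = "wts \<omega> (q1 + q2) \<union> wts \<omega> q1 \<union> wts \<omega> q2"
  let ?t = "\<lambda>q k i. symb (hcomp \<omega> i q) \<odot>\<^bsub>M\<^esub> b (k - i)"
  have fin: "finite ?I" by simp
  have cl: "?t q k i \<in> carrier M" for q k i by (intro smult_closed symb_closed FM.fam_carrier[OF b(2)])
  have cl': "(\<Oplus>\<^bsub>M\<^esub>i\<in>?I. ?t q k i) \<in> carrier M" for q k using cl by (intro M.finsum_closed) auto
  have "(q1 + q2) \<odot>\<^bsub>GM\<^esub> g = FM.cls (\<lambda>k. \<Oplus>\<^bsub>M\<^esub>i\<in>?I. ?t (q1 + q2) k i)"
    unfolding b(1) by (rule GM_smult[OF b(2) fin]) auto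
  also have "\<dots> = FM.cls (\<lambda>k. (\<Oplus>\<^bsub>M\<^esub>i\<in>?I. ?t q1 k i) \<oplus>\<^bsub>M\<^esub> (\<Oplus>\<^bsub>M\<^esub>i\<in>?I. ?t q2 k i))"
  proof (rule arg_cong[where f = FM.cls], rule ext)
    fix k
    have "?t (q1 + q2) k i = ?t q1 k i \<oplus>\<^bsub>M\<^esub> ?t q2 k i" for i
      unfolding hcomp_add weyl_add_symb[symmetric] by (rule smult_l_distr[OF symb_closed symb_closed FM.fam_carrier[OF b(2)]])
    then have "(\<Oplus>\<^bsub>M\<^esub>i\<in>?I. ?t (q1 + q2) k i) = (\<Oplus>\<^bsub>M\<^esub>i\<in>?I. ?t q1 k i \<oplus>\<^bsub>M\<^esub> ?t q2 k i)" by (simp only:)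
    also have "\<dots> = (\<Oplus>\<^bsub>M\<^esub>i\<in>?I. ?t q1 k i) \<oplus>\<^bsub>M\<^esub> (\<Oplus>\<^bsub>M\<^esub>i\<in>?I. ?t q2 k i)"
      by (rule M.finsum_addf) (use cl in auto)
    finally show "(\<Oplus>\<^bsub>M\<^esub>i\<in>?I. ?t (q1 + q2) k i) = (\<Oplus>\<^bsub>M\<^esub>i\<in>?I. ?t q1 k i) \<oplus>\<^bsub>M\<^esub> (\<Oplus>\<^bsub>M\<^esub>i\<in>?I. ?t q2 k i)" .
  qed
  also have "\<dots> = FM.cls (\<lambda>k. \<Oplus>\<^bsub>M\<^esub>i\<in>?I. ?t q1 k i) \<oplus>\<^bsub>GM\<^esub> FM.cls (\<lambda>k. \<Oplus>\<^bsub>M\<^esub>i\<in>?I. ?t q2 k i)"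
    by (rule GM_add[symmetric, OF cl' cl'])
  also have "FM.cls (\<lambda>k. \<Oplus>\<^bsub>M\<^esub>i\<in>?I. ?t q1 k i) = q1 \<odot>\<^bsub>GM\<^esub> g" unfolding b(1) by (rule GM_smult[OF b(2) fin, symmetric]) auto
  also have "FM.cls (\<lambda>k. \<Oplus>\<^bsub>M\<^esub>i\<in>?I. ?t q2 k i) = q2 \<odot>\<^bsub>GM\<^esub> g" unfolding b(1) by (rule GM_smult[OF b(2) fin, symmetric]) auto
  finally show ?thesis .
qed

lemma GM_r_distr:
  assumes "g \<in> carrier GM" "g' \<in> carrier GM"
  shows "q \<odot>\<^bsub>GM\<^esub> (g \<oplus>\<^bsub>GM\<^esub> g') = q \<odot>\<^bsub>GM\<^esub> g \<oplus>\<^bsub>GM\<^esub> q \<odot>\<^bsub>GM\<^esub> g'"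
proof -
  obtain b where b: "g = FM.cls b" "FM.fam b" using assms(1) by (rule GM_cases)
  obtain c where c: "g' = FM.cls c" "FM.fam c" using assms(2) by (rule GM_cases)
  let ?I = "wts \<omega> q"
  let ?t = "\<lambda>b k i. symb (hcomp \<omega> i q) \<odot>\<^bsub>M\<^esub> b (k - i)"
  note bc = FM.fam_carrier[OF b(2)] and cc = FM.fam_carrier[OF c(2)]
  have cl: "?t b k i \<in> carrier M" "?t c k i \<in> carrier M" for k i by (intro smult_closed symb_closed bc cc)+
  have cl': "(\<Oplus>\<^bsub>M\<^esub>i\<in>?I. ?t b k i) \<in> carrier M" "(\<Oplus>\<^bsub>M\<^esub>i\<in>?I. ?t c k i) \<in> carrier M" for k
    using cl by (auto intro!: M.finsum_closed)
  have "q \<odot>\<^bsub>GM\<^esub> (g \<oplus>\<^bsub>GM\<^esub> g') = FM.cls (\<lambda>k. \<Oplus>\<^bsub>M\<^esub>i\<in>?I. ?t (\<lambda>k. b k \<oplus>\<^bsub>M\<^esub> c k) k i)"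
    unfolding b(1) c(1) GM_add[OF bc cc] by (rule GM_smult[OF FM.fam_add[OF b(2) c(2)] finite_wts order_refl])
  also have "\<dots> = FM.cls (\<lambda>k. (\<Oplus>\<^bsub>M\<^esub>i\<in>?I. ?t b k i) \<oplus>\<^bsub>M\<^esub> (\<Oplus>\<^bsub>M\<^esub>i\<in>?I. ?t c k i))"
  proof (rule arg_cong[where f = FM.cls], rule ext)
    fix k
    have "(\<Oplus>\<^bsub>M\<^esub>i\<in>?I. ?t (\<lambda>k. b k \<oplus>\<^bsub>M\<^esub> c k) k i) = (\<Oplus>\<^bsub>M\<^esub>i\<in>?I. ?t b k i \<oplus>\<^bsub>M\<^esub> ?t c k i)"
      by (simp only: smult_r_distr symb_closed bc cc)
    also have "\<dots> = (\<Oplus>\<^bsub>M\<^esub>i\<in>?I. ?t b k i) \<oplus>\<^bsub>M\<^esub> (\<Oplus>\<^bsub>M\<^esub>i\<in>?I. ?t c k i)"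
      by (rule M.finsum_addf) (use cl in auto)
    finally show "(\<Oplus>\<^bsub>M\<^esub>i\<in>?I. ?t (\<lambda>k. b k \<oplus>\<^bsub>M\<^esub> c k) k i) = (\<Oplus>\<^bsub>M\<^esub>i\<in>?I. ?t b k i) \<oplus>\<^bsub>M\<^esub> (\<Oplus>\<^bsub>M\<^esub>i\<in>?I. ?t c k i)" .
  qed
  also have "\<dots> = FM.cls (\<lambda>k. \<Oplus>\<^bsub>M\<^esub>i\<in>?I. ?t b k i) \<oplus>\<^bsub>GM\<^esub> FM.cls (\<lambda>k. \<Oplus>\<^bsub>M\<^esub>i\<in>?I. ?t c k i)"
    by (rule GM_add[symmetric, OF cl'])
  also have "\<dots> = q \<odot>\<^bsub>GM\<^esub> g \<oplus>\<^bsub>GM\<^esub> q \<odot>\<^bsub>GM\<^esub> g'"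
    unfolding b(1) c(1) GM_smult[OF b(2) finite_wts order_refl] GM_smult[OF c(2) finite_wts order_refl] ..
  finally show ?thesis .
qed

lemma GM_assoc: "g \<in> carrier GM \<Longrightarrow> (q1 * q2) \<odot>\<^bsub>GM\<^esub> g = q1 \<odot>\<^bsub>GM\<^esub> (q2 \<odot>\<^bsub>GM\<^esub> g)"
proof (induction q1 rule: mpol_additive_induct)
  case (add q q')
  have "((q + q') * q2) \<odot>\<^bsub>GM\<^esub> g = (q * q2) \<odot>\<^bsub>GM\<^esub> g \<oplus>\<^bsub>GM\<^esub> (q' * q2) \<odot>\<^bsub>GM\<^esub> g"
    unfolding distrib_right by (rule GM_l_distr[OF add.prems])
  also have "\<dots> = (q + q') \<odot>\<^bsub>GM\<^esub> (q2 \<odot>\<^bsub>GM\<^esub> g)"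
    unfolding add.IH(1)[OF add.prems] add.IH(2)[OF add.prems] by (rule GM_l_distr[OF GM_smult_closed[OF add.prems], symmetric])
  finally show ?case .
next
  case (single a c)
  then show ?case
  proof (induction q2 rule: mpol_additive_induct)
    case (add q q')
    have "(single a c * (q + q')) \<odot>\<^bsub>GM\<^esub> g = (single a c * q) \<odot>\<^bsub>GM\<^esub> g \<oplus>\<^bsub>GM\<^esub> (single a c * q') \<odot>\<^bsub>GM\<^esub> g"
      unfolding distrib_left by (rule GM_l_distr[OF add.prems])
    also have "\<dots> = single a c \<odot>\<^bsub>GM\<^esub> ((q + q') \<odot>\<^bsub>GM\<^esub> g)"
      unfolding add.IH(1)[OF add.prems] add.IH(2)[OF add.prems] GM_l_distr[OF add.prems]
      by (rule GM_r_distr[OF GM_smult_closed[OF add.prems] GM_smult_closed[OF add.prems], symmetric])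
    finally show ?case .
  next
    case (single b d)
    obtain x where x: "g = FM.cls x" "FM.fam x" using single.prems by (rule GM_cases)
    note xc = FM.fam_carrier[OF x(2)]
    let ?A = "single a c" and ?B = "single b d" and ?wa = "int (wdeg \<omega> a)" and ?wb = "int (wdeg \<omega> b)"
    obtain s where s: "symb ?A \<otimes>\<^bsub>W\<^esub> symb ?B = symb (?A * ?B + s)" "symb s \<in> FW (?wa + ?wb - 1)"
      by (rule symb_mult_congruent[of ?A ?wa ?B ?wb]) (auto split: if_splits)
    have AB: "?A * ?B = single (a + b) (c * d)" by (simp add: mult_single)
    have famB: "FM.fam (\<lambda>k. symb ?B \<odot>\<^bsub>M\<^esub> x (k - ?wb))"
    proof (rule FM.famI)
      have B: "symb ?B \<in> FW ?wb" unfolding symb_in_FW by (auto split: if_splits)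
      show "symb ?B \<odot>\<^bsub>M\<^esub> x (k - ?wb) \<in> F k" for k using FA.act_filt[OF B FM.fam_F[OF x(2)], of "k - ?wb"] by simp
      show "finite ((\<lambda>k. k + ?wb) ` {k. x k \<notin> F (k - 1)})" using x(2) by (simp add: FM.fam_def)
      fix k assume k: "k \<notin> (\<lambda>k. k + ?wb) ` {k. x k \<notin> F (k - 1)}"
      have "x (k - ?wb) \<in> F (k - ?wb - 1)"
      proof (rule ccontr)
        assume "x (k - ?wb) \<notin> F (k - ?wb - 1)"
        then have "(k - ?wb) + ?wb \<in> (\<lambda>k. k + ?wb) ` {k. x k \<notin> F (k - 1)}" by (intro imageI) simp
        then show False using k by simp
      qed
      from FA.act_filt[OF B this] show "symb ?B \<odot>\<^bsub>M\<^esub> x (k - ?wb) \<in> F (k - 1)" by simp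
    qed
    have 1: "(?A * ?B) \<odot>\<^bsub>GM\<^esub> g = FM.cls (\<lambda>k. symb (?A * ?B) \<odot>\<^bsub>M\<^esub> x (k - ?wa - ?wb))"
      unfolding x(1) AB GM_smult_single[OF x(2)] by (simp add: algebra_simps)
    have 2: "?A \<odot>\<^bsub>GM\<^esub> (?B \<odot>\<^bsub>GM\<^esub> g) = FM.cls (\<lambda>k. symb ?A \<odot>\<^bsub>M\<^esub> (symb ?B \<odot>\<^bsub>M\<^esub> x (k - ?wa - ?wb)))"
      unfolding x(1) GM_smult_single[OF x(2)] GM_smult_single[OF famB] by (simp add: algebra_simps)
    show ?case unfolding 1 2
    proof (subst FM.cls_eq_iff)
      show "symb (?A * ?B) \<odot>\<^bsub>M\<^esub> x (k - ?wa - ?wb) \<in> carrier M" for k by (intro smult_closed symb_closed xc)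
      show "symb ?A \<odot>\<^bsub>M\<^esub> (symb ?B \<odot>\<^bsub>M\<^esub> x (k - ?wa - ?wb)) \<in> carrier M" for k by (intro smult_closed symb_closed xc)
      show "\<forall>k. symb (?A * ?B) \<odot>\<^bsub>M\<^esub> x (k - ?wa - ?wb) \<ominus>\<^bsub>M\<^esub> symb ?A \<odot>\<^bsub>M\<^esub> (symb ?B \<odot>\<^bsub>M\<^esub> x (k - ?wa - ?wb)) \<in> F (k - 1)"
      proof
        fix k
        let ?y = "x (k - ?wa - ?wb)"
        have "symb ?A \<odot>\<^bsub>M\<^esub> (symb ?B \<odot>\<^bsub>M\<^esub> ?y) = (symb ?A \<otimes>\<^bsub>W\<^esub> symb ?B) \<odot>\<^bsub>M\<^esub> ?y"
          by (rule smult_assoc[symmetric, OF symb_closed symb_closed xc])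
        also have "\<dots> = symb (?A * ?B) \<odot>\<^bsub>M\<^esub> ?y \<oplus>\<^bsub>M\<^esub> symb s \<odot>\<^bsub>M\<^esub> ?y"
          unfolding s(1) weyl_add_symb[symmetric] by (rule smult_l_distr[OF symb_closed symb_closed xc])
        finally have eq: "symb ?A \<odot>\<^bsub>M\<^esub> (symb ?B \<odot>\<^bsub>M\<^esub> ?y) = symb (?A * ?B) \<odot>\<^bsub>M\<^esub> ?y \<oplus>\<^bsub>M\<^esub> symb s \<odot>\<^bsub>M\<^esub> ?y" .
        have sF: "symb s \<odot>\<^bsub>M\<^esub> ?y \<in> F (k - 1)"
          using FA.act_filt[OF s(2) FM.fam_F[OF x(2)], of "k - ?wa - ?wb"] by (simp add: algebra_simps)
        have c: "symb (?A * ?B) \<odot>\<^bsub>M\<^esub> ?y \<in> carrier M" "symb s \<odot>\<^bsub>M\<^esub> ?y \<in> carrier M" by (intro smult_closed symb_closed xc)+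
        have "symb (?A * ?B) \<odot>\<^bsub>M\<^esub> ?y \<ominus>\<^bsub>M\<^esub> symb ?A \<odot>\<^bsub>M\<^esub> (symb ?B \<odot>\<^bsub>M\<^esub> ?y) = \<ominus>\<^bsub>M\<^esub> (symb s \<odot>\<^bsub>M\<^esub> ?y)"
          unfolding eq using c by (simp add: a_minus_def M.minus_add M.a_assoc[symmetric] M.r_neg)
        then show "symb (?A * ?B) \<odot>\<^bsub>M\<^esub> ?y \<ominus>\<^bsub>M\<^esub> symb ?A \<odot>\<^bsub>M\<^esub> (symb ?B \<odot>\<^bsub>M\<^esub> ?y) \<in> F (k - 1)"
          using FM.F_inv[OF sF] by simp
      qed
    qed
  qed
qed

lemma GM_one: "g \<in> carrier GM \<Longrightarrow> 1 \<odot>\<^bsub>GM\<^esub> g = g"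
proof -
  assume "g \<in> carrier GM"
  then obtain x where x: "g = FM.cls x" "FM.fam x" by (rule GM_cases)
  have "symb (single 0 1 :: ('n, 'k) polXY) = \<one>\<^bsub>W\<^esub>" by simp
  then have "(single 0 1) \<odot>\<^bsub>GM\<^esub> g = FM.cls (\<lambda>k. \<one>\<^bsub>W\<^esub> \<odot>\<^bsub>M\<^esub> x k)"
    unfolding x(1) GM_smult_single[OF x(2)] by simp
  then show ?thesis using FM.fam_carrier[OF x(2)] by (simp only: smult_one single_one x(1))
qed

lemma GM_left_module: "left_module KXY GM"
  by (intro left_module.intro left_module_axioms.intro GM_abelian_group cring.axioms(1)[OF cring_KXY])
     (simp_all only: KXY_simps GM_smult_closed GM_l_distr GM_r_distr GM_assoc GM_one)

lemma GM_kmodule: "kmodule KXY GM pconst"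
  by (intro kmodule.intro kmodule_axioms.intro GM_left_module)
     (simp_all add: pconst_def single_add mult_single mult.commute, metis lookup_single_eq single_zero)

sublocale KG: kmodule KXY GM pconst by (rule GM_kmodule)

lemma mm_in_F: "mm j \<in> F (p j)"
proof (cases "j < r")
  case True
  have "mm j = \<Psi> (single (0, j) 1)"
    unfolding \<Psi>_single gm_def using mm_closed[of j]
    by (simp add: weyl_monom_zero KM.scal_one smult_one[unfolded weyl_simps])
  also have "\<dots> \<in> F (p j)" by (rule \<Psi>_in_F) (use True in \<open>auto simp: wt_def\<close>)
  finally show ?thesis .
qed (simp add: mm_zero)

lemma fam_concentrated: "x \<in> F d \<Longrightarrow> FM.fam (\<lambda>k. if k = d then x else \<zero>\<^bsub>M\<^esub>)"
  by (rule FM.famI[of _ "{d}"]) auto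

definition mG :: "nat \<Rightarrow> int \<Rightarrow> 'm set" where "mG j = FM.cls (\<lambda>k. if k = p j then mm j else \<zero>\<^bsub>M\<^esub>)"
definition gG :: "('n + 'n \<Rightarrow>\<^sub>0 nat) \<times> nat \<Rightarrow> int \<Rightarrow> 'm set" where "gG e = mon (fst e) \<odot>\<^bsub>GM\<^esub> mG (snd e)"

lemma mG_closed: "mG j \<in> carrier GM" unfolding mG_def by (rule GM_cls[OF fam_concentrated[OF mm_in_F]])
lemma gG_closed: "gG e \<in> carrier GM" unfolding gG_def by (rule GM_smult_closed[OF mG_closed])

lemma gm_in_F: "gm e \<in> F (wt e)"
proof (cases "snd e < r")
  case True
  have "gm e = \<Psi> (single e 1)" unfolding \<Psi>_single by (simp add: KM.scal_one)
  also have "\<dots> \<in> F (wt e)" by (rule \<Psi>_in_F) (use True in \<open>auto split: if_splits\<close>)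
  finally show ?thesis .
next
  case False
  then have "gm e = \<zero>\<^bsub>M\<^esub>" unfolding gm_def by (simp add: mm_zero KM.smult_zero_right weyl_monom_closed)
  then show ?thesis by simp
qed

lemma gG_eq: "gG e = FM.cls (\<lambda>k. if k = wt e then gm e else \<zero>\<^bsub>M\<^esub>)"
proof -
  have "gG e = FM.cls (\<lambda>k. symb (mon (fst e)) \<odot>\<^bsub>M\<^esub> (if k - int (wdeg \<omega> (fst e)) = p (snd e) then mm (snd e) else \<zero>\<^bsub>M\<^esub>))"
    unfolding gG_def mG_def by (rule GM_smult_single[OF fam_concentrated[OF mm_in_F]])
  also have "\<dots> = FM.cls (\<lambda>k. if k = wt e then gm e else \<zero>\<^bsub>M\<^esub>)"
    by (rule arg_cong[where f = FM.cls], rule ext)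
       (auto simp: wt_def gm_def KM.smult_zero_right weyl_monom_closed)
  finally show ?thesis .
qed

lemma pm_restrict_add: "pm_restrict S (a + b) = pm_restrict S a + pm_restrict S b"
  by (rule poly_mapping_eqI) (simp add: lookup_pm_restrict lookup_add)

lemma pm_restrict_single: "pm_restrict S (single e c) = (if e \<in> S then single e c else 0)"
  by (rule poly_mapping_eqI) (auto simp: lookup_pm_restrict lookup_single when_def)

text \<open>
  In the graded module the component of degree \<open>k\<close> of a linear combination only sees the exponents of weight
  exactly \<open>k\<close>.
\<close>
lemma lin_GM: "KG.lin gG a = FM.cls (\<lambda>k. \<Psi> (pm_restrict {e. wt e = k} a))"
proof (induction a rule: mpol_additive_induct)
  case (single e c)
  have "KG.lin gG (single e c) = pconst c \<odot>\<^bsub>GM\<^esub> gG e"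
    unfolding KG.lin_single[of gG, OF gG_closed] KG.scal_def ..
  also have "\<dots> = FM.cls (\<lambda>k. symb (single 0 c) \<odot>\<^bsub>M\<^esub> (if k = wt e then gm e else \<zero>\<^bsub>M\<^esub>))"
    unfolding gG_eq pconst_def GM_smult_single[OF fam_concentrated[OF gm_in_F]] by simp
  also have "\<dots> = FM.cls (\<lambda>k. \<Psi> (pm_restrict {e. wt e = k} (single e c)))"
    by (rule arg_cong[where f = FM.cls], rule ext)
       (auto simp: pm_restrict_single \<Psi>_single \<Psi>_zero KM.scal_def pscale_symb KM.smult_zero_right)
  finally show ?case .
next
  case (add a b)
  have "KG.lin gG (a + b) = KG.lin gG a \<oplus>\<^bsub>GM\<^esub> KG.lin gG b" by (rule KG.lin_add[of gG, OF gG_closed])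
  also have "\<dots> = FM.cls (\<lambda>k. \<Psi> (pm_restrict {e. wt e = k} a) \<oplus>\<^bsub>M\<^esub> \<Psi> (pm_restrict {e. wt e = k} b))"
    unfolding add by (rule GM_add[OF \<Psi>_closed \<Psi>_closed])
  finally show ?case unfolding pm_restrict_add \<Psi>_add .
qed

text \<open>
  Modulo \<open>F (k - 1)\<close> only the terms of weight \<open>k\<close> of a representative matter, and those are
  images of homogeneous combinations of the generators.
\<close>
lemma gG_gen: "KG.kspan (gG ` (UNIV \<times> {..<r})) = carrier GM"
proof
  have gGc: "gG ` (UNIV \<times> {..<r}) \<subseteq> carrier GM" using gG_closed by blast
  then show "KG.kspan (gG ` (UNIV \<times> {..<r})) \<subseteq> carrier GM" by (rule KG.kspan_in_carrier)
  show "carrier GM \<subseteq> KG.kspan (gG ` (UNIV \<times> {..<r}))"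
  proof
    fix g assume "g \<in> carrier GM"
    then obtain b where b: "g = FM.cls b" "FM.fam b" by (rule GM_cases)
    have "\<forall>k. \<exists>a. b k = \<Psi> a \<and> (\<forall>e\<in>keys a. snd e < r \<and> wt e \<le> k)"
    proof
      fix k
      have "b k \<in> \<Psi> ` {a. \<forall>e\<in>keys a. snd e < r \<and> wt e \<le> k}" using FM.fam_F[OF b(2), of k] unfolding F_eq .
      then show "\<exists>a. b k = \<Psi> a \<and> (\<forall>e\<in>keys a. snd e < r \<and> wt e \<le> k)" by (elim imageE) (intro exI conjI, assumption, simp)
    qed
    from choice[OF this] obtain a where a: "\<forall>k. b k = \<Psi> (a k) \<and> (\<forall>e\<in>keys (a k). snd e < r \<and> wt e \<le> k)" by (rule exE)
    let ?T = "{k. b k \<notin> F (k - 1)}"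
    let ?A = "\<Sum>k\<in>?T. pm_restrict {e. wt e = k} (a k)"
    have fin: "finite ?T" using b(2) by (simp add: FM.fam_def)
    have restr: "pm_restrict {e. wt e = k} ?A = (if k \<in> ?T then pm_restrict {e. wt e = k} (a k) else 0)" for k
    proof (rule poly_mapping_eqI)
      fix e
      have "lookup ?A e = (\<Sum>k\<in>?T. if k = wt e then lookup (a k) e else 0)"
        unfolding lookup_sum by (intro sum.cong) (auto simp: lookup_pm_restrict)
      also have "\<dots> = (if wt e \<in> ?T then lookup (a (wt e)) e else 0)" using fin by (simp add: sum.delta)
      finally show "lookup (pm_restrict {e. wt e = k} ?A) e = lookup (if k \<in> ?T then pm_restrict {e. wt e = k} (a k) else 0) e"
        by (auto simp: lookup_pm_restrict)
    qed
    have "g = KG.lin gG ?A"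
      unfolding b(1) lin_GM restr
    proof (subst FM.cls_eq_iff)
      show "b k \<in> carrier M" for k by (rule FM.fam_carrier[OF b(2)])
      show "\<Psi> (if k \<in> ?T then pm_restrict {e. wt e = k} (a k) else 0) \<in> carrier M" for k by (rule \<Psi>_closed)
      show "\<forall>k. b k \<ominus>\<^bsub>M\<^esub> \<Psi> (if k \<in> ?T then pm_restrict {e. wt e = k} (a k) else 0) \<in> F (k - 1)"
      proof
        fix k
        show "b k \<ominus>\<^bsub>M\<^esub> \<Psi> (if k \<in> ?T then pm_restrict {e. wt e = k} (a k) else 0) \<in> F (k - 1)"
        proof (cases "k \<in> ?T")
          case False
          then have "b k \<in> F (k - 1)" by simp
          then show ?thesis using False by (simp add: \<Psi>_zero FM.F_minus)
        next
          case True
          have "b k \<ominus>\<^bsub>M\<^esub> \<Psi> (pm_restrict {e. wt e = k} (a k)) = \<Psi> (a k + - pm_restrict {e. wt e = k} (a k))"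
            unfolding \<Psi>_add \<Psi>_uminus a_minus_def using a by simp
          also have "\<dots> \<in> F (k - 1)"
          proof (rule \<Psi>_in_F)
            fix e assume "e \<in> keys (a k + - pm_restrict {e. wt e = k} (a k))"
            then have "e \<in> keys (a k)" "wt e \<noteq> k"
              by (auto simp: in_keys_iff lookup_add lookup_minus lookup_pm_restrict split: if_splits)
            then show "snd e < r \<and> wt e \<le> k - 1" using a by force
          qed
          finally show ?thesis using True by simp
        qed
      qed
    qed
    moreover have "keys ?A \<subseteq> UNIV \<times> {..<r}"
    proof (rule keys_sum_subset, rule subsetI)
      fix k e assume "e \<in> keys (pm_restrict {e. wt e = k} (a k))"
      then have "e \<in> keys (a k)" by (simp add: keys_pm_restrict)
      then have "snd e < r" using a by blast
      then show "e \<in> UNIV \<times> {..<r}" by (simp add: mem_Times_iff)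
    qed
    ultimately show "g \<in> KG.kspan (gG ` (UNIV \<times> {..<r}))"
      unfolding KG.kspan_eq_lin[of gG, OF gG_closed] by (intro image_eqI CollectI)
  qed
qed

sublocale RG: kmodule KXY "regular_module KXY :: (('n, 'k) polXY, ('n, 'k) polXY) module" pconst by (rule KG.kmodule_regular)

lemma RG_lin: "RG.lin mon c = c"
proof (induction c rule: mpol_additive_induct)
  have cl: "mon a \<in> carrier (regular_module KXY)" for a :: "'n + 'n \<Rightarrow>\<^sub>0 nat" by simp
  case (single a k)
  show ?case unfolding RG.lin_single[of mon, OF cl] by (simp add: RG.scal_def pconst_times)
next
  have cl: "mon a \<in> carrier (regular_module KXY)" for a :: "'n + 'n \<Rightarrow>\<^sub>0 nat" by simp
  case (add p q)
  show ?case unfolding RG.lin_add[of mon, OF cl] add by simp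
qed

lemma RG_kspan: "RG.kspan (mon ` I) = {c. keys c \<subseteq> I}"
  using RG.kspan_eq_lin[of mon I] by (simp add: RG_lin)

lemma framed_GM: "framed_module KXY GM pconst mon mG r"
proof (intro framed_module.intro GM_kmodule framed_module_axioms.intro)
  show "(mon 0 :: ('n, 'k) polXY) = \<one>\<^bsub>KXY\<^esub>" by simp
  fix a :: "'n + 'n \<Rightarrow>\<^sub>0 nat" assume "a \<noteq> 0"
  then obtain v where "lookup a v \<noteq> 0" by (auto simp: poly_mapping_eq_iff fun_eq_iff)
  then have a: "a = single v 1 + (a - single v 1)"
    using exponent_split_off[of 1 a v] by (simp add: add.commute)
  moreover have "(mon a :: ('n, 'k) polXY) = mon (single v 1) \<otimes>\<^bsub>KXY\<^esub> mon (a - single v 1)"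
    unfolding KXY_simps mult_single a[symmetric] by simp
  ultimately show "\<exists>v b. a = single v 1 + b \<and> (mon a :: ('n, 'k) polXY) = mon (single v 1) \<otimes>\<^bsub>KXY\<^esub> mon b"
    by (intro exI conjI)
next
  fix v :: "'n + 'n" and b :: "'n + 'n \<Rightarrow>\<^sub>0 nat"
  show "(mon (single v 1) :: ('n, 'k) polXY) \<otimes>\<^bsub>KXY\<^esub> mon b \<in> lin_span (range pconst) (regular_module KXY) (mon ` {c. mdeg c \<le> mdeg b + 1})"
    unfolding RG_kspan KXY_simps mult_single by simp
next
  show "lin_span (range pconst) (regular_module KXY) (range mon) = carrier (KXY :: ('n, 'k) polXY ring)"
    using RG_kspan[of UNIV] by simp
  show "lin_span (range pconst) GM ((\<lambda>e. mon (fst e) \<odot>\<^bsub>GM\<^esub> mG (snd e)) ` (UNIV \<times> {..<r})) = carrier GM"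
    using gG_gen by (simp add: gG_def[abs_def])
qed (simp_all add: mG_closed)

sublocale SG: framed_module KXY GM pconst mon mG r by (rule framed_GM)

lemma SG_gx: "SG.gx = gG" by (rule ext) (simp add: SG.gx_def gG_def)

end

lemma (in kmodule) lin_eliminate:
  assumes x: "\<And>i. x i \<in> carrier N" and l: "lin x l = \<zero>\<^bsub>N\<^esub>" "lookup l e \<noteq> 0"
  shows "\<exists>b. x e = lin x b \<and> keys b \<subseteq> keys l - {e}"
proof (intro exI conjI)
  let ?b = "single e 1 + sc (- inverse (lookup l e)) l"
  have "lin x ?b = scal 1 (x e) \<oplus>\<^bsub>N\<^esub> scal (- inverse (lookup l e)) \<zero>\<^bsub>N\<^esub>"
    unfolding lin_add[of x, OF x] lin_sc[of x, OF x] lin_single[of x, OF x] l(1) ..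
  then show "x e = lin x ?b" using x by (simp add: scal_one)
  show "keys ?b \<subseteq> keys l - {e}"
    using l(2) by (auto simp: in_keys_iff lookup_add lookup_minus lookup_single when_def split: if_splits)
qed

context good_filtered
begin

section \<open>Leading exponents of relations\<close>

definition pmin :: int where "pmin = Min (insert 0 (p ` {..<r}))"
definition pn :: "nat \<Rightarrow> nat" where "pn j = nat (p j - pmin)"

lemma wt_mkey: "snd e < r \<Longrightarrow> wt e = int (mkey \<omega> pn e) + pmin"
proof -
  assume "snd e < r"
  then have "pmin \<le> p (snd e)" unfolding pmin_def by (intro Min_le) auto
  then show ?thesis by (simp add: wt_def mkey_def pn_def)
qed

abbreviation ml where "ml \<equiv> mless \<omega> pn"
abbreviation lds where "lds \<equiv> leads \<omega> pn"

definition relations :: "(('n + 'n \<Rightarrow>\<^sub>0 nat) \<times> nat \<Rightarrow>\<^sub>0 'k) set" where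
  "relations = {a. keys a \<subseteq> UNIV \<times> {..<r} \<and> \<Psi> a = \<zero>\<^bsub>M\<^esub>}"

text \<open>
  The exponents that lead no relation. They index bases of \<open>M\<close> and of its graded module at the same time, and
  this is why both have the same growth.
\<close>
definition standard :: "(('n + 'n \<Rightarrow>\<^sub>0 nat) \<times> nat) set" where
  "standard = {e \<in> UNIV \<times> {..<r}. \<not> (\<exists>a\<in>relations. lds a e)}"

lemma monom_smult_gm:
  "\<exists>q. weyl_monom \<beta> \<odot>\<^bsub>M\<^esub> gm g = \<Psi> (single (mshift \<beta> g) 1 + q) \<and>
     (\<forall>f\<in>keys q. snd f = snd g \<and> below (fst f) (\<beta> + fst g))"
proof -
  from monom_times_monom[of \<beta> "fst g", where 'k = 'k] obtain s :: "('n, 'k) polXY"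
    where s: "\<forall>c\<in>keys s. below c (\<beta> + fst g)"
      "weyl_monom \<beta> \<circ> weyl_monom (fst g) = symb (mon (\<beta> + fst g) + s)" by (elim exE conjE)
  have "weyl_monom \<beta> \<odot>\<^bsub>M\<^esub> gm g = (weyl_monom \<beta> \<otimes>\<^bsub>W\<^esub> weyl_monom (fst g)) \<odot>\<^bsub>M\<^esub> mm (snd g)"
    unfolding gm_def by (rule smult_assoc[symmetric, OF weyl_monom_closed weyl_monom_closed mm_closed])
  also have "\<dots> = symb (mon (\<beta> + fst g) + s) \<odot>\<^bsub>M\<^esub> mm (snd g)" unfolding weyl_simps s(2) ..
  also have "\<dots> = \<Psi> (single (mshift \<beta> g) 1 + emb (snd g) s)"
    unfolding symb_smult emb_add emb_single mshift_def ..
  finally show ?thesis using s(1) by (intro exI[of _ "emb (snd g) s"]) (simp add: keys_emb)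
qed

lemma below_ml:
  assumes "snd f = snd g" "below (fst f) (\<beta> + fst g)" shows "ml f (mshift \<beta> g)"
  using below_wdeg_less[OF assms(2), of \<omega>] \<omega>_pos assms(1) by (simp add: mless_def mkey_def mshift_def)

text \<open>
  Multiplying a relation by a monomial of the Weyl algebra shifts its leading exponent, because all terms created by
  normal ordering have smaller weight.
\<close>
lemma shift_relation:
  assumes a: "a \<in> relations" "lds a e"
  shows "\<exists>l\<in>relations. lds l (mshift \<beta> e) \<and>
    (\<forall>f\<in>keys l. \<exists>g\<in>keys a. f = mshift \<beta> g \<or> (snd f = snd g \<and> below (fst f) (\<beta> + fst g)))"
proof -
  have "\<forall>g. \<exists>q. weyl_monom \<beta> \<odot>\<^bsub>M\<^esub> gm g = \<Psi> (single (mshift \<beta> g) 1 + q) \<and>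
     (\<forall>f\<in>keys q. snd f = snd g \<and> below (fst f) (\<beta> + fst g))" by (intro allI monom_smult_gm)
  from choice[OF this] obtain q where q': "\<forall>g. weyl_monom \<beta> \<odot>\<^bsub>M\<^esub> gm g = \<Psi> (single (mshift \<beta> g) 1 + q g) \<and>
     (\<forall>f\<in>keys (q g). snd f = snd g \<and> below (fst f) (\<beta> + fst g))" by (rule exE)
  have q: "weyl_monom \<beta> \<odot>\<^bsub>M\<^esub> gm g = \<Psi> (single (mshift \<beta> g) 1 + q g)" for g
    using spec[OF q', of g] by (rule conjunct1)
  have qk: "snd f = snd g" "below (fst f) (\<beta> + fst g)" if "f \<in> keys (q g)" for f g
    using bspec[OF conjunct2[OF spec[OF q', of g]] that] by simp_all
  let ?l = "\<Sum>g\<in>keys a. sc (lookup a g) (single (mshift \<beta> g) 1 + q g)"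
  let ?P = "\<lambda>f g. f = mshift \<beta> g \<or> (snd f = snd g \<and> below (fst f) (\<beta> + fst g))"
  have key: "keys ?l \<subseteq> {f. \<exists>g\<in>keys a. ?P f g}"
  proof (rule keys_sum_subset, rule subsetI)
    fix g f assume g: "g \<in> keys a"
      and fk: "f \<in> keys (sc (lookup a g) (single (mshift \<beta> g) 1 + q g))"
    from fk have "f \<in> keys (single (mshift \<beta> g) (1::'k) + q g)" by (rule subsetD[OF keys_sc])
    from subsetD[OF keys_add this] have "?P f g"
    proof
      assume "f \<in> keys (single (mshift \<beta> g) (1::'k))"
      then show ?thesis by simp
    next
      assume "f \<in> keys (q g)"
      from qk[OF this] show ?thesis by simp
    qed
    then show "f \<in> {f. \<exists>g\<in>keys a. ?P f g}" using g by (intro CollectI bexI)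
  qed
  have "\<Psi> ?l = (\<Oplus>\<^bsub>M\<^esub>g\<in>keys a. KM.scal (lookup a g) (\<Psi> (single (mshift \<beta> g) 1 + q g)))"
    by (rule KM.lin_indep_relation[of gm, OF gm_closed]) simp
  also have "\<dots> = (\<Oplus>\<^bsub>M\<^esub>g\<in>keys a. weyl_monom \<beta> \<odot>\<^bsub>M\<^esub> KM.scal (lookup a g) (gm g))"
    unfolding q[symmetric] KM.smult_scal[OF weyl_monom_closed gm_closed] ..
  also have "\<dots> = weyl_monom \<beta> \<odot>\<^bsub>M\<^esub> \<Psi> a" unfolding KM.lin_def
    by (rule KM.smult_finsum[symmetric, OF weyl_monom_closed]) auto
  also have "\<dots> = \<zero>\<^bsub>M\<^esub>" using a(1) by (simp add: relations_def KM.smult_zero_right weyl_monom_closed)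
  finally have zero: "\<Psi> ?l = \<zero>\<^bsub>M\<^esub>" .
  have er: "snd g < r" if "g \<in> keys a" for g using a(1) that by (auto simp: relations_def)
  have rel: "?l \<in> relations"
    unfolding relations_def
  proof (intro CollectI conjI zero subsetI)
    fix f assume "f \<in> keys ?l"
    from subsetD[OF key this] obtain g where "g \<in> keys a" "?P f g" by (elim CollectE bexE)
    then have "snd f < r" using er[of g] by (auto simp: mshift_def)
    then show "f \<in> UNIV \<times> {..<r}" by (simp add: mem_Times_iff)
  qed
  have small: "ml f (mshift \<beta> e)" if fk: "f \<in> keys (q g)" and g: "g \<in> keys a" for f g
  proof (cases "g = e")
    case True then show ?thesis using below_ml[OF qk[OF fk]] by simp
  next
    case False
    then have "ml (mshift \<beta> g) (mshift \<beta> e)" using a(2) g by (simp add: leads_def mless_mshift)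
    with below_ml[OF qk[OF fk]] show ?thesis by (rule mless_trans)
  qed
  have inj: "mshift \<beta> g = mshift \<beta> e \<longleftrightarrow> g = e" for g by (auto simp: mshift_def prod_eq_iff)
  have "lookup ?l (mshift \<beta> e) = (\<Sum>g\<in>keys a. if g = e then lookup a g else 0)"
    unfolding lookup_sum
  proof (rule sum.cong[OF refl])
    fix g assume g: "g \<in> keys a"
    have "mshift \<beta> e \<notin> keys (q g)" using small[of "mshift \<beta> e" g] g mless_irrefl[of \<omega> pn "mshift \<beta> e"] by argo
    then have "lookup (q g) (mshift \<beta> e) = 0" by (simp add: in_keys_iff)
    then show "lookup (sc (lookup a g) (single (mshift \<beta> g) 1 + q g)) (mshift \<beta> e) =
        (if g = e then lookup a g else 0)"
      by (simp add: lookup_add lookup_single when_def inj)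
  qed
  also have "\<dots> \<noteq> 0" using a(2) by (simp add: leads_def in_keys_iff)
  finally have ek: "mshift \<beta> e \<in> keys ?l" by (simp add: in_keys_iff)
  have "lds ?l (mshift \<beta> e)"
    unfolding leads_def
  proof (intro conjI ek ballI impI)
    fix f assume fl: "f \<in> keys ?l" and ne: "f \<noteq> mshift \<beta> e"
    from subsetD[OF key fl] obtain g where g: "g \<in> keys a" "?P f g" by (elim CollectE bexE)
    have le: "g = e \<or> ml (mshift \<beta> g) (mshift \<beta> e)" using a(2) g(1) by (auto simp: leads_def mless_mshift)
    from g(2) show "ml f (mshift \<beta> e)"
    proof
      assume "f = mshift \<beta> g"
      then show ?thesis using le ne by auto
    next
      assume "snd f = snd g \<and> below (fst f) (\<beta> + fst g)"
      then have "ml f (mshift \<beta> g)" using below_ml by blast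
      then show ?thesis using le mless_trans by blast
    qed
  qed
  moreover have "\<forall>f\<in>keys ?l. \<exists>g\<in>keys a. ?P f g"
    by (rule ballI, drule subsetD[OF key], erule CollectE)
  ultimately show ?thesis using rel by (intro bexI[of _ ?l] conjI)
qed

lemma staircase_standard: "staircase r standard"
  unfolding staircase_def
proof (intro conjI allI impI)
  show "standard \<subseteq> UNIV \<times> {..<r}" by (auto simp: standard_def)
  fix a b j assume ab: "(a + b, j) \<in> standard"
  show "(a, j) \<in> standard"
  proof (rule ccontr)
    assume "(a, j) \<notin> standard"
    then obtain l where "l \<in> relations" "lds l (a, j)" using ab by (auto simp: standard_def)
    from shift_relation[OF this, of b] obtain l' where "l' \<in> relations" "lds l' (mshift b (a, j))" by (elim bexE conjE)
    then have "(a + b, j) \<notin> standard" by (auto simp: standard_def mshift_def add.commute)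
    then show False using ab by simp
  qed
qed

lemma standard_independent:
  assumes "keys a \<subseteq> standard" "\<Psi> a = \<zero>\<^bsub>M\<^esub>" shows "a = 0"
proof (rule ccontr)
  assume "a \<noteq> 0"
  then obtain e where e: "lds a e" using leads_exists by blast
  have "a \<in> relations" using assms by (auto simp: relations_def standard_def)
  moreover have "e \<in> standard" using e assms(1) by (auto simp: leads_def)
  ultimately show False using e by (auto simp: standard_def)
qed

text \<open>
  By Dickson's lemma finitely many relations produce all leading exponents by shifting, and shifting preserves the excess
  of total degree over that of the leading term.
\<close>
lemma bounded_relation:
  "\<exists>C. \<forall>e\<in>UNIV \<times> {..<r} - standard. \<exists>l\<in>relations. lds l e \<and>
     (\<forall>f\<in>keys l. mdeg (fst f) \<le> mdeg (fst e) + C)"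
proof -
  let ?N = "UNIV \<times> {..<r} - standard"
  have "\<exists>G0. finite G0 \<and> G0 \<subseteq> ?N \<and> (\<forall>e\<in>?N. \<exists>g\<in>G0. \<exists>b. e = (fst g + b, snd g))"
    by (rule dickson[of "{..<r}"]) auto
  then obtain G0 where G0: "finite G0" "G0 \<subseteq> ?N" "\<forall>e\<in>?N. \<exists>g\<in>G0. \<exists>b. e = (fst g + b, snd g)" by (elim exE conjE)
  have "\<forall>g\<in>G0. \<exists>l. l \<in> relations \<and> lds l g" using G0(2) by (auto simp: standard_def)
  from bchoice[OF this] obtain l where l: "\<forall>g\<in>G0. l g \<in> relations \<and> lds (l g) g" by (rule exE)
  let ?S = "\<Union>g\<in>G0. (\<lambda>f. mdeg (fst f)) ` keys (l g)"
  let ?C = "Max (insert 0 ?S)"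
  have C: "mdeg (fst f) \<le> ?C" if "g \<in> G0" "f \<in> keys (l g)" for f g
    using G0(1) that by (intro Max_ge) auto
  show ?thesis
  proof (intro exI[of _ ?C] ballI)
    fix e assume "e \<in> ?N"
    then obtain g b where g: "g \<in> G0" "e = (fst g + b, snd g)" using G0(3) by blast
    then have e: "e = mshift b g" by (simp add: mshift_def add.commute)
    from l g(1) have "l g \<in> relations" "lds (l g) g" by simp_all
    from shift_relation[OF this, of b] obtain l' where l': "l' \<in> relations" "lds l' (mshift b g)"
      "\<forall>f\<in>keys l'. \<exists>h\<in>keys (l g). f = mshift b h \<or> (snd f = snd h \<and> below (fst f) (b + fst h))"
      by (elim bexE conjE)
    have "mdeg (fst f) \<le> mdeg (fst e) + ?C" if "f \<in> keys l'" for f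
    proof -
      from bspec[OF l'(3) that] obtain h where h: "h \<in> keys (l g)" "f = mshift b h \<or> (snd f = snd h \<and> below (fst f) (b + fst h))" by (rule bexE)
      have "mdeg (fst f) \<le> mdeg (b + fst h)" using h(2) below_wdeg_le[of "fst f" "b + fst h" "\<lambda>_. Suc 0"] by (auto simp: mshift_def)
      also have "\<dots> \<le> mdeg (fst e) + ?C" using C[OF g(1) h(1)] by (simp add: e mshift_def)
      finally show ?thesis .
    qed
    then show "\<exists>l\<in>relations. lds l e \<and> (\<forall>f\<in>keys l. mdeg (fst f) \<le> mdeg (fst e) + ?C)"
      using l'(1,2) unfolding e by (intro bexI[of _ l'] conjI ballI) auto
  qed
qed

text \<open>
  Reducing an element of \<open>M\<close> may raise the total degree by \<open>C\<close>, but only when the weight drops.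
  So \<open>C\<close> times the weight plus the total degree never increases.
\<close>
lemma growth_M:
  assumes "carrier M \<noteq> {\<zero>\<^bsub>M\<^esub>}"
  shows "growth (\<lambda>i. vdim (range pscale) W M (SM.FN i)) (coordinate_dim standard)" and "standard \<noteq> {}"
proof -
  from bounded_relation obtain C where C: "\<forall>e\<in>UNIV \<times> {..<r} - standard. \<exists>l\<in>relations. lds l e \<and>
     (\<forall>f\<in>keys l. mdeg (fst f) \<le> mdeg (fst e) + C)" by (rule exE)
  \<comment> \<open>Each drop of the weight by one pays for an increase of the total degree by \<open>C\<close>.\<close>
  let ?\<delta> = "\<lambda>e. C * mkey \<omega> pn e + mdeg (fst e)"
  let ?c = "C * (\<Sum>v\<in>UNIV. \<omega> v) + 1" and ?c' = "C * (\<Sum>j<r. pn j)"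
  have indep: "a = 0" if "keys a \<subseteq> standard" "KM.lin SM.gx a = \<zero>\<^bsub>M\<^esub>" for a
    using that standard_independent unfolding SM_gx by blast
  have red: "\<exists>b. SM.gx e = KM.lin SM.gx b \<and> (\<forall>f\<in>keys b. f \<in> UNIV \<times> {..<r} \<and> ml f e \<and> ?\<delta> f \<le> ?\<delta> e)"
    if "e \<in> UNIV \<times> {..<r}" "e \<notin> standard" for e
  proof -
    from bspec[OF C, of e] that obtain l where l: "l \<in> relations" "lds l e" "\<forall>f\<in>keys l. mdeg (fst f) \<le> mdeg (fst e) + C" by auto
    have "\<Psi> l = \<zero>\<^bsub>M\<^esub>" "lookup l e \<noteq> 0" using l by (auto simp: relations_def leads_def in_keys_iff)
    from KM.lin_eliminate[of gm, OF gm_closed this] obtain b where b: "gm e = \<Psi> b" "keys b \<subseteq> keys l - {e}" by (elim exE conjE)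
    have "f \<in> UNIV \<times> {..<r} \<and> ml f e \<and> ?\<delta> f \<le> ?\<delta> e" if "f \<in> keys b" for f
    proof (intro conjI)
      have f: "f \<in> keys l" "f \<noteq> e" using b(2) that by auto
      show "f \<in> UNIV \<times> {..<r}" using f(1) l(1) by (auto simp: relations_def)
      show fe: "ml f e" using f l(2) by (simp add: leads_def)
      show "?\<delta> f \<le> ?\<delta> e"
      proof (cases "mkey \<omega> pn f < mkey \<omega> pn e")
        case True
        then have "C * (mkey \<omega> pn f + 1) \<le> C * mkey \<omega> pn e" by (intro mult_le_mono2) simp
        then show ?thesis using l(3) f(1) by force
      next
        case False
        then show ?thesis using fe unfolding mless_def by auto
      qed
    qed
    then show ?thesis unfolding SM_gx using b(1) by (intro exI[of _ b] conjI ballI) auto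
  qed
  have \<delta>: "?\<delta> e \<le> ?c * mdeg (fst e) + ?c'" if "e \<in> UNIV \<times> {..<r}" for e
  proof -
    have "pn (snd e) \<le> (\<Sum>j<r. pn j)" using that by (intro member_le_sum) auto
    then have "mkey \<omega> pn e \<le> (\<Sum>v\<in>UNIV. \<omega> v) * mdeg (fst e) + (\<Sum>j<r. pn j)"
      unfolding mkey_def using wdeg_le_mdeg[of \<omega> "fst e"] by linarith
    then have "C * mkey \<omega> pn e \<le> C * ((\<Sum>v\<in>UNIV. \<omega> v) * mdeg (fst e) + (\<Sum>j<r. pn j))" by (rule mult_le_mono2)
    then show ?thesis by (simp add: algebra_simps)
  qed
  show "growth (\<lambda>i. vdim (range pscale) W M (SM.FN i)) (coordinate_dim standard)"
    by (rule SM.staircase_growth_FN(1)[where w = \<omega> and p = pn and \<delta> = ?\<delta>, OF staircase_standard assms indep red _ \<delta>]) simp_all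
  show "standard \<noteq> {}"
    by (rule SM.staircase_growth_FN(2)[where w = \<omega> and p = pn and \<delta> = ?\<delta>, OF staircase_standard assms indep red _ \<delta>]) simp_all
qed

end

context good_filtered
begin

lemma F_cases: "y \<in> F k \<Longrightarrow> \<exists>a. y = \<Psi> a \<and> (\<forall>e\<in>keys a. snd e < r \<and> wt e \<le> k)"
  unfolding F_eq by (elim imageE) (intro exI conjI, assumption, simp)

text \<open>
  If a combination of standard generators vanishes in the graded module, its part of weight \<open>k\<close> agrees in
  \<open>M\<close> with a combination of smaller weight. The difference is a relation led by a standard exponent.
\<close>
lemma standard_independent_graded:
  assumes a: "keys a \<subseteq> standard" "KG.lin gG a = \<zero>\<^bsub>GM\<^esub>" shows "a = 0"
proof (rule ccontr)
  assume "a \<noteq> 0"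
  then obtain e where e: "e \<in> keys a" by (meson keys_eq_empty equals0I)
  have keyr: "snd f < r" if "f \<in> keys a" for f using a(1) that by (auto simp: standard_def)
  let ?a = "pm_restrict {f. wt f = wt e} a"
  have "\<forall>k. \<Psi> (pm_restrict {e. wt e = k} a) \<in> F (k - 1)"
    using a(2) unfolding lin_GM GM_simps by (subst (asm) FM.cls_eq_zero_iff) (rule \<Psi>_closed)
  then have "\<Psi> ?a \<in> F (wt e - 1)" by (rule spec)
  from F_cases[OF this] obtain b where b': "\<Psi> ?a = \<Psi> b \<and> (\<forall>f\<in>keys b. snd f < r \<and> wt f \<le> wt e - 1)" by (rule exE)
  note b = conjunct1[OF b'] conjunct2[OF b']
  have eb: "lookup b f = 0" if ge: "wt f \<ge> wt e" for f
  proof (rule ccontr)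
    assume "lookup b f \<noteq> 0"
    then have "f \<in> keys b" by (simp add: in_keys_iff)
    from bspec[OF b(2) this] ge show False by simp
  qed
  have sub: "keys (?a - b) \<subseteq> keys a \<union> keys b"
    using keys_diff[of ?a b] by (auto simp: keys_pm_restrict)
  have dr: "snd f < r" if "f \<in> keys (?a - b)" for f
    using subsetD[OF sub that] keyr bspec[OF b(2), of f] by (elim UnE) simp_all
  have rel: "?a - b \<in> relations"
    unfolding relations_def
  proof (intro CollectI conjI)
    show "keys (?a - b) \<subseteq> UNIV \<times> {..<r}"
    proof
      fix f assume "f \<in> keys (?a - b)"
      from dr[OF this] show "f \<in> UNIV \<times> {..<r}" by (simp add: mem_Times_iff)
    qed
    show "\<Psi> (?a - b) = \<zero>\<^bsub>M\<^esub>" unfolding KM.lin_diff_eq_0[of gm, OF gm_closed] by (rule b(1))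
  qed
  have ek: "e \<in> keys (?a - b)" using e eb[of e] by (simp add: in_keys_iff lookup_minus lookup_pm_restrict)
  then have "?a - b \<noteq> 0" by auto
  then obtain f where f: "lds (?a - b) f" using leads_exists by blast
  then have fk: "f \<in> keys (?a - b)" by (simp add: leads_def)
  then have fr: "snd f < r" by (rule dr)
  have "mkey \<omega> pn e \<le> mkey \<omega> pn f" using f ek by (cases "e = f") (auto simp: leads_def mless_def)
  then have "wt e \<le> wt f" using wt_mkey[OF fr] wt_mkey[OF keyr[OF e]] by simp
  then have "f \<in> keys ?a" using fk eb[of f] by (simp add: in_keys_iff lookup_minus)
  then have "f \<in> standard" using a(1) by (auto simp: keys_pm_restrict)
  then show False using f rel by (auto simp: standard_def)
qed

text \<open>
  The part of top weight of a relation is a relation in the graded module with the same leading exponent. Being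
  homogeneous, it reduces without raising the total degree.
\<close>
lemma growth_GM:
  assumes "carrier GM \<noteq> {\<zero>\<^bsub>GM\<^esub>}"
  shows "growth (\<lambda>i. vdim (range pconst) KXY GM (SG.FN i)) (coordinate_dim standard)"
proof -
  let ?\<delta> = "\<lambda>e :: ('n + 'n \<Rightarrow>\<^sub>0 nat) \<times> nat. mdeg (fst e)"
  have indep: "a = 0" if "keys a \<subseteq> standard" "KG.lin SG.gx a = \<zero>\<^bsub>GM\<^esub>" for a
    using that standard_independent_graded unfolding SG_gx by blast
  have red: "\<exists>b. SG.gx e = KG.lin SG.gx b \<and> (\<forall>f\<in>keys b. f \<in> UNIV \<times> {..<r} \<and> ml f e \<and> ?\<delta> f \<le> ?\<delta> e)"
    if e: "e \<in> UNIV \<times> {..<r}" "e \<notin> standard" for e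
  proof -
    from e obtain l where l: "l \<in> relations" "lds l e" by (auto simp: standard_def)
    have er: "snd e < r" using e by auto
    have lr: "snd f < r" if "f \<in> keys l" for f using l(1) that by (auto simp: relations_def)
    have le: "mkey \<omega> pn f \<le> mkey \<omega> pn e" if "f \<in> keys l" for f
      using l(2) that by (cases "f = e") (auto simp: leads_def mless_def)
    let ?l = "pm_restrict {f. wt f = wt e} l"
    have top: "\<Psi> ?l \<in> F (wt e - 1)"
    proof -
      have "\<Psi> (l + - ?l) \<in> F (wt e - 1)"
      proof (rule \<Psi>_in_F)
        fix f assume "f \<in> keys (l + - ?l)"
        then have f: "f \<in> keys l" "wt f \<noteq> wt e"
          by (auto simp: in_keys_iff lookup_add lookup_minus lookup_pm_restrict split: if_splits)
        then show "snd f < r \<and> wt f \<le> wt e - 1" using lr[OF f(1)] le[OF f(1)] wt_mkey[OF lr[OF f(1)]] wt_mkey[OF er] by simp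
      qed
      then have "\<ominus>\<^bsub>M\<^esub> \<Psi> ?l \<in> F (wt e - 1)" unfolding \<Psi>_add \<Psi>_uminus using l(1) \<Psi>_closed by (simp add: relations_def)
      from FM.F_inv[OF this] show ?thesis using \<Psi>_closed by simp
    qed
    have "pm_restrict {f. wt f = k} ?l = (if k = wt e then ?l else 0)" for k
      by (rule poly_mapping_eqI) (auto simp: lookup_pm_restrict)
    then have low: "\<Psi> (pm_restrict {f. wt f = k} ?l) \<in> F (k - 1)" for k using top by (simp add: \<Psi>_zero)
    have z: "KG.lin gG ?l = \<zero>\<^bsub>GM\<^esub>"
      unfolding lin_GM GM_simps by (rule FM.cls_eq_zero_iff[THEN iffD2, OF \<Psi>_closed], rule allI, rule low)
    have "lookup ?l e \<noteq> 0" using l(2) by (simp add: leads_def in_keys_iff lookup_pm_restrict)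
    from KG.lin_eliminate[of gG, OF gG_closed z this] obtain b where b: "gG e = KG.lin gG b" "keys b \<subseteq> keys ?l - {e}" by (elim exE conjE)
    have "f \<in> UNIV \<times> {..<r} \<and> ml f e \<and> ?\<delta> f \<le> ?\<delta> e" if "f \<in> keys b" for f
    proof -
      have f: "f \<in> keys l" "wt f = wt e" "f \<noteq> e" using b(2) that by (auto simp: keys_pm_restrict)
      have fe: "ml f e" using f l(2) by (simp add: leads_def)
      moreover have "mkey \<omega> pn f = mkey \<omega> pn e" using f(2) wt_mkey[OF lr[OF f(1)]] wt_mkey[OF er] by simp
      ultimately have "?\<delta> f \<le> ?\<delta> e" unfolding mless_def by auto
      then show ?thesis using fe lr[OF f(1)] by (simp add: mem_Times_iff)
    qed
    then show ?thesis unfolding SG_gx using b(1) by (intro exI[of _ b] conjI ballI) auto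
  qed
  show ?thesis
    by (rule SG.staircase_growth_FN(1)[where w = \<omega> and p = pn and \<delta> = ?\<delta> and c = 1 and c' = 0, OF staircase_standard assms indep red]) simp_all
qed

lemma GM_trivial_iff: "carrier GM = {\<zero>\<^bsub>GM\<^esub>} \<longleftrightarrow> carrier M = {\<zero>\<^bsub>M\<^esub>}"
proof
  assume M: "carrier M = {\<zero>\<^bsub>M\<^esub>}"
  have "g = \<zero>\<^bsub>GM\<^esub>" if "g \<in> carrier GM" for g
  proof -
    from that obtain b where b: "g = FM.cls b" "FM.fam b" by (rule GM_cases)
    have "b = (\<lambda>_. \<zero>\<^bsub>M\<^esub>)" using FM.fam_carrier[OF b(2)] M by auto
    then show ?thesis unfolding b(1) GM_simps by simp
  qed
  moreover have "\<zero>\<^bsub>GM\<^esub> \<in> carrier GM" by (rule abelian_monoid.zero_closed[OF abelian_group.axioms(1)[OF GM_abelian_group]])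
  ultimately show "carrier GM = {\<zero>\<^bsub>GM\<^esub>}" by blast
next
  assume GM: "carrier GM = {\<zero>\<^bsub>GM\<^esub>}"
  show "carrier M = {\<zero>\<^bsub>M\<^esub>}"
  proof (rule ccontr)
    assume "carrier M \<noteq> {\<zero>\<^bsub>M\<^esub>}"
    from growth_M(2)[OF this] obtain e where e: "e \<in> standard" by blast
    let ?e = "single e (1::'k)"
    have "KG.lin gG ?e \<in> carrier GM" by (rule KG.lin_closed[of gG, OF gG_closed])
    then have "KG.lin gG ?e = \<zero>\<^bsub>GM\<^esub>" using GM by simp
    then have "?e = 0" using e by (intro standard_independent_graded) auto
    then have "lookup ?e e = 0" by simp
    then show False by simp
  qed
qed

lemma lin_mG: "KG.lin gG (emb j c) = c \<odot>\<^bsub>GM\<^esub> mG j"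
proof (induction c rule: mpol_additive_induct)
  case (single a k)
  have "KG.lin gG (emb j (single a k)) = pconst k \<odot>\<^bsub>GM\<^esub> (mon a \<odot>\<^bsub>GM\<^esub> mG j)"
    unfolding emb_single KG.lin_single[of gG, OF gG_closed] by (simp add: gG_def KG.scal_def)
  also have "\<dots> = (pconst k * mon a) \<odot>\<^bsub>GM\<^esub> mG j" by (rule GM_assoc[symmetric, OF mG_closed])
  also have "pconst k * mon a = single a k" by (simp add: pconst_times)
  finally show ?case .
next
  case (add c d)
  show ?case unfolding emb_add KG.lin_add[of gG, OF gG_closed] add GM_l_distr[OF mG_closed] ..
qed

abbreviation Ann :: "('n, 'k) polXY set" where "Ann \<equiv> annihilator KXY GM"

lemma Ann_iff: "q \<in> Ann \<longleftrightarrow> (\<forall>x\<in>carrier GM. q \<odot>\<^bsub>GM\<^esub> x = \<zero>\<^bsub>GM\<^esub>)" by (simp add: annihilator_def)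

lemma Ann_ideal: "is_ideal Ann"
  unfolding is_ideal_def Ann_iff
proof (intro conjI ballI allI)
  fix x assume x: "x \<in> carrier GM"
  show "0 \<odot>\<^bsub>GM\<^esub> x = \<zero>\<^bsub>GM\<^esub>" using KG.smult_zero_left[OF x] by simp
  fix q s assume q: "q \<in> Ann"
  then have qx: "q \<odot>\<^bsub>GM\<^esub> x = \<zero>\<^bsub>GM\<^esub>" using x by (simp add: Ann_iff)
  show "(s * q) \<odot>\<^bsub>GM\<^esub> x = \<zero>\<^bsub>GM\<^esub>" unfolding GM_assoc[OF x] qx using KG.smult_zero_right[of s] by simp
  assume "s \<in> Ann"
  then have sx: "s \<odot>\<^bsub>GM\<^esub> x = \<zero>\<^bsub>GM\<^esub>" using x by (simp add: Ann_iff)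
  show "(q + s) \<odot>\<^bsub>GM\<^esub> x = \<zero>\<^bsub>GM\<^esub>" unfolding GM_l_distr[OF x] qx sx by simp
qed

lemma Ann_generators:
  assumes "\<And>j. j < r \<Longrightarrow> q \<odot>\<^bsub>GM\<^esub> mG j = \<zero>\<^bsub>GM\<^esub>" shows "q \<in> Ann"
proof -
  have qK: "q \<in> carrier KXY" by simp
  have "KG.ksub {\<zero>\<^bsub>GM\<^esub>}" by (simp add: KG.ksub_def)
  from KG.ksub_preimage[OF qK this] have "KG.ksub {y \<in> carrier GM. q \<odot>\<^bsub>GM\<^esub> y \<in> {\<zero>\<^bsub>GM\<^esub>}}" .
  moreover have "gG ` (UNIV \<times> {..<r}) \<subseteq> {y \<in> carrier GM. q \<odot>\<^bsub>GM\<^esub> y \<in> {\<zero>\<^bsub>GM\<^esub>}}"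
  proof (rule image_subsetI)
    fix e :: "('n + 'n \<Rightarrow>\<^sub>0 nat) \<times> nat" assume "e \<in> UNIV \<times> {..<r}"
    then have er: "snd e < r" by auto
    have "q \<odot>\<^bsub>GM\<^esub> gG e = (mon (fst e) * q) \<odot>\<^bsub>GM\<^esub> mG (snd e)"
      unfolding gG_def GM_assoc[OF mG_closed, symmetric] by (simp add: mult.commute)
    also have "\<dots> = \<zero>\<^bsub>GM\<^esub>"
      unfolding GM_assoc[OF mG_closed] assms[OF er] using KG.smult_zero_right[of "mon (fst e)"] by simp
    finally show "gG e \<in> {y \<in> carrier GM. q \<odot>\<^bsub>GM\<^esub> y \<in> {\<zero>\<^bsub>GM\<^esub>}}" using gG_closed by simp
  qed
  ultimately have "KG.kspan (gG ` (UNIV \<times> {..<r})) \<subseteq> {y \<in> carrier GM. q \<odot>\<^bsub>GM\<^esub> y \<in> {\<zero>\<^bsub>GM\<^esub>}}" by (rule KG.kspan_minimal)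
  then show ?thesis unfolding gG_gen Ann_iff by blast
qed

text \<open>
  If every generator were killed by a nonzero polynomial in the variables \<open>S\<close>, the product of these
  polynomials would annihilate the module.
\<close>
lemma faithful_generator:
  assumes S: "indep_mod Ann S"
  shows "\<exists>j<r. \<forall>q\<in>poly_in S. q \<odot>\<^bsub>GM\<^esub> mG j = \<zero>\<^bsub>GM\<^esub> \<longrightarrow> q = 0"
proof (rule ccontr)
  assume "\<not> ?thesis"
  then have "\<forall>j\<in>{..<r}. \<exists>q. q \<in> poly_in S \<and> q \<odot>\<^bsub>GM\<^esub> mG j = \<zero>\<^bsub>GM\<^esub> \<and> q \<noteq> 0" by auto
  from bchoice[OF this] obtain q where q: "\<forall>j\<in>{..<r}. q j \<in> poly_in S \<and> q j \<odot>\<^bsub>GM\<^esub> mG j = \<zero>\<^bsub>GM\<^esub> \<and> q j \<noteq> 0" by (rule exE)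
  have "prod q {..<r} \<in> Ann"
  proof (rule Ann_generators)
    fix j assume j: "j < r"
    have "prod q {..<r} = prod q ({..<r} - {j}) * q j" using j by (subst prod.remove[of _ j]) (simp_all add: mult.commute)
    then have "prod q {..<r} \<odot>\<^bsub>GM\<^esub> mG j = prod q ({..<r} - {j}) \<odot>\<^bsub>GM\<^esub> (q j \<odot>\<^bsub>GM\<^esub> mG j)" by (simp only: GM_assoc[OF mG_closed])
    also have "\<dots> = \<zero>\<^bsub>GM\<^esub>" using q j KG.smult_zero_right[of "prod q ({..<r} - {j})"] by simp
    finally show "prod q {..<r} \<odot>\<^bsub>GM\<^esub> mG j = \<zero>\<^bsub>GM\<^esub>" .
  qed
  moreover have "prod q {..<r} \<in> poly_in S" by (rule poly_in_prod) (use q in simp)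
  ultimately have "prod q {..<r} = 0" using S by (auto simp: indep_mod_def)
  moreover have "prod q {..<r} \<noteq> 0" by (rule mpol_prod_nonzero) (use q in simp_all)
  ultimately show False by simp
qed

lemma one_not_in_Ann:
  assumes "carrier GM \<noteq> {\<zero>\<^bsub>GM\<^esub>}" shows "1 \<notin> Ann"
proof
  assume "1 \<in> Ann"
  then have "carrier GM \<subseteq> {\<zero>\<^bsub>GM\<^esub>}" using GM_one by (force simp: Ann_iff)
  moreover have "\<zero>\<^bsub>GM\<^esub> \<in> carrier GM" by simp
  ultimately show False using assms by blast
qed

text \<open>
  A coordinate subspace of the staircase gives variables that are independent modulo the annihilator, since the
  corresponding multiples of one generator are independent. Conversely, independent variables act freely on some
  generator, and the box of their monomials cannot outgrow the module.
\<close>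
lemma cdim_Ann:
  assumes nz: "carrier GM \<noteq> {\<zero>\<^bsub>GM\<^esub>}"
  shows "cdim Ann = coordinate_dim standard"
proof (rule antisym)
  have ne: "standard \<noteq> {}" using nz growth_M(2) unfolding GM_trivial_iff by blast
  show "coordinate_dim standard \<le> cdim Ann"
  proof (rule coordinate_dim_witness[OF staircase_standard ne])
    fix S j assume S: "\<And>a. keys a \<subseteq> S \<Longrightarrow> (a, j) \<in> standard" "card S = coordinate_dim standard"
    have "indep_mod Ann S"
      unfolding indep_mod_def
    proof
      fix q assume q: "q \<in> poly_in S \<inter> Ann"
      have "KG.lin gG (emb j q) = \<zero>\<^bsub>GM\<^esub>" unfolding lin_mG using q mG_closed by (simp add: Ann_iff)
      moreover have "keys (emb j q) \<subseteq> standard"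
      proof
        fix e assume "e \<in> keys (emb j q)"
        then have "snd e = j" "keys (fst e) \<subseteq> S" using q by (auto simp: keys_emb poly_in_def)
        then show "e \<in> standard" using S(1)[of "fst e"] by (metis prod.collapse)
      qed
      ultimately have "emb j q = 0" by (intro standard_independent_graded)
      then have "lookup q a = 0" for a using lookup_emb[of j q "(a, j)"] by simp
      then have "q = 0" by (intro poly_mapping_eqI) simp
      then show "q \<in> {0}" by simp
    qed
    from cdim_ge[OF this] show ?thesis using S(2) by simp
  qed
  show "cdim Ann \<le> coordinate_dim standard"
  proof (rule cdim_witness[OF Ann_ideal one_not_in_Ann[OF nz]])
    fix S assume S: "indep_mod Ann S" "card S = cdim Ann"
    from faithful_generator[OF S(1)] obtain j where j: "j < r" "\<forall>q\<in>poly_in S. q \<odot>\<^bsub>GM\<^esub> mG j = \<zero>\<^bsub>GM\<^esub> \<longrightarrow> q = 0" by (elim exE conjE)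
    let ?D = "{e :: ('n + 'n \<Rightarrow>\<^sub>0 nat) \<times> nat. snd e = j \<and> keys (fst e) \<subseteq> S}"
    from growth_GM[OF nz] obtain C where C: "\<forall>i. vdim (range pconst) KXY GM (SG.FN i) \<le> C * (i + 1) ^ coordinate_dim standard"
      unfolding growth_def by blast
    have "(i + 1) ^ card S \<le> C * (card S + 1) ^ coordinate_dim standard * (i + 1) ^ coordinate_dim standard" for i
    proof -
      let ?B = "{e \<in> ?D. mdeg (fst e) \<le> card S * i}"
      have "(i + 1) ^ card S \<le> card ?B" by (rule staircase_lower_count[of ?D r S j]) (use j in auto)
      also have "\<dots> \<le> vdim (range pconst) KXY GM (SG.FN (card S * i))"
      proof (rule KG.family_le_vdim[where x = gG, OF SG.FN_sub _ finite_imageI[OF finite_mdeg_le_pairs] _ gG_closed])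
        show "SG.gx ` {e \<in> UNIV \<times> {..<r}. mdeg (fst e) \<le> card S * i} \<subseteq> carrier GM" by auto
        show "SG.FN (card S * i) \<subseteq> KG.kspan (SG.gx ` {e \<in> UNIV \<times> {..<r}. mdeg (fst e) \<le> card S * i})" by (simp add: SG.FN_def)
        show "finite ?B" by (rule finite_subset[OF _ finite_mdeg_le_pairs[of r "card S * i"]]) (use j in auto)
        show "gG ` ?B \<subseteq> SG.FN (card S * i)" unfolding SG_gx[symmetric] using j(1) by (auto intro!: SG.gx_in_FN)
        fix a assume a: "keys a \<subseteq> ?B" "KG.lin gG a = \<zero>\<^bsub>GM\<^esub>"
        have ae: "a = emb j (component j a)"
        proof (rule poly_mapping_eqI)
          fix e
          show "lookup a e = lookup (emb j (component j a)) e"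
          proof (cases "snd e = j")
            case False
            then have "e \<notin> keys a" using a(1) by blast
            then show ?thesis using False by (simp add: lookup_emb in_keys_iff)
          qed (auto simp: lookup_emb lookup_component)
        qed
        have "component j a \<in> poly_in S"
          unfolding poly_in_def
        proof (intro CollectI ballI)
          fix x assume "x \<in> keys (component j a)"
          then have "(x, j) \<in> keys a" by (simp add: in_keys_iff lookup_component)
          from subsetD[OF a(1) this] show "keys x \<subseteq> S" by simp
        qed
        moreover have "component j a \<odot>\<^bsub>GM\<^esub> mG j = \<zero>\<^bsub>GM\<^esub>" using a(2) unfolding lin_mG[symmetric] ae[symmetric] .
        ultimately have "component j a = 0" using j(2) by blast
        then show "a = 0" using ae by (simp add: emb_def)
      qed
      also have "\<dots> \<le> C * (card S * i + 1) ^ coordinate_dim standard" using C by blast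
      also have "\<dots> \<le> C * ((card S + 1) * (i + 1)) ^ coordinate_dim standard"
        by (intro mult_le_mono2 power_mono) (simp_all add: algebra_simps)
      finally show ?thesis unfolding power_mult_distrib mult.assoc .
    qed
    from exponent_growth_le[OF this] show ?thesis using S(2) by simp
  qed
qed

lemma GKdim_M: "carrier M \<noteq> {\<zero>\<^bsub>M\<^esub>} \<Longrightarrow> GKdim (range pscale) W M = ereal (real (cdim Ann))"
  using SM.GKdim_eq_growth[OF _ growth_M(1)] cdim_Ann GM_trivial_iff by simp

lemma GKdim_GM: "carrier M \<noteq> {\<zero>\<^bsub>M\<^esub>} \<Longrightarrow> GKdim (range pconst) KXY GM = ereal (real (cdim Ann))"
  using SG.GKdim_eq_growth[OF _ growth_GM] cdim_Ann GM_trivial_iff by simp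

end

section \<open>Chains of primes and irreducible closed sets\<close>

lemma chain_dim_mono:
  assumes "\<And>x. x \<in> C \<Longrightarrow> f x \<in> C'" "\<And>x y. x \<in> C \<Longrightarrow> y \<in> C \<Longrightarrow> x \<subset> y \<Longrightarrow> f x \<subset> f y"
  shows "chain_dim C \<le> chain_dim C'"
  unfolding chain_dim_def
proof (rule SUP_subset_mono)
  show "{l. \<exists>P :: nat \<Rightarrow> _. (\<forall>i\<le>l. P i \<in> C) \<and> (\<forall>i<l. P i \<subset> P (Suc i))} \<subseteq>
    {l. \<exists>P :: nat \<Rightarrow> _. (\<forall>i\<le>l. P i \<in> C') \<and> (\<forall>i<l. P i \<subset> P (Suc i))}"
  proof (rule subsetI, elim CollectE exE conjE, rule CollectI)
    fix l and P :: "nat \<Rightarrow> 'a set" assume P: "\<forall>i\<le>l. P i \<in> C" "\<forall>i<l. P i \<subset> P (Suc i)"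
    have "f (P i) \<subset> f (P (Suc i))" if "i < l" for i using that P by (intro assms(2)) simp_all
    then show "\<exists>P. (\<forall>i\<le>l. P i \<in> C') \<and> (\<forall>i<l. P i \<subset> P (Suc i))"
      using P assms(1) by (intro exI[of _ "\<lambda>i. f (P i)"]) simp
  qed
qed simp

lemma chain_dim_antimono:
  assumes "\<And>x. x \<in> C \<Longrightarrow> f x \<in> C'" "\<And>x y. x \<in> C \<Longrightarrow> y \<in> C \<Longrightarrow> x \<subset> y \<Longrightarrow> f y \<subset> f x"
  shows "chain_dim C \<le> chain_dim C'"
  unfolding chain_dim_def
proof (rule SUP_subset_mono)
  show "{l. \<exists>P :: nat \<Rightarrow> _. (\<forall>i\<le>l. P i \<in> C) \<and> (\<forall>i<l. P i \<subset> P (Suc i))} \<subseteq>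
    {l. \<exists>P :: nat \<Rightarrow> _. (\<forall>i\<le>l. P i \<in> C') \<and> (\<forall>i<l. P i \<subset> P (Suc i))}"
  proof (rule subsetI, elim CollectE exE conjE, rule CollectI)
    fix l and P :: "nat \<Rightarrow> 'a set" assume P: "\<forall>i\<le>l. P i \<in> C" "\<forall>i<l. P i \<subset> P (Suc i)"
    have "f (P (l - i)) \<subset> f (P (l - Suc i))" if i: "i < l" for i
    proof (rule assms(2))
      have "l - Suc i < l" "Suc (l - Suc i) = l - i" using i by simp_all
      then show "P (l - Suc i) \<subset> P (l - i)" using P(2) by metis
    qed (use P(1) in simp_all)
    then show "\<exists>P. (\<forall>i\<le>l. P i \<in> C') \<and> (\<forall>i<l. P i \<subset> P (Suc i))"
      using P(1) assms(1) by (intro exI[of _ "\<lambda>i. f (P (l - i))"]) simp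
  qed
qed simp

lemma ideal_KXY_iff: "ideal J (KXY :: ('n::finite, 'k::field_char_0) polXY ring) \<longleftrightarrow> is_ideal J"
proof
  assume "ideal J (KXY :: ('n, 'k) polXY ring)"
  then interpret J: ideal J "KXY :: ('n, 'k) polXY ring" .
  have "0 \<in> J" using additive_subgroup.zero_closed[OF J.is_additive_subgroup] by simp
  moreover have "x + y \<in> J" if "x \<in> J" "y \<in> J" for x y using additive_subgroup.a_closed[OF J.is_additive_subgroup that] by simp
  moreover have "a * x \<in> J" if "x \<in> J" for a x using J.I_l_closed[OF that, of a] by simp
  ultimately show "is_ideal J" by (simp add: is_ideal_def)
next
  assume J: "is_ideal J"
  interpret K: cring "KXY :: ('n, 'k) polXY ring" by (rule cring_KXY)
  have minus: "\<ominus>\<^bsub>KXY\<^esub> x = - x" for x :: "('n, 'k) polXY" by (rule K.minus_equality) simp_all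
  show "ideal J (KXY :: ('n, 'k) polXY ring)"
  proof (rule idealI[OF K.ring_axioms])
    show "subgroup J (add_monoid (KXY :: ('n, 'k) polXY ring))"
    proof (rule subgroup.intro)
      fix x assume "x \<in> J"
      then have "\<ominus>\<^bsub>KXY\<^esub> x \<in> J" unfolding minus using ideal_closed(5)[OF J] by simp
      then show "inv\<^bsub>add_monoid KXY\<^esub> x \<in> J" by (simp only: a_inv_def)
    qed (use ideal_closed[OF J] in simp_all)
  qed (use ideal_closed[OF J] in simp_all)
qed

lemma primeideal_KXY_iff: "primeideal P (KXY :: ('n::finite, 'k::field_char_0) polXY ring) \<longleftrightarrow> is_prime P"
proof
  assume P: "primeideal P (KXY :: ('n, 'k) polXY ring)"
  then interpret P: primeideal P "KXY :: ('n, 'k) polXY ring" .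
  have iP: "is_ideal P" using P.is_ideal ideal_KXY_iff by blast
  have "1 \<notin> P"
  proof
    assume "1 \<in> P"
    then have "x \<in> P" for x using ideal_closed(3)[OF iP, of 1 x] by simp
    then show False using P.I_notcarr by auto
  qed
  then show "is_prime P" using iP P.I_prime by (simp add: is_prime_def)
next
  assume P: "is_prime P"
  show "primeideal P (KXY :: ('n, 'k) polXY ring)"
  proof (rule primeidealI[OF _ cring_KXY])
    show "ideal P KXY" using P by (simp add: ideal_KXY_iff is_prime_def)
    show "carrier KXY \<noteq> P" using P by (auto simp: is_prime_def)
  qed (use P in \<open>simp_all add: is_prime_def\<close>)
qed

context
  fixes I :: "('n::finite, 'k::field_char_0) polXY set"
  assumes I: "is_ideal I"
begin

abbreviation h where "h \<equiv> \<lambda>x. I +>\<^bsub>KXY\<^esub> x"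

lemma h_hom: "ring_hom_ring KXY (KXY Quot I) h"
  using ideal.rcos_ring_hom_ring I ideal_KXY_iff by blast

lemma h_surj: "carrier (KXY Quot I) = range h"
  by (auto simp: FactRing_def A_RCOSETS_def')

lemma h_coset: "h x = {i + x | i. i \<in> I}" by (auto simp: a_r_coset_def')

lemma h_in_image: assumes P: "is_ideal P" "I \<subseteq> P" shows "h x \<in> h ` P \<longleftrightarrow> x \<in> P"
proof
  assume "h x \<in> h ` P"
  then obtain y where y: "y \<in> P" "h x = h y" by blast
  have "x = 0 + x" by simp
  then have "\<exists>i. x = i + x \<and> i \<in> I" using ideal_closed(1)[OF I] by (intro exI conjI)
  then have "x \<in> h x" unfolding h_coset by (rule CollectI)
  then have "x \<in> h y" unfolding y(2) .
  then have "\<exists>i. x = i + y \<and> i \<in> I" unfolding h_coset by (rule CollectD)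
  then obtain i where i: "x = i + y" "i \<in> I" by (elim exE conjE)
  show "x \<in> P" unfolding i(1) by (rule ideal_closed(2)[OF P(1) subsetD[OF P(2) i(2)] y(1)])
qed (rule imageI)

lemma prime_preimage:
  assumes Q: "primeideal Q (KXY Quot I)" shows "is_prime (h -` Q)" "I \<subseteq> h -` Q"
proof -
  interpret h: ring_hom_ring KXY "KXY Quot I" h by (rule h_hom)
  have "primeideal {x \<in> carrier KXY. h x \<in> Q} KXY" by (rule h.primeideal_vimage[OF cring_KXY Q])
  then show "is_prime (h -` Q)" unfolding primeideal_KXY_iff by (simp add: vimage_def)
  have iI: "ideal I KXY" using I by (simp add: ideal_KXY_iff)
  have "h x = \<zero>\<^bsub>KXY Quot I\<^esub>" if "x \<in> I" for x
    using ring.a_rcos_zero[OF cring.axioms(1)[OF cring_KXY] iI that] by (simp add: FactRing_def)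
  moreover have "\<zero>\<^bsub>KXY Quot I\<^esub> \<in> Q"
    using Q unfolding primeideal_def ideal_def by (blast intro: additive_subgroup.zero_closed)
  ultimately show "I \<subseteq> h -` Q" by auto
qed

lemma prime_image:
  assumes P: "is_prime P" "I \<subseteq> P" shows "primeideal (h ` P) (KXY Quot I)"
proof -
  interpret h: ring_hom_ring KXY "KXY Quot I" h by (rule h_hom)
  have iP: "is_ideal P" using P by (simp add: is_prime_def)
  note mem = h_in_image[OF iP P(2)]
  have hm: "h x \<otimes>\<^bsub>KXY Quot I\<^esub> h y = h (x * y)" for x y using h.hom_mult[of x y] by simp
  have ha: "h x \<oplus>\<^bsub>KXY Quot I\<^esub> h y = h (x + y)" for x y using h.hom_add[of x y] by simp
  have hz: "\<zero>\<^bsub>KXY Quot I\<^esub> = h 0" using h.hom_zero by simp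
  have minus: "\<ominus>\<^bsub>KXY Quot I\<^esub> h x = h (- x)" for x
    by (rule h.S.minus_equality) (simp_all only: ha hz h_surj rangeI left_minus)
  show ?thesis
  proof (rule primeidealI)
    show "cring (KXY Quot I)" using ideal.quotient_is_cring[OF _ cring_KXY] I ideal_KXY_iff by blast
    show "ideal (h ` P) (KXY Quot I)"
    proof (rule idealI[OF h.S.ring_axioms])
      show "subgroup (h ` P) (add_monoid (KXY Quot I))"
      proof (rule subgroup.intro)
        show "h ` P \<subseteq> carrier (add_monoid (KXY Quot I))" using h_surj by auto
        show "\<one>\<^bsub>add_monoid (KXY Quot I)\<^esub> \<in> h ` P" using hz ideal_closed(1)[OF iP] by simp
      next
        fix a b assume "a \<in> h ` P" "b \<in> h ` P"
        then obtain x y where "a = h x" "x \<in> P" "b = h y" "y \<in> P" by blast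
        then have "a \<oplus>\<^bsub>KXY Quot I\<^esub> b \<in> h ` P" using ideal_closed(2)[OF iP] by (simp only: ha mem)
        then show "a \<otimes>\<^bsub>add_monoid (KXY Quot I)\<^esub> b \<in> h ` P" by simp
      next
        fix a assume "a \<in> h ` P"
        then obtain x where "a = h x" "x \<in> P" by blast
        then have "\<ominus>\<^bsub>KXY Quot I\<^esub> a \<in> h ` P" using ideal_closed(5)[OF iP] by (simp only: minus mem)
        then show "inv\<^bsub>add_monoid (KXY Quot I)\<^esub> a \<in> h ` P" by (simp only: a_inv_def)
      qed
    next
      fix a b assume "a \<in> h ` P" "b \<in> carrier (KXY Quot I)"
      then obtain x y where xy: "a = h x" "x \<in> P" "b = h y" unfolding h_surj by blast
      show "b \<otimes>\<^bsub>KXY Quot I\<^esub> a \<in> h ` P" unfolding xy hm mem using xy ideal_closed(3)[OF iP] by blast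
      show "a \<otimes>\<^bsub>KXY Quot I\<^esub> b \<in> h ` P" unfolding xy hm mem using xy ideal_closed(4)[OF iP] by blast
    qed
    show "carrier (KXY Quot I) \<noteq> h ` P"
    proof
      assume "carrier (KXY Quot I) = h ` P"
      then have "h 1 \<in> h ` P" unfolding h_surj by blast
      then show False unfolding mem using P(1) by (simp add: is_prime_def)
    qed
    fix a b assume "a \<in> carrier (KXY Quot I)" "b \<in> carrier (KXY Quot I)" and ab: "a \<otimes>\<^bsub>KXY Quot I\<^esub> b \<in> h ` P"
    then obtain x y where xy: "a = h x" "b = h y" unfolding h_surj by blast
    show "a \<in> h ` P \<or> b \<in> h ` P" using ab P(1) unfolding xy hm mem by (simp add: is_prime_def)
  qed
qed

text \<open>
  Primes of the quotient ring correspond to the primes above \<open>I\<close> by preimage and image.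
\<close>
lemma chain_dim_quotient:
  "chain_dim {Q. primeideal Q (KXY Quot I)} = chain_dim {P. is_prime P \<and> I \<subseteq> P}"
proof (rule antisym)
  show "chain_dim {Q. primeideal Q (KXY Quot I)} \<le> chain_dim {P. is_prime P \<and> I \<subseteq> P}"
  proof (rule chain_dim_mono[of _ "(-`) h"])
    fix Q assume "Q \<in> {Q. primeideal Q (KXY Quot I)}"
    then show "h -` Q \<in> {P. is_prime P \<and> I \<subseteq> P}" using prime_preimage by simp
  next
    fix Q Q' assume "Q' \<in> {Q. primeideal Q (KXY Quot I)}" and QQ: "Q \<subset> Q'"
    then have "ideal Q' (KXY Quot I)" by (simp add: primeideal.axioms(1))
    then have "Q' \<subseteq> range h" using additive_subgroup.a_subset[OF ideal.axioms(1)] h_surj by blast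
    then obtain x where "x \<in> h -` Q'" "x \<notin> h -` Q" using QQ by blast
    then show "h -` Q \<subset> h -` Q'" using QQ by blast
  qed
  show "chain_dim {P. is_prime P \<and> I \<subseteq> P} \<le> chain_dim {Q. primeideal Q (KXY Quot I)}"
  proof (rule chain_dim_mono[of _ "(`) h"])
    fix P assume "P \<in> {P. is_prime P \<and> I \<subseteq> P}"
    then show "h ` P \<in> {Q. primeideal Q (KXY Quot I)}" using prime_image by simp
  next
    fix P P' assume P: "P \<in> {P. is_prime P \<and> I \<subseteq> P}" and PP: "P \<subset> P'"
    then obtain x where x: "x \<in> P'" "x \<notin> P" by blast
    have "h x \<notin> h ` P" using h_in_image[of P x] P x(2) by (simp add: is_prime_def)
    then show "h ` P \<subset> h ` P'" using PP x(1) by blast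
  qed
qed

lemma Var_KXY: "Var (KXY :: ('n, 'k) polXY ring) S = {P. is_prime P \<and> S \<subseteq> P}"
  by (simp add: Var_def Spec_def primeideal_KXY_iff)

lemma closedin_Var: 
  "closedin (subtopology (zariski KXY) (Var KXY I)) Z \<longleftrightarrow> (\<exists>S. Z = Var KXY S) \<and> Z \<subseteq> Var KXY I"
proof -
  have "closedin (zariski KXY) (Var KXY I)" unfolding closedin_zariski[OF cring_KXY] by auto
  then show ?thesis by (simp add: closedin_closed_subtopology closedin_zariski[OF cring_KXY])
qed

abbreviation V where "V \<equiv> subtopology (zariski KXY) (Var KXY I)"

lemma irreducible_Var: assumes P: "is_prime P" "I \<subseteq> P" shows "irreducible_closed V (Var KXY P)"
  unfolding irreducible_closed_def closedin_Var
proof (intro conjI allI impI)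
  show "\<exists>S. Var KXY P = Var KXY S" by blast
  show "Var KXY P \<subseteq> Var KXY I" using P(2) by (auto simp: Var_KXY)
  have PP: "P \<in> Var KXY P" using P by (simp add: Var_KXY)
  then show "Var KXY P \<noteq> {}" by blast
  fix C D assume "((\<exists>S. C = Var KXY S) \<and> C \<subseteq> Var KXY I) \<and> ((\<exists>S. D = Var KXY S) \<and> D \<subseteq> Var KXY I) \<and> Var KXY P \<subseteq> C \<union> D"
  then obtain S T where ST: "C = Var KXY S" "D = Var KXY T" "Var KXY P \<subseteq> C \<union> D" by blast
  then have "P \<in> C \<or> P \<in> D" using PP by blast
  then show "Var KXY P \<subseteq> C \<or> Var KXY P \<subseteq> D" unfolding ST(1,2) Var_KXY by blast
qed

text \<open>
  If \<open>a * b\<close> vanishes on \<open>Z\<close>, then \<open>Z\<close> is covered by the zero sets of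
  \<open>a\<close> and of \<open>b\<close>, and irreducibility selects one of them.
\<close>
lemma irreducible_cases:
  assumes Z: "irreducible_closed V Z"
  shows "is_prime (\<Inter>Z)" "I \<subseteq> \<Inter>Z" "Z = Var KXY (\<Inter>Z)"
proof -
  have ne: "Z \<noteq> {}" and sub: "Z \<subseteq> Var KXY I" and ex: "\<exists>S. Z = Var KXY S"
    and irr: "\<And>C D. closedin V C \<Longrightarrow> closedin V D \<Longrightarrow> Z \<subseteq> C \<union> D \<Longrightarrow> Z \<subseteq> C \<or> Z \<subseteq> D"
    using Z unfolding irreducible_closed_def closedin_Var by blast+
  from ex obtain S where S: "Z = Var KXY S" by blast
  have mem: "P \<in> Z \<longleftrightarrow> is_prime P \<and> S \<subseteq> P" for P unfolding S Var_KXY by (rule mem_Collect_eq)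
  have pr: "is_prime P" "is_ideal P" if "P \<in> Z" for P using that unfolding mem is_prime_def by simp_all
  show "I \<subseteq> \<Inter>Z" using sub by (auto simp: Var_KXY)
  have SZ: "S \<subseteq> \<Inter>Z" by (rule Inter_greatest) (simp add: mem)
  show "Z = Var KXY (\<Inter>Z)"
  proof (rule Set.set_eqI, rule iffI)
    fix P assume P: "P \<in> Z"
    show "P \<in> Var KXY (\<Inter>Z)" unfolding Var_KXY by (intro CollectI conjI pr(1)[OF P] Inter_lower[OF P])
  next
    fix P assume "P \<in> Var KXY (\<Inter>Z)"
    then have "is_prime P" "\<Inter>Z \<subseteq> P" unfolding Var_KXY by simp_all
    then show "P \<in> Z" unfolding mem using SZ by (intro conjI) (assumption, rule order_trans)
  qed
  have "is_ideal (\<Inter>Z)"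
    unfolding is_ideal_def
  proof (intro conjI ballI allI InterI)
    fix P assume P: "P \<in> Z"
    show "0 \<in> P" by (rule ideal_closed(1)[OF pr(2)[OF P]])
    fix x assume x: "x \<in> \<Inter>Z"
    show "a * x \<in> P" for a by (rule ideal_closed(3)[OF pr(2)[OF P] InterD[OF x P]])
    fix y assume y: "y \<in> \<Inter>Z"
    show "x + y \<in> P" by (rule ideal_closed(2)[OF pr(2)[OF P] InterD[OF x P] InterD[OF y P]])
  qed
  moreover have "1 \<notin> \<Inter>Z"
  proof
    assume 1: "1 \<in> \<Inter>Z"
    obtain P where P: "P \<in> Z" using ne by blast
    from InterD[OF 1 P] pr(1)[OF P] show False by (simp add: is_prime_def)
  qed
  moreover have "a \<in> \<Inter>Z \<or> b \<in> \<Inter>Z" if ab: "a * b \<in> \<Inter>Z" for a b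
  proof -
    have cl: "closedin V (Var KXY (insert c S))" for c
      unfolding closedin_Var
    proof (intro conjI exI[of _ "insert c S"] refl order_trans[OF _ sub] subsetI)
      fix P assume "P \<in> Var KXY (insert c S)"
      then show "P \<in> Z" by (simp add: Var_KXY mem)
    qed
    have "Z \<subseteq> Var KXY (insert a S) \<union> Var KXY (insert b S)"
    proof
      fix P assume P: "P \<in> Z"
      have "a \<in> P \<or> b \<in> P" using InterD[OF ab P] pr(1)[OF P] by (simp add: is_prime_def)
      moreover have "is_prime P" "S \<subseteq> P" using P by (simp_all add: mem)
      ultimately show "P \<in> Var KXY (insert a S) \<union> Var KXY (insert b S)" by (simp add: Var_KXY)
    qed
    from irr[OF cl cl this] show ?thesis
    proof
      assume *: "Z \<subseteq> Var KXY (insert a S)"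
      have "a \<in> \<Inter>Z"
      proof
        fix P assume "P \<in> Z"
        from subsetD[OF * this] show "a \<in> P" by (simp add: Var_KXY)
      qed
      then show ?thesis ..
    next
      assume *: "Z \<subseteq> Var KXY (insert b S)"
      have "b \<in> \<Inter>Z"
      proof
        fix P assume "P \<in> Z"
        from subsetD[OF * this] show "b \<in> P" by (simp add: Var_KXY)
      qed
      then show ?thesis ..
    qed
  qed
  ultimately show "is_prime (\<Inter>Z)" unfolding is_prime_def by simp
qed

text \<open>Passing from a prime to its closed set reverses inclusions, so chains are read backwards.\<close>
lemma top_Kdim_Var: "top_Kdim V = chain_dim {P. is_prime P \<and> I \<subseteq> P}"
  unfolding top_Kdim_def
proof (rule antisym)
  show "chain_dim {Z. irreducible_closed V Z} \<le> chain_dim {P. is_prime P \<and> I \<subseteq> P}"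
  proof (rule chain_dim_antimono[of _ Inter])
    fix Z assume "Z \<in> {Z. irreducible_closed V Z}"
    then show "\<Inter>Z \<in> {P. is_prime P \<and> I \<subseteq> P}" using irreducible_cases(1,2) by simp
  next
    fix Z Z' assume Z: "Z \<in> {Z. irreducible_closed V Z}" "Z' \<in> {Z. irreducible_closed V Z}" "Z \<subset> Z'"
    have "\<Inter>Z \<noteq> \<Inter>Z'" using irreducible_cases(3)[of Z] irreducible_cases(3)[of Z'] Z by auto
    then show "\<Inter>Z' \<subset> \<Inter>Z" using Z(3) by blast
  qed
  show "chain_dim {P. is_prime P \<and> I \<subseteq> P} \<le> chain_dim {Z. irreducible_closed V Z}"
  proof (rule chain_dim_antimono[of _ "Var KXY"])
    fix P assume "P \<in> {P. is_prime P \<and> I \<subseteq> P}"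
    then show "Var KXY P \<in> {Z. irreducible_closed V Z}" using irreducible_Var by simp
  next
    fix P P' assume "P \<in> {P. is_prime P \<and> I \<subseteq> P}" "P' \<in> {P. is_prime P \<and> I \<subseteq> P}" "P \<subset> P'"
    then have "P \<in> Var KXY P" "P \<notin> Var KXY P'" "Var KXY P' \<subseteq> Var KXY P" by (auto simp: Var_KXY)
    then show "Var KXY P' \<subset> Var KXY P" by blast
  qed
qed

lemma chain_dim_primes: "chain_dim {P. is_prime P \<and> I \<subseteq> P} = (if 1 \<in> I then -\<infinity> else ereal (real (cdim I)))"
proof (cases "1 \<in> I")
  case True
  then have none: "{P. is_prime P \<and> I \<subseteq> P} = {}" by (auto simp: is_prime_def)
  have empty: "{l. \<exists>P :: nat \<Rightarrow> ('n, 'k) polXY set. (\<forall>i\<le>l. P i \<in> {}) \<and> (\<forall>i<l. P i \<subset> P (Suc i))} = {}" by auto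
  then show ?thesis unfolding chain_dim_def none empty using True by (simp add: bot_ereal_def)
next
  case False
  have "{l. \<exists>P. (\<forall>i\<le>l. P i \<in> {P. is_prime P \<and> I \<subseteq> P}) \<and> (\<forall>i<l. P i \<subset> P (Suc i))} = {..cdim I}"
    using prime_chains_above_ideal[OF I False] by auto
  moreover have "(SUP l\<in>{..cdim I}. ereal (real l)) = ereal (real (cdim I))"
    by (rule antisym) (auto intro!: SUP_least SUP_upper)
  ultimately show ?thesis using False by (simp add: chain_dim_def)
qed

end

section \<open>Good filtrations and the theorem\<close>

context weyl_module
begin

lemma FW_smult_sum_mono:
  "\<forall>j<r. a j \<in> FW i \<Longrightarrow> i \<le> k \<Longrightarrow> \<forall>j<r. a j \<in> FW k" using FW.F_mono by blast

text \<open>Any finite generating set works, with all degree shifts zero.\<close>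
lemma good_filtration_exists:
  assumes "finitely_generated W M" shows "\<exists>F. good_filtration FW M F"
proof -
  from assms obtain S where S: "finite S" "S \<subseteq> carrier M" "lin_span (carrier W) M S = carrier M"
    unfolding finitely_generated_def by blast
  from ex_bij_betw_nat_finite[OF S(1)] obtain m where m: "bij_betw m {0..<card S} S" by blast
  define r where "r = card S"
  have mS: "m ` {..<r} = S" "inj_on m {..<r}" using m by (auto simp: r_def bij_betw_def atLeast0LessThan)
  have mc: "m j \<in> carrier M" if "j < r" for j using mS(1) S(2) that by auto
  let ?s = "\<lambda>a. \<Oplus>\<^bsub>M\<^esub>j\<in>{..<r}. a j \<odot>\<^bsub>M\<^esub> m j"
  let ?F = "\<lambda>i. {?s a | a. \<forall>j<r. a j \<in> FW i}"
  have FWc: "a \<in> FW i \<Longrightarrow> a \<in> carrier W" for a i using FW.F_carrier by blast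
  have closed: "(\<lambda>j. a j \<odot>\<^bsub>M\<^esub> m j) \<in> {..<r} \<rightarrow> carrier M" if "\<forall>j<r. a j \<in> carrier W" for a
    using that mc smult_closed by auto
  have sc: "?s a \<in> carrier M" if "\<forall>j<r. a j \<in> carrier W" for a by (rule M.finsum_closed[OF closed[OF that]])
  have act: "b \<odot>\<^bsub>M\<^esub> ?s a = ?s (\<lambda>j. b \<otimes>\<^bsub>W\<^esub> a j)" if b: "b \<in> carrier W" and a: "\<forall>j<r. a j \<in> carrier W" for a b
  proof -
    have "b \<odot>\<^bsub>M\<^esub> ?s a = (\<Oplus>\<^bsub>M\<^esub>j\<in>{..<r}. b \<odot>\<^bsub>M\<^esub> (a j \<odot>\<^bsub>M\<^esub> m j))" by (rule KM.smult_finsum[OF b closed[OF a]])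
    also have "\<dots> = ?s (\<lambda>j. b \<otimes>\<^bsub>W\<^esub> a j)"
      using a b mc by (intro M.finsum_cong') (auto simp: smult_assoc simp del: weyl_simps intro!: smult_closed)
    finally show ?thesis .
  qed
  have add: "?s a \<oplus>\<^bsub>M\<^esub> ?s b = ?s (\<lambda>j. a j \<oplus>\<^bsub>W\<^esub> b j)" if a: "\<forall>j<r. a j \<in> carrier W" and b: "\<forall>j<r. b j \<in> carrier W" for a b
  proof -
    have "?s (\<lambda>j. a j \<oplus>\<^bsub>W\<^esub> b j) = (\<Oplus>\<^bsub>M\<^esub>j\<in>{..<r}. a j \<odot>\<^bsub>M\<^esub> m j \<oplus>\<^bsub>M\<^esub> b j \<odot>\<^bsub>M\<^esub> m j)"
      using a b mc by (intro M.finsum_cong') (auto simp: smult_l_distr simp del: weyl_simps intro!: smult_closed M.a_closed)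
    also have "\<dots> = ?s a \<oplus>\<^bsub>M\<^esub> ?s b" by (rule M.finsum_addf[OF closed[OF a] closed[OF b]])
    finally show ?thesis ..
  qed
  have exh: "\<exists>i. b \<in> FW i" if b: "b \<in> carrier W" for b
  proof -
    from b obtain c where c: "b = symb c" unfolding carrier_weyl by blast
    have "int (wdeg \<omega> a) \<le> int (\<Sum>a\<in>keys c. wdeg \<omega> a)" if "a \<in> keys c" for a
      using that by (intro of_nat_mono member_le_sum) simp_all
    then show ?thesis unfolding c symb_in_FW by blast
  qed
  have "module_filtration FW M ?F"
    unfolding module_filtration_def
  proof (intro conjI allI ballI)
    fix i
    show "additive_subgroup (?F i) M"
    proof (intro additive_subgroup.intro subgroup.intro)
      show "?F i \<subseteq> carrier (add_monoid M)" using sc FWc by auto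
      have "?s (\<lambda>_. \<zero>\<^bsub>W\<^esub>) = (\<Oplus>\<^bsub>M\<^esub>j\<in>{..<r}. \<zero>\<^bsub>M\<^esub>)"
        using mc by (intro M.finsum_cong') (simp_all add: KM.smult_zero_left del: weyl_simps)
      then have "\<zero>\<^bsub>M\<^esub> = ?s (\<lambda>_. \<zero>\<^bsub>W\<^esub>)" by simp
      then have "\<zero>\<^bsub>M\<^esub> \<in> ?F i" by (intro CollectI exI[of _ "\<lambda>_. \<zero>\<^bsub>W\<^esub>"] conjI allI impI FW.F_zero)
      then show "\<one>\<^bsub>add_monoid M\<^esub> \<in> ?F i" by simp
    next
      fix x y assume "x \<in> ?F i" "y \<in> ?F i"
      then obtain a b where ab: "x = ?s a" "\<forall>j<r. a j \<in> FW i" "y = ?s b" "\<forall>j<r. b j \<in> FW i" by blast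
      have "x \<oplus>\<^bsub>M\<^esub> y = ?s (\<lambda>j. a j \<oplus>\<^bsub>W\<^esub> b j)" unfolding ab(1,3) by (rule add) (use ab FWc in blast)+
      then have "x \<oplus>\<^bsub>M\<^esub> y \<in> ?F i" using ab FW.F_add by (intro CollectI exI[of _ "\<lambda>j. a j \<oplus>\<^bsub>W\<^esub> b j"] conjI) blast+
      then show "x \<otimes>\<^bsub>add_monoid M\<^esub> y \<in> ?F i" by simp
    next
      fix x assume "x \<in> ?F i"
      then obtain a where a: "x = ?s a" "\<forall>j<r. a j \<in> FW i" by blast
      have ac: "\<forall>j<r. a j \<in> carrier W" using a FWc by blast
      have nc: "\<forall>j<r. \<ominus>\<^bsub>W\<^esub> a j \<in> carrier W" using ac by blast
      have "?s (\<lambda>j. \<ominus>\<^bsub>W\<^esub> a j) \<oplus>\<^bsub>M\<^esub> x = ?s (\<lambda>j. \<ominus>\<^bsub>W\<^esub> a j \<oplus>\<^bsub>W\<^esub> a j)" unfolding a(1) by (rule add[OF nc ac])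
      also have "\<dots> = (\<Oplus>\<^bsub>M\<^esub>j\<in>{..<r}. \<zero>\<^bsub>M\<^esub>)"
        using mc ac by (intro M.finsum_cong') (simp_all add: KM.smult_zero_left R.l_neg del: weyl_simps)
      also have "\<dots> = \<zero>\<^bsub>M\<^esub>" by simp
      finally have "\<ominus>\<^bsub>M\<^esub> x = ?s (\<lambda>j. \<ominus>\<^bsub>W\<^esub> a j)" using sc[OF ac] sc[OF nc] unfolding a(1) by (intro M.minus_equality)
      then have "\<ominus>\<^bsub>M\<^esub> x \<in> ?F i" using a(2) FW.F_inv by (intro CollectI exI[of _ "\<lambda>j. \<ominus>\<^bsub>W\<^esub> a j"] conjI) blast+
      then show "inv\<^bsub>add_monoid M\<^esub> x \<in> ?F i" by (simp only: a_inv_def)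
    qed
    show "?F i \<subseteq> ?F (i + 1)"
    proof
      fix x assume "x \<in> ?F i"
      then obtain a where "x = ?s a" "\<forall>j<r. a j \<in> FW i" by blast
      then show "x \<in> ?F (i + 1)" using FW_smult_sum_mono[of r a i "i + 1"] by (intro CollectI exI[of _ a]) simp
    qed
  next
    fix i k b x assume b: "b \<in> FW i" and "x \<in> ?F k"
    then obtain a where a: "x = ?s a" "\<forall>j<r. a j \<in> FW k" by blast
    have "b \<odot>\<^bsub>M\<^esub> x = ?s (\<lambda>j. b \<otimes>\<^bsub>W\<^esub> a j)" unfolding a(1) by (rule act) (use a b FWc in blast)+
    then show "b \<odot>\<^bsub>M\<^esub> x \<in> ?F (i + k)" using FW_mult[OF b] a(2) by (intro CollectI exI[of _ "\<lambda>j. b \<otimes>\<^bsub>W\<^esub> a j"] conjI) blast+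
  next
    show "(\<Union>i. ?F i) = carrier M"
    proof
      show "(\<Union>i. ?F i) \<subseteq> carrier M" using sc FWc by blast
      show "carrier M \<subseteq> (\<Union>i. ?F i)"
      proof
        fix x assume "x \<in> carrier M"
        then have "x \<in> lin_span (carrier W) M S" using S(3) by simp
        then obtain T c where T: "x = (\<Oplus>\<^bsub>M\<^esub>s\<in>T. c s \<odot>\<^bsub>M\<^esub> s)" "T \<subseteq> S" "c \<in> T \<rightarrow> carrier W"
          unfolding lin_span_def by blast
        let ?c = "\<lambda>s. if s \<in> T then c s else \<zero>\<^bsub>W\<^esub>"
        have cc: "?c s \<in> carrier W" for s using T(3) R.zero_closed by auto
        have "x = (\<Oplus>\<^bsub>M\<^esub>s\<in>S. ?c s \<odot>\<^bsub>M\<^esub> s)"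
          unfolding T(1)
        proof (rule M.add.finprod_mono_neutral_cong_left[OF S(1) T(2)])
          show "(\<lambda>s. ?c s \<odot>\<^bsub>M\<^esub> s) \<in> S \<rightarrow> carrier M" using cc S(2) smult_closed by blast
          fix s assume "s \<in> S - T"
          then show "?c s \<odot>\<^bsub>M\<^esub> s = \<zero>\<^bsub>M\<^esub>" using S(2) KM.smult_zero_left[of s] by auto
        qed simp
        also have "\<dots> = ?s (\<lambda>j. ?c (m j))"
          unfolding mS(1)[symmetric] using cc mc
          by (intro M.finsum_reindex[OF _ mS(2)]) (auto intro!: smult_closed simp del: weyl_simps)
        finally have x: "x = ?s (\<lambda>j. ?c (m j))" .
        have "\<forall>j. \<exists>i. ?c (m j) \<in> FW i" using exh cc by blast
        from choice[OF this] obtain k where k: "\<forall>j. ?c (m j) \<in> FW (k j)" by (rule exE)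
        let ?k = "Max (insert 0 (k ` {..<r}))"
        have "\<forall>j<r. ?c (m j) \<in> FW ?k"
        proof (intro allI impI)
          fix j assume "j < r"
          then have "k j \<le> ?k" by (intro Max_ge) auto
          from subsetD[OF FW.F_mono[OF this] spec[OF k, of j]] show "?c (m j) \<in> FW ?k" .
        qed
        then have "x \<in> ?F ?k" unfolding x by (intro CollectI exI[of _ "\<lambda>j. ?c (m j)"] conjI refl)
        then show "x \<in> (\<Union>i. ?F i)" by blast
      qed
    qed
  qed
  then show ?thesis
    unfolding good_filtration_def using mc
    by (intro exI[of _ ?F] conjI exI[of _ r] exI[of _ m] exI[of _ "\<lambda>_. 0"]) auto
qed

text \<open>
  For \<open>M = 0\<close> all sides are \<open>-\<infinity>\<close>: the annihilator is the whole ring and lies in no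
  prime. Otherwise all sides are \<open>cdim\<close> of the annihilator.
\<close>
lemma good_filtration_dimensions:
  assumes "good_filtration FW M F"
  shows "Kdim KXY (GrM \<omega> M F) = GKdim (range pscale) W M"
    and "GKdim (range pconst) KXY (GrM \<omega> M F) = GKdim (range pscale) W M"
    and "top_Kdim (subtopology (zariski KXY) (Var KXY (annihilator KXY (GrM \<omega> M F)))) = GKdim (range pscale) W M"
proof -
  from assms obtain r :: nat and m p where F: "module_filtration FW M F" and m: "\<forall>j<r. m j \<in> carrier M"
    and gen: "\<forall>i. F i = {\<Oplus>\<^bsub>M\<^esub>j\<in>{..<r}. a j \<odot>\<^bsub>M\<^esub> m j | a. \<forall>j<r. a j \<in> FW (i - p j)}"
    unfolding good_filtration_def by blast
  define mm where "mm j = (if j < r then m j else \<zero>\<^bsub>M\<^esub>)" for j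
  have same: "(\<Oplus>\<^bsub>M\<^esub>j\<in>{..<r}. a j \<odot>\<^bsub>M\<^esub> mm j) = (\<Oplus>\<^bsub>M\<^esub>j\<in>{..<r}. a j \<odot>\<^bsub>M\<^esub> m j)" if "\<forall>j<r. a j \<in> FW (i - p j)" for a i
    using m that FW.F_carrier by (intro M.finsum_cong') (auto simp: mm_def intro!: smult_closed)
  have "F i = {\<Oplus>\<^bsub>M\<^esub>j\<in>{..<r}. a j \<odot>\<^bsub>M\<^esub> mm j | a. \<forall>j<r. a j \<in> FW (i - p j)}" for i
    unfolding spec[OF gen, of i]
  proof (rule Collect_cong, rule iffI; elim exE conjE)
    fix x a assume a: "\<forall>j<r. a j \<in> FW (i - p j)"
    assume "x = (\<Oplus>\<^bsub>M\<^esub>j\<in>{..<r}. a j \<odot>\<^bsub>M\<^esub> m j)"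
    then show "\<exists>a. x = (\<Oplus>\<^bsub>M\<^esub>j\<in>{..<r}. a j \<odot>\<^bsub>M\<^esub> mm j) \<and> (\<forall>j<r. a j \<in> FW (i - p j))"
      unfolding same[OF a, symmetric] using a by (intro exI[of _ a] conjI)
  next
    fix x a assume a: "\<forall>j<r. a j \<in> FW (i - p j)"
    assume "x = (\<Oplus>\<^bsub>M\<^esub>j\<in>{..<r}. a j \<odot>\<^bsub>M\<^esub> mm j)"
    then show "\<exists>a. x = (\<Oplus>\<^bsub>M\<^esub>j\<in>{..<r}. a j \<odot>\<^bsub>M\<^esub> m j) \<and> (\<forall>j<r. a j \<in> FW (i - p j))"
      unfolding same[OF a] using a by (intro exI[of _ a] conjI)
  qed
  moreover have "mm j \<in> carrier M" for j using m by (simp add: mm_def)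
  moreover have "mm j = \<zero>\<^bsub>M\<^esub>" if "r \<le> j" for j using that by (simp add: mm_def)
  ultimately interpret good_filtered M \<omega> F r mm p
    by (intro good_filtered.intro good_filtered_axioms.intro weyl_module_axioms F)
  have D: "chain_dim {P. is_prime P \<and> Ann \<subseteq> P} = GKdim (range pscale) W M"
  proof (cases "carrier M = {\<zero>\<^bsub>M\<^esub>}")
    case True
    then have "carrier GM = {\<zero>\<^bsub>GM\<^esub>}" by (simp add: GM_trivial_iff)
    then have "1 \<in> Ann" unfolding Ann_iff using GM_one by auto
    then show ?thesis unfolding chain_dim_primes[OF Ann_ideal] using True by (simp add: GKdim_def)
  next
    case False
    then have "carrier GM \<noteq> {\<zero>\<^bsub>GM\<^esub>}" by (simp add: GM_trivial_iff)
    from one_not_in_Ann[OF this] show ?thesis unfolding chain_dim_primes[OF Ann_ideal] GKdim_M[OF False] by simp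
  qed
  show "Kdim KXY GM = GKdim (range pscale) W M" unfolding Kdim_def chain_dim_quotient[OF Ann_ideal] by (rule D)
  show "top_Kdim (subtopology (zariski KXY) (Var KXY Ann)) = GKdim (range pscale) W M"
    unfolding top_Kdim_Var[OF Ann_ideal] by (rule D)
  show "GKdim (range pconst) KXY GM = GKdim (range pscale) W M"
  proof (cases "carrier M = {\<zero>\<^bsub>M\<^esub>}")
    case True
    then show ?thesis using GM_trivial_iff by (simp add: GKdim_def)
  next
    case False
    show ?thesis unfolding GKdim_M[OF False] GKdim_GM[OF False] ..
  qed
qed

end

theorem theorem5p6:
  fixes M :: "(('n::finite, 'k::field_char_0) endo, 'm) module"
  assumes "left_module weyl M"
    and "finitely_generated weyl M"
  shows "\<forall>\<omega>\<in>Omega.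
    (\<forall>F. good_filtration (weyl_filt \<omega>) M F \<longrightarrow>
       Kdim KXY (GrM \<omega> M F) = GKdim (range pconst) KXY (GrM \<omega> M F) \<and>
       GKdim (range pconst) KXY (GrM \<omega> M F) = GKdim (range pscale) weyl M) \<and>
    top_Kdim (subtopology (zariski KXY) (char_variety \<omega> M)) = GKdim (range pscale) weyl M"
proof
  fix \<omega> :: "'n + 'n \<Rightarrow> nat" assume "\<omega> \<in> Omega"
  then interpret weyl_module M \<omega> by (intro weyl_module.intro weyl_module_axioms.intro assms(1))
  have "good_filtration (weyl_filt \<omega>) M (SOME F. good_filtration (weyl_filt \<omega>) M F)"
    using good_filtration_exists[OF assms(2)] by (rule someI_ex)
  from good_filtration_dimensions(3)[OF this]
  show "(\<forall>F. good_filtration (weyl_filt \<omega>) M F \<longrightarrow>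
       Kdim KXY (GrM \<omega> M F) = GKdim (range pconst) KXY (GrM \<omega> M F) \<and>
       GKdim (range pconst) KXY (GrM \<omega> M F) = GKdim (range pscale) weyl M) \<and>
    top_Kdim (subtopology (zariski KXY) (char_variety \<omega> M)) = GKdim (range pscale) weyl M"
    unfolding char_variety_def using good_filtration_dimensions(1,2) by simp
qed

end
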